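(* Let $s\in\mathbb{N}\cup\{0\}$ and let $\Omega\subset\mathbb{R}^2$ be a bounded domain for which there exist a linear operator $E:H^s(\Omega)\to H^s(\mathbb{R}^2)$ and $M_{\mathrm{ext}}>0$ with $E(f)|_\Omega=f$ for all $f\in H^s(\Omega)$ and $\|E\|_{H^s(\Omega)\to H^s(\mathbb{R}^2)}\le M_{\mathrm{ext}}$. Let $\alpha_{\mathrm{w}}>1$, $\alpha_{\mathrm{sh}}>0$, $\beta_{\mathrm{w}}>0$ with $\beta_{\mathrm{w}}\ge s$, $\beta_{\mathrm{sh}}>2+2s+2\alpha_{\mathrm{w}}$, and let $\tau>0$, $\epsilon>0$ be such that $\left(\frac{1-\epsilon}{\tau}-2\right)\alpha_{\mathrm{w}}>\frac52$. Let $\mathcal{SH}(\phi,\psi,\widetilde\psi,c)$ be a shearlet system satisfying (S2), (S4), (S5), and let $\mathcal{W}$ be a boundary wavelet system on $\Omega$ satisfying (W2), (W3), (W4), with these values of $s,\alpha_{\mathrm{sh}},\beta_{\mathrm{sh}},\alpha_{\mathrm{w}},\beta_{\mathrm{w}}$. (All conditions and systems are defined in the context.) Then there exists $T>0$ such that for every $t\ge T$ the boundary shearlet system $(\varphi_n)_{n\in\mathbb{N}}=\mathcal{BSH}^s_{t,\tau}(\mathcal{W};\phi,\psi,\widetilde\psi,c)$ satisfies the following: there are constants $0<A\le B<\infty$ with $$A\|f\|_{H^s(\Omega)}^2\le\sum_{n\in\mathbb{N}}|\langle f,2^{-j_ns}\varphi_n\rangle_{H^s(\Omega)}|^2\le B\|f\|_{H^s(\Omega)}^2\quad\text{for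 all }f\in H^s(\Omega),$$ where $j_n$ is the scale of $\varphi_n$, i.e. $\varphi_n=\psi_{j_n,k_n,m_n,\iota_n}$ or $\varphi_n=\omega_{j_n,m_n,\upsilon_n}$.
   Context: **Conventions.** $\langle f,g\rangle_{H^s}=\sum_{|\mathbf a|\le s}\langle D^{\mathbf a}f,D^{\mathbf a}g\rangle_{L^2}$ for integer $s\geq 0$. $\hat f$ denotes the Fourier transform $\hat f(\xi)=\int f(x)e^{-2\pi i\langle x,\xi\rangle}dx$. $B_r(x)$ is the ball of radius $r$ around $x$. $X\lesssim Y$ means $X\le CY$ with $C$ independent of the running indices and variables; $X\sim Y$ means $X\lesssim Y\lesssim X$. A family $(\varphi_n)$ is a frame for a Hilbert space $\mathcal H$ if $A\|f\|^2\le\sum_n|\langle f,\varphi_n\rangle|^2\le B\|f\|^2$ for all $f\in\mathcal H$ with some $0<A\le B<\infty$; a dual frame $(\varphi_n^d)$ is a frame with $f=\sum_n\langle f,\varphi_n\rangle\varphi_n^d=\sum_n\langle f,\varphi_n^d\rangle\varphi_n$ for all $f \in \mathcal H$. **Shearlet systems.** For $j\ge0$, $k\in\mathbb Z$ let $A_j=\mathrm{diag}(2^j,2^{j/2})$, $\tilde A_j=\mathrm{diag}(2^{j/2},2^j)$, $S_k=\begin{pmatrix}1&k\\0&1\end{pmatrix}$; for $c=(c_1,c_2)$ with $c_1,c_2>0$ let $M_c=\mathrm{diag}(c_1,c_2)$, $M_{\tilde c}=\mathrm{diag}(c_2,c_1)$. For $\phi,\psi,\widetilde\psi\in L^2(\mathbb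 R^2)$ put $\psi_{j,k,m,1}=2^{3j/4}\psi(S_kA_j\cdot-M_cm)$, $\psi_{j,k,m,-1}=2^{3j/4}\widetilde\psi(S_k^T\tilde A_j\cdot-M_{\tilde c}m)$, $\psi_{0,0,m,0}=\phi(\cdot-c_1m)$. The index set is $\Lambda=\{(j,k,m,\iota):\iota\in\{-1,0,1\},\ |\iota|j=j\ge0,\ |k|\le|\iota|\lceil2^{j/2}\rceil,\ m\in\mathbb Z^2\}$ and $\mathcal{SH}(\phi,\psi,\widetilde\psi,c)=(\psi_{j,k,m,\iota})_{(j,k,m,\iota)\in\Lambda}$. - (S2) There are $C_1,C_2>0$ such that for all $\xi\in\mathbb R^2$: $|\hat\psi(\xi)|\le C_1\frac{\min\{1,|\xi_1|^{\alpha_{\mathrm{sh}}}\}}{\max\{1,|\xi_1|^{\beta_{\mathrm{sh}}}\}\max\{1,|\xi_2|^{\beta_{\mathrm{sh}}}\}}$ and $|\hat{\widetilde\psi}(\xi)|\le C_2\frac{\min\{1,|\xi_2|^{\alpha_{\mathrm{sh}}}\}}{\max\{1,|\xi_1|^{\beta_{\mathrm{sh}}}\}\max\{1,|\xi_2|^{\beta_{\mathrm{sh}}}\}}$. - (S4) $(2^{-js}\psi_{j,k,m,\iota})_{(j,k,m,\iota)\in\Lambda}$ is a frame for $H^s(\mathbb R^2)$ (with a dual frame). - (S5) There is $q_{\mathrm{sh}}>0$ with $\mathrm{supp}\,\psi_{j,k,0,\iota}\subset B_{2^{-j/2}q_{\mathrm{sh}}/2}(0)$ for all $(j,k,0,\iota)\in\Lambda$.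 **Boundary wavelet systems.** A set $\mathcal W\subset L^2(\Omega)$ is a boundary wavelet system if for some $J_0\in\mathbb Z$ it has the form $\mathcal W=\{\omega_{j,m,\upsilon}:(j,m,\upsilon)\in\Theta\}$ with $\Theta=\{(J_0,m,0):m\in K_{J_0}\}\cup\{(j,m,\upsilon):j\ge J_0,\ m\in K_j,\ \upsilon\in\{1,2,3\}\}$, where $K_j\subset\Omega$ and $\#K_j\sim2^{2j}$. - (W2) There are $0<C_{\mathrm w}\le D_{\mathrm w}<\infty$ with $C_{\mathrm w}\|f\|_{H^s(\Omega)}^2\le\sum_{(j,m,\upsilon)\in\Theta}2^{2js}|\langle f,\omega_{j,m,\upsilon}\rangle_{L^2(\Omega)}|^2\le D_{\mathrm w}\|f\|_{H^s(\Omega)}^2$ for all $f\in H^s(\Omega)$. - (W3) $(2^{-js}\omega_{j,m,\upsilon})_{\Theta}$ is a frame for $H^s(\Omega)$ with a dual frame $((2^{-js}\omega_{j,m,\upsilon})^d)_{\Theta}$ such that for all $(j,m,\upsilon)\in\Theta$ with $\partial\Omega\cap\mathrm{supp}(2^{-js}\omega_{j,m,\upsilon})^d=\emptyset$ one has, for at least one $i\in\{1,2\}$ and all $\xi\in\mathbb R^2$, $|\widehat{(2^{-js}\omega_{j,m,\upsilon})^d}(\xi)|\lesssim2^{-js}2^{-j}\frac{\min\{1,|2^{-j}\xi_i|^{\alpha_{\mathrm w}}\}}{\max\{1,|2^{-j}\xi_1|^{\beta_{\mathrm w}}\}\max\{1,|2^{-j}\xi_2|^{\beta_{\mathrm w}}\}}$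 (Fourier transform after extension by $0$ to $\mathbb R^2$). Moreover the dual elements have compact support, and $q^{(0)}_{\mathrm w}:=\inf\{q>0:\mathrm{supp}(2^{-js}\omega_{j,m,\upsilon})^d\subset B_{2^{-j}q}(m)\ \forall(j,m,\upsilon)\in\Theta\}$ is finite and positive. - (W4) The $\omega_{j,m,\upsilon}$ have compact support, $q^{(1)}_{\mathrm w}:=\inf\{q>0:\mathrm{supp}\,\omega_{j,m,\upsilon}\subset B_{2^{-j}q}(m)\ \forall(j,m,\upsilon)\in\Theta\}$ is finite and positive, and for some $q^{(2)}_{\mathrm w}>0$, $|m-m'|\ge2^{-j}q^{(2)}_{\mathrm w}$ for all $j\ge J_0$ and $m\ne m'$ in $K_j$. **Boundary shearlet systems.** For $r\in\mathbb R$ let $\Gamma_r=\{x\in\Omega:d(x,\partial\Omega)<q_{\mathrm{sh}}2^{-r}\}$. For $t,\tau>0$ let $\Theta_{t,\tau}=\{(j,m,\upsilon)\in\Theta:B_{2^{-j}(q^{(0)}_{\mathrm w}+q^{(1)}_{\mathrm w})}(m)\cap\Gamma_{\tau(j-t)}\ne\emptyset\}$, $\mathcal W_{t,\tau}=\{\omega_{j,m,\upsilon}:(j,m,\upsilon)\in\Theta_{t,\tau}\}$ and $\Lambda_0=\{(j,k,m,\iota)\in\Lambda:\mathrm{supp}\,\psi_{j,k,m,\iota}\subset\Omega\}$. Then $\mathcal{BSH}^s_{t,\tau}(\mathcal W;\phi,\psi,\widetilde\psi,c)=\{\psi_{j,k,m,\iota}:(j,k,m,\iota)\in\Lambda_0\}\cup\mathcal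 W_{t,\tau}$ (the superscript $s$ refers to the $s$ for which (W3) is used). *)

theory Defs
  imports "HOL-Analysis.Analysis"
begin

section \<open>Square-integrable functions, supports, Fourier transform\<close>

text \<open>
  Elements of \<open>L\<^sup>2(\<Omega>)\<close> are represented by functions on the whole plane of which only the
  values on \<open>\<Omega>\<close> (up to null sets) matter.
\<close>

type_synonym cfun = "real^2 \<Rightarrow> complex"

definition L2 :: "(real^2) set \<Rightarrow> cfun set" where
  "L2 \<Omega> = {f. f \<in> borel_measurable (lebesgue_on \<Omega>) \<and>
              integrable (lebesgue_on \<Omega>) (\<lambda>x. (cmod (f x))\<^sup>2)}"

definition L2_inner :: "(real^2) set \<Rightarrow> cfun \<Rightarrow> cfun \<Rightarrow> complex" where
  "L2_inner \<Omega> f g = (LINT x|lebesgue_on \<Omega>. f x * cnj (g x))"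

definition zero_ext :: "(real^2) set \<Rightarrow> cfun \<Rightarrow> cfun" where
  "zero_ext \<Omega> f = (\<lambda>x. if x \<in> \<Omega> then f x else 0)"

text \<open>Essential support, i.e. the support of an almost-everywhere class.\<close>

definition ess_supp :: "cfun \<Rightarrow> (real^2) set" where
  "ess_supp f = {x. \<forall>U. open U \<and> x \<in> U \<longrightarrow> \<not> (AE y in lebesgue. y \<in> U \<longrightarrow> f y = 0)}"

text \<open>
  The integral formula is only meaningful for integrable functions; below it is applied to
  square-integrable functions whose supports are assumed to be bounded.
\<close>

definition fourier :: "cfun \<Rightarrow> real^2 \<Rightarrow> complex" where
  "fourier f \<xi> = (LINT x|lebesgue. f x * exp (- (2 * pi * \<i> * complex_of_real (x \<bullet> \<xi>))))"


section \<open>Sobolev spaces of integer order\<close>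

definition partial :: "2 \<Rightarrow> cfun \<Rightarrow> cfun" where
  "partial i f x = frechet_derivative f (at x) (axis i 1)"

definition D_classical :: "nat \<times> nat \<Rightarrow> cfun \<Rightarrow> cfun" where
  "D_classical a f = (partial 1 ^^ fst a) ((partial 2 ^^ snd a) f)"

text \<open>
  \<open>C\<^sup>\<infinity>\<close>: every iterated partial derivative (a list of directions, in any order) is
  differentiable everywhere.
\<close>

definition smooth :: "cfun \<Rightarrow> bool" where
  "smooth f \<longleftrightarrow> (\<forall>is x. foldr partial is f differentiable at x)"

definition test_functions :: "(real^2) set \<Rightarrow> cfun set" where
  "test_functions \<Omega> = {\<eta>. smooth \<eta> \<and> compact (closure {x. \<eta> x \<noteq> 0}) \<and> closure {x. \<eta> x \<noteq> 0} \<subseteq> \<Omega>}"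

definition is_weak_deriv :: "(real^2) set \<Rightarrow> nat \<times> nat \<Rightarrow> cfun \<Rightarrow> cfun \<Rightarrow> bool" where
  "is_weak_deriv \<Omega> a f g \<longleftrightarrow> g \<in> L2 \<Omega> \<and>
     (\<forall>\<eta>\<in>test_functions \<Omega>.
        (LINT x|lebesgue_on \<Omega>. f x * D_classical a \<eta> x) =
        (-1) ^ (fst a + snd a) * (LINT x|lebesgue_on \<Omega>. g x * \<eta> x))"

text \<open>Weak derivatives are unique almost everywhere on an open set, so the choice is immaterial.\<close>

definition weak_deriv :: "(real^2) set \<Rightarrow> nat \<times> nat \<Rightarrow> cfun \<Rightarrow> cfun" where
  "weak_deriv \<Omega> a f = (SOME g. is_weak_deriv \<Omega> a f g)"

definition Hs :: "nat \<Rightarrow> (real^2) set \<Rightarrow> cfun set" where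
  "Hs s \<Omega> = {f \<in> L2 \<Omega>. \<forall>a. fst a + snd a \<le> s \<longrightarrow> (\<exists>g. is_weak_deriv \<Omega> a f g)}"

definition Hs_inner :: "nat \<Rightarrow> (real^2) set \<Rightarrow> cfun \<Rightarrow> cfun \<Rightarrow> complex" where
  "Hs_inner s \<Omega> f g =
     (\<Sum>a | fst a + snd a \<le> s. L2_inner \<Omega> (weak_deriv \<Omega> a f) (weak_deriv \<Omega> a g))"

definition Hs_norm :: "nat \<Rightarrow> (real^2) set \<Rightarrow> cfun \<Rightarrow> real" where
  "Hs_norm s \<Omega> f = sqrt (Re (Hs_inner s \<Omega> f f))"

text \<open>
  Linear extension operator with norm at most \<open>M\<close>. Identities are almost-everywhere identities;
  by linearity and boundedness, \<open>E\<close> respects almost-everywhere equality on \<open>\<Omega>\<close>.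
\<close>

definition extension_operator :: "nat \<Rightarrow> (real^2) set \<Rightarrow> (cfun \<Rightarrow> cfun) \<Rightarrow> real \<Rightarrow> bool" where
  "extension_operator s \<Omega> E M \<longleftrightarrow>
     (\<forall>f\<in>Hs s \<Omega>. E f \<in> Hs s UNIV) \<and>
     (\<forall>f\<in>Hs s \<Omega>. \<forall>g\<in>Hs s \<Omega>. \<forall>a b.
        AE x in lebesgue. E (\<lambda>y. a * f y + b * g y) x = a * E f x + b * E g x) \<and>
     (\<forall>f\<in>Hs s \<Omega>. AE x in lebesgue_on \<Omega>. E f x = f x) \<and>
     (\<forall>f\<in>Hs s \<Omega>. Hs_norm s UNIV (E f) \<le> M * Hs_norm s \<Omega> f)"


section \<open>Frames\<close>

definition Hs_frame :: "nat \<Rightarrow> (real^2) set \<Rightarrow> 'i set \<Rightarrow> ('i \<Rightarrow> cfun) \<Rightarrow> bool" where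
  "Hs_frame s \<Omega> I u \<longleftrightarrow> (\<forall>i\<in>I. u i \<in> Hs s \<Omega>) \<and>
     (\<exists>A B. 0 < A \<and> A \<le> B \<and>
        (\<forall>f\<in>Hs s \<Omega>.
           (\<lambda>i. (cmod (Hs_inner s \<Omega> f (u i)))\<^sup>2) summable_on I \<and>
           A * (Hs_norm s \<Omega> f)\<^sup>2 \<le> (\<Sum>\<^sub>\<infinity>i\<in>I. (cmod (Hs_inner s \<Omega> f (u i)))\<^sup>2) \<and>
           (\<Sum>\<^sub>\<infinity>i\<in>I. (cmod (Hs_inner s \<Omega> f (u i)))\<^sup>2) \<le> B * (Hs_norm s \<Omega> f)\<^sup>2))"

text \<open>Unconditional convergence of a series of functions to \<open>f\<close> in the norm of \<open>H\<^sup>s(\<Omega>)\<close>.\<close>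

definition Hs_has_sum :: "nat \<Rightarrow> (real^2) set \<Rightarrow> ('i \<Rightarrow> cfun) \<Rightarrow> 'i set \<Rightarrow> cfun \<Rightarrow> bool" where
  "Hs_has_sum s \<Omega> u I f \<longleftrightarrow>
     ((\<lambda>F. Hs_norm s \<Omega> (\<lambda>x. f x - (\<Sum>i\<in>F. u i x))) \<longlongrightarrow> 0) (finite_subsets_at_top I)"

definition Hs_dual_frame ::
    "nat \<Rightarrow> (real^2) set \<Rightarrow> 'i set \<Rightarrow> ('i \<Rightarrow> cfun) \<Rightarrow> ('i \<Rightarrow> cfun) \<Rightarrow> bool" where
  "Hs_dual_frame s \<Omega> I u d \<longleftrightarrow> Hs_frame s \<Omega> I d \<and>
     (\<forall>f\<in>Hs s \<Omega>. Hs_has_sum s \<Omega> (\<lambda>i x. Hs_inner s \<Omega> f (u i) * d i x) I f \<and>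
                  Hs_has_sum s \<Omega> (\<lambda>i x. Hs_inner s \<Omega> f (d i) * u i x) I f)"


section \<open>Shearlet systems\<close>

text \<open>Indices \<open>(j, k, m, \<iota>)\<close>.\<close>

type_synonym sh_index = "int \<times> int \<times> (int^2) \<times> int"

definition A_mat :: "int \<Rightarrow> real^2^2" where
  "A_mat j = vector [vector [2 powr real_of_int j, 0], vector [0, 2 powr (real_of_int j / 2)]]"

definition At_mat :: "int \<Rightarrow> real^2^2" where
  "At_mat j = vector [vector [2 powr (real_of_int j / 2), 0], vector [0, 2 powr real_of_int j]]"

definition S_mat :: "int \<Rightarrow> real^2^2" where
  "S_mat k = vector [vector [1, of_int k], vector [0, 1]]"

definition M_mat :: "real \<Rightarrow> real \<Rightarrow> real^2^2" where
  "M_mat a b = vector [vector [a, 0], vector [0, b]]"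

definition lattice_pt :: "int^2 \<Rightarrow> real^2" where
  "lattice_pt m = (\<chi> i. of_int (m $ i))"

definition sh_indices :: "sh_index set" where
  "sh_indices = {(j, k, m, \<iota>). \<iota> \<in> {-1, 0, 1} \<and> \<bar>\<iota>\<bar> * j = j \<and> 0 \<le> j \<and>
                              \<bar>k\<bar> \<le> \<bar>\<iota>\<bar> * \<lceil>2 powr (real_of_int j / 2)\<rceil>}"

fun shearlet :: "cfun \<Rightarrow> cfun \<Rightarrow> cfun \<Rightarrow> real \<times> real \<Rightarrow> sh_index \<Rightarrow> cfun" where
  "shearlet \<phi> \<psi> \<psi>' (c1, c2) (j, k, m, \<iota>) = (\<lambda>x.
     if \<iota> = 1 then
       complex_of_real (2 powr (3 * real_of_int j / 4)) *
         \<psi> ((S_mat k ** A_mat j) *v x - M_mat c1 c2 *v lattice_pt m)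
     else if \<iota> = -1 then
       complex_of_real (2 powr (3 * real_of_int j / 4)) *
         \<psi>' ((transpose (S_mat k) ** At_mat j) *v x - M_mat c2 c1 *v lattice_pt m)
     else \<phi> (x - c1 *\<^sub>R lattice_pt m))"

definition shearlet_decay :: "real \<Rightarrow> real \<Rightarrow> cfun \<Rightarrow> cfun \<Rightarrow> bool" where
  "shearlet_decay \<alpha> \<beta> \<psi> \<psi>' \<longleftrightarrow> (\<exists>C1 C2. 0 < C1 \<and> 0 < C2 \<and> (\<forall>\<xi>.
     cmod (fourier \<psi> \<xi>) \<le> C1 * (min 1 (\<bar>\<xi> $ 1\<bar> powr \<alpha>) /
        (max 1 (\<bar>\<xi> $ 1\<bar> powr \<beta>) * max 1 (\<bar>\<xi> $ 2\<bar> powr \<beta>))) \<and>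
     cmod (fourier \<psi>' \<xi>) \<le> C2 * (min 1 (\<bar>\<xi> $ 2\<bar> powr \<alpha>) /
        (max 1 (\<bar>\<xi> $ 1\<bar> powr \<beta>) * max 1 (\<bar>\<xi> $ 2\<bar> powr \<beta>)))))"

text \<open>The normalisation \<open>2\<^bsup>-js\<^esup> u\<close> at scale \<open>j\<close>.\<close>

definition scaled :: "nat \<Rightarrow> int \<Rightarrow> cfun \<Rightarrow> cfun" where
  "scaled s j u = (\<lambda>x. complex_of_real (2 powr (- (real_of_int j * real s))) * u x)"

definition shearlet_sobolev_frame :: "nat \<Rightarrow> cfun \<Rightarrow> cfun \<Rightarrow> cfun \<Rightarrow> real \<times> real \<Rightarrow> bool" where
  "shearlet_sobolev_frame s \<phi> \<psi> \<psi>' c \<longleftrightarrow>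
     Hs_frame s UNIV sh_indices (\<lambda>\<nu>. scaled s (fst \<nu>) (shearlet \<phi> \<psi> \<psi>' c \<nu>)) \<and>
     (\<exists>d. Hs_dual_frame s UNIV sh_indices (\<lambda>\<nu>. scaled s (fst \<nu>) (shearlet \<phi> \<psi> \<psi>' c \<nu>)) d)"

definition shearlet_support :: "real \<Rightarrow> cfun \<Rightarrow> cfun \<Rightarrow> cfun \<Rightarrow> real \<times> real \<Rightarrow> bool" where
  "shearlet_support q \<phi> \<psi> \<psi>' c \<longleftrightarrow> 0 < q \<and>
     (\<forall>j k \<iota>. (j, k, 0, \<iota>) \<in> sh_indices \<longrightarrow>
        ess_supp (shearlet \<phi> \<psi> \<psi>' c (j, k, 0, \<iota>)) \<subseteq> ball 0 (2 powr (- real_of_int j / 2) * q / 2))"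


section \<open>Boundary wavelet systems\<close>

text \<open>Indices \<open>(j, m, \<upsilon>)\<close>, where \<open>m\<close> is the location in \<open>\<Omega>\<close>.\<close>

type_synonym w_index = "int \<times> (real^2) \<times> nat"

definition w_indices :: "int \<Rightarrow> (int \<Rightarrow> (real^2) set) \<Rightarrow> w_index set" where
  "w_indices J0 K = {(J0, m, 0) | m. m \<in> K J0} \<union>
                    {(j, m, \<upsilon>) | j m \<upsilon>. J0 \<le> j \<and> m \<in> K j \<and> \<upsilon> \<in> {1, 2, 3}}"

definition boundary_wavelet_system ::
    "(real^2) set \<Rightarrow> int \<Rightarrow> (int \<Rightarrow> (real^2) set) \<Rightarrow> (w_index \<Rightarrow> cfun) \<Rightarrow> bool" where
  "boundary_wavelet_system \<Omega> J0 K \<omega> \<longleftrightarrow>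
     (\<forall>j\<ge>J0. K j \<subseteq> \<Omega> \<and> finite (K j)) \<and>
     (\<exists>c C. 0 < c \<and> 0 < C \<and>
        (\<forall>j\<ge>J0. c * 2 powr (2 * real_of_int j) \<le> real (card (K j)) \<and>
                 real (card (K j)) \<le> C * 2 powr (2 * real_of_int j))) \<and>
     (\<forall>\<theta>\<in>w_indices J0 K. \<omega> \<theta> \<in> L2 \<Omega>)"

definition wavelet_characterization ::
    "nat \<Rightarrow> (real^2) set \<Rightarrow> w_index set \<Rightarrow> (w_index \<Rightarrow> cfun) \<Rightarrow> bool" where
  "wavelet_characterization s \<Omega> \<Theta> \<omega> \<longleftrightarrow> (\<exists>C D. 0 < C \<and> C \<le> D \<and>
     (\<forall>f\<in>Hs s \<Omega>.
        (\<lambda>\<theta>. 2 powr (2 * real_of_int (fst \<theta>) * real s) * (cmod (L2_inner \<Omega> f (\<omega> \<theta>)))\<^sup>2)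
          summable_on \<Theta> \<and>
        C * (Hs_norm s \<Omega> f)\<^sup>2 \<le>
          (\<Sum>\<^sub>\<infinity>\<theta>\<in>\<Theta>. 2 powr (2 * real_of_int (fst \<theta>) * real s) * (cmod (L2_inner \<Omega> f (\<omega> \<theta>)))\<^sup>2) \<and>
        (\<Sum>\<^sub>\<infinity>\<theta>\<in>\<Theta>. 2 powr (2 * real_of_int (fst \<theta>) * real s) * (cmod (L2_inner \<Omega> f (\<omega> \<theta>)))\<^sup>2)
          \<le> D * (Hs_norm s \<Omega> f)\<^sup>2))"

text \<open>
  The set whose infimum is \<open>q\<^sub>w\<^sup>(\<^sup>0\<^sup>)\<close> (for the dual elements) or \<open>q\<^sub>w\<^sup>(\<^sup>1\<^sup>)\<close> (for the wavelets). The
  infimum being finite means that the set is nonempty.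
\<close>

definition support_radii :: "(real^2) set \<Rightarrow> w_index set \<Rightarrow> (w_index \<Rightarrow> cfun) \<Rightarrow> real set" where
  "support_radii \<Omega> \<Theta> u = {q. 0 < q \<and>
     (\<forall>(j, m, \<upsilon>)\<in>\<Theta>. ess_supp (zero_ext \<Omega> (u (j, m, \<upsilon>))) \<subseteq> ball m (2 powr (- real_of_int j) * q))}"

definition support_radius :: "(real^2) set \<Rightarrow> w_index set \<Rightarrow> (w_index \<Rightarrow> cfun) \<Rightarrow> real" where
  "support_radius \<Omega> \<Theta> u = Inf (support_radii \<Omega> \<Theta> u)"

text \<open>
  \<open>d \<theta>\<close> is the dual element belonging to the normalised wavelet \<open>2\<^bsup>-js\<^esup> \<omega>\<^sub>\<theta>\<close>. The coordinate \<open>i\<close>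
  may depend on \<open>\<theta>\<close> but not on \<open>\<xi>\<close>, while the constant \<open>C\<close> is uniform in both.
\<close>

definition wavelet_dual_decay ::
    "nat \<Rightarrow> (real^2) set \<Rightarrow> real \<Rightarrow> real \<Rightarrow> w_index set \<Rightarrow> (w_index \<Rightarrow> cfun) \<Rightarrow> bool" where
  "wavelet_dual_decay s \<Omega> \<alpha> \<beta> \<Theta> d \<longleftrightarrow> (\<exists>C. 0 < C \<and>
     (\<forall>(j, m, \<upsilon>)\<in>\<Theta>. frontier \<Omega> \<inter> ess_supp (zero_ext \<Omega> (d (j, m, \<upsilon>))) = {} \<longrightarrow>
       (\<exists>i. \<forall>\<xi>. cmod (fourier (zero_ext \<Omega> (d (j, m, \<upsilon>))) \<xi>) \<le>
          C * (2 powr (- (real_of_int j * real s)) * 2 powr (- real_of_int j) *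
            (min 1 (\<bar>2 powr (- real_of_int j) * \<xi> $ i\<bar> powr \<alpha>) /
             (max 1 (\<bar>2 powr (- real_of_int j) * \<xi> $ 1\<bar> powr \<beta>) *
              max 1 (\<bar>2 powr (- real_of_int j) * \<xi> $ 2\<bar> powr \<beta>)))))))"

definition wavelet_dual_condition ::
    "nat \<Rightarrow> (real^2) set \<Rightarrow> real \<Rightarrow> real \<Rightarrow> w_index set \<Rightarrow> (w_index \<Rightarrow> cfun) \<Rightarrow> (w_index \<Rightarrow> cfun) \<Rightarrow> bool"
  where
  "wavelet_dual_condition s \<Omega> \<alpha> \<beta> \<Theta> \<omega> d \<longleftrightarrow>
     Hs_frame s \<Omega> \<Theta> (\<lambda>\<theta>. scaled s (fst \<theta>) (\<omega> \<theta>)) \<and>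
     Hs_dual_frame s \<Omega> \<Theta> (\<lambda>\<theta>. scaled s (fst \<theta>) (\<omega> \<theta>)) d \<and>
     wavelet_dual_decay s \<Omega> \<alpha> \<beta> \<Theta> d \<and>
     (\<forall>\<theta>\<in>\<Theta>. compact (ess_supp (zero_ext \<Omega> (d \<theta>)))) \<and>
     support_radii \<Omega> \<Theta> d \<noteq> {} \<and> 0 < support_radius \<Omega> \<Theta> d"

definition wavelet_support_condition ::
    "(real^2) set \<Rightarrow> int \<Rightarrow> (int \<Rightarrow> (real^2) set) \<Rightarrow> (w_index \<Rightarrow> cfun) \<Rightarrow> bool" where
  "wavelet_support_condition \<Omega> J0 K \<omega> \<longleftrightarrow>
     (\<forall>\<theta>\<in>w_indices J0 K. compact (ess_supp (zero_ext \<Omega> (\<omega> \<theta>)))) \<and>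
     support_radii \<Omega> (w_indices J0 K) \<omega> \<noteq> {} \<and> 0 < support_radius \<Omega> (w_indices J0 K) \<omega> \<and>
     (\<exists>q2>0. \<forall>j\<ge>J0. \<forall>m\<in>K j. \<forall>m'\<in>K j. m \<noteq> m' \<longrightarrow> 2 powr (- real_of_int j) * q2 \<le> norm (m - m'))"


section \<open>Boundary shearlet systems\<close>

definition boundary_strip :: "(real^2) set \<Rightarrow> real \<Rightarrow> real \<Rightarrow> (real^2) set" where
  "boundary_strip \<Omega> q r = {x \<in> \<Omega>. infdist x (frontier \<Omega>) < q * 2 powr (- r)}"

definition boundary_w_indices ::
    "(real^2) set \<Rightarrow> w_index set \<Rightarrow> (w_index \<Rightarrow> cfun) \<Rightarrow> (w_index \<Rightarrow> cfun) \<Rightarrow> real \<Rightarrow> real \<Rightarrow> real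
       \<Rightarrow> w_index set" where
  "boundary_w_indices \<Omega> \<Theta> \<omega> d q_sh t \<tau> = {(j, m, \<upsilon>) \<in> \<Theta>.
     ball m (2 powr (- real_of_int j) * (support_radius \<Omega> \<Theta> d + support_radius \<Omega> \<Theta> \<omega>)) \<inter>
     boundary_strip \<Omega> q_sh (\<tau> * (real_of_int j - t)) \<noteq> {}}"

definition interior_sh_indices ::
    "(real^2) set \<Rightarrow> cfun \<Rightarrow> cfun \<Rightarrow> cfun \<Rightarrow> real \<times> real \<Rightarrow> sh_index set" where
  "interior_sh_indices \<Omega> \<phi> \<psi> \<psi>' c = {\<nu> \<in> sh_indices. ess_supp (shearlet \<phi> \<psi> \<psi>' c \<nu>) \<subseteq> \<Omega>}"

text \<open>
  The boundary shearlet system as a family over the disjoint union of the two (countable) index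
  sets, together with the scale \<open>j\<^sub>n\<close> of each member.
\<close>

definition bsh_indices ::
    "(real^2) set \<Rightarrow> cfun \<Rightarrow> cfun \<Rightarrow> cfun \<Rightarrow> real \<times> real \<Rightarrow> w_index set \<Rightarrow> (w_index \<Rightarrow> cfun) \<Rightarrow>
       (w_index \<Rightarrow> cfun) \<Rightarrow> real \<Rightarrow> real \<Rightarrow> real \<Rightarrow> (sh_index + w_index) set" where
  "bsh_indices \<Omega> \<phi> \<psi> \<psi>' c \<Theta> \<omega> d q_sh t \<tau> =
     interior_sh_indices \<Omega> \<phi> \<psi> \<psi>' c <+> boundary_w_indices \<Omega> \<Theta> \<omega> d q_sh t \<tau>"

definition bsh ::
    "cfun \<Rightarrow> cfun \<Rightarrow> cfun \<Rightarrow> real \<times> real \<Rightarrow> (w_index \<Rightarrow> cfun) \<Rightarrow> sh_index + w_index \<Rightarrow> cfun" where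
  "bsh \<phi> \<psi> \<psi>' c \<omega> = case_sum (shearlet \<phi> \<psi> \<psi>' c) \<omega>"

definition bsh_scale :: "sh_index + w_index \<Rightarrow> int" where
  "bsh_scale = case_sum fst fst"

end

theory Submission
  imports Defs "HOL-Probability.Probability"
begin

text \<open>
  Every \<open>f\<close> is expanded in the wavelet dual frame and split as \<open>f = g + h\<close>, where \<open>h\<close> collects the
  boundary indices. The boundary wavelets control \<open>h\<close>. Extended by zero, \<open>g\<close> lies in \<open>H\<^sup>s(\<real>\<^sup>2)\<close>, so
  its norm is controlled by all its shearlet coefficients. The coefficients for shearlets supported
  in \<open>\<Omega>\<close> are those of \<open>f\<close> minus those of \<open>h\<close>, and the latter are bounded by \<open>h\<close> thanks to the
  extension operator. A shearlet that leaves \<open>\<Omega>\<close> at scale \<open>j\<close> only meets interior dual wavelets of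
  scale \<open>j' > t + j / (2\<tau>)\<close>; as \<open>2\<tau> < 1\<close>, such wavelets oscillate much faster than the shearlet, and
  Parseval's identity together with the decay of the Fourier transforms makes the squared inner
  products summable over all pairs with \<open>j' > j / (2\<tau>)\<close>. Hence their sum over the pairs that occur
  tends to 0 as \<open>t\<close> grows, and the corresponding term is absorbed into \<open>\<parallel>f\<parallel>\<^sup>2\<close>. All wavelet expansions
  are cut off to finite sums, so that completeness of \<open>H\<^sup>s\<close> is never needed. The low-frequency
  generator \<open>\<phi>\<close> has no decay, but only finitely many of its translates meet \<open>\<Omega>\<close>.
\<close>

section \<open>Smooth functions and test functions\<close>

text \<open>Extension by zero keeps weak derivatives here because a cutoff fits between the support
  and the boundary. The room for it is the wavelet radius that the index condition adds to the
  radius of the dual elements; both are positive. Inner products are estimated in the coordinates of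
  the shearlet: with \<xi> = B^T \<eta> for its matrix B, the modulus of its transform becomes that
  of the generator up to a factor. Derivatives and the factor |\<xi>_i|^\<alpha> of the wavelet then
  cost powers of a single weight in \<eta>, with 3 * 2^j as the size of B^T, and the decay exponent
  of the generator pays for them with an integrable rest. Since one factor thus has an integrable
  transform, Parseval's identity follows from inversion in L^1, without a Plancherel extension.
  Elements of \<open>Hs\<close> are representatives and \<open>weak_deriv\<close> is a choice, so
  every comparison of derivatives goes through the fundamental lemma of the calculus of variations;
  the inversion theorem is obtained from the same lemma. The share \<epsilon> in the hypothesis on
  \<tau> is what keeps a geometric decay in the wavelet scale after the shearlet scale has been paid
  for.\<close>

fun diff_upto :: "nat \<Rightarrow> cfun \<Rightarrow> bool" where
  "diff_upto 0 f \<longleftrightarrow> (\<forall>x. f differentiable at x)"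
| "diff_upto (Suc n) f \<longleftrightarrow> (\<forall>x. f differentiable at x) \<and> (\<forall>i. diff_upto n (partial i f))"

text \<open>The finite order serves as induction variable for products, inverses and compositions.
  The recursion peels off the derivative that is taken first, which in \<open>foldr\<close> is the
  last entry of the list; hence the case split from the right.\<close>

lemma diff_upto_iff:
  "diff_upto n f \<longleftrightarrow> (\<forall>is. length is \<le> n \<longrightarrow> (\<forall>x. foldr partial is f differentiable at x))"
proof (induction n arbitrary: f)
  case (Suc n)
  show ?case
  proof safe
    fix "is" :: "2 list" and x
    assume *: "diff_upto (Suc n) f" "length is \<le> Suc n"
    show "foldr partial is f differentiable at x"
    proof (cases "is" rule: rev_cases)
      case (snoc js i)
      with * Suc.IH show ?thesis by auto
    qed (use * in auto)
  next
    assume *: "\<forall>is. length is \<le> Suc n \<longrightarrow> (\<forall>x. foldr partial is f differentiable at x)"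
    have "diff_upto n (partial i f)" for i
      unfolding Suc.IH
    proof (intro allI impI)
      fix "is" :: "2 list" and x assume "length is \<le> n"
      with *[rule_format, of "is @ [i]" x] show "foldr partial is (partial i f) differentiable at x"
        by simp
    qed
    with *[rule_format, of "[]"] show "diff_upto (Suc n) f" by simp
  qed
qed simp

lemma smooth_iff_diff_upto: "smooth f \<longleftrightarrow> (\<forall>n. diff_upto n f)"
  unfolding smooth_def diff_upto_iff by auto

lemma diff_upto_Suc_D: "diff_upto (Suc n) f \<Longrightarrow> diff_upto n f"
  unfolding diff_upto_iff by auto

lemma diff_upto_differentiable: "diff_upto n f \<Longrightarrow> f differentiable at x"
  by (cases n) auto

lemma smooth_partial: "smooth f \<Longrightarrow> smooth (partial i f)"
  unfolding smooth_iff_diff_upto by (metis diff_upto.simps(2))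

lemma smooth_differentiable: "smooth f \<Longrightarrow> f differentiable at x"
  unfolding smooth_iff_diff_upto by (metis diff_upto.simps(1))

lemma smooth_continuous: "smooth f \<Longrightarrow> continuous_on S f"
  by (meson continuous_at_imp_continuous_on differentiable_imp_continuous_within smooth_differentiable)

section \<open>Rules for first partial derivatives\<close>

lemma partial_eq: "(f has_derivative f') (at x) \<Longrightarrow> partial i f x = f' (axis i 1)"
  unfolding partial_def by (metis frechet_derivative_at)

lemma partial_has_derivative:
  "f differentiable at x \<Longrightarrow> (f has_derivative frechet_derivative f (at x)) (at x)"
  by (simp add: frechet_derivative_works)

lemma partial_add:
  assumes "f differentiable at x" "g differentiable at x"
  shows "partial i (\<lambda>x. f x + g x) x = partial i f x + partial i g x"
  using partial_eq[OF has_derivative_add[OF partial_has_derivative[OF assms(1)] partial_has_derivative[OF assms(2)]]]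
  by (simp add: partial_def)

lemma partial_mult:
  assumes "f differentiable at x" "g differentiable at x"
  shows "partial i (\<lambda>x. f x * g x) x = f x * partial i g x + partial i f x * g x"
  using partial_eq[OF has_derivative_mult[OF partial_has_derivative[OF assms(1)] partial_has_derivative[OF assms(2)]]]
  by (simp add: partial_def)

lemma partial_inverse:
  assumes "f differentiable at x" "f x \<noteq> 0"
  shows "partial i (\<lambda>x. inverse (f x)) x = (- 1) * (inverse (f x) * inverse (f x)) * partial i f x"
proof -
  have "((\<lambda>x. inverse (f x)) has_derivative
          (\<lambda>h. - (inverse (f x) * frechet_derivative f (at x) h * inverse (f x)))) (at x)"
    using assms(2) partial_has_derivative[OF assms(1)] by (rule Deriv.has_derivative_inverse)
  from partial_eq[OF this] show ?thesis by (simp add: partial_def)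
qed

section \<open>Closure of finite-order differentiability under algebra and composition\<close>

lemma diff_upto_const: "diff_upto n (\<lambda>x. c)"
proof (induction n arbitrary: c)
  case (Suc n)
  have "partial i (\<lambda>x. c) = (\<lambda>x. 0)" for i
    by (rule ext, subst partial_eq[OF has_derivative_const]) simp
  with Suc show ?case by simp
qed simp

lemma diff_upto_coord: "diff_upto n (\<lambda>x. complex_of_real (x \<bullet> v))"
proof -
  have *: "((\<lambda>x. complex_of_real (x \<bullet> v)) has_derivative (\<lambda>h. complex_of_real (h \<bullet> v))) (at x)"
    for x :: "real^2"
    by (auto intro!: derivative_eq_intros)
  have "partial i (\<lambda>x. complex_of_real (x \<bullet> v)) = (\<lambda>x. complex_of_real (axis i 1 \<bullet> v))" for i
    by (rule ext, subst partial_eq[OF *]) simp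
  moreover have "(\<lambda>x. complex_of_real (x \<bullet> v)) differentiable at x" for x
    using * unfolding differentiable_def by blast
  ultimately show ?thesis by (cases n) (simp_all add: diff_upto_const)
qed

lemma diff_upto_add: "diff_upto n f \<Longrightarrow> diff_upto n g \<Longrightarrow> diff_upto n (\<lambda>x. f x + g x)"
proof (induction n arbitrary: f g)
  case (Suc n)
  have "partial i (\<lambda>x. f x + g x) = (\<lambda>x. partial i f x + partial i g x)" for i
    using Suc.prems by (intro ext partial_add) auto
  with Suc show ?case by simp
qed simp

lemma diff_upto_mult: "diff_upto n f \<Longrightarrow> diff_upto n g \<Longrightarrow> diff_upto n (\<lambda>x. f x * g x)"
proof (induction n arbitrary: f g)
  case (Suc n)
  have "partial i (\<lambda>x. f x * g x) = (\<lambda>x. f x * partial i g x + partial i f x * g x)" for i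
    using Suc.prems by (intro ext partial_mult) auto
  with Suc.prems show ?case
    by (auto intro!: diff_upto_add Suc.IH simp: diff_upto_Suc_D)
qed simp

text \<open>The derivative -f' / f^2 contains 1/f again, but only to order n, where the induction
  hypothesis for the same f supplies it.\<close>

lemma diff_upto_inverse:
  "diff_upto n f \<Longrightarrow> (\<And>x. f x \<noteq> 0) \<Longrightarrow> diff_upto n (\<lambda>x. inverse (f x))"
proof (induction n arbitrary: f)
  case (Suc n)
  have "partial i (\<lambda>x. inverse (f x)) = (\<lambda>x. (- 1) * (inverse (f x) * inverse (f x)) * partial i f x)" for i
    using Suc.prems by (intro ext partial_inverse) auto
  moreover have "diff_upto n (\<lambda>x. inverse (f x))"
    using Suc by (simp add: diff_upto_Suc_D)
  ultimately have "diff_upto n (partial i (\<lambda>x. inverse (f x)))" for i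
    using diff_upto_mult[OF diff_upto_mult[OF diff_upto_const[of n "- 1"]
        diff_upto_mult[of n "\<lambda>x. inverse (f x)" "\<lambda>x. inverse (f x)"]], of "partial i f"]
      Suc.prems by simp
  moreover have "(\<lambda>x. inverse (f x)) differentiable at x" for x
    using Suc.prems by (simp add: differentiable_inverse)
  ultimately show ?case by simp
qed (simp add: differentiable_inverse)

text \<open>\<open>R\<close> is a class of real functions that contains a derivative of each member.
  By the chain rule a derivative of h(p) is a product of h'(p), with h' again in \<open>R\<close>,
  and a derivative of p, so induction on the order with h arbitrary works.\<close>

lemma diff_upto_compose:
  assumes R: "\<And>h. h \<in> R \<Longrightarrow> \<exists>h'\<in>R. \<forall>t. (h has_real_derivative h' t) (at t)"
    and p: "\<And>n. diff_upto n (\<lambda>x. complex_of_real (p x))"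
    and "h \<in> R"
  shows "diff_upto n (\<lambda>x. complex_of_real (h (p x)))"
  using \<open>h \<in> R\<close>
proof (induction n arbitrary: h)
  have pd: "(p has_derivative (\<lambda>v. Re (frechet_derivative (\<lambda>x. complex_of_real (p x)) (at x) v))) (at x)"
    for x
    using has_derivative_Re[OF partial_has_derivative[OF diff_upto_differentiable[OF p[of 0]]], of x]
    by simp
  \<comment> \<open>\<open>pd\<close> recovers only the real part of the derivative of the embedded
    p; this shows that nothing is lost.\<close>
  have im: "Im (frechet_derivative (\<lambda>x. complex_of_real (p x)) (at x) v) = 0" for x v
  proof -
    have "((\<lambda>x. 0) has_derivative (\<lambda>v. Im (frechet_derivative (\<lambda>x. complex_of_real (p x)) (at x) v))) (at x)"
      using has_derivative_Im[OF partial_has_derivative[OF diff_upto_differentiable[OF p[of 0]]], of x]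
      by simp
    from has_derivative_unique[OF this has_derivative_const] show ?thesis by (auto dest: fun_cong)
  qed
  have d: "((\<lambda>x. complex_of_real (h (p x))) has_derivative
      (\<lambda>v. complex_of_real (h' (p x)) * frechet_derivative (\<lambda>x. complex_of_real (p x)) (at x) v)) (at x)"
    if "\<forall>t. (h has_real_derivative h' t) (at t)" for h h' x
  proof -
    have "((\<lambda>x. h (p x)) has_derivative
        (\<lambda>v. Re (frechet_derivative (\<lambda>x. complex_of_real (p x)) (at x) v) * h' (p x))) (at x)"
      using has_derivative_compose[OF pd, of h] that
      by (simp add: has_field_derivative_def mult.commute)
    from has_derivative_of_real[OF this, where 'a=complex]
    show ?thesis
      by (rule has_derivative_eq_rhs) (auto simp: complex_eq_iff im)
  qed
  {
    case 0
    then show ?case using R d unfolding diff_upto.simps differentiable_def by metis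
  next
    case (Suc n)
    obtain h' where h': "h' \<in> R" "\<forall>t. (h has_real_derivative h' t) (at t)" using R Suc.prems by blast
    have "partial i (\<lambda>x. complex_of_real (h (p x))) =
       (\<lambda>x. complex_of_real (h' (p x)) * partial i (\<lambda>x. complex_of_real (p x)) x)" for i
      by (rule ext, subst partial_eq[OF d[OF h'(2)]]) (simp add: partial_def)
    moreover have "diff_upto n (partial i (\<lambda>x. complex_of_real (p x)))" for i
      using p[of "Suc n"] by simp
    ultimately show ?case
      using d[OF h'(2)] Suc.IH[OF h'(1)] diff_upto_mult
      unfolding diff_upto.simps differentiable_def by auto
  }
qed

section \<open>Exponentials as eigenfunctions of differentiation\<close>

lemma partial_exp_inner:
  "partial i (\<lambda>x. exp (c * complex_of_real (x \<bullet> v))) =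
     (\<lambda>x. (c * complex_of_real (v $ i)) * exp (c * complex_of_real (x \<bullet> v)))"
  "(\<lambda>x. exp (c * complex_of_real (x \<bullet> v))) differentiable at (y :: real^2)"
proof -
  have *: "((\<lambda>x. exp (c * complex_of_real (x \<bullet> v))) has_derivative
      (\<lambda>h. c * complex_of_real (h \<bullet> v) * exp (c * complex_of_real (x \<bullet> v)))) (at x)"
    for x :: "real^2"
    by (auto intro!: derivative_eq_intros has_derivative_compose[where g=exp, OF _ DERIV_exp[unfolded has_field_derivative_def], THEN has_derivative_eq_rhs] simp: fun_eq_iff)
  show "partial i (\<lambda>x. exp (c * complex_of_real (x \<bullet> v))) =
     (\<lambda>x. (c * complex_of_real (v $ i)) * exp (c * complex_of_real (x \<bullet> v)))"
    by (rule ext, subst partial_eq[OF *]) (simp add: inner_axis')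
  show "(\<lambda>x. exp (c * complex_of_real (x \<bullet> v))) differentiable at y"
    using * unfolding differentiable_def by blast
qed

lemma diff_upto_exp_inner: "diff_upto n (\<lambda>x. exp (c * complex_of_real (x \<bullet> v)))"
proof (induction n)
  case (Suc n)
  then show ?case
    by (auto simp: partial_exp_inner intro!: diff_upto_mult diff_upto_const simp del: mult_cancel_left1)
qed (simp add: partial_exp_inner)

lemma partial_cmult: "f differentiable at x \<Longrightarrow> partial i (\<lambda>x. c * f x) x = c * partial i f x"
  using partial_mult[of "\<lambda>x. c" x f i] partial_eq[OF has_derivative_const, of i c x] by simp

lemma smooth_mult: "smooth f \<Longrightarrow> smooth g \<Longrightarrow> smooth (\<lambda>x. f x * g x)"
  unfolding smooth_iff_diff_upto by (auto intro: diff_upto_mult)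

lemma smooth_exp_inner: "smooth (\<lambda>x. exp (c * complex_of_real (x \<bullet> v)))"
  unfolding smooth_iff_diff_upto by (auto intro: diff_upto_exp_inner)

lemma partial_exp_inner_iterate:
  "(partial i ^^ n) (\<lambda>x. a * exp (c * complex_of_real (x \<bullet> v))) =
     (\<lambda>x. a * (c * complex_of_real (v $ i)) ^ n * exp (c * complex_of_real (x \<bullet> v)))"
proof (induction n)
  case (Suc n)
  show ?case
    unfolding funpow.simps o_def Suc
    by (rule ext, subst partial_cmult[OF partial_exp_inner(2)], subst partial_exp_inner(1)) (simp add: mult_ac)
qed simp

lemma D_classical_exp_inner:
  "D_classical a (\<lambda>x. exp (c * complex_of_real (x \<bullet> v))) =
     (\<lambda>x. (c * complex_of_real (v $ 1)) ^ fst a * (c * complex_of_real (v $ 2)) ^ snd a *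
          exp (c * complex_of_real (x \<bullet> v)))"
  using partial_exp_inner_iterate[where i=2 and n="snd a" and a=1 and c=c and v=v]
    partial_exp_inner_iterate[where i=1 and n="fst a" and a="(c * complex_of_real (v $ 2)) ^ snd a"
      and c=c and v=v]
  unfolding D_classical_def by (simp add: mult_ac)

text \<open>Both functions have the same set of derivatives at x, so the choice made by
  \<open>frechet_derivative\<close> is the same, even if that set is empty.\<close>

lemma partial_local:
  assumes "open U" "\<And>x. x \<in> U \<Longrightarrow> f x = g x" "x \<in> U"
  shows "partial i f x = partial i g x"
proof -
  have "(f has_derivative f') (at x) \<longleftrightarrow> (g has_derivative f') (at x)" for f'
    using has_derivative_transform_within_open[OF _ assms(1,3), where t=UNIV and f'=f'] assms(2)
    by (metis UNIV_I)
  then show ?thesis unfolding partial_def frechet_derivative_def by simp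
qed

lemma partial_iterate_local:
  assumes "open U" "\<And>x. x \<in> U \<Longrightarrow> f x = g x" "x \<in> U"
  shows "(partial i ^^ n) f x = (partial i ^^ n) g x"
  using assms(3)
proof (induction n arbitrary: x)
  case (Suc n)
  show ?case unfolding funpow.simps o_def by (rule partial_local[OF assms(1) Suc.IH Suc.prems])
qed (use assms in simp)

lemma D_classical_local:
  assumes "open U" "\<And>x. x \<in> U \<Longrightarrow> f x = g x" "x \<in> U"
  shows "D_classical a f x = D_classical a g x"
  unfolding D_classical_def
  by (intro partial_iterate_local[OF assms(1) _ assms(3)] partial_iterate_local[OF assms(1,2)])

lemma smooth_D_classical: "smooth f \<Longrightarrow> smooth (D_classical a f)"
proof -
  have "smooth g \<Longrightarrow> smooth ((partial i ^^ n) g)" for i n g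
    by (induction n) (auto intro: smooth_partial)
  then show "smooth f \<Longrightarrow> smooth (D_classical a f)" unfolding D_classical_def by blast
qed

lemma D_classical_eq_0:
  assumes "x \<notin> closure {x. f x \<noteq> 0}"
  shows "D_classical a f x = 0"
proof -
  have z: "(partial i ^^ n) (\<lambda>x. 0) = (\<lambda>x. 0)" for i n
  proof (induction n)
    case (Suc n)
    show ?case unfolding funpow.simps o_def Suc
      by (rule ext, subst partial_eq[OF has_derivative_const]) simp
  qed simp
  have "D_classical a f x = D_classical a (\<lambda>x. 0) x"
    by (rule D_classical_local[of "- closure {x. f x \<noteq> 0}"])
      (use assms closure_subset[of "{x. f x \<noteq> 0}"] in \<open>auto\<close>)
  then show ?thesis unfolding D_classical_def by (simp add: z)
qed

section \<open>The flat function exp(-1/t) and the cutoffs built from it\<close>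

definition bump_family :: "(real \<Rightarrow> real) set" where
  "bump_family = {\<lambda>t. if t > 0 then poly q (1 / t) * exp (- (1 / t)) else 0 | q. True}"

lemma poly_exp_decay: "((\<lambda>y. poly q y * exp (- y)) \<longlongrightarrow> 0) (at_top :: real filter)"
proof -
  \<comment> \<open>The extra power y^n makes the induction over the coefficients go through,
    because \<open>pCons\<close> multiplies the tail by y.\<close>
  have "((\<lambda>y. poly q y * exp (- y) * y ^ n) \<longlongrightarrow> 0) (at_top :: real filter)" for n
  proof (induction q arbitrary: n)
    case (pCons a q)
    have "((\<lambda>y. a * (y ^ n / exp y) + poly q y * exp (- y) * y ^ Suc n) \<longlongrightarrow> a * 0 + 0) (at_top :: real filter)"
      by (rule tendsto_add[OF tendsto_mult[OF tendsto_const tendsto_power_div_exp_0] pCons.IH])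
    moreover have "a * (y ^ n / exp y) + poly q y * exp (- y) * y ^ Suc n = poly (pCons a q) y * exp (- y) * y ^ n" for y
      unfolding exp_minus divide_inverse poly_pCons by (simp add: distrib_right distrib_left mult_ac)
    ultimately show ?case by simp
  qed simp
  from this[of 0] show ?thesis by simp
qed

text \<open>The functions q(1/t) exp(-1/t), continued by 0 to t \<le> 0, differentiate into
  functions of the same form. So each is infinitely often differentiable, also at 0, where exp(-1/t)
  beats every power of 1/t.\<close>

lemma bump_family_closed:
  assumes "h \<in> bump_family"
  shows "\<exists>h'\<in>bump_family. \<forall>t. (h has_real_derivative h' t) (at t)"
proof -
  from assms obtain q where h: "h = (\<lambda>t. if t > 0 then poly q (1 / t) * exp (- (1 / t)) else 0)"
    unfolding bump_family_def by auto
  \<comment> \<open>For t > 0 the derivative of q(1/t) exp(-1/t) is t^(-2) (q - q')(1/t) exp(-1/t),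
    and t^(-2) is the polynomial X^2 at 1/t.\<close>
  define r where "r = [:0, 0, 1:] * (q - pderiv q)"
  define h' where "h' = (\<lambda>t::real. if t > 0 then poly r (1 / t) * exp (- (1 / t)) else 0)"
  have "(h has_real_derivative h' t) (at t)" for t
  proof (cases t "0 :: real" rule: linorder_cases)
    case greater
    have inv: "((\<lambda>t. 1 / t) has_real_derivative - (1 / t)\<^sup>2) (at t)"
      using greater DERIV_inverse[of t UNIV] by (simp add: inverse_eq_divide power2_eq_square)
    have "((\<lambda>t. poly q (1 / t) * exp (- (1 / t))) has_real_derivative
        poly (pderiv q) (1 / t) * (- (1 / t)\<^sup>2) * exp (- (1 / t)) +
        exp (- (1 / t)) * - (- (1 / t)\<^sup>2) * poly q (1 / t)) (at t)"
      by (intro DERIV_mult DERIV_chain2[OF poly_DERIV inv] DERIV_chain2[OF DERIV_exp DERIV_minus[OF inv]])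
    moreover have "poly (pderiv q) (1 / t) * (- (1 / t)\<^sup>2) * exp (- (1 / t)) +
        exp (- (1 / t)) * - (- (1 / t)\<^sup>2) * poly q (1 / t) = h' t"
    proof -
      have "poly (pderiv q) y * (- y\<^sup>2) * e + e * - (- y\<^sup>2) * poly q y = poly r y * e" for y e :: real
        unfolding r_def poly_mult poly_diff by (simp add: algebra_simps power2_eq_square)
      with greater show ?thesis unfolding h'_def by presburger
    qed
    ultimately have "((\<lambda>t. poly q (1 / t) * exp (- (1 / t))) has_real_derivative h' t) (at t)"
      by simp
    then show ?thesis
      by (rule has_field_derivative_transform_within_open[of _ _ _ "{0<..}"])
        (use greater in \<open>auto simp: h\<close>)
  next
    case less
    have "((\<lambda>t. 0) has_real_derivative h' t) (at t)" using less by (simp add: h'_def)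
    then show ?thesis
      by (rule has_field_derivative_transform_within_open[of _ _ _ "{..<0}"])
        (use less in \<open>auto simp: h\<close>)
  next
    case equal
    \<comment> \<open>The difference quotient at 0 is h(t)/t, and the factor 1/t turns q into X
      q.\<close>
    have "((\<lambda>t. poly (pCons 0 q) (inverse t) * exp (- inverse t)) \<longlongrightarrow> 0) (at_right (0 :: real))"
      using filterlim_compose[OF poly_exp_decay filterlim_inverse_at_top_right] .
    then have "((\<lambda>t. (h t - h 0) / (t - 0)) \<longlongrightarrow> 0) (at_right 0)"
    proof (rule Lim_transform_eventually)
      show "\<forall>\<^sub>F t in at_right 0. poly (pCons 0 q) (inverse t) * exp (- inverse t) = (h t - h 0) / (t - 0)"
        using eventually_at_right_less[of 0] by eventually_elim (simp add: h divide_inverse mult_ac)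
    qed
    moreover have "((\<lambda>t. (h t - h 0) / (t - 0)) \<longlongrightarrow> 0) (at_left 0)"
    proof (rule Lim_transform_eventually[OF tendsto_const])
      show "\<forall>\<^sub>F t in at_left 0. 0 = (h t - h 0) / (t - 0)"
        unfolding eventually_at_filter by (rule always_eventually) (auto simp: h)
    qed
    ultimately have "((\<lambda>t. (h t - h 0) / (t - 0)) \<longlongrightarrow> 0) (at 0)"
      by (simp add: filterlim_split_at)
    then show ?thesis using equal by (simp add: has_field_derivative_iff h'_def)
  qed
  moreover have "h' \<in> bump_family" unfolding h'_def bump_family_def by (intro CollectI exI[of _ r] conjI refl TrueI)
  ultimately show ?thesis by blast
qed

definition bump :: "real \<Rightarrow> real" where
  "bump t = (if t > 0 then exp (- (1 / t)) else 0)"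

lemma bump_bounds: "0 \<le> bump t" "bump t \<le> 1" "0 < bump t \<longleftrightarrow> 0 < t" "bump t \<noteq> 0 \<longleftrightarrow> 0 < t"
  unfolding bump_def by auto

lemma bump_in_family: "bump \<in> bump_family"
  unfolding bump_family_def bump_def
  by (auto intro!: exI[of _ "1 :: real poly"])

lemma diff_upto_bump:
  "(\<And>n. diff_upto n (\<lambda>x. complex_of_real (p x))) \<Longrightarrow> diff_upto n (\<lambda>x. complex_of_real (bump (p x)))"
  by (rule diff_upto_compose[OF bump_family_closed _ bump_in_family])

lemma diff_upto_affine: "diff_upto n (\<lambda>x. complex_of_real (a + b * (x \<bullet> v)))"
  using diff_upto_add[OF diff_upto_const diff_upto_mult[OF diff_upto_const diff_upto_coord], of n "of_real a" "of_real b" v]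
  by simp

text \<open>Four one-sided bumps, one per edge. The parameter r controls only the steepness: the
  support stays in the box, while the functions tend to the indicator of the open box as r
  grows.\<close>

lemma box_bump_test:
  fixes a b :: "real^2"
  assumes "cbox a b \<subseteq> \<Omega>" and that: "r > 0"
  shows "(\<lambda>x. complex_of_real (bump (r * (x$1 - a$1)) * bump (r * (b$1 - x$1)) *
            (bump (r * (x$2 - a$2)) * bump (r * (b$2 - x$2))))) \<in> test_functions \<Omega>"
    (is "?f \<in> _")
proof -
  have c: "diff_upto n (\<lambda>x. complex_of_real (c + d * x $ i))" for n c d i
    using diff_upto_affine[of n c d "axis i 1"] by (simp add: inner_axis)
  have 1: "diff_upto n (\<lambda>x. complex_of_real (bump (c + d * x $ i)))" for n c d i
    by (rule diff_upto_bump) (rule c)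
  have "diff_upto n ?f" for n
    using diff_upto_mult[OF diff_upto_mult[OF 1 1] diff_upto_mult[OF 1 1],
       of n "- r * a$1" r 1 "r * b$1" "-r" 1 "- r * a$2" r 2 "r * b$2" "-r" 2]
    by (simp add: algebra_simps)
  moreover have "closure {x. ?f x \<noteq> 0} \<subseteq> cbox a b"
    by (rule closure_minimal)
      (use that in \<open>auto simp: bump_bounds mem_box_cart zero_less_mult_iff exhaust_2 forall_2\<close>)
  moreover from this have "compact (closure {x. ?f x \<noteq> 0})"
    by (meson bounded_cbox bounded_subset closed_closure compact_eq_bounded_closed)
  ultimately show ?thesis
    unfolding test_functions_def smooth_iff_diff_upto using assms by blast
qed

text \<open>The usual quotient of bumps, taken in the squared distance p from m, which is a
  polynomial and hence smooth at the centre too. The value is 1 where p \<le> r^2 and 0 where p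
  \<ge> R^2.\<close>

lemma radial_cutoff:
  fixes m :: "real^2"
  assumes "0 \<le> r" "r < R" "cball m R \<subseteq> \<Omega>"
  obtains \<kappa> where "\<kappa> \<in> test_functions \<Omega>" "\<And>x. x \<in> ball m r \<Longrightarrow> \<kappa> x = 1" 
proof -
  define a where "a = r\<^sup>2"
  define b where "b = R\<^sup>2"
  have ab: "a < b" unfolding a_def b_def using assms by (simp add: power_strict_mono)
  define p where "p = (\<lambda>x :: real^2. (norm (x - m))\<^sup>2)"
  have p_eq: "p x = (x $ 1 - m $ 1) * (x $ 1 - m $ 1) + (x $ 2 - m $ 2) * (x $ 2 - m $ 2)" for x
    unfolding p_def power2_norm_eq_inner by (simp add: inner_vec_def sum_2)
  have c: "diff_upto n (\<lambda>x. complex_of_real (x $ i - d))" for n d i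
    using diff_upto_affine[of n "-d" 1 "axis i 1"] by (simp add: inner_axis)
  have p: "diff_upto n (\<lambda>x. complex_of_real (p x))" for n
    using diff_upto_add[OF diff_upto_mult[OF c c] diff_upto_mult[OF c c], of n 1 "m$1" 1 "m$1" 2 "m$2" 2 "m$2"]
    by (simp add: p_eq)
  have 1: "diff_upto n (\<lambda>x. complex_of_real (b - p x))" "diff_upto n (\<lambda>x. complex_of_real (p x - a))" for n
    using diff_upto_add[OF diff_upto_const diff_upto_mult[OF diff_upto_const p], of n "of_real b" "- 1"]
      diff_upto_add[OF diff_upto_const p, of n "- of_real a"]
    by simp_all
  define S where "S = (\<lambda>x. bump (b - p x) * inverse (bump (b - p x) + bump (p x - a)))"
  \<comment> \<open>As a < b, every point satisfies p < b or p > a, so one of the two summands is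
    positive.\<close>
  have pos: "bump (b - p x) + bump (p x - a) > 0" for x
    using bump_bounds ab by (smt (verit))
  have "diff_upto n (\<lambda>x. complex_of_real (bump (b - p x)) *
      inverse (complex_of_real (bump (b - p x)) + complex_of_real (bump (p x - a))))" for n
    using pos by (intro diff_upto_mult diff_upto_inverse diff_upto_add diff_upto_bump 1)
      (metis of_real_add of_real_eq_0_iff order_less_irrefl)
  then have sm: "smooth (\<lambda>x. complex_of_real (S x))"
    unfolding smooth_iff_diff_upto S_def by simp
  have sub: "closure {x. complex_of_real (S x) \<noteq> 0} \<subseteq> cball m R"
  proof (rule closure_minimal)
    show "{x. complex_of_real (S x) \<noteq> 0} \<subseteq> cball m R"
    proof
      fix x assume "x \<in> {x. complex_of_real (S x) \<noteq> 0}"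
      then have "p x < b" by (auto simp: S_def bump_bounds)
      then have "norm (x - m) < R" unfolding p_def b_def using assms by (simp add: power_less_imp_less_base)
      then show "x \<in> cball m R" by (simp add: dist_norm norm_minus_commute)
    qed
  qed simp
  then have "compact (closure {x. complex_of_real (S x) \<noteq> 0})"
    by (meson bounded_cball bounded_subset closed_closure compact_eq_bounded_closed)
  with sm sub assms(3) have "(\<lambda>x. complex_of_real (S x)) \<in> test_functions \<Omega>"
    unfolding test_functions_def by blast
  moreover have "complex_of_real (S x) = 1" if "x \<in> ball m r" for x
  proof -
    have "norm (x - m) < r" using that by (simp add: dist_norm norm_minus_commute)
    then have "p x < a" unfolding p_def a_def by (simp add: power_strict_mono)
    then have "bump (p x - a) = 0" by (simp add: bump_def)
    then show ?thesis using pos[of x] by (simp add: S_def)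
  qed
  ultimately show ?thesis using that by blast
qed

lemma test_functions_mult:
  assumes "\<kappa> \<in> test_functions \<Omega>" "smooth f"
  shows "(\<lambda>x. \<kappa> x * f x) \<in> test_functions \<Omega>"
proof -
  have "closure {x. \<kappa> x * f x \<noteq> 0} \<subseteq> closure {x. \<kappa> x \<noteq> 0}" by (intro closure_mono) auto
  moreover have "compact (closure {x. \<kappa> x \<noteq> 0})" "closure {x. \<kappa> x \<noteq> 0} \<subseteq> \<Omega>" "smooth \<kappa>"
    using assms(1) by (auto simp: test_functions_def)
  moreover have "compact (closure {x. \<kappa> x * f x \<noteq> 0})"
    using compact_Int_closed[OF calculation(2) closed_closure[of "{x. \<kappa> x * f x \<noteq> 0}"]] calculation(1)
    by (simp add: Int_absorb1)
  ultimately show ?thesis using smooth_mult[OF _ assms(2)] unfolding test_functions_def by auto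
qed

lemma test_functions_mono: "\<Omega> \<subseteq> \<Omega>' \<Longrightarrow> test_functions \<Omega> \<subseteq> test_functions \<Omega>'"
  unfolding test_functions_def by auto

section \<open>The fundamental lemma of the calculus of variations\<close>

lemma continuous_imp_lebesgue_measurable:
  "continuous_on UNIV f \<Longrightarrow> f \<in> borel_measurable lebesgue"
  by (rule measurable_completion) (simp add: borel_measurable_continuous_onI)

lemma borel_measurable_indicator_scaleR:
  fixes f :: "'a \<Rightarrow> 'b::{real_normed_vector, second_countable_topology}"
  assumes "S \<in> sets M" "f \<in> borel_measurable M"
  shows "(\<lambda>x. indicator S x *\<^sub>R f x) \<in> borel_measurable M"
  using assms by (intro borel_measurable_scaleR borel_measurable_indicator)

lemma sigma_finite_lebesgue: "sigma_finite_measure (lebesgue :: 'a::euclidean_space measure)"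
proof
  let ?A = "range (\<lambda>n::nat. cball (0::'a) (real n))"
  have "\<Union>?A = UNIV"
    by (auto simp: real_arch_simple)
  moreover have "emeasure lebesgue (cball (0::'a) (real n)) \<noteq> \<infinity>" for n
    using lmeasurable_cball[of "0::'a" "real n"] by (auto simp: fmeasurable_def)
  ultimately show "\<exists>A::'a set set. countable A \<and> A \<subseteq> sets lebesgue \<and> \<Union> A = space lebesgue \<and>
      (\<forall>a\<in>A. emeasure lebesgue a \<noteq> \<infinity>)"
    by (intro exI[of _ ?A]) auto
qed

text \<open>A Dynkin argument: open boxes are stable under intersection and generate the Borel sets,
  and the sets over which g integrates to 0 are closed under complements and disjoint countable
  unions.\<close>

lemma AE_zero_if_box_integrals_zero:
  fixes g :: cfun
  assumes g: "integrable lebesgue g"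
    and 0: "\<And>a b. (LINT x|lebesgue. indicator (box a b) x *\<^sub>R g x) = 0"
  shows "AE x in lebesgue. g x = 0"
proof -
  have gm [measurable]: "g \<in> borel_measurable lebesgue" using g by auto
  have int: "integrable lebesgue (\<lambda>x. indicator A x *\<^sub>R g x)" if "A \<in> sets lebesgue" for A
    using integrable_mult_indicator[OF that g] .
  \<comment> \<open>The complement step needs the integral over the whole plane, which is the limit
    over growing boxes.\<close>
  have tot: "(LINT x|lebesgue. g x) = 0"
  proof (rule LIMSEQ_unique)
    show "(\<lambda>n. LINT x|lebesgue. indicator (box (- (real n *\<^sub>R One)) (real n *\<^sub>R One)) x *\<^sub>R g x)
        \<longlonglongrightarrow> (LINT x|lebesgue. g x)"
    proof (rule integral_dominated_convergence[where w="\<lambda>x. norm (g x)"])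
      show "AE x in lebesgue. (\<lambda>n. indicator (box (- (real n *\<^sub>R One)) (real n *\<^sub>R One)) x *\<^sub>R g x) \<longlonglongrightarrow> g x"
      proof (rule AE_I2)
        fix x :: "real^2"
        have "x \<in> (\<Union>n::nat. box (- (real n *\<^sub>R One)) (real n *\<^sub>R One))" using UN_box_eq_UNIV by auto
        then obtain N :: nat where N: "x \<in> box (- (real N *\<^sub>R One)) (real N *\<^sub>R One)" by auto
        have "x \<in> box (- (real n *\<^sub>R One)) (real n *\<^sub>R One)" if "n \<ge> N" for n
          using N that unfolding mem_box by (auto simp: inner_Basis)
        then have "eventually (\<lambda>n. indicator (box (- (real n *\<^sub>R One)) (real n *\<^sub>R One)) x *\<^sub>R g x = g x) sequentially"
          unfolding eventually_sequentially by (intro exI[of _ N]) auto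
        then show "(\<lambda>n. indicator (box (- (real n *\<^sub>R One)) (real n *\<^sub>R One)) x *\<^sub>R g x) \<longlonglongrightarrow> g x"
          by (rule tendsto_eventually)
      qed
      show "AE x in lebesgue. norm (indicator (box (- (real n *\<^sub>R One)) (real n *\<^sub>R One)) x *\<^sub>R g x) \<le> norm (g x)" for n
        by (auto intro!: AE_I2 simp: indicator_def)
      show "(\<lambda>x. indicator (box (- (real n *\<^sub>R One)) (real n *\<^sub>R One)) x *\<^sub>R g x) \<in> borel_measurable lebesgue" for n
        by (rule borel_measurable_integrable[OF int]) simp
    qed (use g in auto)
  qed (simp add: 0)
  have bor: "(LINT x|lebesgue. indicator A x *\<^sub>R g x) = 0" if "A \<in> sets borel" for A
  proof -
    have *: "A \<in> sigma_sets UNIV (range (\<lambda>(a, b). box a b))"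
      using that unfolding borel_eq_box by simp
    have st: "Int_stable (range (\<lambda>(a, b). box a b :: (real^2) set))"
      unfolding Int_stable_def by (auto simp: box_Int_box)
    have "range (\<lambda>(a, b). box a b :: (real^2) set) \<subseteq> Pow UNIV" by simp
    from st this * show ?thesis
    proof (induction rule: sigma_sets_induct_disjoint)
      case (basic A)
      then show ?case using 0 by auto
    next
      case (compl A)
      then have A: "A \<in> sets lebesgue"
      proof -
        have "A \<in> sets borel" using compl.hyps unfolding borel_eq_box by simp
        then show ?thesis by simp
      qed
      have "(LINT x|lebesgue. indicator (UNIV - A) x *\<^sub>R g x) = (LINT x|lebesgue. g x - indicator A x *\<^sub>R g x)"
        by (intro Bochner_Integration.integral_cong) (auto simp: indicator_def)
      also have "\<dots> = 0" using g int[OF A] compl tot by simp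
      finally show ?case by simp
    next
      case (union F)
      have F: "F i \<in> sets lebesgue" for i
      proof -
        have "F i \<in> sigma_sets UNIV (range (\<lambda>(a, b). box a b))" using union.hyps(2) by blast
        then have "F i \<in> sets borel" unfolding borel_eq_box by simp
        then show ?thesis by simp
      qed
      have "(\<lambda>n. LINT x|lebesgue. (\<Sum>i<n. indicator (F i) x) *\<^sub>R g x) \<longlonglongrightarrow>
          (LINT x|lebesgue. indicator (\<Union>i. F i) x *\<^sub>R g x)"
      proof (rule integral_dominated_convergence[where w="\<lambda>x. norm (g x)"])
        show "AE x in lebesgue. (\<lambda>n. (\<Sum>i<n. indicator (F i) x) *\<^sub>R g x) \<longlonglongrightarrow> indicator (\<Union>i. F i) x *\<^sub>R g x"
          using indicator_sums[of F, OF union.hyps(1)[unfolded disjoint_family_on_def, rule_format]]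
          unfolding sums_def by (auto intro!: AE_I2 tendsto_scaleR)
        show "AE x in lebesgue. norm ((\<Sum>i<n. indicator (F i) x) *\<^sub>R g x) \<le> norm (g x)" for n
        proof (rule AE_I2)
          fix x
          have "(\<Sum>i<n. indicator (F i) x) = (indicator (\<Union>i<n. F i) x :: real)"
            using union.hyps(1) by (subst indicator_UN_disjoint) (auto simp: disjoint_family_on_def)
          then show "norm ((\<Sum>i<n. indicator (F i) x) *\<^sub>R g x) \<le> norm (g x)" by (simp add: indicator_def)
        qed
      qed (use g F in auto)
      moreover have "(LINT x|lebesgue. (\<Sum>i<n. indicator (F i) x) *\<^sub>R g x) = 0" for n
      proof -
        have "(LINT x|lebesgue. (\<Sum>i<n. indicator (F i) x) *\<^sub>R g x) =
            (LINT x|lebesgue. (\<Sum>i<n. indicator (F i) x *\<^sub>R g x))"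
          by (simp add: scaleR_sum_left)
        also have "\<dots> = (\<Sum>i<n. LINT x|lebesgue. indicator (F i) x *\<^sub>R g x)"
          by (rule Bochner_Integration.integral_sum) (use int F in auto)
        finally show ?thesis using union.IH by simp
      qed
      ultimately show ?case by (simp add: LIMSEQ_const_iff)
    qed simp
  qed
  show ?thesis
  proof (rule sigma_finite_measure.density_zero[OF sigma_finite_lebesgue g])
    \<comment> \<open>A Lebesgue set differs from a Borel set by part of a null set, so the Borel
      case carries over.\<close>
    fix A :: "(real^2) set" assume "A \<in> sets lebesgue"
    then obtain S N N' where A: "A = S \<union> N" "N \<subseteq> N'" "N' \<in> null_sets lborel" "S \<in> sets lborel"
      by (rule sets_completionE)
    have N': "AE x in lebesgue. x \<notin> N'"
      using A(3) by (intro AE_not_in null_sets_completionI)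
    have "(LINT x|lebesgue. indicator A x *\<^sub>R g x) = (LINT x|lebesgue. indicator S x *\<^sub>R g x)"
    proof (rule integral_cong_AE)
      show "AE x in lebesgue. indicator A x *\<^sub>R g x = indicator S x *\<^sub>R g x"
        using N' by eventually_elim (use A in \<open>auto simp: indicator_def\<close>)
    qed (use \<open>A \<in> sets lebesgue\<close> A(4) in \<open>auto intro!: borel_measurable_integrable[OF int]\<close>)
    also have "\<dots> = 0" using bor A by simp
    finally show "set_lebesgue_integral lebesgue A g = 0" unfolding set_lebesgue_integral_def .
  qed
qed

lemma continuous_test_function: "\<eta> \<in> test_functions \<Omega> \<Longrightarrow> continuous_on S \<eta>"
  unfolding test_functions_def by (auto intro: smooth_continuous)

lemma bump_tendsto:
  assumes "\<And>n. 0 < r n" "filterlim r at_top sequentially"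
  shows "(\<lambda>n. bump (r n * t)) \<longlonglongrightarrow> (if t > 0 then 1 else 0)"
proof (cases "t > 0")
  case True
  have "filterlim (\<lambda>n. r n * t) at_top sequentially"
    using filterlim_tendsto_pos_mult_at_top[OF tendsto_const True assms(2)] by (simp add: mult.commute)
  from tendsto_inverse_0_at_top[OF this] have "(\<lambda>n. exp (- inverse (r n * t))) \<longlonglongrightarrow> exp (- 0)"
    by (intro tendsto_exp tendsto_minus)
  then show ?thesis using True assms(1) by (simp add: bump_def inverse_eq_divide)
next
  case False
  then have "\<not> 0 < r n * t" for n using assms(1)[of n] by (simp add: zero_less_mult_iff not_less)
  then show ?thesis using False by (simp add: bump_def)
qed

lemma lebesgue_on_integral:
  fixes f :: "real^2 \<Rightarrow> 'b::{banach, second_countable_topology}"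
  assumes "\<Omega> \<in> sets lebesgue"
  shows "(LINT x|lebesgue_on \<Omega>. f x) = (LINT x|lebesgue. indicator \<Omega> x *\<^sub>R f x)"
    and "integrable (lebesgue_on \<Omega>) f \<longleftrightarrow> integrable lebesgue (\<lambda>x. indicator \<Omega> x *\<^sub>R f x)"
    and "f \<in> borel_measurable (lebesgue_on \<Omega>) \<longleftrightarrow> (\<lambda>x. indicator \<Omega> x *\<^sub>R f x) \<in> borel_measurable lebesgue"
    and "(AE x in lebesgue_on \<Omega>. P x) \<longleftrightarrow> (AE x in lebesgue. x \<in> \<Omega> \<longrightarrow> P x)"
  using assms by (simp_all add: integral_restrict_space integrable_restrict_space
      borel_measurable_restrict_space_iff AE_restrict_space_iff)

text \<open>The test functions of \<open>box_bump_test\<close> converge boundedly to indicators of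
  boxes, so h integrates to 0 over every box whose closure lies in \<Omega>. This makes h vanish on
  each closed box in \<Omega>, and countably many of these cover \<Omega>.\<close>

lemma fundamental_lemma:
  assumes \<Omega>: "open \<Omega>"
    and int: "\<And>a b. cbox a b \<subseteq> \<Omega> \<Longrightarrow> integrable lebesgue (\<lambda>x. indicator (cbox a b) x *\<^sub>R h x)"
    and 0: "\<And>\<eta>. \<eta> \<in> test_functions \<Omega> \<Longrightarrow> (LINT x|lebesgue_on \<Omega>. h x * \<eta> x) = 0"
  shows "AE x in lebesgue_on \<Omega>. h x = 0"
proof -
  have \<Omega>s: "\<Omega> \<in> sets lebesgue" using \<Omega> by auto
  have box0: "(LINT x|lebesgue. indicator (box a b) x *\<^sub>R h x) = 0" if ab: "cbox a b \<subseteq> \<Omega>" for a b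
  proof (rule LIMSEQ_unique)
    define \<eta> :: "real \<Rightarrow> cfun" where "\<eta> = (\<lambda>r x. complex_of_real (bump (r * (x$1 - a$1)) * bump (r * (b$1 - x$1)) *
            (bump (r * (x$2 - a$2)) * bump (r * (b$2 - x$2)))))"
    have test: "\<eta> r \<in> test_functions \<Omega>" if "r > 0" for r
      unfolding \<eta>_def by (rule box_bump_test[OF ab that])
    define g where "g = (\<lambda>x. indicator (cbox a b) x *\<^sub>R h x)"
    have g: "integrable lebesgue g" unfolding g_def by (rule int[OF ab])
    have \<eta>0: "x \<in> cbox a b" if "\<eta> r x \<noteq> 0" "r > 0" for r x
      using that by (auto simp: \<eta>_def bump_bounds mem_box_cart zero_less_mult_iff forall_2)
    have \<eta>1: "norm (\<eta> r x) \<le> 1" for r x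
      unfolding \<eta>_def norm_of_real by (auto simp: abs_mult bump_bounds intro!: mult_le_one)
    have eq: "(LINT x|lebesgue_on \<Omega>. h x * \<eta> r x) = (LINT x|lebesgue. g x * \<eta> r x)" if "r > 0" for r
      unfolding lebesgue_on_integral[OF \<Omega>s]
      by (rule Bochner_Integration.integral_cong)
        (use \<eta>0[OF _ that] ab in \<open>auto simp: g_def indicator_def\<close>)
    show "(\<lambda>n. LINT x|lebesgue. g x * \<eta> (real (Suc n)) x) \<longlonglongrightarrow> 0"
      using eq 0[OF test] by (simp del: of_nat_Suc)
    have lim: "(\<lambda>n. \<eta> (real (Suc n)) x) \<longlonglongrightarrow> indicator (box a b) x" for x
    proof -
      have r: "filterlim (\<lambda>n. real (Suc n)) at_top sequentially"
        by (rule filterlim_compose[OF filterlim_real_sequentially filterlim_Suc])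
      have "(\<lambda>n. \<eta> (real (Suc n)) x) \<longlonglongrightarrow> complex_of_real (
          (if x$1 - a$1 > 0 then 1 else 0) * (if b$1 - x$1 > 0 then 1 else 0) *
          ((if x$2 - a$2 > 0 then 1 else 0) * (if b$2 - x$2 > 0 then 1 else 0)))"
        unfolding \<eta>_def by (intro tendsto_of_real tendsto_mult bump_tendsto r) simp_all
      moreover have "complex_of_real (
          (if x$1 - a$1 > 0 then 1 else 0) * (if b$1 - x$1 > 0 then 1 else 0) *
          ((if x$2 - a$2 > 0 then 1 else 0) * (if b$2 - x$2 > 0 then 1 else 0))) = indicator (box a b) x"
        by (auto simp: indicator_def mem_box_cart forall_2)
      ultimately show ?thesis by simp
    qed
    show "(\<lambda>n. LINT x|lebesgue. g x * \<eta> (real (Suc n)) x) \<longlonglongrightarrow> (LINT x|lebesgue. indicator (box a b) x *\<^sub>R h x)"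
    proof (rule integral_dominated_convergence[where w="\<lambda>x. norm (g x)"])
      have "indicator (box a b) x *\<^sub>R h x = g x * indicator (box a b) x" for x
        using box_subset_cbox[of a b] by (auto simp: g_def indicator_def)
      then show "AE x in lebesgue. (\<lambda>n. g x * \<eta> (real (Suc n)) x) \<longlonglongrightarrow> indicator (box a b) x *\<^sub>R h x"
        using lim by (auto intro!: AE_I2 tendsto_mult)
      show "AE x in lebesgue. norm (g x * \<eta> (real (Suc n)) x) \<le> norm (g x)" for n
        using \<eta>1 by (auto intro!: AE_I2 mult_left_le simp: norm_mult)
      show m: "(\<lambda>x. g x * \<eta> (real (Suc n)) x) \<in> borel_measurable lebesgue" for n
      proof -
        have [measurable]: "g \<in> borel_measurable lebesgue" using g by (rule borel_measurable_integrable)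
        have [measurable]: "\<eta> (real (Suc n)) \<in> borel_measurable lebesgue"
          by (rule continuous_imp_lebesgue_measurable[OF continuous_test_function[OF test]]) simp
        show ?thesis by (rule borel_measurable_times) measurable
      qed
      show "(\<lambda>x. indicator (box a b) x *\<^sub>R h x) \<in> borel_measurable lebesgue"
      proof -
        have "(\<lambda>x. indicator (box a b) x *\<^sub>R g x) \<in> borel_measurable lebesgue"
          using borel_measurable_scaleR[OF borel_measurable_indicator borel_measurable_integrable[OF g], of "box a b"] by simp
        moreover have "indicator (box a b) x *\<^sub>R g x = indicator (box a b) x *\<^sub>R h x" for x
          using box_subset_cbox[of a b] by (auto simp: g_def indicator_def)
        ultimately show ?thesis by simp
      qed
    qed (use g in auto)
  qed
  \<comment> \<open>The function cut off to one closed box is integrable on the plane. Its integral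
    over any further box is one over an intersection of boxes, which is again a box inside
    \<Omega>.\<close>
  have cb: "AE x in lebesgue. x \<in> cbox a b \<longrightarrow> h x = 0" if ab: "cbox a b \<subseteq> \<Omega>" for a b
  proof -
    have bi: "(LINT x|lebesgue. indicator (box c d) x *\<^sub>R (indicator (cbox a b) x *\<^sub>R h x)) = 0" for c d
    proof -
      obtain e f where ef: "cbox c d \<inter> cbox a b = cbox e f" "box c d \<inter> box a b = box e f"
        by (metis (no_types) Int_interval box_Int_box)
      have "cbox e f \<subseteq> \<Omega>" using ef(1) ab by auto
      \<comment> \<open>\<open>box0\<close> speaks of open boxes while the cutoff is to a closed
        one; the edges in between form a null set.\<close>
      have N: "AE x in lebesgue. x \<notin> cbox a b - box a b"
        by (rule AE_not_in) (rule negligible_frontier_interval[unfolded negligible_iff_null_sets])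
      have "(LINT x|lebesgue. indicator (box c d) x *\<^sub>R (indicator (cbox a b) x *\<^sub>R h x)) =
          (LINT x|lebesgue. indicator (box c d \<inter> box a b) x *\<^sub>R h x)"
      proof (rule integral_cong_AE)
        have hm: "(\<lambda>x. indicator (cbox a b) x *\<^sub>R h x) \<in> borel_measurable lebesgue"
          using int[OF ab] by (rule borel_measurable_integrable)
        show "(\<lambda>x. indicator (box c d) x *\<^sub>R (indicator (cbox a b) x *\<^sub>R h x)) \<in> borel_measurable lebesgue"
          by (rule borel_measurable_indicator_scaleR[OF _ hm]) simp
        have "(\<lambda>x. indicator (box c d \<inter> box a b) x *\<^sub>R (indicator (cbox a b) x *\<^sub>R h x)) \<in> borel_measurable lebesgue"
          by (rule borel_measurable_indicator_scaleR[OF _ hm]) simp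
        moreover have "indicator (box c d \<inter> box a b) x *\<^sub>R (indicator (cbox a b) x *\<^sub>R h x) =
            indicator (box c d \<inter> box a b) x *\<^sub>R h x" for x
          using box_subset_cbox[of a b] by (auto simp: indicator_def)
        ultimately show "(\<lambda>x. indicator (box c d \<inter> box a b) x *\<^sub>R h x) \<in> borel_measurable lebesgue" by (simp only:)
        show "AE x in lebesgue. indicator (box c d) x *\<^sub>R (indicator (cbox a b) x *\<^sub>R h x) =
            indicator (box c d \<inter> box a b) x *\<^sub>R h x"
          using N by eventually_elim (use box_subset_cbox[of a b] in \<open>auto simp: indicator_def\<close>)
      qed
      also have "\<dots> = 0" unfolding ef(2) using \<open>cbox e f \<subseteq> \<Omega>\<close> by (rule box0)
      finally show ?thesis .
    qed
    from AE_zero_if_box_integrals_zero[OF int[OF ab] bi] show ?thesis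
      by eventually_elim (auto simp: indicator_def)
  qed
  obtain D where D: "countable D" "\<And>X. X \<in> D \<Longrightarrow> X \<subseteq> \<Omega>" "\<And>X. X \<in> D \<Longrightarrow> \<exists>a b. X = cbox a b" "\<Union>D = \<Omega>"
    by (rule open_countable_Union_open_cbox[OF \<Omega>]) blast
  have "AE x in lebesgue. \<forall>X\<in>D. x \<in> X \<longrightarrow> h x = 0"
    unfolding AE_ball_countable[OF D(1)]
  proof
    fix X assume X: "X \<in> D"
    then obtain a b where "X = cbox a b" using D(3) by blast
    with D(2)[OF X] cb show "AE x in lebesgue. x \<in> X \<longrightarrow> h x = 0" by simp
  qed
  then have "AE x in lebesgue. x \<in> \<Omega> \<longrightarrow> h x = 0"
    by eventually_elim (use D(4) in auto)
  then show ?thesis unfolding lebesgue_on_integral[OF \<Omega>s] .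
qed

section \<open>Weak derivatives\<close>

lemma L2_iff:
  assumes "\<Omega> \<in> sets lebesgue"
  shows "f \<in> L2 \<Omega> \<longleftrightarrow> zero_ext \<Omega> f \<in> borel_measurable lebesgue \<and>
     integrable lebesgue (\<lambda>x. (cmod (zero_ext \<Omega> f x))\<^sup>2)"
proof -
  have "(\<lambda>x. indicator \<Omega> x *\<^sub>R f x) = zero_ext \<Omega> f"
    "(\<lambda>x. indicator \<Omega> x *\<^sub>R (cmod (f x))\<^sup>2) = (\<lambda>x. (cmod (zero_ext \<Omega> f x))\<^sup>2)"
    by (auto simp: fun_eq_iff zero_ext_def indicator_def)
  then show ?thesis unfolding L2_def by (simp add: lebesgue_on_integral[OF assms])
qed

lemma L2_restrict:
  assumes "f \<in> L2 \<Omega>'" "\<Omega> \<subseteq> \<Omega>'" "\<Omega> \<in> sets lebesgue" "\<Omega>' \<in> sets lebesgue"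
  shows "f \<in> L2 \<Omega>"
proof -
  have "zero_ext \<Omega> f = (\<lambda>x. indicator \<Omega> x *\<^sub>R zero_ext \<Omega>' f x)"
    "(\<lambda>x. (cmod (zero_ext \<Omega> f x))\<^sup>2) = (\<lambda>x. indicator \<Omega> x *\<^sub>R (cmod (zero_ext \<Omega>' f x))\<^sup>2)"
    using assms(2) by (auto simp: fun_eq_iff zero_ext_def indicator_def)
  with assms show ?thesis
    using integrable_mult_indicator[OF assms(3), of "\<lambda>x. (cmod (zero_ext \<Omega>' f x))\<^sup>2"]
    by (auto simp: L2_iff)
qed

lemma L2_mult_integrable:
  assumes "f \<in> L2 \<Omega>" "g \<in> L2 \<Omega>"
  shows "integrable (lebesgue_on \<Omega>) (\<lambda>x. f x * g x)"
proof (rule Bochner_Integration.integrable_bound)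
  show "integrable (lebesgue_on \<Omega>) (\<lambda>x. (cmod (f x))\<^sup>2 + (cmod (g x))\<^sup>2)"
    using assms unfolding L2_def by auto
  show "(\<lambda>x. f x * g x) \<in> borel_measurable (lebesgue_on \<Omega>)"
    using assms unfolding L2_def by auto
  have "cmod (a * b) \<le> (cmod a)\<^sup>2 + (cmod b)\<^sup>2" for a b
    using sum_squares_bound[of "cmod a" "cmod b"] mult_nonneg_nonneg[OF norm_ge_zero[of a] norm_ge_zero[of b]]
    unfolding norm_mult by linarith
  then show "AE x in lebesgue_on \<Omega>. norm (f x * g x) \<le> norm ((cmod (f x))\<^sup>2 + (cmod (g x))\<^sup>2)"
    by (auto intro!: AE_I2)
qed

lemma borel_measurable_cnj [measurable (raw)]:
  "f \<in> borel_measurable M \<Longrightarrow> (\<lambda>x. cnj (f x)) \<in> borel_measurable M"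
  by (rule borel_measurable_continuous_on[OF continuous_on_cnj[OF continuous_on_id]])

lemma L2_cnj: "f \<in> L2 \<Omega> \<Longrightarrow> (\<lambda>x. cnj (f x)) \<in> L2 \<Omega>"
  unfolding L2_def by (simp add: borel_measurable_cnj)

lemma L2_cmult: "f \<in> L2 \<Omega> \<Longrightarrow> (\<lambda>x. c * f x) \<in> L2 \<Omega>"
  unfolding L2_def by (auto simp: norm_mult power_mult_distrib)

lemma L2_add:
  assumes "f \<in> L2 \<Omega>" "g \<in> L2 \<Omega>"
  shows "(\<lambda>x. f x + g x) \<in> L2 \<Omega>"
proof -
  have "integrable (lebesgue_on \<Omega>) (\<lambda>x. (cmod (f x + g x))\<^sup>2)"
  proof (rule Bochner_Integration.integrable_bound)
    show "integrable (lebesgue_on \<Omega>) (\<lambda>x. 2 * (cmod (f x))\<^sup>2 + 2 * (cmod (g x))\<^sup>2)"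
      using assms unfolding L2_def by auto
    show "(\<lambda>x. (cmod (f x + g x))\<^sup>2) \<in> borel_measurable (lebesgue_on \<Omega>)"
      using assms unfolding L2_def by auto
    have "(cmod (a + b))\<^sup>2 \<le> 2 * (cmod a)\<^sup>2 + 2 * (cmod b)\<^sup>2" for a b
    proof -
      have "(cmod (a + b))\<^sup>2 \<le> (cmod a + cmod b)\<^sup>2" by (simp add: norm_triangle_ineq power_mono)
      also have "\<dots> \<le> 2 * (cmod a)\<^sup>2 + 2 * (cmod b)\<^sup>2"
        using sum_squares_bound[of "cmod a" "cmod b"] unfolding power2_sum by linarith
      finally show ?thesis .
    qed
    then show "AE x in lebesgue_on \<Omega>. norm ((cmod (f x + g x))\<^sup>2) \<le> norm (2 * (cmod (f x))\<^sup>2 + 2 * (cmod (g x))\<^sup>2)"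
      by (auto intro!: AE_I2)
  qed
  with assms show ?thesis unfolding L2_def by auto
qed

lemma L2_AE_cong:
  assumes "f \<in> L2 \<Omega>" "AE x in lebesgue_on \<Omega>. f x = g x" "\<Omega> \<in> sets lebesgue"
  shows "g \<in> L2 \<Omega>"
proof -
  have m: "zero_ext \<Omega> f \<in> borel_measurable lebesgue" using assms(1) by (simp add: L2_iff[OF assms(3)])
  have ae: "AE x in lebesgue. zero_ext \<Omega> g x = zero_ext \<Omega> f x"
    using assms(2) unfolding lebesgue_on_integral[OF assms(3)]
    by eventually_elim (auto simp: zero_ext_def)
  have gm: "zero_ext \<Omega> g \<in> borel_measurable lebesgue"
    by (rule borel_measurable_AE[OF m]) (use ae in \<open>auto elim: eventually_mono\<close>)
  moreover have "integrable lebesgue (\<lambda>x. (cmod (zero_ext \<Omega> f x))\<^sup>2)" using assms(1) by (simp add: L2_iff[OF assms(3)])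
  then have "integrable lebesgue (\<lambda>x. (cmod (zero_ext \<Omega> g x))\<^sup>2)"
    by (rule integrable_cong_AE_imp) (use ae gm in auto)
  ultimately show ?thesis by (simp add: L2_iff[OF assms(3)])
qed

text \<open>On a set of finite measure |f| \<le> 1 + |f|^2 gives integrability. This is how
  square-integrable functions enter the fundamental lemma and the Fourier integral.\<close>

lemma L2_integrable_bounded:
  assumes "f \<in> L2 \<Omega>" "S \<in> lmeasurable" "S \<subseteq> \<Omega>" "\<Omega> \<in> sets lebesgue"
  shows "integrable lebesgue (\<lambda>x. indicator S x *\<^sub>R f x)"
proof (rule Bochner_Integration.integrable_bound)
  have f: "f \<in> L2 S" by (rule L2_restrict[OF assms(1,3) _ assms(4)]) (use assms(2) in auto)
  have S: "S \<in> sets lebesgue" using assms(2) by auto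
  show "integrable lebesgue (\<lambda>x. indicator S x + (cmod (zero_ext S f x))\<^sup>2 :: real)"
    using f assms(2) L2_iff[OF S] by (auto intro!: Bochner_Integration.integrable_add simp: fmeasurable_def)
  have eq: "(\<lambda>x. indicator S x *\<^sub>R f x) = zero_ext S f" by (auto simp: zero_ext_def indicator_def)
  show "(\<lambda>x. indicator S x *\<^sub>R f x) \<in> borel_measurable lebesgue"
    unfolding eq using f L2_iff[OF S] by auto
  have "r \<le> 1 + r\<^sup>2" for r :: real using sum_squares_bound[of r 1] zero_le_power2[of r]
    by (smt (verit) mult_1 mult_cancel_left1 one_power2)
  then show "AE x in lebesgue. norm (indicator S x *\<^sub>R f x) \<le> norm (indicator S x + (cmod (zero_ext S f x))\<^sup>2 :: real)"
    by (auto intro!: AE_I2 simp: zero_ext_def indicator_def)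
qed

lemma test_function_L2:
  assumes "\<eta> \<in> test_functions \<Omega>" "S \<in> sets lebesgue"
  shows "D_classical a \<eta> \<in> L2 S" "\<eta> \<in> L2 S"
proof -
  have *: "h \<in> L2 UNIV" if h: "continuous_on UNIV h" and K: "compact K" and 0: "\<And>x. x \<notin> K \<Longrightarrow> h x = 0"
    for h :: cfun and K
  proof -
    obtain B where B: "\<And>x. x \<in> K \<Longrightarrow> norm (h x) \<le> B"
      using compact_imp_bounded[OF compact_continuous_image[OF continuous_on_subset[OF h] K]]
      by (auto simp: bounded_iff)
    have m: "h \<in> borel_measurable lebesgue"
      by (rule continuous_imp_lebesgue_measurable[OF h])
    have "integrable lebesgue (\<lambda>x. (cmod (h x))\<^sup>2)"
    proof (rule Bochner_Integration.integrable_bound)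
      show "integrable lebesgue (\<lambda>x. B\<^sup>2 * indicator K x :: real)"
        using lmeasurable_compact[OF K] by (auto simp: fmeasurable_def)
      show "AE x in lebesgue. norm ((cmod (h x))\<^sup>2) \<le> norm (B\<^sup>2 * indicator K x :: real)"
        using B 0 by (auto intro!: AE_I2 power_mono simp: indicator_def)
    qed (use m in auto)
    with m show ?thesis by (simp add: L2_iff zero_ext_def)
  qed
  have sm: "smooth \<eta>" and K: "compact (closure {x. \<eta> x \<noteq> 0})" using assms(1) by (auto simp: test_functions_def)
  have "D_classical a \<eta> \<in> L2 UNIV"
    by (rule *[OF smooth_continuous[OF smooth_D_classical[OF sm]] K D_classical_eq_0])
  then show "D_classical a \<eta> \<in> L2 S" by (rule L2_restrict) (use assms in auto)
  have "\<eta> \<in> L2 UNIV"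
    by (rule *[OF smooth_continuous[OF sm] K]) (use closure_subset[of "{x. \<eta> x \<noteq> 0}"] in auto)
  then show "\<eta> \<in> L2 S" by (rule L2_restrict) (use assms in auto)
qed

lemma weak_deriv_L2: "is_weak_deriv \<Omega> a f g \<Longrightarrow> g \<in> L2 \<Omega>"
  unfolding is_weak_deriv_def by simp

text \<open>The difference of the two derivatives integrates to 0 against every test function.
  Allowing two functions that agree only almost everywhere makes it possible to replace the
  arbitrary choice \<open>weak_deriv\<close> by any concrete weak derivative of any
  representative.\<close>

lemma weak_deriv_unique:
  assumes "open \<Omega>" "is_weak_deriv \<Omega> a f g" "is_weak_deriv \<Omega> a f' g'"
    and "f \<in> L2 \<Omega>" "AE x in lebesgue_on \<Omega>. f x = f' x"
  shows "AE x in lebesgue_on \<Omega>. g x = g' x"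
proof -
  have \<Omega>: "\<Omega> \<in> sets lebesgue" using assms(1) by auto
  have g: "g \<in> L2 \<Omega>" "g' \<in> L2 \<Omega>" using assms weak_deriv_L2 by blast+
  have f': "f' \<in> L2 \<Omega>" using L2_AE_cong[OF assms(4,5) \<Omega>] .
  have "AE x in lebesgue_on \<Omega>. g x - g' x = 0"
  proof (rule fundamental_lemma[OF assms(1)])
    fix a b :: "real^2" assume "cbox a b \<subseteq> \<Omega>"
    then show "integrable lebesgue (\<lambda>x. indicator (cbox a b) x *\<^sub>R (g x - g' x))"
      using L2_integrable_bounded[OF L2_add[OF g(1) L2_cmult[OF g(2), of "-1"]] _ _ \<Omega>, of "cbox a b"]
      by simp
  next
    fix \<eta> assume \<eta>: "\<eta> \<in> test_functions \<Omega>"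
    have "(LINT x|lebesgue_on \<Omega>. f x * D_classical a \<eta> x) = (LINT x|lebesgue_on \<Omega>. f' x * D_classical a \<eta> x)"
    proof (rule integral_cong_AE)
      show "AE x in lebesgue_on \<Omega>. f x * D_classical a \<eta> x = f' x * D_classical a \<eta> x"
        using assms(5) by eventually_elim simp
    qed (use L2_mult_integrable[OF assms(4) test_function_L2(1)[OF \<eta> \<Omega>]]
          L2_mult_integrable[OF f' test_function_L2(1)[OF \<eta> \<Omega>]] in auto)
    moreover have "(LINT x|lebesgue_on \<Omega>. f x * D_classical a \<eta> x) = (-1) ^ (fst a + snd a) * (LINT x|lebesgue_on \<Omega>. g x * \<eta> x)"
      "(LINT x|lebesgue_on \<Omega>. f' x * D_classical a \<eta> x) = (-1) ^ (fst a + snd a) * (LINT x|lebesgue_on \<Omega>. g' x * \<eta> x)"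
      using assms(2,3) \<eta> unfolding is_weak_deriv_def by auto
    ultimately have "(-1) ^ (fst a + snd a) * (LINT x|lebesgue_on \<Omega>. g x * \<eta> x) =
        (-1) ^ (fst a + snd a) * (LINT x|lebesgue_on \<Omega>. g' x * \<eta> x)" by simp
    then have "(LINT x|lebesgue_on \<Omega>. g x * \<eta> x) = (LINT x|lebesgue_on \<Omega>. g' x * \<eta> x)" by simp
    then show "(LINT x|lebesgue_on \<Omega>. (g x - g' x) * \<eta> x) = 0"
      using L2_mult_integrable[OF g(1) test_function_L2(2)[OF \<eta> \<Omega>]]
        L2_mult_integrable[OF g(2) test_function_L2(2)[OF \<eta> \<Omega>]]
      by (simp add: algebra_simps)
  qed
  then show ?thesis by simp
qed

lemma is_weak_deriv_AE_cong:
  assumes "open \<Omega>" "is_weak_deriv \<Omega> a f g" "f \<in> L2 \<Omega>"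
    and "AE x in lebesgue_on \<Omega>. f x = f' x" "AE x in lebesgue_on \<Omega>. g x = g' x"
  shows "is_weak_deriv \<Omega> a f' g'"
proof -
  have \<Omega>: "\<Omega> \<in> sets lebesgue" using assms(1) by auto
  have g: "g \<in> L2 \<Omega>" using assms(2) by (rule weak_deriv_L2)
  have g': "g' \<in> L2 \<Omega>" using L2_AE_cong[OF g assms(5) \<Omega>] .
  have f': "f' \<in> L2 \<Omega>" using L2_AE_cong[OF assms(3,4) \<Omega>] .
  have "(LINT x|lebesgue_on \<Omega>. f' x * D_classical a \<eta> x) = (-1) ^ (fst a + snd a) * (LINT x|lebesgue_on \<Omega>. g' x * \<eta> x)"
    if \<eta>: "\<eta> \<in> test_functions \<Omega>" for \<eta>
  proof -
    have "(LINT x|lebesgue_on \<Omega>. f x * D_classical a \<eta> x) = (LINT x|lebesgue_on \<Omega>. f' x * D_classical a \<eta> x)"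
    proof (rule integral_cong_AE)
      show "AE x in lebesgue_on \<Omega>. f x * D_classical a \<eta> x = f' x * D_classical a \<eta> x"
        using assms(4) by eventually_elim simp
    qed (use L2_mult_integrable[OF assms(3) test_function_L2(1)[OF \<eta> \<Omega>]]
          L2_mult_integrable[OF f' test_function_L2(1)[OF \<eta> \<Omega>]] in auto)
    moreover have "(LINT x|lebesgue_on \<Omega>. g x * \<eta> x) = (LINT x|lebesgue_on \<Omega>. g' x * \<eta> x)"
    proof (rule integral_cong_AE)
      show "AE x in lebesgue_on \<Omega>. g x * \<eta> x = g' x * \<eta> x"
        using assms(5) by eventually_elim simp
    qed (use L2_mult_integrable[OF g test_function_L2(2)[OF \<eta> \<Omega>]]
          L2_mult_integrable[OF g' test_function_L2(2)[OF \<eta> \<Omega>]] in auto)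
    moreover have "(LINT x|lebesgue_on \<Omega>. f x * D_classical a \<eta> x) = (-1) ^ (fst a + snd a) * (LINT x|lebesgue_on \<Omega>. g x * \<eta> x)"
      using assms(2) \<eta> unfolding is_weak_deriv_def by auto
    ultimately show ?thesis by simp
  qed
  with g' show ?thesis unfolding is_weak_deriv_def by blast
qed

text \<open>A test function on the smaller set is one on the larger set, and it vanishes with its
  derivatives off the smaller set, so the integrals over both sets agree.\<close>

lemma is_weak_deriv_restrict:
  assumes "is_weak_deriv \<Omega>' a f g" "\<Omega> \<subseteq> \<Omega>'" "open \<Omega>" "open \<Omega>'"
  shows "is_weak_deriv \<Omega> a f g"
proof -
  have \<Omega>: "\<Omega> \<in> sets lebesgue" "\<Omega>' \<in> sets lebesgue" using assms by auto
  have "g \<in> L2 \<Omega>" using L2_restrict[OF weak_deriv_L2[OF assms(1)] assms(2) \<Omega>] .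
  moreover have "(LINT x|lebesgue_on \<Omega>. f x * D_classical a \<eta> x) =
      (-1) ^ (fst a + snd a) * (LINT x|lebesgue_on \<Omega>. g x * \<eta> x)" if \<eta>: "\<eta> \<in> test_functions \<Omega>" for \<eta>
  proof -
    have z: "\<eta> x = 0" "D_classical a \<eta> x = 0" if "x \<notin> \<Omega>" for x
    proof -
      have x: "x \<notin> closure {x. \<eta> x \<noteq> 0}" using \<eta> that unfolding test_functions_def by blast
      then show "\<eta> x = 0" using closure_subset[of "{x. \<eta> x \<noteq> 0}"] by blast
      show "D_classical a \<eta> x = 0" using x by (rule D_classical_eq_0)
    qed
    have "(LINT x|lebesgue_on \<Omega>. f x * D_classical a \<eta> x) = (LINT x|lebesgue_on \<Omega>'. f x * D_classical a \<eta> x)"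
      "(LINT x|lebesgue_on \<Omega>. g x * \<eta> x) = (LINT x|lebesgue_on \<Omega>'. g x * \<eta> x)"
      unfolding lebesgue_on_integral[OF \<Omega>(1)] lebesgue_on_integral[OF \<Omega>(2)]
      by (rule Bochner_Integration.integral_cong; use z assms(2) in \<open>auto simp: indicator_def\<close>)+
    moreover have "\<eta> \<in> test_functions \<Omega>'" using \<eta> test_functions_mono[OF assms(2)] by auto
    ultimately show ?thesis using assms(1) unfolding is_weak_deriv_def by simp
  qed
  ultimately show ?thesis unfolding is_weak_deriv_def by blast
qed

lemma is_weak_deriv_add:
  assumes "is_weak_deriv \<Omega> a f g" "is_weak_deriv \<Omega> a f' g'" "f \<in> L2 \<Omega>" "f' \<in> L2 \<Omega>" "\<Omega> \<in> sets lebesgue"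
  shows "is_weak_deriv \<Omega> a (\<lambda>x. f x + f' x) (\<lambda>x. g x + g' x)"
  unfolding is_weak_deriv_def
proof (intro conjI ballI L2_add weak_deriv_L2[OF assms(1)] weak_deriv_L2[OF assms(2)])
  fix \<eta> assume \<eta>: "\<eta> \<in> test_functions \<Omega>"
  note L2_mult_integrable[OF assms(3) test_function_L2(1)[OF \<eta> assms(5)]]
    L2_mult_integrable[OF assms(4) test_function_L2(1)[OF \<eta> assms(5)]]
    L2_mult_integrable[OF weak_deriv_L2[OF assms(1)] test_function_L2(2)[OF \<eta> assms(5)]]
    L2_mult_integrable[OF weak_deriv_L2[OF assms(2)] test_function_L2(2)[OF \<eta> assms(5)]]
  moreover have "(LINT x|lebesgue_on \<Omega>. f x * D_classical a \<eta> x) = (-1) ^ (fst a + snd a) * (LINT x|lebesgue_on \<Omega>. g x * \<eta> x)"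
    "(LINT x|lebesgue_on \<Omega>. f' x * D_classical a \<eta> x) = (-1) ^ (fst a + snd a) * (LINT x|lebesgue_on \<Omega>. g' x * \<eta> x)"
    using assms(1,2) \<eta> unfolding is_weak_deriv_def by auto
  ultimately show "(LINT x|lebesgue_on \<Omega>. (f x + f' x) * D_classical a \<eta> x) =
      (-1) ^ (fst a + snd a) * (LINT x|lebesgue_on \<Omega>. (g x + g' x) * \<eta> x)"
    by (simp add: distrib_left distrib_right)
qed

lemma is_weak_deriv_cmult:
  assumes "is_weak_deriv \<Omega> a f g"
  shows "is_weak_deriv \<Omega> a (\<lambda>x. c * f x) (\<lambda>x. c * g x)"
  using assms unfolding is_weak_deriv_def by (auto intro!: L2_cmult simp: mult.assoc)

section \<open>The spaces \<open>H\<^sup>s\<close> as semi-inner-product spaces\<close>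

lemma Hs_L2: "f \<in> Hs s \<Omega> \<Longrightarrow> f \<in> L2 \<Omega>"
  unfolding Hs_def by blast

lemma Hs_weak_deriv:
  "f \<in> Hs s \<Omega> \<Longrightarrow> fst a + snd a \<le> s \<Longrightarrow> is_weak_deriv \<Omega> a f (weak_deriv \<Omega> a f)"
  unfolding weak_deriv_def Hs_def mem_Collect_eq by (rule someI_ex[of "is_weak_deriv \<Omega> a f"]) blast

lemma Hs_weak_deriv_L2: "f \<in> Hs s \<Omega> \<Longrightarrow> fst a + snd a \<le> s \<Longrightarrow> weak_deriv \<Omega> a f \<in> L2 \<Omega>"
  by (rule weak_deriv_L2[OF Hs_weak_deriv])

lemma HsI: "f \<in> L2 \<Omega> \<Longrightarrow> (\<And>a. fst a + snd a \<le> s \<Longrightarrow> \<exists>g. is_weak_deriv \<Omega> a f g) \<Longrightarrow> f \<in> Hs s \<Omega>"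
  unfolding Hs_def by blast

lemma weak_deriv_AE_eq:
  assumes "open \<Omega>" "f \<in> Hs s \<Omega>" "fst a + snd a \<le> s" "is_weak_deriv \<Omega> a f' g"
    and "AE x in lebesgue_on \<Omega>. f x = f' x"
  shows "AE x in lebesgue_on \<Omega>. weak_deriv \<Omega> a f x = g x"
  by (rule weak_deriv_unique[OF assms(1) Hs_weak_deriv[OF assms(2,3)] assms(4) Hs_L2[OF assms(2)] assms(5)])

lemma Hs_add: "open \<Omega> \<Longrightarrow> f \<in> Hs s \<Omega> \<Longrightarrow> g \<in> Hs s \<Omega> \<Longrightarrow> (\<lambda>x. f x + g x) \<in> Hs s \<Omega>"
  by (rule HsI, simp add: L2_add Hs_L2,
      rule exI, rule is_weak_deriv_add[OF Hs_weak_deriv Hs_weak_deriv], simp_all add: Hs_L2)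

lemma Hs_cmult: "f \<in> Hs s \<Omega> \<Longrightarrow> (\<lambda>x. c * f x) \<in> Hs s \<Omega>"
  by (rule HsI, simp add: L2_cmult Hs_L2, rule exI, rule is_weak_deriv_cmult[OF Hs_weak_deriv])

lemma is_weak_deriv_zero: "is_weak_deriv \<Omega> a (\<lambda>x. 0) (\<lambda>x. 0)"
  unfolding is_weak_deriv_def L2_def by simp

lemma Hs_zero: "(\<lambda>x. 0) \<in> Hs s \<Omega>"
  by (rule HsI) (auto intro: is_weak_deriv_zero exI simp: L2_def)

lemma Hs_AE_cong:
  assumes "open \<Omega>" "f \<in> Hs s \<Omega>" "AE x in lebesgue_on \<Omega>. f x = f' x"
  shows "f' \<in> Hs s \<Omega>"
proof (rule HsI)
  show "f' \<in> L2 \<Omega>" using L2_AE_cong[OF Hs_L2[OF assms(2)] assms(3)] assms(1) by auto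
  show "\<exists>g. is_weak_deriv \<Omega> a f' g" if "fst a + snd a \<le> s" for a
    using is_weak_deriv_AE_cong[OF assms(1) Hs_weak_deriv[OF assms(2) that] Hs_L2[OF assms(2)] assms(3) AE_I2[OF refl]]
    by blast
qed

lemma Hs_restrict:
  assumes "open \<Omega>" "f \<in> Hs s UNIV"
  shows "f \<in> Hs s \<Omega>"
proof (rule HsI)
  show "f \<in> L2 \<Omega>" using L2_restrict[OF Hs_L2[OF assms(2)]] assms(1) by auto
  show "\<exists>g. is_weak_deriv \<Omega> a f g" if "fst a + snd a \<le> s" for a
    using is_weak_deriv_restrict[OF Hs_weak_deriv[OF assms(2) that] _ assms(1)] by auto
qed

lemma L2_inner_AE_cong:
  assumes "f \<in> L2 \<Omega>" "g \<in> L2 \<Omega>" "f' \<in> L2 \<Omega>" "g' \<in> L2 \<Omega>"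
    and "AE x in lebesgue_on \<Omega>. f x = f' x" "AE x in lebesgue_on \<Omega>. g x = g' x"
  shows "L2_inner \<Omega> f g = L2_inner \<Omega> f' g'"
  unfolding L2_inner_def
proof (rule integral_cong_AE)
  show "AE x in lebesgue_on \<Omega>. f x * cnj (g x) = f' x * cnj (g' x)"
    using assms(5,6) by eventually_elim simp
qed (use L2_mult_integrable[OF assms(1) L2_cnj[OF assms(2)]] L2_mult_integrable[OF assms(3) L2_cnj[OF assms(4)]] in auto)

text \<open>The gateway out of the choice in \<open>weak_deriv\<close>: the inner product may be
  computed with whatever versions of the derivatives are at hand.\<close>

lemma Hs_inner_eq:
  assumes "\<And>a. fst a + snd a \<le> s \<Longrightarrow> f' a \<in> L2 \<Omega> \<and> (AE x in lebesgue_on \<Omega>. weak_deriv \<Omega> a f x = f' a x)"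
    and "\<And>a. fst a + snd a \<le> s \<Longrightarrow> g' a \<in> L2 \<Omega> \<and> (AE x in lebesgue_on \<Omega>. weak_deriv \<Omega> a g x = g' a x)"
    and "f \<in> Hs s \<Omega>" "g \<in> Hs s \<Omega>"
  shows "Hs_inner s \<Omega> f g = (\<Sum>a | fst a + snd a \<le> s. L2_inner \<Omega> (f' a) (g' a))"
  unfolding Hs_inner_def
  using assms by (intro sum.cong refl L2_inner_AE_cong) (auto intro: Hs_weak_deriv_L2)

lemma Hs_inner_AE_cong:
  assumes "open \<Omega>" "f \<in> Hs s \<Omega>" "g \<in> Hs s \<Omega>" "AE x in lebesgue_on \<Omega>. f x = f' x"
  shows "Hs_inner s \<Omega> f g = Hs_inner s \<Omega> f' g"
  unfolding Hs_inner_def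
proof (intro sum.cong refl)
  fix a :: "nat \<times> nat" assume "a \<in> {a. fst a + snd a \<le> s}"
  then have a: "fst a + snd a \<le> s" by simp
  have f': "f' \<in> Hs s \<Omega>" by (rule Hs_AE_cong[OF assms(1,2,4)])
  show "L2_inner \<Omega> (weak_deriv \<Omega> a f) (weak_deriv \<Omega> a g) = L2_inner \<Omega> (weak_deriv \<Omega> a f') (weak_deriv \<Omega> a g)"
    using a f' assms
    by (intro L2_inner_AE_cong Hs_weak_deriv_L2 weak_deriv_AE_eq[OF assms(1,2) a Hs_weak_deriv[OF f' a] assms(4)] AE_I2 refl)
qed

lemma L2_inner_cnj: "cnj (L2_inner \<Omega> f g) = L2_inner \<Omega> g f"
  unfolding L2_inner_def by (subst Bochner_Integration.integral_cnj[symmetric]) (simp add: mult.commute)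

lemma Hs_inner_cnj: "cnj (Hs_inner s \<Omega> f g) = Hs_inner s \<Omega> g f"
  unfolding Hs_inner_def by (simp add: L2_inner_cnj)

lemma L2_inner_self: "Re (L2_inner \<Omega> f f) \<ge> 0"
proof -
  have "L2_inner \<Omega> f f = (LINT x|lebesgue_on \<Omega>. complex_of_real ((cmod (f x))\<^sup>2))"
    unfolding L2_inner_def by (simp only: complex_norm_square)
  also have "\<dots> = complex_of_real (LINT x|lebesgue_on \<Omega>. (cmod (f x))\<^sup>2)"
    by (rule integral_complex_of_real)
  finally show ?thesis by simp
qed

lemma Hs_inner_self: "Re (Hs_inner s \<Omega> f f) \<ge> 0"
  unfolding Hs_inner_def Re_sum by (intro sum_nonneg L2_inner_self)

lemma L2_inner_add:
  assumes "f \<in> L2 \<Omega>" "g \<in> L2 \<Omega>" "h \<in> L2 \<Omega>"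
  shows "L2_inner \<Omega> (\<lambda>x. f x + g x) h = L2_inner \<Omega> f h + L2_inner \<Omega> g h"
  using L2_mult_integrable[OF assms(1) L2_cnj[OF assms(3)]] L2_mult_integrable[OF assms(2) L2_cnj[OF assms(3)]]
  unfolding L2_inner_def by (simp add: distrib_right)

lemma L2_inner_cmult: "L2_inner \<Omega> (\<lambda>x. c * f x) h = c * L2_inner \<Omega> f h"
  unfolding L2_inner_def by (simp add: mult.assoc)

lemma Hs_inner_add:
  assumes "open \<Omega>" "f \<in> Hs s \<Omega>" "g \<in> Hs s \<Omega>" "h \<in> Hs s \<Omega>"
  shows "Hs_inner s \<Omega> (\<lambda>x. f x + g x) h = Hs_inner s \<Omega> f h + Hs_inner s \<Omega> g h"
proof -
  have "Hs_inner s \<Omega> (\<lambda>x. f x + g x) h =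
      (\<Sum>a | fst a + snd a \<le> s. L2_inner \<Omega> (\<lambda>x. weak_deriv \<Omega> a f x + weak_deriv \<Omega> a g x) (weak_deriv \<Omega> a h))"
  proof (rule Hs_inner_eq)
    fix a :: "nat \<times> nat" assume a: "fst a + snd a \<le> s"
    have "is_weak_deriv \<Omega> a (\<lambda>x. f x + g x) (\<lambda>x. weak_deriv \<Omega> a f x + weak_deriv \<Omega> a g x)"
      using assms a by (intro is_weak_deriv_add Hs_weak_deriv Hs_L2) auto
    from weak_deriv_AE_eq[OF assms(1) Hs_add[OF assms(1-3)] a this]
    show "(\<lambda>x. weak_deriv \<Omega> a f x + weak_deriv \<Omega> a g x) \<in> L2 \<Omega> \<and>
       (AE x in lebesgue_on \<Omega>. weak_deriv \<Omega> a (\<lambda>x. f x + g x) x = weak_deriv \<Omega> a f x + weak_deriv \<Omega> a g x)"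
      using assms a by (auto intro!: L2_add Hs_weak_deriv_L2)
  qed (use assms in \<open>auto intro: Hs_weak_deriv_L2 Hs_add\<close>)
  also have "\<dots> = Hs_inner s \<Omega> f h + Hs_inner s \<Omega> g h"
    unfolding Hs_inner_def sum.distrib[symmetric]
    using assms by (intro sum.cong refl L2_inner_add Hs_weak_deriv_L2) auto
  finally show ?thesis .
qed

lemma Hs_inner_cmult:
  assumes "open \<Omega>" "f \<in> Hs s \<Omega>" "h \<in> Hs s \<Omega>"
  shows "Hs_inner s \<Omega> (\<lambda>x. c * f x) h = c * Hs_inner s \<Omega> f h"
proof -
  have "Hs_inner s \<Omega> (\<lambda>x. c * f x) h =
      (\<Sum>a | fst a + snd a \<le> s. L2_inner \<Omega> (\<lambda>x. c * weak_deriv \<Omega> a f x) (weak_deriv \<Omega> a h))"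
  proof (rule Hs_inner_eq)
    fix a :: "nat \<times> nat" assume a: "fst a + snd a \<le> s"
    have "is_weak_deriv \<Omega> a (\<lambda>x. c * f x) (\<lambda>x. c * weak_deriv \<Omega> a f x)"
      using assms a by (intro is_weak_deriv_cmult Hs_weak_deriv) auto
    from weak_deriv_AE_eq[OF assms(1) Hs_cmult[OF assms(2)] a this]
    show "(\<lambda>x. c * weak_deriv \<Omega> a f x) \<in> L2 \<Omega> \<and>
       (AE x in lebesgue_on \<Omega>. weak_deriv \<Omega> a (\<lambda>x. c * f x) x = c * weak_deriv \<Omega> a f x)"
      using assms a by (auto intro!: L2_cmult Hs_weak_deriv_L2)
  qed (use assms in \<open>auto intro: Hs_weak_deriv_L2 Hs_cmult\<close>)
  also have "\<dots> = c * Hs_inner s \<Omega> f h"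
    unfolding Hs_inner_def sum_distrib_left L2_inner_cmult ..
  finally show ?thesis .
qed

text \<open>Only a semi-inner product, as functions that vanish almost everywhere have norm 0
  without being the zero function. Symmetry and positivity hold for arbitrary functions, linearity
  on the carrier only. Both \<Omega> and the plane give instances.\<close>

locale semi_inner_space =
  fixes V :: "cfun set" and ip :: "cfun \<Rightarrow> cfun \<Rightarrow> complex"
  assumes zero_mem: "(\<lambda>x. 0) \<in> V"
    and add_mem: "f \<in> V \<Longrightarrow> g \<in> V \<Longrightarrow> (\<lambda>x. f x + g x) \<in> V"
    and cmult_mem: "f \<in> V \<Longrightarrow> (\<lambda>x. c * f x) \<in> V"
    and ip_add: "f \<in> V \<Longrightarrow> g \<in> V \<Longrightarrow> h \<in> V \<Longrightarrow> ip (\<lambda>x. f x + g x) h = ip f h + ip g h"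
    and ip_cmult: "f \<in> V \<Longrightarrow> h \<in> V \<Longrightarrow> ip (\<lambda>x. c * f x) h = c * ip f h"
    and ip_cnj: "cnj (ip f g) = ip g f"
    and ip_self: "0 \<le> Re (ip f f)"
begin

definition nrm2 :: "cfun \<Rightarrow> real" where "nrm2 f = Re (ip f f)"

lemma nrm2_nonneg: "0 \<le> nrm2 f"
  unfolding nrm2_def by (rule ip_self)

lemma ip_self_eq: "ip f f = complex_of_real (nrm2 f)"
  using ip_cnj[of f f] unfolding nrm2_def by (simp add: complex_eq_iff)

lemma diff_mem: "f \<in> V \<Longrightarrow> g \<in> V \<Longrightarrow> (\<lambda>x. f x - g x) \<in> V"
  using add_mem[OF _ cmult_mem[of g "-1"], of f] by simp

lemma ip_diff: "f \<in> V \<Longrightarrow> g \<in> V \<Longrightarrow> h \<in> V \<Longrightarrow> ip (\<lambda>x. f x - g x) h = ip f h - ip g h"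
  using ip_add[OF _ cmult_mem[of g "-1"], of f h] ip_cmult[of g h "-1"] by simp

lemma ip_add_right: "f \<in> V \<Longrightarrow> g \<in> V \<Longrightarrow> h \<in> V \<Longrightarrow> ip h (\<lambda>x. f x + g x) = ip h f + ip h g"
  using ip_add[of f g h] ip_cnj by (metis complex_cnj_add)

lemma ip_cmult_right: "f \<in> V \<Longrightarrow> h \<in> V \<Longrightarrow> ip h (\<lambda>x. c * f x) = cnj c * ip h f"
  using ip_cmult[of f h c] ip_cnj by (metis complex_cnj_mult)

lemma nrm2_add_eq:
  assumes "f \<in> V" "g \<in> V"
  shows "nrm2 (\<lambda>x. f x + g x) = nrm2 f + 2 * Re (ip f g) + nrm2 g"
proof -
  have "ip (\<lambda>x. f x + g x) (\<lambda>x. f x + g x) = ip f f + ip f g + (ip g f + ip g g)"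
    using assms by (simp add: ip_add ip_add_right add_mem)
  moreover have "Re (ip g f) = Re (ip f g)" by (metis ip_cnj complex_cnj(1) cnj.simps(1))
  ultimately show ?thesis unfolding nrm2_def by simp
qed

lemma nrm2_cmult: "f \<in> V \<Longrightarrow> nrm2 (\<lambda>x. c * f x) = (cmod c)\<^sup>2 * nrm2 f"
proof -
  assume f: "f \<in> V"
  have "ip (\<lambda>x. c * f x) (\<lambda>x. c * f x) = (c * cnj c) * ip f f"
    using f by (simp add: ip_cmult ip_cmult_right cmult_mem)
  also have "\<dots> = complex_of_real ((cmod c)\<^sup>2 * nrm2 f)"
    unfolding ip_self_eq of_real_mult complex_norm_square ..
  finally show ?thesis unfolding nrm2_def[of "\<lambda>x. c * f x"] by simp
qed

text \<open>Half of the parallelogram law: the norm of f - g is nonnegative.\<close>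

lemma nrm2_add_le:
  assumes "f \<in> V" "g \<in> V"
  shows "nrm2 (\<lambda>x. f x + g x) \<le> 2 * nrm2 f + 2 * nrm2 g"
proof -
  have "nrm2 (\<lambda>x. f x + (-1) * g x) = nrm2 f + 2 * Re (ip f (\<lambda>x. (-1) * g x)) + nrm2 (\<lambda>x. (-1) * g x)"
    by (rule nrm2_add_eq[OF assms(1) cmult_mem[OF assms(2)]])
  also have "\<dots> = nrm2 f - 2 * Re (ip f g) + nrm2 g"
    using assms ip_cmult_right[of g f "-1"] nrm2_cmult[of g "-1"] by simp
  finally have "0 \<le> nrm2 f - 2 * Re (ip f g) + nrm2 g" using nrm2_nonneg by metis
  then show ?thesis using nrm2_add_eq[OF assms] by linarith
qed

lemma sum_mem: "finite F \<Longrightarrow> (\<And>i. i \<in> F \<Longrightarrow> d i \<in> V) \<Longrightarrow> (\<lambda>x. \<Sum>i\<in>F. c i * d i x) \<in> V"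
proof (induction F rule: finite_induct)
  case (insert i F)
  then show ?case using add_mem[OF cmult_mem[of "d i" "c i"], of "\<lambda>x. \<Sum>i\<in>F. c i * d i x"] by simp
qed (simp add: zero_mem)

lemma ip_zero: "h \<in> V \<Longrightarrow> ip (\<lambda>x. 0) h = 0"
  using ip_cmult[of "\<lambda>x. 0" h 0] zero_mem by simp

lemma ip_sum:
  "finite F \<Longrightarrow> (\<And>i. i \<in> F \<Longrightarrow> d i \<in> V) \<Longrightarrow> h \<in> V \<Longrightarrow>
     ip (\<lambda>x. \<Sum>i\<in>F. c i * d i x) h = (\<Sum>i\<in>F. c i * ip (d i) h)"
proof (induction F rule: finite_induct)
  case (insert i F)
  then show ?case
    using ip_add[OF cmult_mem[of "d i" "c i"] sum_mem[of F d c], of h] ip_cmult[of "d i" h "c i"] by simp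
qed (simp add: ip_zero)

text \<open>Duality of analysis and synthesis: a Bessel bound for the coefficients of all g bounds
  linear combinations by the same constant. The combination h is tested against itself.\<close>

lemma synthesis_bound:
  assumes "finite F" "\<And>i. i \<in> F \<Longrightarrow> d i \<in> V" "0 \<le> B"
    and B: "\<And>g. g \<in> V \<Longrightarrow> (\<Sum>i\<in>F. (cmod (ip g (d i)))\<^sup>2) \<le> B * nrm2 g"
  shows "nrm2 (\<lambda>x. \<Sum>i\<in>F. c i * d i x) \<le> B * (\<Sum>i\<in>F. (cmod (c i))\<^sup>2)"
proof -
  define h where "h = (\<lambda>x. \<Sum>i\<in>F. c i * d i x)"
  define S where "S = (\<Sum>i\<in>F. (cmod (c i))\<^sup>2)"
  have S: "0 \<le> S" unfolding S_def by (simp add: sum_nonneg)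
  have h: "h \<in> V" unfolding h_def by (rule sum_mem[OF assms(1,2)])
  have "nrm2 h = cmod (ip h h)" using nrm2_nonneg[of h] by (simp add: ip_self_eq)
  also have "ip h h = (\<Sum>i\<in>F. c i * ip (d i) h)"
    using ip_sum[OF assms(1,2) h] unfolding h_def by simp
  also have "cmod \<dots> \<le> (\<Sum>i\<in>F. cmod (c i) * cmod (ip (d i) h))"
    by (rule order_trans[OF norm_sum]) (simp add: norm_mult)
  finally have "(nrm2 h)\<^sup>2 \<le> (\<Sum>i\<in>F. cmod (c i) * cmod (ip (d i) h))\<^sup>2"
    using nrm2_nonneg by (intro power_mono)
  also have "\<dots> \<le> S * (\<Sum>i\<in>F. (cmod (ip (d i) h))\<^sup>2)"
    unfolding S_def by (rule Cauchy_Schwarz_ineq_sum)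
  also have "(\<Sum>i\<in>F. (cmod (ip (d i) h))\<^sup>2) = (\<Sum>i\<in>F. (cmod (ip h (d i)))\<^sup>2)"
    by (metis ip_cnj complex_mod_cnj)
  also have "S * \<dots> \<le> S * (B * nrm2 h)" using B[OF h] S by (rule mult_left_mono)
  \<comment> \<open>One factor \<open>nrm2 h\<close> is now cancelled; if it is 0 the claim is
    trivial.\<close>
  finally have *: "nrm2 h * nrm2 h \<le> (B * S) * nrm2 h" by (simp add: power2_eq_square mult_ac)
  have "nrm2 h \<le> B * S"
  proof (cases "nrm2 h = 0")
    case True
    then show ?thesis using S assms(3) by simp
  next
    case False
    then show ?thesis using * nrm2_nonneg[of h] by simp
  qed
  then show ?thesis unfolding h_def S_def .
qed

end

lemma semi_inner_space_Hs: "open \<Omega> \<Longrightarrow> semi_inner_space (Hs s \<Omega>) (Hs_inner s \<Omega>)"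
  by unfold_locales
    (auto intro: Hs_zero Hs_add Hs_cmult Hs_inner_add Hs_inner_cmult Hs_inner_cnj Hs_inner_self)

lemma Hs_norm_square: "(Hs_norm s \<Omega> f)\<^sup>2 = Re (Hs_inner s \<Omega> f f)"
  unfolding Hs_norm_def using Hs_inner_self by simp

section \<open>Supports\<close>

lemma closed_ess_supp: "closed (ess_supp f)"
proof -
  have "- ess_supp f = \<Union>{U. open U \<and> (AE y in lebesgue. y \<in> U \<longrightarrow> f y = 0)}"
    unfolding ess_supp_def by auto
  moreover have "open (\<Union>{U. open U \<and> (AE y in lebesgue. y \<in> U \<longrightarrow> f y = 0)})" by auto
  ultimately show ?thesis by (simp add: closed_def)
qed

text \<open>The complement of the essential support is a union of possibly uncountably many open
  sets on which f vanishes almost everywhere; by Lindelof countably many of them suffice.\<close>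

lemma AE_zero_outside_ess_supp: "AE x in lebesgue. x \<notin> ess_supp f \<longrightarrow> f x = 0"
proof -
  define \<F> where "\<F> = {U. open U \<and> (AE y in lebesgue. y \<in> U \<longrightarrow> f y = 0)}"
  obtain \<F>' where F': "\<F>' \<subseteq> \<F>" "countable \<F>'" "\<Union>\<F>' = \<Union>\<F>"
    using Lindelof[of \<F>] unfolding \<F>_def by auto
  have "AE x in lebesgue. \<forall>U\<in>\<F>'. x \<in> U \<longrightarrow> f x = 0"
    unfolding AE_ball_countable[OF F'(2)] using F'(1) unfolding \<F>_def by blast
  then show ?thesis
  proof eventually_elim
    case (elim x)
    show ?case
    proof
      assume "x \<notin> ess_supp f"
      then have "x \<in> \<Union>\<F>" unfolding ess_supp_def \<F>_def by auto
      then show "f x = 0" using elim F'(3) by blast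
    qed
  qed
qed

lemma ess_supp_subset:
  assumes "closed S" "AE x in lebesgue. x \<notin> S \<longrightarrow> f x = 0"
  shows "ess_supp f \<subseteq> S"
proof
  fix x assume "x \<in> ess_supp f"
  then show "x \<in> S" using assms unfolding ess_supp_def by (auto dest!: spec[of _ "- S"])
qed

lemma AE_translate:
  fixes v :: "'a::euclidean_space"
  assumes "AE x in lebesgue. P x"
  shows "AE x in lebesgue. P (x - v)"
proof -
  obtain N where N: "N \<in> null_sets lebesgue" "{x. \<not> P x} \<subseteq> N"
    using assms unfolding eventually_ae_filter by auto
  from N(1) have "negligible ((+) v ` N)"
    unfolding negligible_iff_null_sets[symmetric] by (rule negligible_translation)
  moreover have "{x. \<not> P (x - v)} \<subseteq> (+) v ` N" using N(2) by (force simp: image_iff)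
  ultimately show ?thesis
    unfolding eventually_ae_filter by (auto simp: negligible_iff_null_sets)
qed

lemma ess_supp_translate: "ess_supp (\<lambda>x. f (x - v)) \<subseteq> (+) v ` ess_supp f"
proof (rule ess_supp_subset)
  show "closed ((+) v ` ess_supp f)" by (simp add: closed_translation closed_ess_supp)
  show "AE x in lebesgue. x \<notin> (+) v ` ess_supp f \<longrightarrow> f (x - v) = 0"
    using AE_translate[OF AE_zero_outside_ess_supp[of f], of v]
    by eventually_elim (force simp: image_iff)
qed

lemma zero_ext_UNIV [simp]: "zero_ext UNIV f = f"
  unfolding zero_ext_def by simp

text \<open>Weak derivatives are local: on the open set where f is almost everywhere 0, the
  restricted derivative is a weak derivative of 0, and by uniqueness it is 0 there.\<close>

lemma weak_deriv_vanishes: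
  assumes "open \<Omega>" "f \<in> Hs s \<Omega>" "fst a + snd a \<le> s"
  shows "AE x in lebesgue_on \<Omega>. x \<notin> ess_supp (zero_ext \<Omega> f) \<longrightarrow> weak_deriv \<Omega> a f x = 0"
proof -
  define U where "U = \<Omega> - ess_supp (zero_ext \<Omega> f)"
  have U: "open U" "U \<subseteq> \<Omega>" unfolding U_def using assms(1) closed_ess_supp by auto
  have sets: "U \<in> sets lebesgue" "\<Omega> \<in> sets lebesgue" using U assms(1) by auto
  have "AE x in lebesgue_on U. weak_deriv \<Omega> a f x = 0"
  proof (rule weak_deriv_unique[OF U(1) _ is_weak_deriv_zero])
    show "is_weak_deriv U a f (weak_deriv \<Omega> a f)"
      by (rule is_weak_deriv_restrict[OF Hs_weak_deriv[OF assms(2,3)] U(2,1) assms(1)])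
    show "f \<in> L2 U" by (rule L2_restrict[OF Hs_L2[OF assms(2)] U(2) sets])
    show "AE x in lebesgue_on U. f x = 0"
      unfolding lebesgue_on_integral[OF sets(1)]
      using AE_zero_outside_ess_supp[of "zero_ext \<Omega> f"]
      by eventually_elim (auto simp: U_def zero_ext_def split: if_splits)
  qed
  then show ?thesis
    unfolding lebesgue_on_integral[OF sets(1)] lebesgue_on_integral[OF sets(2)]
    by eventually_elim (auto simp: U_def)
qed

lemma weak_deriv_restrict_AE:
  assumes "open \<Omega>" "f \<in> Hs s UNIV" "fst a + snd a \<le> s"
  shows "AE x in lebesgue_on \<Omega>. weak_deriv \<Omega> a f x = weak_deriv UNIV a f x"
  by (rule weak_deriv_AE_eq[OF assms(1) Hs_restrict[OF assms(1,2)] assms(3)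
      is_weak_deriv_restrict[OF Hs_weak_deriv[OF assms(2,3)] _ assms(1)]]) auto

text \<open>Derivatives on \<Omega> are restrictions of those on the plane, and the derivatives of p
  vanish off its support, so nothing is lost outside \<Omega>.\<close>

lemma Hs_inner_restrict:
  assumes "open \<Omega>" "f \<in> Hs s UNIV" "p \<in> Hs s UNIV" "ess_supp p \<subseteq> \<Omega>"
  shows "Hs_inner s \<Omega> f p = Hs_inner s UNIV f p"
proof -
  have sets: "\<Omega> \<in> sets lebesgue" using assms(1) by auto
  have L: "weak_deriv UNIV a h \<in> L2 \<Omega>" if "h \<in> Hs s UNIV" "fst a + snd a \<le> s" for a h
    by (rule L2_restrict[OF Hs_weak_deriv_L2[OF that] _ sets]) auto
  have "Hs_inner s \<Omega> f p =
      (\<Sum>a | fst a + snd a \<le> s. L2_inner \<Omega> (weak_deriv UNIV a f) (weak_deriv UNIV a p))"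
    by (rule Hs_inner_eq)
      (simp_all add: L assms weak_deriv_restrict_AE[OF assms(1,2)] weak_deriv_restrict_AE[OF assms(1,3)]
         Hs_restrict[OF assms(1)])
  also have "\<dots> = Hs_inner s UNIV f p"
    unfolding Hs_inner_def
  proof (intro sum.cong refl)
    fix a :: "nat \<times> nat" assume "a \<in> {a. fst a + snd a \<le> s}"
    then have a: "fst a + snd a \<le> s" by simp
    have int: "integrable (lebesgue_on UNIV) (\<lambda>x. weak_deriv UNIV a f x * cnj (weak_deriv UNIV a p x))"
      by (intro L2_mult_integrable L2_cnj Hs_weak_deriv_L2[OF assms(2) a] Hs_weak_deriv_L2[OF assms(3) a])
    have "L2_inner \<Omega> (weak_deriv UNIV a f) (weak_deriv UNIV a p) =
        (LINT x|lebesgue. indicator \<Omega> x *\<^sub>R (weak_deriv UNIV a f x * cnj (weak_deriv UNIV a p x)))"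
      unfolding L2_inner_def lebesgue_on_integral[OF sets] ..
    also have "\<dots> = (LINT x|lebesgue. weak_deriv UNIV a f x * cnj (weak_deriv UNIV a p x))"
    proof (rule integral_cong_AE)
      show "AE x in lebesgue. indicator \<Omega> x *\<^sub>R (weak_deriv UNIV a f x * cnj (weak_deriv UNIV a p x)) =
          weak_deriv UNIV a f x * cnj (weak_deriv UNIV a p x)"
        using weak_deriv_vanishes[OF open_UNIV assms(3) a]
        unfolding lebesgue_on_UNIV_eq zero_ext_UNIV
        by eventually_elim (use assms(4) in \<open>auto simp: indicator_def\<close>)
    qed (use int sets in \<open>auto simp: lebesgue_on_UNIV_eq intro!: borel_measurable_indicator_scaleR\<close>)
    finally show "L2_inner \<Omega> (weak_deriv UNIV a f) (weak_deriv UNIV a p) =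
        L2_inner UNIV (weak_deriv UNIV a f) (weak_deriv UNIV a p)"
      unfolding L2_inner_def lebesgue_on_UNIV_eq .
  qed
  finally show ?thesis .
qed

text \<open>A test function \<eta> on the plane need not be one on \<Omega>, but \<kappa> \<eta> is,
  for a cutoff \<kappa> that is 1 on the ball holding the support of f. There \<kappa> \<eta> and
  \<eta> have the same derivatives, and elsewhere f and its weak derivative vanish. The margin
  \<open>r < R\<close> is the room for \<kappa>.\<close>

lemma Hs_zero_ext:
  assumes "open \<Omega>" "f \<in> Hs s \<Omega>" "ess_supp (zero_ext \<Omega> f) \<subseteq> ball m r" "r < R" "cball m R \<subseteq> \<Omega>" "0 \<le> r"
  shows "zero_ext \<Omega> f \<in> Hs s UNIV"
proof (rule HsI)
  have sets: "\<Omega> \<in> sets lebesgue" using assms(1) by auto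
  obtain \<kappa> where \<kappa>: "\<kappa> \<in> test_functions \<Omega>" "\<And>x. x \<in> ball m r \<Longrightarrow> \<kappa> x = 1"
    using radial_cutoff[OF assms(6,4,5)] by blast
  have ext: "zero_ext \<Omega> h \<in> L2 UNIV" if "h \<in> L2 \<Omega>" for h
    using that L2_iff[OF sets, of h] L2_iff[of UNIV "zero_ext \<Omega> h"] by simp
  show "zero_ext \<Omega> f \<in> L2 UNIV" using assms(2) by (intro ext Hs_L2)
  show "\<exists>g. is_weak_deriv UNIV a (zero_ext \<Omega> f) g" if a: "fst a + snd a \<le> s" for a
  proof
    define g where "g = weak_deriv \<Omega> a f"
    have fg: "is_weak_deriv \<Omega> a f g" unfolding g_def by (rule Hs_weak_deriv[OF assms(2) a])
    have L: "f \<in> L2 \<Omega>" "g \<in> L2 \<Omega>" using fg assms(2) by (auto intro: Hs_L2 weak_deriv_L2)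
    have f0: "AE x in lebesgue. x \<in> \<Omega> \<longrightarrow> x \<notin> ball m r \<longrightarrow> f x = 0"
      using AE_zero_outside_ess_supp[of "zero_ext \<Omega> f"]
      by eventually_elim (use assms(3) in \<open>auto simp: zero_ext_def\<close>)
    have g0: "AE x in lebesgue. x \<in> \<Omega> \<longrightarrow> x \<notin> ball m r \<longrightarrow> g x = 0"
      using weak_deriv_vanishes[OF assms(1,2) a] unfolding lebesgue_on_integral[OF sets] g_def
      by eventually_elim (use assms(3) in auto)
    show "is_weak_deriv UNIV a (zero_ext \<Omega> f) (zero_ext \<Omega> g)"
      unfolding is_weak_deriv_def
    proof (intro conjI ballI)
      show "zero_ext \<Omega> g \<in> L2 UNIV" by (rule ext[OF L(2)])
      fix \<eta> assume \<eta>: "\<eta> \<in> test_functions UNIV"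
      have \<kappa>\<eta>: "(\<lambda>x. \<kappa> x * \<eta> x) \<in> test_functions \<Omega>"
        using \<eta> by (intro test_functions_mult[OF \<kappa>(1)]) (auto simp: test_functions_def)
      have D: "D_classical a (\<lambda>x. \<kappa> x * \<eta> x) x = D_classical a \<eta> x" if "x \<in> ball m r" for x
        by (rule D_classical_local[OF open_ball _ that]) (simp add: \<kappa>(2))
      \<comment> \<open>Used for both sides of the defining identity: with f against the derivatives
        of the test functions, and with g against the test functions themselves.\<close>
      have eq: "(LINT x|lebesgue_on UNIV. zero_ext \<Omega> h x * k x) = (LINT x|lebesgue_on \<Omega>. h x * k' x)"
        if h: "h \<in> L2 \<Omega>" "AE x in lebesgue. x \<in> \<Omega> \<longrightarrow> x \<notin> ball m r \<longrightarrow> h x = 0"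
          and k: "k \<in> L2 UNIV" "k' \<in> L2 \<Omega>" "\<And>x. x \<in> ball m r \<Longrightarrow> k' x = k x" for h k k'
        unfolding lebesgue_on_integral[OF sets] lebesgue_on_UNIV_eq
      proof (rule integral_cong_AE)
        show "AE x in lebesgue. zero_ext \<Omega> h x * k x = indicator \<Omega> x *\<^sub>R (h x * k' x)"
          using h(2) by eventually_elim (use k(3) in \<open>auto simp: zero_ext_def indicator_def\<close>)
        show "(\<lambda>x. zero_ext \<Omega> h x * k x) \<in> borel_measurable lebesgue"
          using L2_mult_integrable[OF ext[OF h(1)] k(1)] by (auto simp: lebesgue_on_UNIV_eq)
        show "(\<lambda>x. indicator \<Omega> x *\<^sub>R (h x * k' x)) \<in> borel_measurable lebesgue"
          using borel_measurable_integrable[OF L2_mult_integrable[OF h(1) k(2)]]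
          unfolding lebesgue_on_integral(3)[OF sets] .
      qed
      have "(LINT x|lebesgue_on UNIV. zero_ext \<Omega> f x * D_classical a \<eta> x) =
          (LINT x|lebesgue_on \<Omega>. f x * D_classical a (\<lambda>x. \<kappa> x * \<eta> x) x)"
        by (rule eq[OF L(1) f0 test_function_L2(1)[OF \<eta>] test_function_L2(1)[OF \<kappa>\<eta> sets] D]) auto
      also have "\<dots> = (-1) ^ (fst a + snd a) * (LINT x|lebesgue_on \<Omega>. g x * (\<kappa> x * \<eta> x))"
        using fg \<kappa>\<eta> unfolding is_weak_deriv_def by blast
      also have "(LINT x|lebesgue_on \<Omega>. g x * (\<kappa> x * \<eta> x)) = (LINT x|lebesgue_on UNIV. zero_ext \<Omega> g x * \<eta> x)"
        by (rule eq[OF L(2) g0 test_function_L2(2)[OF \<eta>] test_function_L2(2)[OF \<kappa>\<eta> sets], symmetric])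
          (auto simp: \<kappa>(2))
      finally show "(LINT x|lebesgue_on UNIV. zero_ext \<Omega> f x * D_classical a \<eta> x) =
          (-1) ^ (fst a + snd a) * (LINT x|lebesgue_on UNIV. zero_ext \<Omega> g x * \<eta> x)" .
    qed
  qed
qed

text \<open>Derivatives stay within the supports, so all integrands vanish. The support of g is
  taken in the whole plane, as that is how shearlets are located; it contains the support of g cut
  off to \<Omega>.\<close>

lemma Hs_inner_disjoint_supports:
  assumes "open \<Omega>" "f \<in> Hs s \<Omega>" "g \<in> Hs s \<Omega>" "ess_supp (zero_ext \<Omega> f) \<inter> ess_supp g = {}"
  shows "Hs_inner s \<Omega> f g = 0"
  unfolding Hs_inner_def
proof (intro sum.neutral ballI)
  fix a :: "nat \<times> nat" assume "a \<in> {a. fst a + snd a \<le> s}"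
  then have a: "fst a + snd a \<le> s" by simp
  have "ess_supp (zero_ext \<Omega> g) \<subseteq> ess_supp g"
    using AE_zero_outside_ess_supp[of g]
    by (intro ess_supp_subset closed_ess_supp) (auto simp: zero_ext_def elim: eventually_mono)
  with assms(4) have d: "ess_supp (zero_ext \<Omega> f) \<inter> ess_supp (zero_ext \<Omega> g) = {}" by blast
  have "AE x in lebesgue_on \<Omega>. weak_deriv \<Omega> a f x * cnj (weak_deriv \<Omega> a g x) = 0"
    using weak_deriv_vanishes[OF assms(1,2) a] weak_deriv_vanishes[OF assms(1,3) a]
    by eventually_elim (use d in auto)
  then show "L2_inner \<Omega> (weak_deriv \<Omega> a f) (weak_deriv \<Omega> a g) = 0"
    unfolding L2_inner_def by (rule integral_eq_zero_AE)
qed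

section \<open>Fourier inversion for integrable transforms\<close>

text \<open>Fubini and the measurability of parametric integrals are applied on
  \<open>lborel\<close>, whereas elements of \<open>L2\<close> are only Lebesgue measurable. A
  change on a null set, made separately for real and imaginary part, bridges the two.\<close>

lemma ex_borel_version:
  fixes g :: "real^2 \<Rightarrow> complex"
  assumes "g \<in> borel_measurable lebesgue"
  obtains g0 where "g0 \<in> borel_measurable borel" "AE x in lebesgue. g x = g0 x"
proof -
  have "(\<lambda>x. Re (g x)) \<in> borel_measurable lebesgue" "(\<lambda>x. Im (g x)) \<in> borel_measurable lebesgue"
    using assms by measurable
  from this[THEN completion_ex_borel_measurable_real]
  obtain u v where uv: "u \<in> borel_measurable lborel" "v \<in> borel_measurable lborel"
    "AE x in lborel. Re (g x) = u x" "AE x in lborel. Im (g x) = v x" by blast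
  have "(\<lambda>x. Complex (u x) (v x)) = (\<lambda>x. complex_of_real (u x) + \<i> * complex_of_real (v x))"
    by (auto simp: complex_eq_iff)
  moreover have "(\<lambda>x. complex_of_real (u x) + \<i> * complex_of_real (v x)) \<in> borel_measurable borel"
    using uv(1,2) by simp
  moreover have "AE x in lborel. g x = Complex (u x) (v x)"
    using uv(3,4) by eventually_elim (simp add: complex_eq_iff)
  ultimately show ?thesis by (intro that[of "\<lambda>x. Complex (u x) (v x)"] AE_completion) simp_all
qed

lemma integrable_lebesgue_borel_version:
  fixes g :: "real^2 \<Rightarrow> complex"
  assumes "integrable lebesgue g" "g0 \<in> borel_measurable borel" "AE x in lebesgue. g x = g0 x"
  shows "integrable lborel g0"
proof -
  have "g0 \<in> borel_measurable lebesgue" using assms(2) by (simp add: measurable_completion)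
  then have "integrable lebesgue g0"
    by (rule integrable_cong_AE_imp[OF assms(1)]) (rule assms(3))
  then show ?thesis using assms(2) by (simp add: integrable_completion)
qed

text \<open>The exchange of integrals for integrable f, g and a bounded kernel, dominated by C |f|
  |g|. It is applied to exponentials and to rescaled Gaussians.\<close>

lemma Fubini_kernel:
  fixes f g :: "real^2 \<Rightarrow> complex" and k :: "real^2 \<Rightarrow> real^2 \<Rightarrow> complex"
  assumes f: "integrable lborel f" and g: "integrable lborel g"
    and k: "case_prod k \<in> borel_measurable (borel \<Otimes>\<^sub>M borel)" and C: "\<And>x y. cmod (k x y) \<le> C"
  shows "(LINT x|lborel. f x * (LINT y|lborel. g y * k x y)) = (LINT y|lborel. g y * (LINT x|lborel. f x * k x y))"
proof -
  have [measurable]: "f \<in> borel_measurable borel" "g \<in> borel_measurable borel" using f g by auto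
  have k' [measurable]: "case_prod k \<in> borel_measurable (lborel \<Otimes>\<^sub>M lborel)"
    using k measurable_cong_sets[OF sets_pair_measure_cong[OF sets_lborel sets_lborel] refl] by blast
  have int: "integrable (lborel \<Otimes>\<^sub>M lborel) (\<lambda>(x, y). f x * g y * k x y)"
  proof (rule Bochner_Integration.integrable_bound)
    show "integrable (lborel \<Otimes>\<^sub>M lborel) (\<lambda>(x, y). C * (norm (f x) * norm (g y)))"
      using lborel_pair.Fubini_integrable[of "\<lambda>(x, y). C * (norm (f x) * norm (g y))"] f g
      by (simp add: abs_mult)
    show "(\<lambda>(x, y). f x * g y * k x y) \<in> borel_measurable (lborel \<Otimes>\<^sub>M lborel)"
      unfolding split_beta using measurable_compose[OF measurable_fst, of f] k'
      by (intro borel_measurable_times) (simp_all add: split_beta)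
    have "cmod (f x * g y * k x y) \<le> \<bar>C * (cmod (f x) * cmod (g y))\<bar>" for x y
    proof -
      have "cmod (f x * g y * k x y) \<le> cmod (f x) * cmod (g y) * C"
        using C[of x y] by (simp add: norm_mult mult_left_mono)
      also have "\<dots> \<le> \<bar>C * (cmod (f x) * cmod (g y))\<bar>" by (simp add: mult_ac)
      finally show ?thesis .
    qed
    then show "AE z in lborel \<Otimes>\<^sub>M lborel. norm (case z of (x, y) \<Rightarrow> f x * g y * k x y) \<le>
        norm (case z of (x, y) \<Rightarrow> C * (norm (f x) * norm (g y)))"
      by (auto intro!: AE_I2 simp: split_beta)
  qed
  have "(LINT x|lborel. f x * (LINT y|lborel. g y * k x y)) = (LINT x|lborel. LINT y|lborel. f x * g y * k x y)"
    by (simp add: mult.assoc)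
  also have "\<dots> = (LINT y|lborel. LINT x|lborel. f x * g y * k x y)"
    by (rule lborel_pair.Fubini_integral[OF int, symmetric])
  also have "\<dots> = (LINT y|lborel. LINT x|lborel. g y * (f x * k x y))"
    by (simp add: mult_ac)
  also have "\<dots> = (LINT y|lborel. g y * (LINT x|lborel. f x * k x y))"
    by simp
  finally show ?thesis .
qed

text \<open>Lebesgue measure on the plane is the image of the product measure indexed by the two
  basis vectors; \<open>F\<close> attaches each one-dimensional factor to its basis vector.\<close>

lemma product_lborel_vec2:
  fixes f1 f2 :: "real \<Rightarrow> complex"
  assumes f: "integrable lborel f1" "integrable lborel f2"
  shows "integrable lborel (\<lambda>x::real^2. f1 (x $ 1) * f2 (x $ 2))"
    and "(LINT x|lborel. f1 ((x::real^2) $ 1) * f2 (x $ 2)) = (LINT t|lborel. f1 t) * (LINT t|lborel. f2 t)"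
proof -
  interpret product_sigma_finite "\<lambda>_::real^2. lborel :: real measure" by standard
  have B: "(Basis :: (real^2) set) = {axis 1 1, axis 2 1}"
    unfolding Basis_vec_def by (auto simp: UNIV_2)
  have ne: "axis 1 1 \<noteq> (axis 2 1 :: real^2)" by (simp add: axis_eq_axis)
  define F where "F = (\<lambda>b::real^2. if b = axis 1 1 then f1 else f2)"
  have F: "integrable lborel (F b)" for b using f by (simp add: F_def)
  have P: "(\<Prod>b\<in>Basis. F b (h b)) = f1 (h (axis 1 1)) * f2 (h (axis 2 1))" for h
    using ne by (simp add: B F_def)
  have "(\<Sum>b\<in>Basis. h b *\<^sub>R b) $ 1 = h (axis 1 1)" "(\<Sum>b\<in>Basis. h b *\<^sub>R b) $ 2 = h (axis 2 1)"
    for h :: "real^2 \<Rightarrow> real"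
    using ne by (simp_all add: B axis_def)
  then have eq: "f1 ((\<Sum>b\<in>Basis. h b *\<^sub>R b) $ 1) * f2 ((\<Sum>b\<in>Basis. h b *\<^sub>R b) $ 2) = (\<Prod>b\<in>Basis. F b (h b))"
    for h :: "real^2 \<Rightarrow> real"
    by (simp only: P)
  define T where "T = (\<lambda>f. \<Sum>b\<in>(Basis :: (real^2) set). f b *\<^sub>R b)"
  define M where "M = (\<Pi>\<^sub>M b\<in>(Basis :: (real^2) set). lborel :: real measure)"
  have lb: "(lborel :: (real^2) measure) = distr M borel T" unfolding M_def T_def by (rule lborel_eq)
  have m: "T \<in> measurable M borel" unfolding M_def T_def by measurable
  have eq': "(\<lambda>h. f1 (T h $ 1) * f2 (T h $ 2)) = (\<lambda>h. \<Prod>b\<in>Basis. F b (h b))"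
    unfolding T_def by (rule ext) (rule eq)
  have mf: "f1 \<in> borel_measurable borel" "f2 \<in> borel_measurable borel" using f by auto
  have m2: "(\<lambda>x::real^2. f1 (x $ 1) * f2 (x $ 2)) \<in> borel_measurable borel"
  proof (rule borel_measurable_times)
    have "(\<lambda>x::real^2. x $ i) \<in> borel_measurable borel" for i :: 2
      by (intro borel_measurable_continuous_onI continuous_intros)
    from measurable_compose[OF this mf(1)] measurable_compose[OF this mf(2)]
    show "(\<lambda>x::real^2. f1 (x $ 1)) \<in> borel_measurable borel" "(\<lambda>x::real^2. f2 (x $ 2)) \<in> borel_measurable borel"
      by blast+
  qed
  have "integrable M (\<lambda>h. f1 (T h $ 1) * f2 (T h $ 2))"
    unfolding eq' unfolding M_def by (rule product_integrable_prod) (auto intro: F)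
  then show "integrable lborel (\<lambda>x::real^2. f1 (x $ 1) * f2 (x $ 2))"
    unfolding lb by (subst integrable_distr_eq[OF m m2])
  have "(LINT x|lborel. f1 ((x::real^2) $ 1) * f2 (x $ 2)) = (LINT h|M. (\<Prod>b\<in>Basis. F b (h b)))"
    unfolding lb eq'[symmetric] by (rule integral_distr[OF m m2])
  also have "\<dots> = (\<Prod>b\<in>Basis. integral\<^sup>L lborel (F b))"
    unfolding M_def by (rule product_integral_prod) (auto intro: F)
  also have "\<dots> = (LINT t|lborel. f1 t) * (LINT t|lborel. f2 t)"
    using ne by (simp add: B F_def)
  finally show "(LINT x|lborel. f1 ((x::real^2) $ 1) * f2 (x $ 2)) = (LINT t|lborel. f1 t) * (LINT t|lborel. f2 t)" .
qed

text \<open>The characteristic function of the standard normal distribution after the substitution x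
  = c t with c = 2 pi / n.\<close>

lemma gaussian_fourier_1d:
  assumes n: "n > (0::real)"
  shows "integrable lborel (\<lambda>t. complex_of_real (exp (- (2 * pi * t / n)\<^sup>2 / 2)))"
    and "(LINT t|lborel. complex_of_real (exp (- (2 * pi * t / n)\<^sup>2 / 2)) * exp (\<i> * complex_of_real (2 * pi * z * t))) =
       complex_of_real (n * std_normal_density (n * z))"
proof -
  define c where "c = 2 * pi / n"
  have c: "c > 0" using n by (simp add: c_def)
  have sq: "complex_of_real (exp (- (2 * pi * t / n)\<^sup>2 / 2)) = complex_of_real (sqrt (2 * pi) * std_normal_density (0 + c * t))" for t
    by (simp add: std_normal_density_def c_def)
  show "integrable lborel (\<lambda>t. complex_of_real (exp (- (2 * pi * t / n)\<^sup>2 / 2)))"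
    unfolding sq using c lborel_integrable_real_affine[of std_normal_density c 0]
    by (auto intro!: integrable_of_real)
  have "complex_of_real (exp (- (n * z)\<^sup>2 / 2)) = (CLINT x|std_normal_distribution. iexp (n * z * x))"
    using char_std_normal_distribution by (metis char_def)
  also have "\<dots> = (CLINT x|lborel. std_normal_density x *\<^sub>R iexp (n * z * x))"
    by (rule integral_density) auto
  also have "\<dots> = c *\<^sub>R (CLINT t|lborel. std_normal_density (0 + c * t) *\<^sub>R iexp (n * z * (0 + c * t)))"
    using c by (subst lborel_integral_real_affine[of c _ 0]) auto
  also have "(CLINT t|lborel. std_normal_density (0 + c * t) *\<^sub>R iexp (n * z * (0 + c * t))) =
      (CLINT t|lborel. complex_of_real (1 / sqrt (2 * pi)) * (complex_of_real (exp (- (2 * pi * t / n)\<^sup>2 / 2)) *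
         exp (\<i> * complex_of_real (2 * pi * z * t))))"
  proof (rule Bochner_Integration.integral_cong[OF refl])
    fix t
    have "n * z * (0 + c * t) = 2 * pi * z * t" using n by (simp add: c_def)
    moreover have "std_normal_density (0 + c * t) = 1 / sqrt (2 * pi) * exp (- (2 * pi * t / n)\<^sup>2 / 2)"
      by (simp add: std_normal_density_def c_def)
    ultimately show "std_normal_density (0 + c * t) *\<^sub>R iexp (n * z * (0 + c * t)) =
       complex_of_real (1 / sqrt (2 * pi)) * (complex_of_real (exp (- (2 * pi * t / n)\<^sup>2 / 2)) *
         exp (\<i> * complex_of_real (2 * pi * z * t)))"
      by (simp only: scaleR_conv_of_real of_real_mult mult.assoc)
  qed
  also have "c *\<^sub>R \<dots> = complex_of_real (c / sqrt (2 * pi)) *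
      (CLINT t|lborel. complex_of_real (exp (- (2 * pi * t / n)\<^sup>2 / 2)) * exp (\<i> * complex_of_real (2 * pi * z * t)))"
    by (simp add: scaleR_conv_of_real)
  finally have *: "complex_of_real (exp (- (n * z)\<^sup>2 / 2)) = complex_of_real (c / sqrt (2 * pi)) *
      (CLINT t|lborel. complex_of_real (exp (- (2 * pi * t / n)\<^sup>2 / 2)) * exp (\<i> * complex_of_real (2 * pi * z * t)))" .
  have "sqrt (2 * pi) * sqrt (2 * pi) = 2 * pi" by simp
  then have **: "c / sqrt (2 * pi) = sqrt (2 * pi) / n" unfolding c_def using n by (simp add: field_simps)
  have "complex_of_real (n / sqrt (2 * pi)) * complex_of_real (exp (- (n * z)\<^sup>2 / 2)) =
     complex_of_real (n / sqrt (2 * pi) * (sqrt (2 * pi) / n)) *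
      (CLINT t|lborel. complex_of_real (exp (- (2 * pi * t / n)\<^sup>2 / 2)) * exp (\<i> * complex_of_real (2 * pi * z * t)))"
    unfolding * ** of_real_mult by (simp only: mult.assoc)
  moreover have "n / sqrt (2 * pi) * (sqrt (2 * pi) / n) = 1" using n by simp
  moreover have "n * std_normal_density (n * z) = n / sqrt (2 * pi) * exp (- (n * z)\<^sup>2 / 2)"
    by (simp add: std_normal_density_def)
  ultimately show "(LINT t|lborel. complex_of_real (exp (- (2 * pi * t / n)\<^sup>2 / 2)) * exp (\<i> * complex_of_real (2 * pi * z * t))) =
       complex_of_real (n * std_normal_density (n * z))"
    by (simp only: of_real_mult of_real_1 mult_1)
qed

text \<open>A convergence factor on the frequency side: it tends to 1 as n grows, and its inverse
  transform is the concentrating kernel n^2 \<open>gauss\<close>(n z).\<close>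

definition gauss_freq :: "real \<Rightarrow> cfun" where
  "gauss_freq n \<xi> = complex_of_real (exp (- (2 * pi * \<xi> $ 1 / n)\<^sup>2 / 2)) * complex_of_real (exp (- (2 * pi * \<xi> $ 2 / n)\<^sup>2 / 2))"

definition gauss :: cfun where
  "gauss z = complex_of_real (std_normal_density (z $ 1)) * complex_of_real (std_normal_density (z $ 2))"

lemma integrable_gauss_freq: "n > 0 \<Longrightarrow> integrable lborel (gauss_freq n)"
  unfolding gauss_freq_def by (intro product_lborel_vec2 gaussian_fourier_1d)

lemma integrable_gauss: "integrable lborel gauss" and integral_gauss: "(LINT z|lborel. gauss z) = 1"
  unfolding gauss_def
  using product_lborel_vec2[of "\<lambda>t. complex_of_real (std_normal_density t)" "\<lambda>t. complex_of_real (std_normal_density t)"]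
  by auto

lemma inner_vec2: "(x::real^2) \<bullet> y = x $ 1 * y $ 1 + x $ 2 * y $ 2"
  by (simp add: inner_vec_def sum_2)

lemma gauss_freq_fourier:
  assumes n: "n > 0"
  shows "(LINT \<xi>|lborel. gauss_freq n \<xi> * exp (2 * pi * \<i> * complex_of_real (z \<bullet> \<xi>))) = complex_of_real (n\<^sup>2) * gauss (n *\<^sub>R z)"
proof -
  define f where "f = (\<lambda>w t. complex_of_real (exp (- (2 * pi * t / n)\<^sup>2 / 2)) * exp (\<i> * complex_of_real (2 * pi * w * t)))"
  have int: "integrable lborel (f w)" for w
  proof (rule Bochner_Integration.integrable_bound[OF gaussian_fourier_1d(1)[OF n]])
    have "f w \<in> borel_measurable borel"
      unfolding f_def by (intro borel_measurable_continuous_onI continuous_intros) (use n in auto)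
    then show "f w \<in> borel_measurable lborel" by simp
  qed (auto simp: f_def norm_mult)
  have "gauss_freq n \<xi> * exp (2 * pi * \<i> * complex_of_real (z \<bullet> \<xi>)) = f (z $ 1) (\<xi> $ 1) * f (z $ 2) (\<xi> $ 2)" for \<xi>
    unfolding f_def gauss_freq_def inner_vec2 by (simp add: exp_add[symmetric] algebra_simps)
  then have "(LINT \<xi>|lborel. gauss_freq n \<xi> * exp (2 * pi * \<i> * complex_of_real (z \<bullet> \<xi>))) =
      (LINT t|lborel. f (z $ 1) t) * (LINT t|lborel. f (z $ 2) t)"
    using product_lborel_vec2(2)[OF int int] by simp
  also have "\<dots> = complex_of_real (n * std_normal_density (n * z $ 1)) * complex_of_real (n * std_normal_density (n * z $ 2))"
    unfolding f_def by (simp only: gaussian_fourier_1d(2)[OF n])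
  finally show ?thesis by (simp add: gauss_def power2_eq_square)
qed

lemma lborel_integral_affine:
  fixes f :: "'a::euclidean_space \<Rightarrow> 'b::{banach, second_countable_topology}"
  assumes "c \<noteq> 0" "f \<in> borel_measurable borel"
  shows "(LINT x|lborel. f x) = \<bar>c\<bar> ^ DIM('a) *\<^sub>R (LINT x|lborel. f (t + c *\<^sub>R x))"
proof -
  have m: "(\<lambda>x::'a. t + c *\<^sub>R x) \<in> borel_measurable lborel" by simp
  have "(LINT x|lborel. f x) = (LINT x|density (distr lborel borel (\<lambda>x. t + c *\<^sub>R x)) (\<lambda>_. \<bar>c\<bar> ^ DIM('a)). f x)"
    using lborel_affine[OF assms(1), of t] by simp
  also have "\<dots> = (LINT x|distr lborel borel (\<lambda>x. t + c *\<^sub>R x). (\<bar>c\<bar> ^ DIM('a)) *\<^sub>R f x)"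
    using assms(2) by (subst integral_density) auto
  also have "\<dots> = \<bar>c\<bar> ^ DIM('a) *\<^sub>R (LINT x|lborel. f (t + c *\<^sub>R x))"
    using assms(2) by (subst integral_distr[OF m]) auto
  finally show ?thesis .
qed

text \<open>The substitution y = x + w / n. Afterwards the Gaussian is fixed and only the argument
  of \<eta> moves towards x, which suits dominated convergence.\<close>

lemma gauss_approx_identity:
  assumes \<eta>: "\<eta> \<in> test_functions UNIV" and n: "n > 0"
  shows "(LINT y|lborel. \<eta> y * (complex_of_real (n\<^sup>2) * gauss (n *\<^sub>R (y - x)))) = (LINT w|lborel. \<eta> (x + (1 / n) *\<^sub>R w) * gauss w)"
proof -
  have [measurable]: "\<eta> \<in> borel_measurable borel" "gauss \<in> borel_measurable borel"
    using continuous_test_function[OF \<eta>, of UNIV] integrable_gauss by (auto intro: borel_measurable_continuous_onI)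
  have "(LINT y|lborel. \<eta> y * (complex_of_real (n\<^sup>2) * gauss (n *\<^sub>R (y - x)))) =
      (\<bar>1 / n\<bar> ^ DIM(real^2)) *\<^sub>R (LINT w|lborel. \<eta> (x + (1 / n) *\<^sub>R w) * (complex_of_real (n\<^sup>2) * gauss (n *\<^sub>R (x + (1 / n) *\<^sub>R w - x))))"
    using n by (intro lborel_integral_affine) auto
  also have "\<dots> = (LINT w|lborel. (1 / n)\<^sup>2 *\<^sub>R (\<eta> (x + (1 / n) *\<^sub>R w) * (complex_of_real (n\<^sup>2) * gauss (n *\<^sub>R (x + (1 / n) *\<^sub>R w - x)))))"
    using n by (simp add: power_divide)
  also have "\<dots> = (LINT w|lborel. \<eta> (x + (1 / n) *\<^sub>R w) * gauss w)"
  proof (rule Bochner_Integration.integral_cong[OF refl])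
    fix w
    have "n *\<^sub>R (x + (1 / n) *\<^sub>R w - x) = w" using n by simp
    moreover have "(1 / n)\<^sup>2 *\<^sub>R (a * (complex_of_real (n\<^sup>2) * b)) = a * b" for a b :: complex
    proof -
      have "complex_of_real ((1 / n)\<^sup>2) * complex_of_real (n\<^sup>2) = 1"
        using n by (simp add: power_divide flip: of_real_mult)
      then show ?thesis unfolding scaleR_conv_of_real by (metis mult.assoc mult.left_commute mult_1)
    qed
    ultimately show "(1 / n)\<^sup>2 *\<^sub>R (\<eta> (x + (1 / n) *\<^sub>R w) * (complex_of_real (n\<^sup>2) * gauss (n *\<^sub>R (x + (1 / n) *\<^sub>R w - x)))) =
       \<eta> (x + (1 / n) *\<^sub>R w) * gauss w" by (simp only:)
  qed
  finally show ?thesis .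
qed

lemma test_function_bounded:
  assumes "\<eta> \<in> test_functions \<Omega>"
  obtains C where "0 \<le> C" "\<And>x. cmod (\<eta> x) \<le> C"
proof -
  let ?K = "closure {x. \<eta> x \<noteq> 0}"
  have "compact (\<eta> ` ?K)"
    using assms by (intro compact_continuous_image continuous_test_function) (auto simp: test_functions_def)
  then obtain B where B: "\<And>x. x \<in> ?K \<Longrightarrow> cmod (\<eta> x) \<le> B"
    unfolding compact_eq_bounded_closed bounded_iff by blast
  have "cmod (\<eta> x) \<le> max B 0" for x
    using B[of x] closure_subset[of "{x. \<eta> x \<noteq> 0}"] by (cases "\<eta> x = 0") auto
  then show ?thesis using that[of "max B 0"] by auto
qed

lemma test_function_integrable:
  assumes "\<eta> \<in> test_functions UNIV"
  shows "integrable lborel \<eta>"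
proof -
  let ?K = "closure {x. \<eta> x \<noteq> 0}"
  have K: "compact ?K" using assms by (simp add: test_functions_def)
  have "integrable lborel (\<lambda>x. indicator ?K x *\<^sub>R \<eta> x)"
    by (rule borel_integrable_compact[OF K continuous_test_function[OF assms]])
  moreover have "indicator ?K x *\<^sub>R \<eta> x = \<eta> x" for x
    using closure_subset[of "{x. \<eta> x \<noteq> 0}"] by (auto simp: indicator_def)
  ultimately show ?thesis by simp
qed

section \<open>Measurability of Fourier integrals\<close>

lemma exp_inner_measurable:
  "(\<lambda>(x::real^2, y::real^2). exp (c * complex_of_real (x \<bullet> y))) \<in> borel_measurable (borel \<Otimes>\<^sub>M borel)"
  by (simp add: borel_prod) (intro borel_measurable_continuous_onI continuous_intros; simp add: split_beta; intro continuous_intros)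

lemma fourier_eq_lborel:
  assumes "g \<in> borel_measurable borel"
  shows "fourier g \<xi> = (LINT x|lborel. g x * exp (- (2 * pi * \<i> * complex_of_real (x \<bullet> \<xi>))))"
proof -
  have "(\<lambda>x. exp (- (2 * pi * \<i> * complex_of_real (x \<bullet> \<xi>)))) \<in> borel_measurable borel"
    by (intro borel_measurable_continuous_onI continuous_intros)
  with assms show ?thesis unfolding fourier_def by (intro integral_completion) simp
qed

lemma fourier_AE_cong:
  assumes "AE x in lebesgue. f x = g x" "f \<in> borel_measurable lebesgue" "g \<in> borel_measurable lebesgue"
  shows "fourier f = fourier g"
proof
  fix \<xi> :: "real^2"
  have e: "(\<lambda>x. exp (- (2 * pi * \<i> * complex_of_real (x \<bullet> \<xi>)))) \<in> borel_measurable lebesgue"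
    by (intro continuous_imp_lebesgue_measurable continuous_intros)
  show "fourier f \<xi> = fourier g \<xi>"
    unfolding fourier_def
  proof (rule integral_cong_AE)
    show "AE x in lebesgue. f x * exp (- (2 * pi * \<i> * complex_of_real (x \<bullet> \<xi>))) =
        g x * exp (- (2 * pi * \<i> * complex_of_real (x \<bullet> \<xi>)))"
      using assms(1) by eventually_elim simp
  qed (use assms(2,3) e in \<open>auto intro: borel_measurable_times\<close>)
qed

lemma parametric_integral_measurable:
  fixes k :: "real^2 \<Rightarrow> real^2 \<Rightarrow> complex"
  assumes "f \<in> borel_measurable borel" "case_prod k \<in> borel_measurable (borel \<Otimes>\<^sub>M borel)"
  shows "(\<lambda>x. LINT y|lborel. f y * k x y) \<in> borel_measurable borel"
proof -
  have "case_prod k \<in> borel_measurable (borel \<Otimes>\<^sub>M lborel)"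
    using assms(2) measurable_cong_sets[OF sets_pair_measure_cong[OF refl sets_lborel] refl] by blast
  moreover have "(\<lambda>z. f (snd z)) \<in> borel_measurable (borel \<Otimes>\<^sub>M lborel)"
    using assms(1) by simp
  ultimately have "(\<lambda>(x, y). f y * k x y) \<in> borel_measurable (borel \<Otimes>\<^sub>M lborel)"
    unfolding split_beta by (intro borel_measurable_times)
  then show ?thesis by (rule lborel.borel_measurable_lebesgue_integral)
qed

lemma gauss_freq_le_1: "cmod (gauss_freq n \<xi>) \<le> 1"
  unfolding gauss_freq_def norm_mult by (auto intro!: mult_le_one)

lemma gauss_le_1: "cmod (gauss z) \<le> 1"
proof -
  have "1 \<le> sqrt (2 * pi)" using pi_gt3 by simp
  then have "std_normal_density t \<le> 1" for t
    unfolding std_normal_density_def by (intro mult_le_one) auto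
  then show ?thesis unfolding gauss_def norm_mult by (auto intro!: mult_le_one)
qed

lemma gauss_freq_tendsto: "(\<lambda>n. gauss_freq (real (Suc n)) \<xi>) \<longlonglongrightarrow> 1"
proof -
  have "(\<lambda>n. exp (- (2 * pi * a / real (Suc n))\<^sup>2 / 2)) \<longlonglongrightarrow> exp (- (0\<^sup>2) / 2)" for a
    by (intro tendsto_intros LIMSEQ_Suc[OF lim_const_over_n]) simp
  then have "(\<lambda>n. gauss_freq (real (Suc n)) \<xi>) \<longlonglongrightarrow> complex_of_real (exp (- (0\<^sup>2) / 2)) * complex_of_real (exp (- (0\<^sup>2) / 2))"
    unfolding gauss_freq_def by (intro tendsto_mult tendsto_of_real)
  then show ?thesis by simp
qed

text \<open>Gaussian summability in weak form. The inverse transform g' of F is compared with g by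
  integrating both against test functions; the fundamental lemma then identifies them almost
  everywhere.\<close>

lemma fourier_inversion_lborel:
  fixes g F :: cfun
  assumes g: "integrable lborel g" and F: "integrable lborel F"
    and gF: "\<And>\<xi>. F \<xi> = (LINT x|lborel. g x * exp (- (2 * pi * \<i> * complex_of_real (x \<bullet> \<xi>))))"
  shows "AE x in lebesgue. g x = (LINT \<xi>|lborel. F \<xi> * exp (2 * pi * \<i> * complex_of_real (x \<bullet> \<xi>)))"
proof -
  define g' where "g' = (\<lambda>x. LINT \<xi>|lborel. F \<xi> * exp (2 * pi * \<i> * complex_of_real (x \<bullet> \<xi>)))"
  define B where "B = (LINT \<xi>|lborel. cmod (F \<xi>))"
  have gm: "g \<in> borel_measurable borel" and Fm: "F \<in> borel_measurable borel" using g F by auto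
  have phase_m: "(\<lambda>\<xi>. exp (2 * pi * \<i> * complex_of_real (x \<bullet> \<xi>))) \<in> borel_measurable borel" for x :: "real^2"
    by (intro borel_measurable_continuous_onI continuous_intros)
  have g'm: "g' \<in> borel_measurable borel"
    unfolding g'_def by (rule parametric_integral_measurable[OF Fm exp_inner_measurable])
  have Fe: "integrable lborel (\<lambda>\<xi>. F \<xi> * exp (2 * pi * \<i> * complex_of_real (x \<bullet> \<xi>)))" for x
    by (rule Bochner_Integration.integrable_bound[OF F]) (use Fm phase_m in \<open>auto simp: norm_mult\<close>)
  have g'B: "cmod (g' x) \<le> B" for x
  proof -
    have "cmod (g' x) \<le> (LINT \<xi>|lborel. norm (F \<xi> * exp (2 * pi * \<i> * complex_of_real (x \<bullet> \<xi>))))"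
      unfolding g'_def by (rule integral_norm_bound)
    then show ?thesis unfolding B_def by (simp add: norm_mult)
  qed
  have test: "(LINT x|lborel. \<eta> x * g' x) = (LINT x|lborel. g x * \<eta> x)" if \<eta>: "\<eta> \<in> test_functions UNIV" for \<eta>
  proof -
    obtain C where C: "0 \<le> C" "\<And>x. cmod (\<eta> x) \<le> C" using test_function_bounded[OF \<eta>] by blast
    have \<eta>i: "integrable lborel \<eta>" by (rule test_function_integrable[OF \<eta>])
    have \<eta>m: "\<eta> \<in> borel_measurable borel" using \<eta>i by auto
    have \<eta>c: "continuous_on UNIV \<eta>" by (rule continuous_test_function[OF \<eta>])
    \<comment> \<open>\<open>A\<close> is the inverse transform damped by the Gaussian;
      \<open>H\<close> is the Gaussian mean of the test function.\<close>
    define A where "A = (\<lambda>n y. LINT \<xi>|lborel. gauss_freq n \<xi> * (F \<xi> * exp (2 * pi * \<i> * complex_of_real (y \<bullet> \<xi>))))"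
    define H where "H = (\<lambda>n x. LINT y|lborel. \<eta> y * (complex_of_real (n\<^sup>2) * gauss (n *\<^sub>R (y - x))))"
    have gaussm: "gauss \<in> borel_measurable borel" using integrable_gauss by auto
    have km: "(\<lambda>(y, x). (complex_of_real (n\<^sup>2) * gauss (n *\<^sub>R (y - x)))) \<in> borel_measurable (borel \<Otimes>\<^sub>M borel)" for n :: real
    proof -
      have "(\<lambda>z. n *\<^sub>R (fst z - snd z)) \<in> borel_measurable (borel \<Otimes>\<^sub>M (borel :: (real^2) measure))" by measurable
      from measurable_compose[OF this gaussm] show ?thesis by (simp add: split_beta)
    qed
    have A_eq: "A n y = (LINT x|lborel. g x * (complex_of_real (n\<^sup>2) * gauss (n *\<^sub>R (y - x))))" if n: "n > 0" for n y
    proof -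
      define k where "k = (\<lambda>\<xi> x. exp (2 * pi * \<i> * complex_of_real ((y - x) \<bullet> \<xi>)))"
      have km: "case_prod k \<in> borel_measurable (borel \<Otimes>\<^sub>M borel)"
        unfolding k_def borel_prod
        by (intro borel_measurable_continuous_onI) (auto simp: split_beta intro!: continuous_intros)
      have "A n y = (LINT \<xi>|lborel. gauss_freq n \<xi> * (LINT x|lborel. g x * k \<xi> x))"
        unfolding A_def
      proof (rule Bochner_Integration.integral_cong[OF refl])
        fix \<xi>
        have "F \<xi> * exp (2 * pi * \<i> * complex_of_real (y \<bullet> \<xi>)) =
            (LINT x|lborel. g x * exp (- (2 * pi * \<i> * complex_of_real (x \<bullet> \<xi>))) * exp (2 * pi * \<i> * complex_of_real (y \<bullet> \<xi>)))"
          unfolding gF by simp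
        also have "\<dots> = (LINT x|lborel. g x * k \<xi> x)"
          unfolding k_def mult.assoc exp_add[symmetric] by (simp add: inner_diff_left algebra_simps)
        finally show "gauss_freq n \<xi> * (F \<xi> * exp (2 * pi * \<i> * complex_of_real (y \<bullet> \<xi>))) =
            gauss_freq n \<xi> * (LINT x|lborel. g x * k \<xi> x)" by simp
      qed
      also have "\<dots> = (LINT x|lborel. g x * (LINT \<xi>|lborel. gauss_freq n \<xi> * k \<xi> x))"
        by (rule Fubini_kernel[OF integrable_gauss_freq[OF n] g km, of 1]) (simp add: k_def)
      finally show ?thesis unfolding k_def gauss_freq_fourier[OF n] .
    qed
    \<comment> \<open>The point of testing: \<open>A_eq\<close> shows that A is a Gaussian mean of
      g, and the exchange of integrals moves this mean to \<eta>. There the limit is pointwise by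
      continuity, whereas g is merely integrable.\<close>
    have swap: "(LINT y|lborel. \<eta> y * A n y) = (LINT x|lborel. g x * H n x)" if n: "n > 0" for n
      unfolding A_eq[OF n] H_def
    proof (rule Fubini_kernel[OF \<eta>i g km])
      show "cmod (complex_of_real (n\<^sup>2) * gauss (n *\<^sub>R (x - y))) \<le> n\<^sup>2" for x y
        using gauss_le_1[of "n *\<^sub>R (x - y)"] unfolding norm_mult norm_of_real abs_power2
        by (intro mult_left_le) auto
    qed
    define N where "N = (\<lambda>k. real (Suc k))"
    have N: "N k > 0" for k by (simp add: N_def)
    have H_eq: "H n x = (LINT w|lborel. \<eta> (x + (1 / n) *\<^sub>R w) * gauss w)" if "n > 0" for n x
      unfolding H_def by (rule gauss_approx_identity[OF \<eta> that])
    have lim1: "(\<lambda>k. LINT y|lborel. \<eta> y * A (N k) y) \<longlonglongrightarrow> (LINT y|lborel. \<eta> y * g' y)"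
    proof (rule integral_dominated_convergence[where w="\<lambda>y. cmod (\<eta> y) * B"])
      have Al: "(\<lambda>k. A (N k) y) \<longlonglongrightarrow> g' y" for y
        unfolding A_def g'_def
      proof (rule integral_dominated_convergence[where w="\<lambda>\<xi>. cmod (F \<xi>)"])
        show "AE \<xi> in lborel. (\<lambda>k. gauss_freq (N k) \<xi> * (F \<xi> * exp (2 * pi * \<i> * complex_of_real (y \<bullet> \<xi>))))
            \<longlonglongrightarrow> F \<xi> * exp (2 * pi * \<i> * complex_of_real (y \<bullet> \<xi>))"
          using tendsto_mult[OF gauss_freq_tendsto tendsto_const] unfolding N_def by (auto intro!: AE_I2)
        show "AE \<xi> in lborel. norm (gauss_freq (N k) \<xi> * (F \<xi> * exp (2 * pi * \<i> * complex_of_real (y \<bullet> \<xi>)))) \<le> cmod (F \<xi>)" for k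
          using gauss_freq_le_1 by (auto intro!: AE_I2 mult_left_le_one_le simp: norm_mult)
        show "(\<lambda>\<xi>. gauss_freq (N k) \<xi> * (F \<xi> * exp (2 * pi * \<i> * complex_of_real (y \<bullet> \<xi>)))) \<in> borel_measurable lborel" for k
          using borel_measurable_integrable[OF integrable_gauss_freq[OF N[of k]]] borel_measurable_integrable[OF Fe]
          by (rule borel_measurable_times)
      qed (use F Fe in auto)
      then show "AE y in lborel. (\<lambda>k. \<eta> y * A (N k) y) \<longlonglongrightarrow> \<eta> y * g' y"
        by (auto intro!: AE_I2 tendsto_intros)
      have AB: "cmod (A n y) \<le> B" for n y
      proof -
        have "cmod (A n y) \<le> (LINT \<xi>|lborel. norm (gauss_freq n \<xi> * (F \<xi> * exp (2 * pi * \<i> * complex_of_real (y \<bullet> \<xi>)))))"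
          unfolding A_def by (rule integral_norm_bound)
        also have "\<dots> \<le> B" unfolding B_def
          by (rule Bochner_Integration.integral_mono_AE')
            (use F gauss_freq_le_1 in \<open>auto intro!: AE_I2 mult_left_le_one_le simp: norm_mult\<close>)
        finally show ?thesis .
      qed
      then show "AE y in lborel. norm (\<eta> y * A (N k) y) \<le> cmod (\<eta> y) * B" for k
        by (auto intro!: AE_I2 mult_left_mono simp: norm_mult)
      have "A (N k) \<in> borel_measurable borel" for k
      proof -
        have "A (N k) = (\<lambda>y. LINT \<xi>|lborel. (gauss_freq (N k) \<xi> * F \<xi>) * exp (2 * pi * \<i> * complex_of_real (y \<bullet> \<xi>)))"
          unfolding A_def by (simp add: mult.assoc)
        moreover have "(\<lambda>\<xi>. gauss_freq (N k) \<xi> * F \<xi>) \<in> borel_measurable borel"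
          using borel_measurable_integrable[OF integrable_gauss_freq[OF N[of k]]] Fm by simp
        ultimately show ?thesis using parametric_integral_measurable[OF _ exp_inner_measurable] by simp
      qed
      then show "(\<lambda>y. \<eta> y * A (N k) y) \<in> borel_measurable lborel" for k using \<eta>m by simp
    qed (use \<eta>i \<eta>m g'm in auto)
    have lim2: "(\<lambda>k. LINT x|lborel. g x * H (N k) x) \<longlonglongrightarrow> (LINT x|lborel. g x * \<eta> x)"
    proof (rule integral_dominated_convergence[where w="\<lambda>x. cmod (g x) * (C * (LINT w|lborel. cmod (gauss w)))"])
      have Hl: "(\<lambda>k. H (N k) x) \<longlonglongrightarrow> \<eta> x" for x
      proof -
        have "(\<lambda>k. LINT w|lborel. \<eta> (x + (1 / N k) *\<^sub>R w) * gauss w) \<longlonglongrightarrow> (LINT w|lborel. \<eta> x * gauss w)"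
        proof (rule integral_dominated_convergence[where w="\<lambda>w. C * cmod (gauss w)"])
          have l: "(\<lambda>k. \<eta> (x + (1 / N k) *\<^sub>R w)) \<longlonglongrightarrow> \<eta> x" for w
          proof -
            have "(\<lambda>k. x + (1 / N k) *\<^sub>R w) \<longlonglongrightarrow> x + 0 *\<^sub>R w"
              unfolding N_def by (intro tendsto_intros LIMSEQ_Suc[OF lim_const_over_n])
            moreover have "isCont \<eta> x" using \<eta>c by (simp add: continuous_on_eq_continuous_at)
            ultimately show ?thesis using isCont_tendsto_compose[of x \<eta>] by simp
          qed
          show "AE w in lborel. (\<lambda>k. \<eta> (x + (1 / N k) *\<^sub>R w) * gauss w) \<longlonglongrightarrow> \<eta> x * gauss w"
            using l by (auto intro!: AE_I2 tendsto_intros)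
          show "AE w in lborel. norm (\<eta> (x + (1 / N k) *\<^sub>R w) * gauss w) \<le> C * cmod (gauss w)" for k
            using C by (auto intro!: AE_I2 mult_right_mono simp: norm_mult)
          show "(\<lambda>w. \<eta> (x + (1 / N k) *\<^sub>R w) * gauss w) \<in> borel_measurable lborel" for k
          proof -
            have "(\<lambda>w. x + (1 / N k) *\<^sub>R w) \<in> borel_measurable borel" by simp
            from measurable_compose[OF this \<eta>m] gaussm show ?thesis by simp
          qed
        qed (use integrable_gauss gaussm in auto)
        then show ?thesis using H_eq[OF N] integral_gauss by simp
      qed
      then show "AE x in lborel. (\<lambda>k. g x * H (N k) x) \<longlonglongrightarrow> g x * \<eta> x"
        by (auto intro!: AE_I2 tendsto_intros)
      have HB: "cmod (H (N k) x) \<le> C * (LINT w|lborel. cmod (gauss w))" for k x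
      proof -
        have "cmod (H (N k) x) \<le> (LINT w|lborel. norm (\<eta> (x + (1 / N k) *\<^sub>R w) * gauss w))"
          unfolding H_eq[OF N] by (rule integral_norm_bound)
        also have "\<dots> \<le> (LINT w|lborel. C * cmod (gauss w))"
          by (rule Bochner_Integration.integral_mono_AE')
            (use integrable_gauss C in \<open>auto intro!: AE_I2 mult_right_mono simp: norm_mult\<close>)
        finally show ?thesis by simp
      qed
      then show "AE x in lborel. norm (g x * H (N k) x) \<le> cmod (g x) * (C * (LINT w|lborel. cmod (gauss w)))" for k
        by (auto intro!: AE_I2 mult_left_mono simp: norm_mult)
      have "(\<lambda>(x, y). (complex_of_real (n\<^sup>2) * gauss (n *\<^sub>R (y - x)))) \<in> borel_measurable (borel \<Otimes>\<^sub>M borel)" for n :: real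
      proof -
        have "(\<lambda>z. n *\<^sub>R (snd z - fst z)) \<in> borel_measurable (borel \<Otimes>\<^sub>M (borel :: (real^2) measure))" by measurable
        from measurable_compose[OF this gaussm] show ?thesis by (simp add: split_beta)
      qed
      from parametric_integral_measurable[OF \<eta>m this] show "(\<lambda>x. g x * H (N k) x) \<in> borel_measurable lborel" for k
        unfolding H_def using gm by simp
    qed (use g gm \<eta>m in auto)
    show ?thesis using lim1 unfolding swap[OF N] using lim2 by (rule LIMSEQ_unique)
  qed
  \<comment> \<open>Integrability on boxes holds as g is integrable and g' is bounded by the L^1
    norm of F.\<close>
  have "AE x in lebesgue_on UNIV. g x - g' x = 0"
  proof (rule fundamental_lemma)
    fix a b :: "real^2"
    have "integrable lborel (\<lambda>x. indicator (cbox a b) x *\<^sub>R g x)"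
      using g by (intro integrable_mult_indicator) auto
    moreover have "integrable lborel (\<lambda>x. indicator (cbox a b) x *\<^sub>R g' x)"
    proof (rule Bochner_Integration.integrable_bound)
      show "integrable lborel (\<lambda>x. B * indicator (cbox a b) x)"
        by (intro integrable_mult_right integrable_real_indicator) (auto simp: emeasure_lborel_cbox_eq)
      show "(\<lambda>x. indicator (cbox a b) x *\<^sub>R g' x) \<in> borel_measurable lborel" using g'm by simp
      show "AE x in lborel. norm (indicator (cbox a b) x *\<^sub>R g' x) \<le> norm (B * indicator (cbox a b) x)"
        using order_trans[OF g'B abs_ge_self] by (intro AE_I2) (auto simp: indicator_def)
    qed
    ultimately have "integrable lborel (\<lambda>x. indicator (cbox a b) x *\<^sub>R g x - indicator (cbox a b) x *\<^sub>R g' x)"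
      by (rule Bochner_Integration.integrable_diff)
    then have "integrable lborel (\<lambda>x. indicator (cbox a b) x *\<^sub>R (g x - g' x))"
      by (simp add: scaleR_diff_right)
    moreover have "(\<lambda>x. indicator (cbox a b) x *\<^sub>R (g x - g' x)) \<in> borel_measurable lborel"
      using gm g'm by simp
    ultimately show "integrable lebesgue (\<lambda>x. indicator (cbox a b) x *\<^sub>R (g x - g' x))"
      by (simp add: integrable_completion)
  next
    fix \<eta> assume \<eta>: "\<eta> \<in> test_functions UNIV"
    obtain C where C: "0 \<le> C" "\<And>x. cmod (\<eta> x) \<le> C" using test_function_bounded[OF \<eta>] by blast
    have \<eta>i: "integrable lborel \<eta>" by (rule test_function_integrable[OF \<eta>])
    have \<eta>m: "\<eta> \<in> borel_measurable borel" using \<eta>i by auto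
    have 1: "integrable lborel (\<lambda>x. g x * \<eta> x)"
      by (rule Bochner_Integration.integrable_bound[of _ "\<lambda>x. C * norm (g x)"])
        (use g C gm \<eta>m in \<open>auto simp: norm_mult intro!: AE_I2 mult_left_mono simp: mult.commute[of C] abs_mult\<close>)
    have 2: "integrable lborel (\<lambda>x. \<eta> x * g' x)"
      by (rule Bochner_Integration.integrable_bound[of _ "\<lambda>x. norm (\<eta> x) * B"])
        (use \<eta>i order_trans[OF g'B abs_ge_self] g'm \<eta>m in \<open>auto simp: norm_mult abs_mult intro!: AE_I2 mult_left_mono\<close>)
    have "(LINT x|lebesgue_on UNIV. (g x - g' x) * \<eta> x) = (LINT x|lborel. (g x - g' x) * \<eta> x)"
      unfolding lebesgue_on_UNIV_eq using gm g'm \<eta>m by (intro integral_completion) simp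
    also have "\<dots> = (LINT x|lborel. g x * \<eta> x - \<eta> x * g' x)" by (simp add: algebra_simps)
    also have "\<dots> = 0" using 1 2 test[OF \<eta>] by simp
    finally show "(LINT x|lebesgue_on UNIV. (g x - g' x) * \<eta> x) = 0" .
  qed auto
  then show ?thesis unfolding lebesgue_on_UNIV_eq g'_def by simp
qed

text \<open>The integrability of one transform is enough: g is replaced by its inversion integral
  and the order of integration is exchanged. In the application g is a derivative of a shearlet,
  whose transform decays fast.\<close>

theorem parseval:
  assumes u: "integrable lebesgue u" and g: "integrable lebesgue g" and F: "integrable lborel (fourier g)"
  shows "(LINT x|lebesgue. u x * cnj (g x)) = (LINT \<xi>|lborel. fourier u \<xi> * cnj (fourier g \<xi>))"
proof -
  obtain u0 where u0: "u0 \<in> borel_measurable borel" "AE x in lebesgue. u x = u0 x"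
    by (rule ex_borel_version[of u]) (use u in auto)
  obtain g0 where g0: "g0 \<in> borel_measurable borel" "AE x in lebesgue. g x = g0 x"
    by (rule ex_borel_version[of g]) (use g in auto)
  have u0i: "integrable lborel u0" by (rule integrable_lebesgue_borel_version[OF u u0])
  have g0i: "integrable lborel g0" by (rule integrable_lebesgue_borel_version[OF g g0])
  have um: "u \<in> borel_measurable lebesgue" and gm: "g \<in> borel_measurable lebesgue" using u g by auto
  have u0m: "u0 \<in> borel_measurable lebesgue" using u0(1) by (simp add: measurable_completion)
  have g0m: "g0 \<in> borel_measurable lebesgue" using g0(1) by (simp add: measurable_completion)
  have fu: "fourier u = fourier u0" by (rule fourier_AE_cong[OF u0(2) um u0m])
  have fg: "fourier g = fourier g0" by (rule fourier_AE_cong[OF g0(2) gm g0m])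
  define g' where "g' = (\<lambda>x. LINT \<xi>|lborel. fourier g \<xi> * exp (2 * pi * \<i> * complex_of_real (x \<bullet> \<xi>)))"
  have inv: "AE x in lebesgue. g0 x = g' x"
    unfolding g'_def
    by (rule fourier_inversion_lborel[OF g0i F]) (simp add: fg fourier_eq_lborel[OF g0(1)])
  have g'm: "g' \<in> borel_measurable borel"
    unfolding g'_def using F by (intro parametric_integral_measurable exp_inner_measurable) auto
  have "(LINT x|lebesgue. u x * cnj (g x)) = (LINT x|lebesgue. u0 x * cnj (g' x))"
  proof (rule integral_cong_AE)
    show "AE x in lebesgue. u x * cnj (g x) = u0 x * cnj (g' x)"
      using u0(2) g0(2) inv by eventually_elim simp
    show "(\<lambda>x. u x * cnj (g x)) \<in> borel_measurable lebesgue"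
      using um gm by (intro borel_measurable_times borel_measurable_cnj)
    show "(\<lambda>x. u0 x * cnj (g' x)) \<in> borel_measurable lebesgue"
      using u0(1) g'm by (intro borel_measurable_times borel_measurable_cnj measurable_completion) simp_all
  qed
  also have "\<dots> = (LINT x|lborel. u0 x * cnj (g' x))"
    using borel_measurable_cnj[OF g'm] u0(1) by (intro integral_completion) simp
  also have "\<dots> = (LINT x|lborel. u0 x * (LINT \<xi>|lborel. cnj (fourier g \<xi>) * exp (- (2 * pi * \<i>) * complex_of_real (x \<bullet> \<xi>))))"
  proof -
    have "cnj (g' x) = (LINT \<xi>|lborel. cnj (fourier g \<xi>) * exp (- (2 * pi * \<i>) * complex_of_real (x \<bullet> \<xi>)))" for x
      unfolding g'_def by (subst Bochner_Integration.integral_cnj[symmetric]) (simp add: exp_cnj)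
    then show ?thesis by simp
  qed
  also have "\<dots> = (LINT \<xi>|lborel. cnj (fourier g \<xi>) * (LINT x|lborel. u0 x * exp (- (2 * pi * \<i>) * complex_of_real (x \<bullet> \<xi>))))"
  proof (rule Fubini_kernel[OF u0i _ exp_inner_measurable])
    show "integrable lborel (\<lambda>\<xi>. cnj (fourier g \<xi>))" using F by simp
    show "cmod (exp (- (2 * pi * \<i>) * complex_of_real (x \<bullet> y))) \<le> 1" for x y :: "real^2" by simp
  qed
  also have "\<dots> = (LINT \<xi>|lborel. fourier u \<xi> * cnj (fourier g \<xi>))"
    unfolding fu fourier_eq_lborel[OF u0(1)] by (simp add: mult.commute)
  finally show ?thesis .
qed

section \<open>Fourier transforms of weak derivatives and of affine images\<close>

lemma L2_integrable_bounded_support: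
  assumes "f \<in> L2 UNIV" "AE x in lebesgue. x \<notin> ball 0 r \<longrightarrow> f x = 0"
  shows "integrable lebesgue f"
proof -
  have i: "integrable lebesgue (\<lambda>x. indicator (ball 0 r) x *\<^sub>R f x)"
    by (rule L2_integrable_bounded[OF assms(1)]) auto
  show ?thesis
  proof (rule integrable_cong_AE_imp[OF i])
    show "f \<in> borel_measurable lebesgue" using assms(1) by (simp add: L2_iff)
    show "AE x in lebesgue. indicator (ball 0 r) x *\<^sub>R f x = f x"
      using assms(2) by eventually_elim (auto simp: indicator_def)
  qed
qed

lemma ess_supp_in_ball:
  assumes "bounded (ess_supp u)"
  obtains r where "r > 0" "ess_supp u \<subseteq> ball 0 r"
  using bounded_subset_ballD[OF assms, of 0] by blast

lemma integrable_bounded_ess_supp: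
  assumes "f \<in> L2 UNIV" "bounded (ess_supp f)"
  shows "integrable lebesgue f"
proof -
  obtain r where r: "ess_supp f \<subseteq> ball 0 r" using ess_supp_in_ball[OF assms(2)] by blast
  show ?thesis
    by (rule L2_integrable_bounded_support[OF assms(1), of r])
      (use AE_zero_outside_ess_supp[of f] in eventually_elim, use r in auto)
qed

lemma weak_deriv_UNIV_integrable:
  assumes "u \<in> Hs s UNIV" "bounded (ess_supp u)" "fst a + snd a \<le> s"
  shows "integrable lebesgue (weak_deriv UNIV a u)"
proof -
  obtain r where r: "ess_supp u \<subseteq> ball 0 r" using ess_supp_in_ball[OF assms(2)] by blast
  show ?thesis
  proof (rule L2_integrable_bounded_support[of _ r])
    show "weak_deriv UNIV a u \<in> L2 UNIV" by (rule Hs_weak_deriv_L2[OF assms(1,3)])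
    show "AE x in lebesgue. x \<notin> ball 0 r \<longrightarrow> weak_deriv UNIV a u x = 0"
      using weak_deriv_vanishes[OF open_UNIV assms(1,3)] unfolding lebesgue_on_UNIV_eq zero_ext_UNIV
      by eventually_elim (use r in auto)
  qed
qed

text \<open>The exponential is smooth but not compactly supported. Multiplied by a cutoff that is 1
  on a ball around the support of u, it becomes a test function, and the definition of the weak
  derivative performs the integration by parts.\<close>

lemma fourier_weak_deriv:
  assumes u: "u \<in> Hs s UNIV" "bounded (ess_supp u)" and a: "fst a + snd a \<le> s"
  shows "fourier (weak_deriv UNIV a u) \<xi> =
    (2 * pi * \<i> * complex_of_real (\<xi> $ 1)) ^ fst a * (2 * pi * \<i> * complex_of_real (\<xi> $ 2)) ^ snd a * fourier u \<xi>"
proof -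
  obtain r where r: "r > 0" "ess_supp u \<subseteq> ball 0 r" using ess_supp_in_ball[OF u(2)] by blast
  obtain \<kappa> where \<kappa>: "\<kappa> \<in> test_functions UNIV" "\<And>x. x \<in> ball 0 r \<Longrightarrow> \<kappa> x = 1"
    using radial_cutoff[of r "r + 1" "0 :: real^2" UNIV] r(1) by auto
  define c where "c = - (2 * pi * \<i>)"
  define e where "e = (\<lambda>x. exp (c * complex_of_real (x \<bullet> \<xi>)))"
  define \<eta> where "\<eta> = (\<lambda>x. \<kappa> x * e x)"
  define b where "b = (c * complex_of_real (\<xi> $ 1)) ^ fst a * (c * complex_of_real (\<xi> $ 2)) ^ snd a"
  define g where "g = weak_deriv UNIV a u"
  have e_eq: "e x = exp (- (2 * pi * \<i> * complex_of_real (x \<bullet> \<xi>)))" for x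
    unfolding e_def c_def by simp
  have em: "e \<in> borel_measurable lebesgue"
    unfolding e_def by (intro continuous_imp_lebesgue_measurable continuous_intros)
  have \<eta>: "\<eta> \<in> test_functions UNIV"
    unfolding \<eta>_def e_def by (rule test_functions_mult[OF \<kappa>(1) smooth_exp_inner])
  have D: "D_classical a \<eta> x = b * e x" if "x \<in> ball 0 r" for x
  proof -
    have "D_classical a \<eta> x = D_classical a e x"
      by (rule D_classical_local[OF open_ball _ that]) (simp add: \<eta>_def \<kappa>(2))
    then show ?thesis unfolding e_def D_classical_exp_inner b_def by simp
  qed
  have u0: "AE x in lebesgue. x \<notin> ball 0 r \<longrightarrow> u x = 0"
    using AE_zero_outside_ess_supp[of u] by eventually_elim (use r in auto)
  have g0: "AE x in lebesgue. x \<notin> ball 0 r \<longrightarrow> g x = 0"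
    using weak_deriv_vanishes[OF open_UNIV u(1) a] unfolding lebesgue_on_UNIV_eq zero_ext_UNIV g_def
    by eventually_elim (use r in auto)
  have um: "u \<in> borel_measurable lebesgue" using Hs_L2[OF u(1)] by (simp add: L2_iff)
  have gm: "g \<in> borel_measurable lebesgue"
    using Hs_weak_deriv_L2[OF u(1) a] by (simp add: L2_iff g_def)
  have wd: "(LINT x|lebesgue_on UNIV. u x * D_classical a \<eta> x) = (-1) ^ (fst a + snd a) * (LINT x|lebesgue_on UNIV. g x * \<eta> x)"
    using Hs_weak_deriv[OF u(1) a] \<eta> unfolding is_weak_deriv_def g_def by blast
  have "(LINT x|lebesgue_on UNIV. u x * D_classical a \<eta> x) = (LINT x|lebesgue. b * (u x * e x))"
    unfolding lebesgue_on_UNIV_eq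
  proof (rule integral_cong_AE)
    show "AE x in lebesgue. u x * D_classical a \<eta> x = b * (u x * e x)"
      using u0 by eventually_elim (use D in \<open>auto simp: mult_ac\<close>)
    show "(\<lambda>x. u x * D_classical a \<eta> x) \<in> borel_measurable lebesgue"
      using test_function_L2(1)[OF \<eta>, of UNIV a] um by (intro borel_measurable_times) (simp_all add: L2_iff)
    show "(\<lambda>x. b * (u x * e x)) \<in> borel_measurable lebesgue"
      by (intro borel_measurable_times borel_measurable_const um em)
  qed
  then have 1: "(LINT x|lebesgue_on UNIV. u x * D_classical a \<eta> x) = b * fourier u \<xi>"
    unfolding fourier_def e_eq by simp
  have "(LINT x|lebesgue_on UNIV. g x * \<eta> x) = (LINT x|lebesgue. g x * e x)"
    unfolding lebesgue_on_UNIV_eq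
  proof (rule integral_cong_AE)
    show "AE x in lebesgue. g x * \<eta> x = g x * e x"
      using g0 by eventually_elim (use \<kappa>(2) in \<open>auto simp: \<eta>_def\<close>)
    show "(\<lambda>x. g x * \<eta> x) \<in> borel_measurable lebesgue"
      using test_function_L2(2)[OF \<eta>, of UNIV] gm by (intro borel_measurable_times) (simp_all add: L2_iff)
    show "(\<lambda>x. g x * e x) \<in> borel_measurable lebesgue"
      by (intro borel_measurable_times gm em)
  qed
  then have 2: "(LINT x|lebesgue_on UNIV. g x * \<eta> x) = fourier g \<xi>"
    unfolding fourier_def e_eq .
  have "fourier g \<xi> = (-1) ^ (fst a + snd a) * ((-1) ^ (fst a + snd a) * fourier g \<xi>)"
    by (simp flip: mult.assoc power_add)
  also have "\<dots> = (-1) ^ (fst a + snd a) * (b * fourier u \<xi>)"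
    using wd unfolding 1 2 by simp
  also have "\<dots> = ((-1) ^ (fst a + snd a) * b) * fourier u \<xi>" by (simp add: mult.assoc)
  \<comment> \<open>The sign from the definition of weak derivatives cancels the one in c = -2 pi
    i.\<close>
  also have "(-1) ^ (fst a + snd a) * b =
      (2 * pi * \<i> * complex_of_real (\<xi> $ 1)) ^ fst a * (2 * pi * \<i> * complex_of_real (\<xi> $ 2)) ^ snd a"
  proof -
    have *: "(c * z) ^ n = (-1) ^ n * (2 * pi * \<i> * z) ^ n" for z n
      unfolding c_def by (simp flip: power_mult_distrib)
    have "(-1) ^ (fst a + snd a) * b = ((-1) ^ fst a * (-1) ^ fst a) * ((-1) ^ snd a * (-1) ^ snd a) *
        ((2 * pi * \<i> * complex_of_real (\<xi> $ 1)) ^ fst a * (2 * pi * \<i> * complex_of_real (\<xi> $ 2)) ^ snd a)"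
      unfolding b_def * power_add by (simp only: mult_ac)
    then show ?thesis by (simp flip: power_mult_distrib)
  qed
  finally show ?thesis unfolding g_def .
qed

section \<open>Linear changes of variables\<close>

lemma inner_matrix_transpose: "((B::real^2^2) *v x) \<bullet> y = x \<bullet> (transpose B *v y)"
  by (simp add: inner_vec2 matrix_vector_mult_def sum_2 transpose_def algebra_simps)

lemma matrix_inverse_exists:
  assumes "det (B::real^2^2) \<noteq> 0"
  shows "\<exists>B'. (\<forall>x. B *v (B' *v x) = x) \<and> (\<forall>x. B' *v (B *v x) = x) \<and> det B' * det B = 1"
proof -
  obtain B' where B': "B ** B' = mat 1" "B' ** B = mat 1"
    using assms invertible_det_nz[of B] unfolding invertible_def by blast
  have "det B' * det B = 1" using B'(2) by (metis det_I det_mul)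
  with B' show ?thesis by (intro exI[of _ B']) (simp add: matrix_vector_mul_assoc)
qed

text \<open>Checked on boxes: the preimage of a box under B is its image under the inverse, whose
  volume carries the inverse determinant.\<close>

lemma lborel_matrix:
  assumes B: "det (B::real^2^2) \<noteq> 0"
  shows "lborel = density (distr lborel borel ((*v) B)) (\<lambda>_. ennreal \<bar>det B\<bar>)" (is "_ = ?M")
proof (rule lborel_eqI)
  obtain B' where B': "\<And>x. B *v (B' *v x) = x" "\<And>x. B' *v (B *v x) = x" "det B' * det B = 1"
    using matrix_inverse_exists[OF B] by blast
  have m: "(*v) B \<in> borel_measurable borel"
    by (intro borel_measurable_continuous_onI linear_continuous_on matrix_vector_mul_bounded_linear)
  fix l u :: "real^2" assume "\<And>b. b \<in> Basis \<Longrightarrow> l \<bullet> b \<le> u \<bullet> b"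
  then have lu: "emeasure lborel (box l u) = (\<Prod>b\<in>Basis. (u - l) \<bullet> b)"
    by (simp add: emeasure_lborel_box)
  have pre: "(*v) B -` box l u = (*v) B' ` box l u"
    using B'(1,2) by (auto simp: image_iff) metis
  have lm: "(*v) B' ` box l u \<in> lmeasurable"
    by (rule measurable_linear_image) auto
  have ms: "measure lebesgue ((*v) B' ` box l u) = \<bar>det B'\<bar> * measure lebesgue (box l u)"
    using measure_linear_image[of "(*v) B'" "box l u"] by simp
  have bs: "(*v) B -` box l u \<in> sets borel"
    using measurable_sets[OF m, of "box l u"] by simp
  have "emeasure ?M (box l u) = (\<integral>\<^sup>+x. ennreal \<bar>det B\<bar> * indicator (box l u) x \<partial>distr lborel borel ((*v) B))"
    by (subst emeasure_density) auto
  also have "\<dots> = ennreal \<bar>det B\<bar> * emeasure (distr lborel borel ((*v) B)) (box l u)"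
    by (rule nn_integral_cmult_indicator) simp
  also have "\<dots> = ennreal \<bar>det B\<bar> * emeasure lborel ((*v) B -` box l u)"
    using m by (subst emeasure_distr) auto
  also have "emeasure lborel ((*v) B -` box l u) = emeasure lebesgue ((*v) B' ` box l u)"
    using bs by (simp add: pre)
  also have "\<dots> = ennreal (\<bar>det B'\<bar> * measure lebesgue (box l u))"
    unfolding ms[symmetric] by (rule emeasure_eq_measure2[OF lm])
  also have "ennreal \<bar>det B\<bar> * \<dots> = ennreal ((\<bar>det B\<bar> * \<bar>det B'\<bar>) * measure lebesgue (box l u))"
    by (simp add: ennreal_mult' mult.assoc)
  also have "\<bar>det B\<bar> * \<bar>det B'\<bar> = 1" using B'(3) by (simp flip: abs_mult add: mult.commute)
  also have "ennreal (1 * measure lebesgue (box l u)) = emeasure lborel (box l u)"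
    using emeasure_eq_measure2[OF lmeasurable_box[of l u]] by simp
  finally show "emeasure ?M (box l u) = (\<Prod>b\<in>Basis. (u - l) \<bullet> b)" using lu by simp
qed simp

lemma lborel_matrix_integral:
  fixes f :: "real^2 \<Rightarrow> 'b::{banach, second_countable_topology}"
  assumes B: "det (B::real^2^2) \<noteq> 0" and f: "f \<in> borel_measurable borel"
  shows "(LINT x|lborel. f x) = \<bar>det B\<bar> *\<^sub>R (LINT x|lborel. f (B *v x))"
    and "integrable lborel f \<longleftrightarrow> integrable lborel (\<lambda>x. f (B *v x))"
proof -
  have m: "(*v) B \<in> measurable lborel borel"
    by (simp, intro borel_measurable_continuous_onI linear_continuous_on matrix_vector_mul_bounded_linear)
  have "(LINT x|lborel. f x) = (LINT x|density (distr lborel borel ((*v) B)) (\<lambda>_. ennreal \<bar>det B\<bar>). f x)"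
    using lborel_matrix[OF B] by simp
  also have "\<dots> = (LINT x|distr lborel borel ((*v) B). \<bar>det B\<bar> *\<^sub>R f x)"
    using f by (subst integral_density) auto
  also have "\<dots> = \<bar>det B\<bar> *\<^sub>R (LINT x|lborel. f (B *v x))"
    using f by (subst integral_distr[OF m]) auto
  finally show "(LINT x|lborel. f x) = \<bar>det B\<bar> *\<^sub>R (LINT x|lborel. f (B *v x))" .
  have "integrable lborel f \<longleftrightarrow> integrable (density (distr lborel borel ((*v) B)) (\<lambda>_. ennreal \<bar>det B\<bar>)) f"
    using lborel_matrix[OF B] by simp
  also have "\<dots> \<longleftrightarrow> integrable (distr lborel borel ((*v) B)) (\<lambda>x. \<bar>det B\<bar> *\<^sub>R f x)"
    using f by (subst integrable_density) auto
  also have "\<dots> \<longleftrightarrow> integrable lborel (\<lambda>x. \<bar>det B\<bar> *\<^sub>R f (B *v x))"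
    using f by (subst integrable_distr_eq[OF m]) auto
  also have "\<dots> \<longleftrightarrow> integrable lborel (\<lambda>x. f (B *v x))"
  proof
    assume "integrable lborel (\<lambda>x. \<bar>det B\<bar> *\<^sub>R f (B *v x))"
    then have "integrable lborel (\<lambda>x. (1 / \<bar>det B\<bar>) *\<^sub>R \<bar>det B\<bar> *\<^sub>R f (B *v x))"
      by (rule integrable_scaleR_right)
    then show "integrable lborel (\<lambda>x. f (B *v x))" using B by simp
  qed (rule integrable_scaleR_right)
  finally show "integrable lborel f \<longleftrightarrow> integrable lborel (\<lambda>x. f (B *v x))" .
qed

lemma AE_matrix:
  assumes B: "det (B::real^2^2) \<noteq> 0" and "AE x in lebesgue. P x"
  shows "AE x in lebesgue. P (B *v x)"
proof -
  obtain B' where B': "\<And>x. B *v (B' *v x) = x" "\<And>x. B' *v (B *v x) = x"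
    using matrix_inverse_exists[OF B] by blast
  obtain N where N: "N \<in> null_sets lebesgue" "{x. \<not> P x} \<subseteq> N"
    using assms(2) unfolding eventually_ae_filter by auto
  from N(1) have "negligible ((*v) B' ` N)"
    unfolding negligible_iff_null_sets[symmetric] 
    by (intro negligible_differentiable_image_negligible linear_imp_differentiable_on) auto
  moreover have "{x. \<not> P (B *v x)} \<subseteq> (*v) B' ` N"
  proof
    fix x assume "x \<in> {x. \<not> P (B *v x)}"
    with N(2) have "B *v x \<in> N" by blast
    then show "x \<in> (*v) B' ` N" using B'(2) by (metis imageI)
  qed
  ultimately show ?thesis
    unfolding eventually_ae_filter by (auto simp: negligible_iff_null_sets)
qed

text \<open>The translation contributes a phase, which the modulus removes. Evaluating at B^T \<eta>
  and leaving the determinant on the left avoids inverse matrices and is the form that a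
  substitution \<xi> = B^T \<eta> consumes.\<close>

lemma fourier_affine:
  assumes B: "det (B::real^2^2) \<noteq> 0" and g: "integrable lebesgue g"
    and h: "\<And>x. h x = k * g (B *v x - v)"
  shows "\<bar>det B\<bar> * cmod (fourier h (transpose B *v \<eta>)) = cmod k * cmod (fourier g \<eta>)"
proof -
  obtain g0 where g0: "g0 \<in> borel_measurable borel" "AE x in lebesgue. g x = g0 x"
    by (rule ex_borel_version[of g]) (use g in auto)
  have Bm: "(\<lambda>x. B *v x - v) \<in> borel_measurable borel"
    by (intro borel_measurable_continuous_onI continuous_intros linear_continuous_on matrix_vector_mul_bounded_linear)
  define h0 where "h0 = (\<lambda>x. g0 (B *v x - v))"
  have h0m: "h0 \<in> borel_measurable borel"
    unfolding h0_def by (rule measurable_compose[OF Bm g0(1)])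
  have ae: "AE x in lebesgue. h x = k * h0 x"
    using AE_matrix[OF B AE_translate[OF g0(2), of v]] by eventually_elim (simp add: h h0_def)
  have leb: "f \<in> borel_measurable lebesgue" if "f \<in> borel_measurable borel" for f :: cfun
    using that by (simp add: measurable_completion)
  have kh0: "(\<lambda>x. k * h0 x) \<in> borel_measurable borel" using h0m by simp
  have hm: "h \<in> borel_measurable lebesgue"
    by (rule borel_measurable_AE[OF leb[OF kh0]]) (use ae in \<open>auto elim: eventually_mono\<close>)
  have fh: "fourier h = fourier (\<lambda>x. k * h0 x)"
    by (rule fourier_AE_cong[OF ae hm leb[OF kh0]])
  have fg: "fourier g = fourier g0"
    using g by (intro fourier_AE_cong[OF g0(2) _ leb[OF g0(1)]]) auto
  let ?e = "\<lambda>x \<xi>. exp (- (2 * pi * \<i> * complex_of_real (x \<bullet> \<xi>)))"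
  have em: "(\<lambda>x. ?e x \<xi>) \<in> borel_measurable borel" for \<xi> :: "real^2"
    by (intro borel_measurable_continuous_onI continuous_intros)
  have "fourier g \<eta> = (LINT x|lborel. g0 x * ?e x \<eta>)" unfolding fg by (rule fourier_eq_lborel[OF g0(1)])
  also have "\<dots> = (LINT x|lborel. g0 (- v + 1 *\<^sub>R x) * ?e (- v + 1 *\<^sub>R x) \<eta>)"
    using g0(1) em by (subst lborel_integral_affine[of 1 _ "- v"]) auto
  also have "\<dots> = (LINT x|lborel. g0 (x - v) * ?e (x - v) \<eta>)" by simp
  also have "\<dots> = \<bar>det B\<bar> *\<^sub>R (LINT x|lborel. g0 (B *v x - v) * ?e (B *v x - v) \<eta>)"
  proof (rule lborel_matrix_integral(1)[OF B])
    have "(\<lambda>x. x - v) \<in> borel_measurable borel" by simp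
    from measurable_compose[OF this g0(1)] measurable_compose[OF this em[of \<eta>]]
    show "(\<lambda>x. g0 (x - v) * ?e (x - v) \<eta>) \<in> borel_measurable borel" by simp
  qed
  also have "(LINT x|lborel. g0 (B *v x - v) * ?e (B *v x - v) \<eta>) =
      (LINT x|lborel. exp (2 * pi * \<i> * complex_of_real (v \<bullet> \<eta>)) * (h0 x * ?e x (transpose B *v \<eta>)))"
  proof (rule Bochner_Integration.integral_cong[OF refl])
    fix x
    have "?e (B *v x - v) \<eta> = exp (2 * pi * \<i> * complex_of_real (v \<bullet> \<eta>)) * ?e x (transpose B *v \<eta>)"
      unfolding exp_add[symmetric] inner_diff_left inner_matrix_transpose by (simp add: algebra_simps)
    then show "g0 (B *v x - v) * ?e (B *v x - v) \<eta> =
        exp (2 * pi * \<i> * complex_of_real (v \<bullet> \<eta>)) * (h0 x * ?e x (transpose B *v \<eta>))"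
      unfolding h0_def by (simp only: mult_ac)
  qed
  also have "\<dots> = exp (2 * pi * \<i> * complex_of_real (v \<bullet> \<eta>)) * fourier h0 (transpose B *v \<eta>)"
    unfolding fourier_eq_lborel[OF h0m] by simp
  finally have "cmod (fourier g \<eta>) = \<bar>det B\<bar> * cmod (fourier h0 (transpose B *v \<eta>))"
    by (simp add: norm_mult)
  moreover have "fourier (\<lambda>x. k * h0 x) \<xi> = k * fourier h0 \<xi>" for \<xi>
    unfolding fourier_def by (simp add: mult.assoc)
  ultimately show ?thesis unfolding fh by (simp add: norm_mult)
qed

section \<open>Inner products of dual wavelets and shearlets\<close>

text \<open>Its \<beta>-th power is the denominator in the decay condition for the generators. It
  dominates 1 and each coordinate, so that a single power of it measures everything, and its power
  -2 is integrable over the plane.\<close>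

definition decay_weight :: "real^2 \<Rightarrow> real" where
  "decay_weight \<eta> = max 1 \<bar>\<eta> $ 1\<bar> * max 1 \<bar>\<eta> $ 2\<bar>"

lemma decay_weight_ge: "1 \<le> decay_weight \<eta>" "\<bar>\<eta> $ i\<bar> \<le> decay_weight \<eta>"
proof -
  have *: "1 \<le> a * b" "a \<le> a * b" "b \<le> a * b" if "1 \<le> a" "1 \<le> b" for a b :: real
    using that mult_mono[of 1 a 1 b] mult_left_mono[of 1 b a] mult_right_mono[of 1 a b] by auto
  show "1 \<le> decay_weight \<eta>" unfolding decay_weight_def by (rule *) auto
  have "\<bar>\<eta> $ 1\<bar> \<le> decay_weight \<eta>" "\<bar>\<eta> $ 2\<bar> \<le> decay_weight \<eta>"
    unfolding decay_weight_def using *(2,3)[of "max 1 \<bar>\<eta> $ 1\<bar>" "max 1 \<bar>\<eta> $ 2\<bar>"] by linarith+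
  then show "\<bar>\<eta> $ i\<bar> \<le> decay_weight \<eta>" using exhaust_2[of i] by auto
qed

text \<open>The weight is a product of one-variable factors, and max(1,|t|)^(-2) \<le> 2 / (1 +
  t^2).\<close>

lemma decay_weight_integrable: "integrable lborel (\<lambda>\<eta>. (decay_weight \<eta>) powr (-2))"
proof -
  have 1: "integrable lborel (\<lambda>t::real. (max 1 \<bar>t\<bar>) powr (-2))"
  proof (rule Bochner_Integration.integrable_bound)
    show "integrable lborel (\<lambda>t::real. 2 * inverse (1 + t\<^sup>2))"
      using integrable_inverse_1_plus_square unfolding set_integrable_def by simp
    have "(max 1 \<bar>t\<bar>) powr (-2) \<le> 2 * inverse (1 + t\<^sup>2)" for t :: real
    proof -
      have m: "(1::real) \<le> max 1 \<bar>t\<bar>" by simp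
      have "1 + t\<^sup>2 \<le> 2 * (max 1 \<bar>t\<bar>)\<^sup>2"
        using one_le_power[OF m, of 2] power_mono[of "\<bar>t\<bar>" "max 1 \<bar>t\<bar>" 2]
        unfolding power2_abs by linarith
      then have "inverse ((max 1 \<bar>t\<bar>)\<^sup>2) \<le> 2 * inverse (1 + t\<^sup>2)"
        using m by (simp add: field_simps add_pos_nonneg)
      moreover have "(max 1 \<bar>t\<bar>) powr (-2) = inverse ((max 1 \<bar>t\<bar>)\<^sup>2)"
        using m by (simp add: powr_minus powr_numeral del: max_less_iff_conj)
      ultimately show ?thesis by simp
    qed
    then show "AE t::real in lborel. norm ((max 1 \<bar>t\<bar>) powr (-2)) \<le> norm (2 * inverse (1 + t\<^sup>2))"
      by (auto intro!: AE_I2 intro: order_trans[OF _ abs_ge_self])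
  qed simp
  from product_lborel_vec2(1)[OF integrable_of_real[OF 1] integrable_of_real[OF 1]]
  have "integrable lborel (\<lambda>x::real^2. complex_of_real ((max 1 \<bar>x $ 1\<bar>) powr (-2)) * complex_of_real ((max 1 \<bar>x $ 2\<bar>) powr (-2)))" .
  then have "integrable lborel (\<lambda>x::real^2. Re (complex_of_real ((max 1 \<bar>x $ 1\<bar>) powr (-2)) * complex_of_real ((max 1 \<bar>x $ 2\<bar>) powr (-2))))"
    by (rule integrable_Re)
  moreover have "Re (complex_of_real ((max 1 \<bar>x $ 1\<bar>) powr (-2)) * complex_of_real ((max 1 \<bar>x $ 2\<bar>) powr (-2))) =
     (decay_weight x) powr (-2)" for x
    unfolding decay_weight_def by (simp add: powr_mult)
  ultimately show ?thesis by simp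
qed

lemma fourier_measurable:
  assumes "integrable lebesgue u"
  shows "fourier u \<in> borel_measurable borel"
proof -
  obtain u0 where u0: "u0 \<in> borel_measurable borel" "AE x in lebesgue. u x = u0 x"
    by (rule ex_borel_version[of u]) (use assms in auto)
  have "fourier u = fourier u0"
    using assms u0(1) by (intro fourier_AE_cong[OF u0(2)]) (auto simp: measurable_completion)
  also have "fourier u0 = (\<lambda>\<xi>. LINT x|lborel. u0 x * exp ((- (2 * pi * \<i>)) * complex_of_real (\<xi> \<bullet> x)))"
    unfolding fourier_eq_lborel[OF u0(1)] by (simp add: inner_commute)
  also have "\<dots> \<in> borel_measurable borel"
    by (rule parametric_integral_measurable[OF u0(1) exp_inner_measurable])
  finally show ?thesis .
qed

text \<open>The powers of 2 pi appear doubled because both arguments of the inner product are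
  differentiated.\<close>

definition sobolev_const :: "nat \<Rightarrow> real" where
  "sobolev_const s = (\<Sum>a | fst a + snd a \<le> s. (2 * pi) ^ (2 * (fst a + snd a))) *
     (LINT \<eta>|lborel. (decay_weight \<eta>) powr (-2))"

text \<open>Parseval, followed by \<xi> = B^T \<eta>; the determinant of this substitution cancels
  the one in \<open>fourier_affine\<close>. With N = \<open>decay_weight\<close>, the derivatives
  cost (L N)^(2s) up to powers of 2 pi, the vanishing of the transform of u at \<xi>_i = 0 costs
  (\<delta> L N)^\<alpha>, and g pays N^(-\<beta>). The assumption on \<beta> leaves N^(-2).
  Smallness comes from \<delta> L, the ratio of the scales of p and u.\<close>

lemma Hs_inner_fourier_bound:
  assumes u: "u \<in> Hs s UNIV" "bounded (ess_supp u)" and p: "p \<in> Hs s UNIV" "bounded (ess_supp p)"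
    and B: "det (B::real^2^2) \<noteq> 0" and g: "integrable lebesgue g"
    and pg: "\<And>x. p x = complex_of_real k * g (B *v x - v)" and k: "0 \<le> k"
    and gd: "\<And>\<eta>. cmod (fourier g \<eta>) \<le> C1 * (decay_weight \<eta>) powr (- \<beta>)" and C1: "0 \<le> C1"
    and ud: "\<And>\<xi>. cmod (fourier u \<xi>) \<le> C2 * \<bar>\<delta> * \<xi> $ i\<bar> powr \<alpha>" and C2: "0 \<le> C2"
    and L: "\<And>\<eta> i. \<bar>(transpose B *v \<eta>) $ i\<bar> \<le> L * decay_weight \<eta>" and L1: "1 \<le> L"
    and \<delta>: "0 \<le> \<delta>" and \<alpha>: "0 \<le> \<alpha>" and \<beta>: "2 + 2 * real s + \<alpha> \<le> \<beta>"
  shows "cmod (Hs_inner s UNIV u p) \<le> sobolev_const s * (k * C1 * C2 * (\<delta> * L) powr \<alpha> * L ^ (2 * s))"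
proof -
  let ?N = decay_weight
  define I where "I = (LINT \<eta>|lborel. (?N \<eta>) powr (-2))"
  define K where "K = k * C1 * C2 * (\<delta> * L) powr \<alpha> * L ^ (2 * s)"
  have K0: "0 \<le> K" unfolding K_def using k C1 C2 L1 by simp
  have N1: "1 \<le> ?N \<eta>" for \<eta> by (rule decay_weight_ge)
  have T: "det (transpose B) \<noteq> 0" using B by simp
  have up: "integrable lebesgue u" "integrable lebesgue p"
    using u p by (auto intro: integrable_bounded_ess_supp Hs_L2)
  have fp: "\<bar>det B\<bar> * cmod (fourier p (transpose B *v \<eta>)) \<le> k * C1 * (?N \<eta>) powr (- \<beta>)" for \<eta>
    using fourier_affine[OF B g pg] gd[of \<eta>] k by (simp add: mult_left_mono mult.assoc)
  \<comment> \<open>Used with m = s for one differentiated factor, and with m = 2s for the product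
    of the two.\<close>
  have poly: "(2 * pi) ^ n * \<bar>\<xi> $ 1\<bar> ^ n1 * \<bar>\<xi> $ 2\<bar> ^ n2 \<le> (2 * pi) ^ n * (L ^ m * (?N \<eta>) ^ m)"
    if "\<xi> = transpose B *v \<eta>" "n1 + n2 \<le> m" for \<xi> \<eta> n n1 n2 m
  proof -
    have LN: "1 \<le> L * ?N \<eta>" using L1 N1[of \<eta>] mult_mono[of 1 L 1 "?N \<eta>"] by simp
    have "\<bar>\<xi> $ 1\<bar> ^ n1 * \<bar>\<xi> $ 2\<bar> ^ n2 \<le> (L * ?N \<eta>) ^ n1 * (L * ?N \<eta>) ^ n2"
      using L[of \<eta>] that(1) LN by (intro mult_mono power_mono) auto
    also have "\<dots> = (L * ?N \<eta>) ^ (n1 + n2)" by (simp add: power_add)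
    also have "\<dots> \<le> (L * ?N \<eta>) ^ m" using LN that(2) by (rule power_increasing[rotated])
    finally show ?thesis by (simp add: power_mult_distrib mult.assoc)
  qed
  have each: "cmod (L2_inner UNIV (weak_deriv UNIV a u) (weak_deriv UNIV a p)) \<le> (2 * pi) ^ (2 * (fst a + snd a)) * I * K"
    if a: "fst a + snd a \<le> s" for a
  proof -
    let ?Du = "weak_deriv UNIV a u" and ?Dp = "weak_deriv UNIV a p"
    let ?n = "fst a + snd a"
    have int: "integrable lebesgue ?Du" "integrable lebesgue ?Dp"
      using u p a by (auto intro: weak_deriv_UNIV_integrable)
    have nf: "cmod (fourier (weak_deriv UNIV a f) \<xi>) = (2 * pi) ^ ?n * \<bar>\<xi> $ 1\<bar> ^ fst a * \<bar>\<xi> $ 2\<bar> ^ snd a * cmod (fourier f \<xi>)"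
      if "f \<in> Hs s UNIV" "bounded (ess_supp f)" for f \<xi>
      unfolding fourier_weak_deriv[OF that a] norm_mult norm_power
      by (simp add: power_mult_distrib power_add)
    have m: "fourier ?Dp \<in> borel_measurable borel" "fourier ?Du \<in> borel_measurable borel"
      by (rule fourier_measurable[OF int(2)], rule fourier_measurable[OF int(1)])
    \<comment> \<open>The hypothesis of \<open>parseval\<close>: one differentiated factor costs
      N^s, and s - \<beta> \<le> -2.\<close>
    have F: "integrable lborel (fourier ?Dp)"
      unfolding lborel_matrix_integral(2)[OF T m(1)]
    proof (rule Bochner_Integration.integrable_bound)
      define M where "M = (2 * pi) ^ ?n * L ^ s * k * C1 / \<bar>det B\<bar>"
      show "integrable lborel (\<lambda>\<eta>. M * (?N \<eta>) powr (-2))"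
        by (intro integrable_mult_right decay_weight_integrable)
      have "(*v) (transpose B) \<in> borel_measurable borel"
        by (intro borel_measurable_continuous_onI linear_continuous_on matrix_vector_mul_bounded_linear)
      from measurable_compose[OF this m(1)]
      show "(\<lambda>x. fourier ?Dp (transpose B *v x)) \<in> borel_measurable lborel" by simp
      have "cmod (fourier ?Dp (transpose B *v \<eta>)) \<le> M * (?N \<eta>) powr (-2)" for \<eta>
      proof -
        have fp': "cmod (fourier p (transpose B *v \<eta>)) \<le> k * C1 * (?N \<eta>) powr (- \<beta>) / \<bar>det B\<bar>"
          using fp[of \<eta>] B by (simp add: field_simps)
        have "cmod (fourier ?Dp (transpose B *v \<eta>)) \<le>
            ((2 * pi) ^ ?n * (L ^ s * (?N \<eta>) ^ s)) * (k * C1 * (?N \<eta>) powr (- \<beta>) / \<bar>det B\<bar>)"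
          unfolding nf[OF p] using L1 N1[of \<eta>] by (intro mult_mono[OF poly[OF refl a] fp']) auto
        also have "\<dots> = M * ((?N \<eta>) ^ s * (?N \<eta>) powr (- \<beta>))" unfolding M_def by simp
        also have "(?N \<eta>) ^ s * (?N \<eta>) powr (- \<beta>) = (?N \<eta>) powr (real s - \<beta>)"
          using N1[of \<eta>] by (simp add: powr_realpow[symmetric] powr_add[symmetric])
        also have "M * \<dots> \<le> M * (?N \<eta>) powr (-2)"
          using N1[of \<eta>] \<alpha> \<beta> k C1 L1 unfolding M_def by (intro mult_left_mono powr_mono) auto
        finally show ?thesis .
      qed
      then show "AE \<eta> in lborel. norm (fourier ?Dp (transpose B *v \<eta>)) \<le> norm (M * (?N \<eta>) powr (-2))"
        by (auto intro!: AE_I2 intro: order_trans[OF _ abs_ge_self])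
    qed
    let ?G = "\<lambda>\<xi>. fourier ?Du \<xi> * cnj (fourier ?Dp \<xi>)"
    have Gm: "?G \<in> borel_measurable borel" by (intro borel_measurable_times borel_measurable_cnj m)
    have "L2_inner UNIV ?Du ?Dp = (LINT \<xi>|lborel. ?G \<xi>)"
      unfolding L2_inner_def lebesgue_on_UNIV_eq by (rule parseval[OF int F])
    also have "\<dots> = \<bar>det (transpose B)\<bar> *\<^sub>R (LINT \<eta>|lborel. ?G (transpose B *v \<eta>))"
      by (rule lborel_matrix_integral(1)[OF T Gm])
    also have "cmod \<dots> \<le> (LINT \<eta>|lborel. \<bar>det B\<bar> * norm (?G (transpose B *v \<eta>)))"
      using integral_norm_bound[of lborel "\<lambda>\<eta>. ?G (transpose B *v \<eta>)"] by (simp add: mult_left_mono)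
    also have "\<dots> \<le> (LINT \<eta>|lborel. (2 * pi) ^ (2 * ?n) * K * (?N \<eta>) powr (-2))"
    proof (rule Bochner_Integration.integral_mono_AE')
      show "integrable lborel (\<lambda>\<eta>. (2 * pi) ^ (2 * ?n) * K * (?N \<eta>) powr (-2))"
        by (intro integrable_mult_right decay_weight_integrable)
      have "\<bar>det B\<bar> * norm (?G (transpose B *v \<eta>)) \<le> (2 * pi) ^ (2 * ?n) * K * (?N \<eta>) powr (-2)" for \<eta>
      proof -
        define \<xi> where "\<xi> = transpose B *v \<eta>"
        have N: "1 \<le> ?N \<eta>" by (rule N1)
        \<comment> \<open>The factor |\<delta> \<xi>_i|^\<alpha> is traded for a power of the weight
          in \<eta>, with the small quantity \<delta> L split off.\<close>
        have "\<bar>\<delta> * \<xi> $ i\<bar> powr \<alpha> \<le> (\<delta> * L * ?N \<eta>) powr \<alpha>"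
          using L[of \<eta> i] \<delta> \<alpha> unfolding \<xi>_def
          by (intro powr_mono2) (auto simp: abs_mult mult.assoc intro: mult_left_mono)
        then have fu: "cmod (fourier u \<xi>) \<le> C2 * ((\<delta> * L) powr \<alpha> * (?N \<eta>) powr \<alpha>)"
          using ud[of \<xi>] C2 \<delta> L1 N by (auto simp: powr_mult intro: order_trans mult_left_mono)
        have "\<bar>det B\<bar> * norm (?G \<xi>) =
            ((2 * pi) ^ (2 * ?n) * \<bar>\<xi> $ 1\<bar> ^ (2 * fst a) * \<bar>\<xi> $ 2\<bar> ^ (2 * snd a)) * (cmod (fourier u \<xi>) * (\<bar>det B\<bar> * cmod (fourier p \<xi>)))"
        proof -
          have sq: "z ^ (2 * n) = z ^ n * z ^ n" for z :: real and n by (simp add: mult_2 power_add)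
          then show ?thesis
            unfolding norm_mult complex_mod_cnj nf[OF u] nf[OF p] sq by (simp only: mult_ac)
        qed
        also have "\<dots> \<le> ((2 * pi) ^ (2 * ?n) * (L ^ (2 * s) * (?N \<eta>) ^ (2 * s))) *
            ((C2 * ((\<delta> * L) powr \<alpha> * (?N \<eta>) powr \<alpha>)) * (k * C1 * (?N \<eta>) powr (- \<beta>)))"
          using a L1 N C2
          by (intro mult_mono[OF poly[OF \<xi>_def] mult_mono[OF fu fp[of \<eta>, folded \<xi>_def]]]) auto
        also have "\<dots> = (2 * pi) ^ (2 * ?n) * K * ((?N \<eta>) ^ (2 * s) * (?N \<eta>) powr \<alpha> * (?N \<eta>) powr (- \<beta>))"
          unfolding K_def by (simp only: mult_ac)
        also have "(?N \<eta>) ^ (2 * s) * (?N \<eta>) powr \<alpha> * (?N \<eta>) powr (- \<beta>) = (?N \<eta>) powr (2 * real s + \<alpha> - \<beta>)"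
          using N powr_realpow[of "?N \<eta>" "2 * s"] by (simp add: powr_add powr_diff powr_minus divide_inverse)
        also have "(2 * pi) ^ (2 * ?n) * K * \<dots> \<le> (2 * pi) ^ (2 * ?n) * K * (?N \<eta>) powr (-2)"
          using N \<beta> K0 by (intro mult_left_mono powr_mono) auto
        finally show ?thesis unfolding \<xi>_def .
      qed
      then show "AE \<eta> in lborel. \<bar>det B\<bar> * norm (?G (transpose B *v \<eta>)) \<le> (2 * pi) ^ (2 * ?n) * K * (?N \<eta>) powr (-2)"
        by (intro AE_I2)
    qed (use K0 in auto)
    also have "\<dots> = (2 * pi) ^ (2 * ?n) * I * K" unfolding I_def by simp
    finally show ?thesis .
  qed
  have "cmod (Hs_inner s UNIV u p) \<le> (\<Sum>a | fst a + snd a \<le> s. (2 * pi) ^ (2 * (fst a + snd a)) * I * K)"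
    unfolding Hs_inner_def by (rule order_trans[OF norm_sum]) (rule sum_mono, use each in auto)
  also have "\<dots> = sobolev_const s * K"
    unfolding sobolev_const_def I_def by (simp add: sum_distrib_right)
  finally show ?thesis unfolding K_def .
qed

section \<open>Geometry of the supports\<close>

text \<open>The segment from x to y leaves \<Omega> and so meets the frontier at a point no farther
  from x than y.\<close>

lemma infdist_frontier_le:
  fixes x y :: "'a::euclidean_space"
  assumes "x \<in> \<Omega>" "y \<notin> \<Omega>"
  shows "infdist x (frontier \<Omega>) \<le> dist x y"
proof -
  have "closed_segment x y \<inter> frontier \<Omega> \<noteq> {}"
    by (rule connected_Int_frontier) (use assms in auto)
  then obtain z where z: "z \<in> closed_segment x y" "z \<in> frontier \<Omega>" by blast
  have "infdist x (frontier \<Omega>) \<le> dist x z" by (rule infdist_le[OF z(2)])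
  also have "\<dots> \<le> dist x y" using dist_in_closed_segment[OF z(1)] by (simp add: dist_commute)
  finally show ?thesis .
qed

text \<open>If the ball left \<Omega>, a radius from its centre would hit the frontier inside the
  ball, and points of \<Omega> near that hit lie in the strip.\<close>

lemma ball_inside_if_avoids_strip:
  assumes "m \<in> \<Omega>" "0 < q" "ball m \<rho> \<inter> boundary_strip \<Omega> q r = {}"
  shows "ball m \<rho> \<subseteq> \<Omega>"
proof (rule ccontr)
  assume "\<not> ball m \<rho> \<subseteq> \<Omega>"
  then obtain y where y: "y \<in> ball m \<rho>" "y \<notin> \<Omega>" by blast
  have \<rho>: "m \<in> ball m \<rho>" using y by (auto intro: le_less_trans[OF zero_le_dist])
  have "closed_segment m y \<inter> frontier \<Omega> \<noteq> {}"
    by (rule connected_Int_frontier) (use assms(1) y in auto)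
  then obtain p where p: "p \<in> closed_segment m y" "p \<in> frontier \<Omega>" by blast
  have pb: "p \<in> ball m \<rho>"
    using p(1) \<rho> y(1) by (meson closed_segment_subset convex_ball subsetD)
  \<comment> \<open>The strip consists of points of \<Omega>, so the frontier point p is
    approximated from \<Omega>, closely enough to stay both in the ball and in the strip.\<close>
  define e where "e = min (\<rho> - dist m p) (q * 2 powr (- r))"
  have "0 < e" unfolding e_def using pb assms(2) by simp
  moreover have "p \<in> closure \<Omega>" using p(2) by (simp add: frontier_def)
  ultimately obtain z where z: "z \<in> \<Omega>" "dist z p < e" by (meson closure_approachable)
  have "infdist z (frontier \<Omega>) \<le> dist z p" by (rule infdist_le[OF p(2)])
  then have "z \<in> boundary_strip \<Omega> q r" unfolding boundary_strip_def using z by (simp add: e_def)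
  moreover have "z \<in> ball m \<rho>"
    using z(2) dist_triangle[of m z p] by (simp add: e_def dist_commute)
  ultimately show False using assms(3) by blast
qed

text \<open>Passing to the infimum of the admissible radii turns the strict bounds by open balls
  into a non-strict one.\<close>

lemma support_radius_bound:
  assumes "support_radii \<Omega> \<Theta> u \<noteq> {}" "(j, m, \<upsilon>) \<in> \<Theta>" "x \<in> ess_supp (zero_ext \<Omega> (u (j, m, \<upsilon>)))"
  shows "dist m x \<le> 2 powr (- real_of_int j) * support_radius \<Omega> \<Theta> u"
proof -
  have "2 powr (real_of_int j) * dist m x \<le> q" if "q \<in> support_radii \<Omega> \<Theta> u" for q
  proof -
    have "x \<in> ball m (2 powr (- real_of_int j) * q)"
      using that assms(2,3) unfolding support_radii_def by blast
    then have "dist m x < 2 powr (- real_of_int j) * q" by simp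
    then show ?thesis by (simp add: powr_minus field_simps)
  qed
  then have "2 powr (real_of_int j) * dist m x \<le> support_radius \<Omega> \<Theta> u"
    unfolding support_radius_def using assms(1) by (intro cInf_greatest)
  then show ?thesis by (simp add: powr_minus field_simps)
qed

section \<open>Counting\<close>

lemma card_floor_interval:
  fixes a b :: real
  assumes "a \<le> b"
  shows "real (card {\<lfloor>a\<rfloor>..\<lfloor>b\<rfloor>}) \<le> b - a + 2"
proof -
  have "\<lfloor>a\<rfloor> \<le> \<lfloor>b\<rfloor>" using assms by (rule floor_mono)
  then show ?thesis by simp linarith
qed

text \<open>Points are sorted into a grid of mesh \<delta>/2. Two points in one cell differ by less
  than \<delta>/2 in each coordinate, hence by less than \<delta> in norm, so each cell holds at
  most one point.\<close>

lemma packing_bound: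
  fixes A :: "(real^2) set"
  assumes A: "A \<subseteq> cball c r" and \<delta>: "0 < \<delta>" and r: "0 \<le> r"
    and sep: "\<And>x y. x \<in> A \<Longrightarrow> y \<in> A \<Longrightarrow> x \<noteq> y \<Longrightarrow> \<delta> \<le> norm (x - y)"
  shows "finite A \<and> real (card A) \<le> (4 * r / \<delta> + 2)\<^sup>2"
proof -
  define f where "f = (\<lambda>x::real^2. (\<lfloor>x $ 1 * (2 / \<delta>)\<rfloor>, \<lfloor>x $ 2 * (2 / \<delta>)\<rfloor>))"
  define I where "I = (\<lambda>i. {\<lfloor>(c $ i - r) * (2 / \<delta>)\<rfloor>..\<lfloor>(c $ i + r) * (2 / \<delta>)\<rfloor>})"
  have inj: "inj_on f A"
  proof (rule inj_onI, rule ccontr)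
    fix x y assume xy: "x \<in> A" "y \<in> A" "f x = f y" "x \<noteq> y"
    have fl: "\<bar>s - t\<bar> < \<delta> / 2" if "\<lfloor>s * (2 / \<delta>)\<rfloor> = \<lfloor>t * (2 / \<delta>)\<rfloor>" for s t :: real
    proof -
      have "\<bar>s * (2 / \<delta>) - t * (2 / \<delta>)\<bar> < 1" using that by linarith
      then have "\<bar>s - t\<bar> * \<bar>2 / \<delta>\<bar> < 1" by (simp only: abs_mult[symmetric] left_diff_distrib)
      then show ?thesis using \<delta> by (simp add: field_simps)
    qed
    have "norm (x - y) \<le> \<bar>(x - y) $ 1\<bar> + \<bar>(x - y) $ 2\<bar>"
      using norm_le_l1_cart[of "x - y"] by (simp add: sum_2)
    also have "\<dots> < \<delta>" using fl[of "x $ 1" "y $ 1"] fl[of "x $ 2" "y $ 2"] xy(3) by (simp add: f_def)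
    finally show False using sep[OF xy(1,2,4)] by simp
  qed
  have sub: "f ` A \<subseteq> I 1 \<times> I 2"
  proof
    fix z assume "z \<in> f ` A"
    then obtain x where x: "x \<in> A" "z = f x" by blast
    have "norm (x - c) \<le> r" using A x(1) by (auto simp: dist_norm norm_minus_commute)
    then have *: "\<bar>x $ i - c $ i\<bar> \<le> r" for i using component_le_norm_cart[of "x - c" i] by simp
    have "\<lfloor>x $ i * (2 / \<delta>)\<rfloor> \<in> I i" for i
      unfolding I_def atLeastAtMost_iff
      using *[of i] \<delta> by (intro conjI floor_mono mult_right_mono) (auto simp: abs_le_iff)
    then show "z \<in> I 1 \<times> I 2" by (simp add: x(2) f_def)
  qed
  have fin: "finite (I i)" for i unfolding I_def by simp
  have "finite A" using finite_subset[OF sub] fin inj by (simp add: finite_image_iff)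
  moreover have "real (card A) \<le> (4 * r / \<delta> + 2)\<^sup>2"
  proof -
    have "card A = card (f ` A)" using inj by (simp add: card_image)
    also have "\<dots> \<le> card (I 1 \<times> I 2)" by (rule card_mono[OF _ sub]) (use fin in auto)
    finally have "real (card A) \<le> real (card (I 1)) * real (card (I 2))"
      by (simp add: card_cartesian_product flip: of_nat_mult)
    also have "\<dots> \<le> (4 * r / \<delta> + 2) * (4 * r / \<delta> + 2)"
    proof -
      have "real (card (I i)) \<le> 4 * r / \<delta> + 2" for i
      proof -
        have "real (card (I i)) \<le> (c $ i + r) * (2 / \<delta>) - (c $ i - r) * (2 / \<delta>) + 2"
          unfolding I_def using r \<delta> by (intro card_floor_interval mult_right_mono) auto
        also have "\<dots> = 4 * r / \<delta> + 2" using \<delta> by (simp add: field_simps)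
        finally show ?thesis .
      qed
      then show ?thesis using r \<delta> by (intro mult_mono) auto
    qed
    finally show ?thesis by (simp add: power2_eq_square)
  qed
  ultimately show ?thesis ..
qed

lemma lattice_count:
  assumes "0 \<le> X" "0 \<le> Y"
  shows "finite {m :: int^2. \<bar>real_of_int (m $ 1)\<bar> \<le> X \<and> \<bar>real_of_int (m $ 2)\<bar> \<le> Y}" (is "finite ?S")
    and "real (card {m :: int^2. \<bar>real_of_int (m $ 1)\<bar> \<le> X \<and> \<bar>real_of_int (m $ 2)\<bar> \<le> Y}) \<le> (2 * X + 2) * (2 * Y + 2)"
proof -
  define f where "f = (\<lambda>m :: int^2. (m $ 1, m $ 2))"
  have inj: "inj_on f ?S" unfolding f_def inj_on_def by (auto simp: vec_eq_iff forall_2)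
  have *: "n \<in> {\<lfloor>- Z\<rfloor>..\<lfloor>Z\<rfloor>}" if "\<bar>real_of_int n\<bar> \<le> Z" for n Z
    using that by (simp add: le_floor_iff abs_le_iff) linarith
  have sub: "f ` ?S \<subseteq> {\<lfloor>-X\<rfloor>..\<lfloor>X\<rfloor>} \<times> {\<lfloor>-Y\<rfloor>..\<lfloor>Y\<rfloor>}"
    using * unfolding f_def by blast
  show fin: "finite ?S" using finite_subset[OF sub] inj by (simp add: finite_image_iff)
  have "card ?S = card (f ` ?S)" using inj by (simp add: card_image)
  also have "\<dots> \<le> card ({\<lfloor>-X\<rfloor>..\<lfloor>X\<rfloor>} \<times> {\<lfloor>-Y\<rfloor>..\<lfloor>Y\<rfloor>})" by (rule card_mono[OF _ sub]) auto
  finally have "real (card ?S) \<le> real (card {\<lfloor>-X\<rfloor>..\<lfloor>X\<rfloor>}) * real (card {\<lfloor>-Y\<rfloor>..\<lfloor>Y\<rfloor>})"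
    unfolding card_cartesian_product of_nat_mult[symmetric] of_nat_le_iff .
  also have "\<dots> \<le> (X - (-X) + 2) * (Y - (-Y) + 2)"
    using assms by (intro mult_mono card_floor_interval) auto
  finally show "real (card ?S) \<le> (2 * X + 2) * (2 * Y + 2)" by simp
qed

section \<open>Summation\<close>

text \<open>A finite partial sum, grouped by level, is at most C times a product of two partial
  geometric sums, so partial sums are bounded.\<close>

lemma summable_on_levels:
  fixes a :: "'a \<Rightarrow> real" and lev :: "'a \<Rightarrow> nat \<times> nat"
  assumes a: "\<And>p. p \<in> P \<Longrightarrow> 0 \<le> a p"
    and xy: "0 \<le> x" "x < 1" "0 \<le> y" "y < 1" and C: "0 \<le> C"
    and fib: "\<And>F i k. finite F \<Longrightarrow> F \<subseteq> {p \<in> P. lev p = (i, k)} \<Longrightarrow> sum a F \<le> C * (x ^ i * y ^ k)"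
  shows "a summable_on P"
proof (rule nonneg_bdd_above_summable_on[OF a])
  have "sum a F \<le> C * (1 / (1 - x) * (1 / (1 - y)))" if F: "F \<subseteq> P" "finite F" for F
  proof -
    obtain n where n: "\<And>p. p \<in> F \<Longrightarrow> fst (lev p) < n \<and> snd (lev p) < n"
    proof -
      have "finite ((\<lambda>p. fst (lev p)) ` F \<union> (\<lambda>p. snd (lev p)) ` F)" using F by simp
      then obtain n where "\<forall>k\<in>(\<lambda>p. fst (lev p)) ` F \<union> (\<lambda>p. snd (lev p)) ` F. k < n"
        by (meson finite_nat_set_iff_bounded)
      then show ?thesis by (intro that[of n]) auto
    qed
    have "sum a F = (\<Sum>z\<in>{..<n} \<times> {..<n}. sum a {p \<in> F. lev p = z})"
      by (rule sum.group[symmetric]) (use F n in \<open>auto simp: image_subset_iff mem_Times_iff\<close>)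
    also have "\<dots> \<le> (\<Sum>z\<in>{..<n} \<times> {..<n}. C * (x ^ fst z * y ^ snd z))"
    proof (rule sum_mono)
      fix z
      show "sum a {p \<in> F. lev p = z} \<le> C * (x ^ fst z * y ^ snd z)"
        by (rule fib) (use F in auto)
    qed
    also have "\<dots> = C * (\<Sum>z\<in>{..<n} \<times> {..<n}. case z of (i, k) \<Rightarrow> x ^ i * y ^ k)"
      by (simp add: sum_distrib_left split_beta)
    also have "(\<Sum>z\<in>{..<n} \<times> {..<n}. case z of (i, k) \<Rightarrow> x ^ i * y ^ k) = (\<Sum>i<n. x ^ i) * (\<Sum>k<n. y ^ k)"
      by (simp add: sum_product sum.cartesian_product)
    also have "C * \<dots> \<le> C * (1 / (1 - x) * (1 / (1 - y)))"
    proof -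
      have g: "(\<Sum>i<n. z ^ i) \<le> 1 / (1 - z)" if "0 \<le> z" "z < 1" for z :: real
        using sum_le_suminf[OF summable_geometric[of z], of "{..<n}"] that suminf_geometric[of z] by simp
      show ?thesis using C xy by (intro mult_left_mono mult_mono g sum_nonneg) auto
    qed
    finally show ?thesis .
  qed
  then show "bdd_above (sum a ` {F. F \<subseteq> P \<and> finite F})"
    by (intro bdd_aboveI[of _ "C * (1 / (1 - x) * (1 / (1 - y)))"]) auto
qed auto

text \<open>Some finite F carries all of the sum but e. Once t exceeds every value of h on F, the
  set where h > t misses F; nothing else about h matters.\<close>

lemma infsum_tail:
  fixes a :: "'a \<Rightarrow> real" and h :: "'a \<Rightarrow> real"
  assumes s: "a summable_on P" and a: "\<And>p. p \<in> P \<Longrightarrow> 0 \<le> a p" and e: "0 < e"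
  obtains T where "T > 0" "\<And>t. t \<ge> T \<Longrightarrow> infsum a {p \<in> P. t < h p} \<le> e"
proof -
  have "(sum a \<longlongrightarrow> infsum a P) (finite_subsets_at_top P)"
    using has_sum_infsum[OF s] unfolding has_sum_def .
  then have "eventually (\<lambda>F. dist (sum a F) (infsum a P) < e) (finite_subsets_at_top P)"
    using e by (rule tendstoD)
  then obtain F where F: "finite F" "F \<subseteq> P" "dist (sum a F) (infsum a P) < e"
    unfolding eventually_finite_subsets_at_top by blast
  define T where "T = Max (insert 1 (h ` F))"
  have T: "T > 0" "\<And>p. p \<in> F \<Longrightarrow> h p \<le> T"
  proof -
    have "1 \<le> T" unfolding T_def using F(1) by (intro Max_ge) auto
    then show "T > 0" by simp
    show "h p \<le> T" if "p \<in> F" for p unfolding T_def using F(1) that by (intro Max_ge) auto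
  qed
  show ?thesis
  proof (rule that[OF T(1)])
    fix t assume t: "t \<ge> T"
    let ?Q = "{p \<in> P. t < h p}"
    have d: "?Q \<subseteq> P - F" using T(2) t by fastforce
    have sQ: "a summable_on ?Q" "a summable_on (P - F)"
      by (rule summable_on_subset_banach[OF s], blast)+
    have "infsum a ?Q \<le> infsum a (P - F)"
      by (rule infsum_mono_neutral[OF sQ]) (use d a in auto)
    also have "\<dots> = infsum a P - sum a F"
      using infsum_Diff[OF s _ F(2)] F(1) by simp
    also have "\<dots> \<le> e" using F(3) by (simp add: dist_real_def)
    finally show "infsum a ?Q \<le> e" .
  qed
qed

section \<open>Combining the two frames\<close>

lemma cmod_diff3_square: "(cmod (a - b - c))\<^sup>2 \<le> 3 * (cmod a)\<^sup>2 + 3 * (cmod b)\<^sup>2 + 3 * (cmod c)\<^sup>2"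
proof -
  have "cmod (a - b - c) \<le> cmod a + cmod b + cmod c"
    by (meson add_mono norm_triangle_ineq4 order_refl order_trans)
  then have "(cmod (a - b - c))\<^sup>2 \<le> (cmod a + cmod b + cmod c)\<^sup>2" by (simp add: power_mono)
  also have "\<dots> \<le> 3 * (cmod a)\<^sup>2 + 3 * (cmod b)\<^sup>2 + 3 * (cmod c)\<^sup>2"
    using sum_squares_bound[of "cmod a" "cmod b"] sum_squares_bound[of "cmod a" "cmod c"]
      sum_squares_bound[of "cmod b" "cmod c"]
    by (simp add: power2_eq_square algebra_simps)
  finally show ?thesis .
qed

lemma splitting_bound:
  fixes x y a b a' b' :: real
  assumes "x \<le> 2 * y + 2 * z" "z \<le> 2 * a + 2 * b" "a \<le> a'" "b \<le> b'"
  shows "x \<le> 2 * y + 4 * a' + 4 * b'"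
  using assms by linarith

text \<open>For finitely many terms the union of the supports is closed and still inside \<Omega>,
  so the extension by zero has support in \<Omega> and inner products over \<Omega> and over the
  plane coincide.\<close>

lemma zero_ext_finite_combination:
  fixes c :: "'t \<Rightarrow> complex" and d :: "'t \<Rightarrow> cfun"
  assumes \<Omega>: "open \<Omega>" and F: "finite F"
    and dV: "\<And>\<theta>. \<theta> \<in> F \<Longrightarrow> d \<theta> \<in> Hs s \<Omega>"
    and ext: "\<And>\<theta>. \<theta> \<in> F \<Longrightarrow> zero_ext \<Omega> (d \<theta>) \<in> Hs s UNIV"
    and supp: "\<And>\<theta>. \<theta> \<in> F \<Longrightarrow> ess_supp (zero_ext \<Omega> (d \<theta>)) \<subseteq> \<Omega>"
  defines "g \<equiv> (\<lambda>x. \<Sum>\<theta>\<in>F. c \<theta> * d \<theta> x)"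
  shows "zero_ext \<Omega> g \<in> Hs s UNIV"
    and "q \<in> Hs s UNIV \<Longrightarrow> Hs_inner s UNIV (zero_ext \<Omega> g) q = Hs_inner s \<Omega> g q"
    and "Hs_norm s UNIV (zero_ext \<Omega> g) = Hs_norm s \<Omega> g"
proof -
  interpret U: semi_inner_space "Hs s UNIV" "Hs_inner s UNIV" by (rule semi_inner_space_Hs) simp
  interpret semi_inner_space "Hs s \<Omega>" "Hs_inner s \<Omega>" by (rule semi_inner_space_Hs[OF \<Omega>])
  let ?G = "zero_ext \<Omega> g"
  have sets: "\<Omega> \<in> sets lebesgue" using \<Omega> by auto
  have gV: "g \<in> Hs s \<Omega>" unfolding g_def by (rule sum_mem[OF F dV])
  have G_eq: "?G = (\<lambda>x. \<Sum>\<theta>\<in>F. c \<theta> * zero_ext \<Omega> (d \<theta>) x)"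
    unfolding g_def zero_ext_def by auto
  show GU: "?G \<in> Hs s UNIV" unfolding G_eq by (rule U.sum_mem[OF F ext])
  have ae: "AE x in lebesgue_on \<Omega>. ?G x = g x"
    unfolding lebesgue_on_integral[OF sets] by (auto simp: zero_ext_def)
  have Gs: "ess_supp ?G \<subseteq> \<Omega>"
  proof -
    have "AE x in lebesgue. \<forall>\<theta>\<in>F. x \<notin> ess_supp (zero_ext \<Omega> (d \<theta>)) \<longrightarrow> zero_ext \<Omega> (d \<theta>) x = 0"
      using F AE_zero_outside_ess_supp by (simp add: AE_finite_all)
    then have "AE x in lebesgue. x \<notin> (\<Union>\<theta>\<in>F. ess_supp (zero_ext \<Omega> (d \<theta>))) \<longrightarrow> ?G x = 0"
      by eventually_elim (auto simp: G_eq intro!: sum.neutral)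
    then have "ess_supp ?G \<subseteq> (\<Union>\<theta>\<in>F. ess_supp (zero_ext \<Omega> (d \<theta>)))"
      using F by (intro ess_supp_subset) (auto intro: closed_ess_supp)
    with supp show ?thesis by blast
  qed
  have GV: "?G \<in> Hs s \<Omega>" by (rule Hs_restrict[OF \<Omega> GU])
  have inner: "Hs_inner s UNIV ?G q = Hs_inner s \<Omega> g q" if q: "q \<in> Hs s UNIV" for q
  proof -
    have "Hs_inner s UNIV ?G q = cnj (Hs_inner s \<Omega> q ?G)"
      unfolding Hs_inner_restrict[OF \<Omega> q GU Gs] by (rule U.ip_cnj[symmetric])
    also have "\<dots> = Hs_inner s \<Omega> ?G q" by (rule ip_cnj)
    also have "\<dots> = Hs_inner s \<Omega> g q"
      by (rule Hs_inner_AE_cong[OF \<Omega> GV Hs_restrict[OF \<Omega> q] ae])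
    finally show ?thesis .
  qed
  then show "q \<in> Hs s UNIV \<Longrightarrow> Hs_inner s UNIV ?G q = Hs_inner s \<Omega> g q" .
  have "Hs_inner s UNIV ?G ?G = Hs_inner s \<Omega> g ?G" by (rule inner[OF GU])
  also have "\<dots> = cnj (Hs_inner s \<Omega> ?G g)" by (rule ip_cnj[symmetric])
  also have "Hs_inner s \<Omega> ?G g = Hs_inner s \<Omega> g g" by (rule Hs_inner_AE_cong[OF \<Omega> GV gV ae])
  also have "cnj \<dots> = Hs_inner s \<Omega> g g" by (rule ip_cnj)
  finally show "Hs_norm s UNIV ?G = Hs_norm s \<Omega> g" unfolding Hs_norm_def by simp
qed

text \<open>The functional-analytic core, free of shearlets. \<open>\<Theta>i\<close> are the
  indices whose dual elements may be extended by zero, and \<open>Q\<close> holds all pairs of an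
  outer element p and an interior dual element that interact; their total coupling is at most e.
  Smallness of e against AS / Bu yields the lower bound.\<close>

lemma frame_absorption:
  fixes \<Lambda> \<Lambda>0 :: "'l set" and \<Theta> \<Theta>i :: "'t set" and p :: "'l \<Rightarrow> cfun" and u d :: "'t \<Rightarrow> cfun"
  assumes \<Omega>: "open \<Omega>" and \<Lambda>: "\<Lambda>0 \<subseteq> \<Lambda>" and \<Theta>: "\<Theta>i \<subseteq> \<Theta>"
    and dV: "\<And>\<theta>. \<theta> \<in> \<Theta> \<Longrightarrow> d \<theta> \<in> Hs s \<Omega>" and uV: "\<And>\<theta>. \<theta> \<in> \<Theta> \<Longrightarrow> u \<theta> \<in> Hs s \<Omega>"
    and pU: "\<And>l. l \<in> \<Lambda> \<Longrightarrow> p l \<in> Hs s UNIV"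
    and Bu: "\<And>f. f \<in> Hs s \<Omega> \<Longrightarrow> (\<lambda>\<theta>. (cmod (Hs_inner s \<Omega> f (u \<theta>)))\<^sup>2) summable_on \<Theta> \<and>
          (\<Sum>\<^sub>\<infinity>\<theta>\<in>\<Theta>. (cmod (Hs_inner s \<Omega> f (u \<theta>)))\<^sup>2) \<le> Bu * (Hs_norm s \<Omega> f)\<^sup>2"
    and Bd: "\<And>f. f \<in> Hs s \<Omega> \<Longrightarrow> (\<lambda>\<theta>. (cmod (Hs_inner s \<Omega> f (d \<theta>)))\<^sup>2) summable_on \<Theta> \<and>
          (\<Sum>\<^sub>\<infinity>\<theta>\<in>\<Theta>. (cmod (Hs_inner s \<Omega> f (d \<theta>)))\<^sup>2) \<le> Bd * (Hs_norm s \<Omega> f)\<^sup>2"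
    and rec: "\<And>f. f \<in> Hs s \<Omega> \<Longrightarrow> Hs_has_sum s \<Omega> (\<lambda>\<theta> x. Hs_inner s \<Omega> f (u \<theta>) * d \<theta> x) \<Theta> f"
    and AS: "\<And>g. g \<in> Hs s UNIV \<Longrightarrow> (\<lambda>l. (cmod (Hs_inner s UNIV g (p l)))\<^sup>2) summable_on \<Lambda> \<and>
          AS * (Hs_norm s UNIV g)\<^sup>2 \<le> (\<Sum>\<^sub>\<infinity>l\<in>\<Lambda>. (cmod (Hs_inner s UNIV g (p l)))\<^sup>2)"
    and BS: "\<And>f. f \<in> Hs s \<Omega> \<Longrightarrow> (\<lambda>l. (cmod (Hs_inner s \<Omega> f (p l)))\<^sup>2) summable_on \<Lambda>0 \<and>
          (\<Sum>\<^sub>\<infinity>l\<in>\<Lambda>0. (cmod (Hs_inner s \<Omega> f (p l)))\<^sup>2) \<le> BS * (Hs_norm s \<Omega> f)\<^sup>2"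
    and ext: "\<And>\<theta>. \<theta> \<in> \<Theta>i \<Longrightarrow> zero_ext \<Omega> (d \<theta>) \<in> Hs s UNIV"
    and supp: "\<And>\<theta>. \<theta> \<in> \<Theta>i \<Longrightarrow> ess_supp (zero_ext \<Omega> (d \<theta>)) \<subseteq> \<Omega>"
    and Q: "(\<lambda>(l, \<theta>). (cmod (Hs_inner s \<Omega> (d \<theta>) (p l)))\<^sup>2) summable_on Q"
      "(\<Sum>\<^sub>\<infinity>(l, \<theta>)\<in>Q. (cmod (Hs_inner s \<Omega> (d \<theta>) (p l)))\<^sup>2) \<le> e"
    and Q0: "\<And>l \<theta>. l \<in> \<Lambda> - \<Lambda>0 \<Longrightarrow> \<theta> \<in> \<Theta>i \<Longrightarrow> (l, \<theta>) \<notin> Q \<Longrightarrow> Hs_inner s \<Omega> (d \<theta>) (p l) = 0"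
    and pos: "0 < AS" "0 \<le> Bu" "0 < Bd" "0 \<le> BS" "0 \<le> e" and small: "8 * Bu * e \<le> AS"
  shows "\<exists>A>0. \<forall>f\<in>Hs s \<Omega>. A * (Hs_norm s \<Omega> f)\<^sup>2 \<le>
     (\<Sum>\<^sub>\<infinity>l\<in>\<Lambda>0. (cmod (Hs_inner s \<Omega> f (p l)))\<^sup>2) + (\<Sum>\<^sub>\<infinity>\<theta>\<in>\<Theta> - \<Theta>i. (cmod (Hs_inner s \<Omega> f (u \<theta>)))\<^sup>2)"
proof -
  interpret semi_inner_space "Hs s \<Omega>" "Hs_inner s \<Omega>" by (rule semi_inner_space_Hs[OF \<Omega>])
  have norm_eq: "(Hs_norm s \<Omega> f)\<^sup>2 = nrm2 f" for f unfolding nrm2_def by (rule Hs_norm_square)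
  let ?ip = "Hs_inner s \<Omega>"
  have pV: "p l \<in> Hs s \<Omega>" if "l \<in> \<Lambda>" for l by (rule Hs_restrict[OF \<Omega> pU[OF that]])
  \<comment> \<open>The factor 2 comes from moving half of the squared norm of f to the left. In 12
    = 4 * 3 the 4 is from splitting f twice into two summands, the 3 from a square of three
    summands. The term 4 * Bd bounds the boundary part h itself.\<close>
  define C where "C = 2 * (12 / AS + 12 * BS * Bd / AS + 4 * Bd)"
  have C: "C > 0" unfolding C_def using pos by (simp add: add_pos_nonneg)
  have key: "nrm2 f \<le> C * ((\<Sum>\<^sub>\<infinity>l\<in>\<Lambda>0. (cmod (?ip f (p l)))\<^sup>2) + (\<Sum>\<^sub>\<infinity>\<theta>\<in>\<Theta> - \<Theta>i. (cmod (?ip f (u \<theta>)))\<^sup>2))"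
    if f: "f \<in> Hs s \<Omega>" for f
  proof -
    define c where "c = (\<lambda>\<theta>. ?ip f (u \<theta>))"
    define W where "W = (\<Sum>\<^sub>\<infinity>\<theta>\<in>\<Theta> - \<Theta>i. (cmod (c \<theta>))\<^sup>2)"
    define Z where "Z = (\<Sum>\<^sub>\<infinity>l\<in>\<Lambda>0. (cmod (?ip f (p l)))\<^sup>2)"
    have WZ: "0 \<le> W" "0 \<le> Z" unfolding W_def Z_def by (auto intro: infsum_nonneg)
    have cs: "(\<lambda>\<theta>. (cmod (c \<theta>))\<^sup>2) summable_on \<Theta>" "(\<Sum>\<^sub>\<infinity>\<theta>\<in>\<Theta>. (cmod (c \<theta>))\<^sup>2) \<le> Bu * nrm2 f"
      using Bu[OF f] unfolding c_def norm_eq by auto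
    \<comment> \<open>Apart from the remainder of the finite expansion the right side does not
      depend on F; the remainder becomes arbitrarily small by \<open>rec\<close>.\<close>
    have est: "nrm2 f \<le> (2 + 12 * BS / AS) * nrm2 (\<lambda>x. f x - (\<Sum>\<theta>\<in>F. c \<theta> * d \<theta> x)) +
        (12 / AS * Z + (12 * BS * Bd / AS + 4 * Bd) * W + nrm2 f / 2)"
      if F: "finite F" "F \<subseteq> \<Theta>" for F
    proof -
      define Fi where "Fi = F \<inter> \<Theta>i"
      define Fb where "Fb = F - \<Theta>i"
      define g where "g = (\<lambda>x. \<Sum>\<theta>\<in>Fi. c \<theta> * d \<theta> x)"
      define h where "h = (\<lambda>x. \<Sum>\<theta>\<in>Fb. c \<theta> * d \<theta> x)"
      define r where "r = (\<lambda>x. f x - (\<Sum>\<theta>\<in>F. c \<theta> * d \<theta> x))"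
      have fin: "finite Fi" "finite Fb" using F(1) unfolding Fi_def Fb_def by auto
      have Fsub: "Fi \<subseteq> \<Theta>" "Fi \<subseteq> \<Theta>i" "Fb \<subseteq> \<Theta> - \<Theta>i" using F(2) \<Theta> unfolding Fi_def Fb_def by auto
      have gV: "g \<in> Hs s \<Omega>" unfolding g_def by (rule sum_mem[OF fin(1)]) (use dV Fsub in auto)
      have hV: "h \<in> Hs s \<Omega>" unfolding h_def by (rule sum_mem[OF fin(2)]) (use dV Fsub in auto)
      have split: "(\<Sum>\<theta>\<in>F. c \<theta> * d \<theta> x) = g x + h x" for x
        unfolding g_def h_def Fi_def Fb_def using sum.Int_Diff[OF F(1)] by blast
      have rV: "r \<in> Hs s \<Omega>" unfolding r_def split by (intro diff_mem f add_mem gV hV)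
      have Fb_le: "(\<Sum>\<theta>\<in>Fb. (cmod (c \<theta>))\<^sup>2) \<le> W"
        unfolding W_def using fin Fsub summable_on_subset_banach[OF cs(1), of "\<Theta> - \<Theta>i"]
        by (intro finite_sum_le_infsum) auto
      have Fi_le: "(\<Sum>\<theta>\<in>Fi. (cmod (c \<theta>))\<^sup>2) \<le> Bu * nrm2 f"
        using finite_sum_le_infsum[OF cs(1) fin(1) Fsub(1)] cs(2) by simp
      have h_le: "nrm2 h \<le> Bd * W"
      proof -
        have "nrm2 h \<le> Bd * (\<Sum>\<theta>\<in>Fb. (cmod (c \<theta>))\<^sup>2)"
          unfolding h_def
        proof (rule synthesis_bound[OF fin(2)])
          show "(\<Sum>\<theta>\<in>Fb. (cmod (?ip k (d \<theta>)))\<^sup>2) \<le> Bd * nrm2 k" if "k \<in> Hs s \<Omega>" for k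
          proof -
            have "(\<Sum>\<theta>\<in>Fb. (cmod (?ip k (d \<theta>)))\<^sup>2) \<le> (\<Sum>\<^sub>\<infinity>\<theta>\<in>\<Theta>. (cmod (?ip k (d \<theta>)))\<^sup>2)"
              using Bd[OF that] fin Fsub by (intro finite_sum_le_infsum) auto
            then show ?thesis using Bd[OF that] unfolding norm_eq by simp
          qed
        qed (use dV Fsub pos in auto)
        also have "\<dots> \<le> Bd * W" using Fb_le pos by (intro mult_left_mono) auto
        finally show ?thesis .
      qed
      have dF: "\<And>\<theta>. \<theta> \<in> Fi \<Longrightarrow> d \<theta> \<in> Hs s \<Omega>" "\<And>\<theta>. \<theta> \<in> Fi \<Longrightarrow> zero_ext \<Omega> (d \<theta>) \<in> Hs s UNIV"
        "\<And>\<theta>. \<theta> \<in> Fi \<Longrightarrow> ess_supp (zero_ext \<Omega> (d \<theta>)) \<subseteq> \<Omega>"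
        using dV ext supp Fsub by blast+
      have G1: "zero_ext \<Omega> g \<in> Hs s UNIV"
        unfolding g_def by (rule zero_ext_finite_combination(1)[OF \<Omega> fin(1)]) (simp_all add: dF)
      have G2: "Hs_inner s UNIV (zero_ext \<Omega> g) q = ?ip g q" if "q \<in> Hs s UNIV" for q
        unfolding g_def by (rule zero_ext_finite_combination(2)[OF \<Omega> fin(1) _ _ _ that]) (simp_all add: dF)
      have G3: "Hs_norm s UNIV (zero_ext \<Omega> g) = Hs_norm s \<Omega> g"
        unfolding g_def by (rule zero_ext_finite_combination(3)[OF \<Omega> fin(1)]) (simp_all add: dF)
      have gsum: "(\<lambda>l. (cmod (?ip g (p l)))\<^sup>2) summable_on \<Lambda>" and
        g_le: "AS * nrm2 g \<le> (\<Sum>\<^sub>\<infinity>l\<in>\<Lambda>. (cmod (?ip g (p l)))\<^sup>2)"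
      proof -
        have eq: "Hs_inner s UNIV (zero_ext \<Omega> g) (p l) = ?ip g (p l)" if "l \<in> \<Lambda>" for l
          by (rule G2[OF pU[OF that]])
        have "(\<lambda>l. (cmod (Hs_inner s UNIV (zero_ext \<Omega> g) (p l)))\<^sup>2) summable_on \<Lambda>"
          using AS[OF G1] by simp
        then show "(\<lambda>l. (cmod (?ip g (p l)))\<^sup>2) summable_on \<Lambda>"
          by (rule summable_on_cong[THEN iffD1, rotated]) (simp add: eq)
        have "(\<Sum>\<^sub>\<infinity>l\<in>\<Lambda>. (cmod (Hs_inner s UNIV (zero_ext \<Omega> g) (p l)))\<^sup>2) = (\<Sum>\<^sub>\<infinity>l\<in>\<Lambda>. (cmod (?ip g (p l)))\<^sup>2)"
          by (rule infsum_cong) (simp add: eq)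
        then show "AS * nrm2 g \<le> (\<Sum>\<^sub>\<infinity>l\<in>\<Lambda>. (cmod (?ip g (p l)))\<^sup>2)"
          using AS[OF G1] G3 unfolding norm_eq[symmetric] by simp
      qed
      \<comment> \<open>On the inner elements g = f - r - h. The part of f is kept as Z; the parts
        of r and h are controlled by the upper bound \<open>BS\<close>.\<close>
      have in_le: "(\<Sum>\<^sub>\<infinity>l\<in>\<Lambda>0. (cmod (?ip g (p l)))\<^sup>2) \<le> 3 * Z + 3 * (BS * nrm2 r) + 3 * (BS * nrm2 h)"
      proof -
        have s1: "(\<lambda>l. 3 * (cmod (?ip f (p l)))\<^sup>2 + 3 * (cmod (?ip r (p l)))\<^sup>2 + 3 * (cmod (?ip h (p l)))\<^sup>2) summable_on \<Lambda>0"
          using BS[OF f] BS[OF rV] BS[OF hV] by (intro summable_on_add summable_on_cmult_right) auto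
        have "(\<Sum>\<^sub>\<infinity>l\<in>\<Lambda>0. (cmod (?ip g (p l)))\<^sup>2) \<le>
            (\<Sum>\<^sub>\<infinity>l\<in>\<Lambda>0. 3 * (cmod (?ip f (p l)))\<^sup>2 + 3 * (cmod (?ip r (p l)))\<^sup>2 + 3 * (cmod (?ip h (p l)))\<^sup>2)"
        proof (rule infsum_mono)
          show "(\<lambda>l. (cmod (?ip g (p l)))\<^sup>2) summable_on \<Lambda>0"
            by (rule summable_on_subset_banach[OF gsum \<Lambda>])
          fix l assume "l \<in> \<Lambda>0"
          then have pl: "p l \<in> Hs s \<Omega>" using pV \<Lambda> by blast
          have "?ip r (p l) = ?ip f (p l) - (?ip g (p l) + ?ip h (p l))"
            unfolding r_def split by (simp add: ip_diff[OF f add_mem[OF gV hV] pl] ip_add[OF gV hV pl])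
          then have "?ip g (p l) = ?ip f (p l) - ?ip r (p l) - ?ip h (p l)" by simp
          then show "(cmod (?ip g (p l)))\<^sup>2 \<le> 3 * (cmod (?ip f (p l)))\<^sup>2 + 3 * (cmod (?ip r (p l)))\<^sup>2 + 3 * (cmod (?ip h (p l)))\<^sup>2"
            using cmod_diff3_square by metis
        qed (rule s1)
        also have "\<dots> = 3 * Z + 3 * (\<Sum>\<^sub>\<infinity>l\<in>\<Lambda>0. (cmod (?ip r (p l)))\<^sup>2) + 3 * (\<Sum>\<^sub>\<infinity>l\<in>\<Lambda>0. (cmod (?ip h (p l)))\<^sup>2)"
          unfolding Z_def using BS[OF f] BS[OF rV] BS[OF hV]
          by (simp add: infsum_add summable_on_add summable_on_cmult_right infsum_cmult_right)
        also have "\<dots> \<le> 3 * Z + 3 * (BS * nrm2 r) + 3 * (BS * nrm2 h)"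
          using BS[OF rV] BS[OF hV] unfolding norm_eq by auto
        finally show ?thesis .
      qed
      \<comment> \<open>Cauchy-Schwarz in the wavelet index separates the coefficients of f, bounded
        by Bu, from the couplings, whose sum over the interacting pairs is at most e.\<close>
      have out_le: "(\<Sum>\<^sub>\<infinity>l\<in>\<Lambda> - \<Lambda>0. (cmod (?ip g (p l)))\<^sup>2) \<le> Bu * nrm2 f * e"
      proof (rule infsum_le_finite_sums)
        show "(\<lambda>l. (cmod (?ip g (p l)))\<^sup>2) summable_on \<Lambda> - \<Lambda>0"
          by (rule summable_on_subset_banach[OF gsum]) auto
        fix L assume L: "finite L" "L \<subseteq> \<Lambda> - \<Lambda>0"
        let ?a = "\<lambda>(l, \<theta>). (cmod (?ip (d \<theta>) (p l)))\<^sup>2"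
        have "(\<Sum>l\<in>L. (cmod (?ip g (p l)))\<^sup>2) \<le> (\<Sum>l\<in>L. (Bu * nrm2 f) * (\<Sum>\<theta>\<in>Fi. (cmod (?ip (d \<theta>) (p l)))\<^sup>2))"
        proof (rule sum_mono)
          fix l assume "l \<in> L"
          then have pl: "p l \<in> Hs s \<Omega>" using pV L by blast
          have "cmod (?ip g (p l)) \<le> (\<Sum>\<theta>\<in>Fi. cmod (c \<theta>) * cmod (?ip (d \<theta>) (p l)))"
          proof -
            have "?ip g (p l) = (\<Sum>\<theta>\<in>Fi. c \<theta> * ?ip (d \<theta>) (p l))"
              unfolding g_def by (rule ip_sum[OF fin(1) _ pl]) (simp add: dF)
            then show ?thesis by (simp add: norm_mult order_trans[OF norm_sum])
          qed
          then have "(cmod (?ip g (p l)))\<^sup>2 \<le> (\<Sum>\<theta>\<in>Fi. cmod (c \<theta>) * cmod (?ip (d \<theta>) (p l)))\<^sup>2"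
            by (simp add: power_mono)
          also have "\<dots> \<le> (\<Sum>\<theta>\<in>Fi. (cmod (c \<theta>))\<^sup>2) * (\<Sum>\<theta>\<in>Fi. (cmod (?ip (d \<theta>) (p l)))\<^sup>2)"
            by (rule Cauchy_Schwarz_ineq_sum)
          also have "\<dots> \<le> (Bu * nrm2 f) * (\<Sum>\<theta>\<in>Fi. (cmod (?ip (d \<theta>) (p l)))\<^sup>2)"
            by (rule mult_right_mono[OF Fi_le]) (simp add: sum_nonneg)
          finally show "(cmod (?ip g (p l)))\<^sup>2 \<le> (Bu * nrm2 f) * (\<Sum>\<theta>\<in>Fi. (cmod (?ip (d \<theta>) (p l)))\<^sup>2)" .
        qed
        also have "\<dots> = (Bu * nrm2 f) * (\<Sum>z\<in>L \<times> Fi. ?a z)"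
          by (simp add: sum_distrib_left sum.cartesian_product split_beta)
        also have "(\<Sum>z\<in>L \<times> Fi. ?a z) = (\<Sum>z\<in>(L \<times> Fi) \<inter> Q. ?a z)"
        proof (rule sum.mono_neutral_right)
          show "\<forall>z\<in>L \<times> Fi - (L \<times> Fi) \<inter> Q. ?a z = 0"
          proof
            fix z assume z: "z \<in> L \<times> Fi - (L \<times> Fi) \<inter> Q"
            obtain l \<theta> where lt: "z = (l, \<theta>)" by (cases z)
            have "l \<in> \<Lambda> - \<Lambda>0" "\<theta> \<in> \<Theta>i" "(l, \<theta>) \<notin> Q" using z lt L(2) Fsub(2) by auto
            from Q0[OF this] show "?a z = 0" by (simp add: lt)
          qed
        qed (use L fin in auto)
        also have "\<dots> \<le> infsum ?a Q"
          by (rule finite_sum_le_infsum[OF Q(1)]) (use L fin in auto)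
        also have "\<dots> \<le> e" by (rule Q(2))
        finally show "(\<Sum>l\<in>L. (cmod (?ip g (p l)))\<^sup>2) \<le> Bu * nrm2 f * e"
          using pos nrm2_nonneg[of f] by (simp add: mult_left_mono)
      qed
      have "(\<Sum>\<^sub>\<infinity>l\<in>\<Lambda>. (cmod (?ip g (p l)))\<^sup>2) =
          (\<Sum>\<^sub>\<infinity>l\<in>\<Lambda>0. (cmod (?ip g (p l)))\<^sup>2) + (\<Sum>\<^sub>\<infinity>l\<in>\<Lambda> - \<Lambda>0. (cmod (?ip g (p l)))\<^sup>2)"
        using infsum_Un_disjoint[of "\<lambda>l. (cmod (?ip g (p l)))\<^sup>2" \<Lambda>0 "\<Lambda> - \<Lambda>0"] \<Lambda>
          summable_on_subset_banach[OF gsum, of \<Lambda>0] summable_on_subset_banach[OF gsum, of "\<Lambda> - \<Lambda>0"]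
        by (simp add: Un_absorb1)
      then have "AS * nrm2 g \<le> 3 * Z + 3 * (BS * nrm2 r) + 3 * (BS * nrm2 h) + Bu * nrm2 f * e"
        using g_le in_le out_le by linarith
      moreover have "BS * nrm2 h \<le> BS * (Bd * W)" using h_le pos by (intro mult_left_mono)
      ultimately have "AS * nrm2 g \<le> 3 * Z + 3 * (BS * nrm2 r) + 3 * (BS * (Bd * W)) + Bu * nrm2 f * e" by linarith
      then have "nrm2 g \<le> (3 * Z + 3 * (BS * nrm2 r) + 3 * (BS * (Bd * W)) + Bu * nrm2 f * e) / AS"
        using pos by (simp add: field_simps)
      also have "\<dots> = 3 / AS * Z + 3 * BS / AS * nrm2 r + 3 * BS * Bd / AS * W + (Bu * e / AS) * nrm2 f"
        by (simp add: add_divide_distrib mult_ac)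
      \<comment> \<open>The 1/8 becomes 1/2 after the factor 4 of \<open>splitting_bound\<close> and
        can then be absorbed.\<close>
      also have "(Bu * e / AS) * nrm2 f \<le> 1 / 8 * nrm2 f"
        using small pos by (intro mult_right_mono nrm2_nonneg) (simp add: field_simps)
      finally have g8: "nrm2 g \<le> 3 / AS * Z + 3 * BS / AS * nrm2 r + 3 * BS * Bd / AS * W + 1 / 8 * nrm2 f" by simp
      have "f = (\<lambda>x. r x + (g x + h x))" unfolding r_def split by simp
      then have "nrm2 f \<le> 2 * nrm2 r + 2 * nrm2 (\<lambda>x. g x + h x)"
        using nrm2_add_le[OF rV add_mem[OF gV hV]] by simp
      from splitting_bound[OF this nrm2_add_le[OF gV hV] g8 h_le]
      have "nrm2 f \<le> 2 * nrm2 r + 4 * (3 / AS * Z + 3 * BS / AS * nrm2 r + 3 * BS * Bd / AS * W + 1 / 8 * nrm2 f) + 4 * (Bd * W)" .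
      also have "\<dots> = (2 + 12 * BS / AS) * nrm2 r + (12 / AS * Z + (12 * BS * Bd / AS + 4 * Bd) * W + nrm2 f / 2)"
        by (simp add: algebra_simps)
      finally show ?thesis unfolding r_def .
    qed
    have "nrm2 f \<le> 12 / AS * Z + (12 * BS * Bd / AS + 4 * Bd) * W + nrm2 f / 2"
    proof (rule field_le_epsilon)
      \<comment> \<open>D is the factor in front of the remainder in \<open>est\<close>, so a
        remainder of squared norm at most \<epsilon> / D costs at most \<epsilon>.\<close>
      fix \<epsilon> :: real assume \<epsilon>: "0 < \<epsilon>"
      define D where "D = 2 + 12 * BS / AS"
      have D: "D > 0" unfolding D_def using pos by (simp add: add_pos_nonneg)
      have "((\<lambda>F. Hs_norm s \<Omega> (\<lambda>x. f x - (\<Sum>\<theta>\<in>F. c \<theta> * d \<theta> x))) \<longlongrightarrow> 0) (finite_subsets_at_top \<Theta>)"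
        using rec[OF f] unfolding Hs_has_sum_def c_def .
      then have "eventually (\<lambda>F. dist (Hs_norm s \<Omega> (\<lambda>x. f x - (\<Sum>\<theta>\<in>F. c \<theta> * d \<theta> x))) 0 < sqrt (\<epsilon> / D)) (finite_subsets_at_top \<Theta>)"
        using \<epsilon> D by (intro tendstoD) auto
      then obtain F where F: "finite F" "F \<subseteq> \<Theta>" "\<bar>Hs_norm s \<Omega> (\<lambda>x. f x - (\<Sum>\<theta>\<in>F. c \<theta> * d \<theta> x))\<bar> < sqrt (\<epsilon> / D)"
        unfolding eventually_finite_subsets_at_top by (auto simp: dist_real_def)
      have "nrm2 (\<lambda>x. f x - (\<Sum>\<theta>\<in>F. c \<theta> * d \<theta> x)) = \<bar>Hs_norm s \<Omega> (\<lambda>x. f x - (\<Sum>\<theta>\<in>F. c \<theta> * d \<theta> x))\<bar>\<^sup>2"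
        unfolding norm_eq[symmetric] by simp
      also have "\<dots> \<le> (sqrt (\<epsilon> / D))\<^sup>2" using F(3) by (intro power_mono) auto
      also have "\<dots> = \<epsilon> / D" using \<epsilon> D by simp
      finally have "D * nrm2 (\<lambda>x. f x - (\<Sum>\<theta>\<in>F. c \<theta> * d \<theta> x)) \<le> \<epsilon>" using D by (simp add: field_simps)
      then show "nrm2 f \<le> 12 / AS * Z + (12 * BS * Bd / AS + 4 * Bd) * W + nrm2 f / 2 + \<epsilon>"
        using est[OF F(1,2)] unfolding D_def by linarith
    qed
    then have "nrm2 f \<le> 2 * (12 / AS * Z) + 2 * ((12 * BS * Bd / AS + 4 * Bd) * W)" by linarith
    also have "\<dots> = 2 * (12 / AS) * Z + 2 * (12 * BS * Bd / AS + 4 * Bd) * W"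
      by (simp only: mult.assoc)
    also have "\<dots> \<le> C * Z + C * W"
      using WZ pos unfolding C_def by (intro add_mono mult_right_mono) auto
    finally show ?thesis unfolding W_def Z_def c_def by (simp add: distrib_left)
  qed
  show ?thesis
  proof (intro exI[of _ "1 / C"] conjI ballI)
    show "1 / C > 0" using C by simp
    fix f assume f: "f \<in> Hs s \<Omega>"
    then show "1 / C * (Hs_norm s \<Omega> f)\<^sup>2 \<le>
     (\<Sum>\<^sub>\<infinity>l\<in>\<Lambda>0. (cmod (Hs_inner s \<Omega> f (p l)))\<^sup>2) + (\<Sum>\<^sub>\<infinity>\<theta>\<in>\<Theta> - \<Theta>i. (cmod (Hs_inner s \<Omega> f (u \<theta>)))\<^sup>2)"
      using key[OF f] C unfolding norm_eq by (simp add: field_simps)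
  qed
qed

section \<open>Shearlets\<close>

text \<open>The linear part of the argument of the generator, meaningful for \<iota> = 1 and \<iota>
  = -1. For \<iota> = 0 the value is arbitrary and facts about it exclude that case.\<close>

definition sh_matrix :: "int \<Rightarrow> int \<Rightarrow> int \<Rightarrow> real^2^2" where
  "sh_matrix j k \<iota> = (if \<iota> = 1 then S_mat k ** A_mat j else transpose (S_mat k) ** At_mat j)"

definition sh_shift :: "real \<Rightarrow> real \<Rightarrow> int^2 \<Rightarrow> int \<Rightarrow> real^2" where
  "sh_shift c1 c2 m \<iota> = (if \<iota> = 1 then M_mat c1 c2 else M_mat c2 c1) *v lattice_pt m"

lemma shearlet_affine:
  assumes "\<iota> = 1 \<or> \<iota> = -1"
  shows "shearlet \<phi> \<psi> \<psi>' (c1, c2) (j, k, m, \<iota>) x =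
    complex_of_real (2 powr (3 * real_of_int j / 4)) *
      (if \<iota> = 1 then \<psi> else \<psi>') (sh_matrix j k \<iota> *v x - sh_shift c1 c2 m \<iota>)"
  using assms by (auto simp: sh_matrix_def sh_shift_def)

lemma sh_matrix_apply:
  "(sh_matrix j k 1 *v x) $ 1 = 2 powr real_of_int j * x $ 1 + real_of_int k * 2 powr (real_of_int j / 2) * x $ 2"
  "(sh_matrix j k 1 *v x) $ 2 = 2 powr (real_of_int j / 2) * x $ 2"
  "(sh_matrix j k (-1) *v x) $ 1 = 2 powr (real_of_int j / 2) * x $ 1"
  "(sh_matrix j k (-1) *v x) $ 2 = real_of_int k * 2 powr (real_of_int j / 2) * x $ 1 + 2 powr real_of_int j * x $ 2"
  by (simp_all add: sh_matrix_def S_mat_def A_mat_def At_mat_def matrix_vector_mult_def matrix_matrix_mult_def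
      transpose_def sum_2)

lemma sh_matrix_transpose_apply:
  "(transpose (sh_matrix j k 1) *v x) $ 1 = 2 powr real_of_int j * x $ 1"
  "(transpose (sh_matrix j k 1) *v x) $ 2 = real_of_int k * 2 powr (real_of_int j / 2) * x $ 1 + 2 powr (real_of_int j / 2) * x $ 2"
  "(transpose (sh_matrix j k (-1)) *v x) $ 1 = real_of_int k * 2 powr (real_of_int j / 2) * x $ 2 + 2 powr (real_of_int j / 2) * x $ 1"
  "(transpose (sh_matrix j k (-1)) *v x) $ 2 = 2 powr real_of_int j * x $ 2"
  by (simp_all add: sh_matrix_def S_mat_def A_mat_def At_mat_def matrix_vector_mult_def matrix_matrix_mult_def
      transpose_def sum_2)

lemma sh_matrix_det: "\<iota> = 1 \<or> \<iota> = -1 \<Longrightarrow> det (sh_matrix j k \<iota>) \<noteq> 0"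
  by (auto simp: sh_matrix_def S_mat_def A_mat_def At_mat_def matrix_matrix_mult_def transpose_def sum_2 det_2)

lemma sh_shift_apply:
  "sh_shift c1 c2 m 1 $ 1 = c1 * real_of_int (m $ 1)" "sh_shift c1 c2 m 1 $ 2 = c2 * real_of_int (m $ 2)"
  "sh_shift c1 c2 m (-1) $ 1 = c2 * real_of_int (m $ 1)" "sh_shift c1 c2 m (-1) $ 2 = c1 * real_of_int (m $ 2)"
  by (simp_all add: sh_shift_def M_mat_def lattice_pt_def matrix_vector_mult_def sum_2)

lemma sh_indices_bounds:
  assumes "(j, k, m, \<iota>) \<in> sh_indices"
  shows "0 \<le> j" "\<iota> \<in> {-1, 0, 1}" "\<bar>k\<bar> \<le> \<lceil>2 powr (real_of_int j / 2)\<rceil>" "\<bar>real_of_int k\<bar> \<le> 2 * 2 powr (real_of_int j / 2)"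
    "\<iota> = 0 \<Longrightarrow> j = 0" "(j, k, m', \<iota>) \<in> sh_indices"
proof -
  show j: "0 \<le> j" and i: "\<iota> \<in> {-1, 0, 1}" and "\<iota> = 0 \<Longrightarrow> j = 0" and "(j, k, m', \<iota>) \<in> sh_indices"
    using assms unfolding sh_indices_def by auto
  have p: "1 \<le> 2 powr (real_of_int j / 2)" using j by (simp add: ge_one_powr_ge_zero)
  then have c: "0 \<le> \<lceil>2 powr (real_of_int j / 2)\<rceil>" by linarith
  have "\<bar>k\<bar> \<le> \<bar>\<iota>\<bar> * \<lceil>2 powr (real_of_int j / 2)\<rceil>" using assms unfolding sh_indices_def by auto
  also have "\<dots> \<le> 1 * \<lceil>2 powr (real_of_int j / 2)\<rceil>" using i c by (intro mult_right_mono) auto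
  finally show k: "\<bar>k\<bar> \<le> \<lceil>2 powr (real_of_int j / 2)\<rceil>" by simp
  then have "real_of_int \<bar>k\<bar> \<le> real_of_int \<lceil>2 powr (real_of_int j / 2)\<rceil>" by (simp only: of_int_le_iff)
  also have "\<dots> \<le> 2 powr (real_of_int j / 2) + 1" by linarith
  finally show "\<bar>real_of_int k\<bar> \<le> 2 * 2 powr (real_of_int j / 2)" using p by simp
qed

lemma powr_half_square: "2 powr (real_of_int j / 2) * 2 powr (real_of_int j / 2) = 2 powr real_of_int j"
  by (simp flip: powr_add)

text \<open>The shear entry k 2^(j/2) is at most 2 * 2^j, because |k| \<le> 2 * 2^(j/2), and the
  diagonal entry adds at most 2^j. This is the origin of the constant 3 * 2^j. The unsheared
  coordinate only grows by 2^(j/2).\<close>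

lemma shear_component_bound:
  assumes "0 \<le> j" "\<bar>real_of_int k\<bar> \<le> 2 * 2 powr (real_of_int j / 2)" "\<bar>a\<bar> \<le> r" "\<bar>b\<bar> \<le> r"
  shows "\<bar>2 powr real_of_int j * a\<bar> \<le> 3 * 2 powr real_of_int j * r"
    "\<bar>2 powr (real_of_int j / 2) * a\<bar> \<le> 2 powr (real_of_int j / 2) * r"
    "\<bar>real_of_int k * 2 powr (real_of_int j / 2) * a + 2 powr real_of_int j * b\<bar> \<le> 3 * 2 powr real_of_int j * r"
    "\<bar>real_of_int k * 2 powr (real_of_int j / 2) * a + 2 powr (real_of_int j / 2) * b\<bar> \<le> 3 * 2 powr real_of_int j * r"
proof -
  have r: "0 \<le> r" using assms(3) by linarith
  have h: "2 powr (real_of_int j / 2) \<le> 2 powr real_of_int j" using assms(1) by simp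
  have ka: "\<bar>real_of_int k * 2 powr (real_of_int j / 2) * a\<bar> \<le> 2 * 2 powr real_of_int j * r"
  proof -
    have "\<bar>real_of_int k * 2 powr (real_of_int j / 2) * a\<bar> = \<bar>real_of_int k\<bar> * 2 powr (real_of_int j / 2) * \<bar>a\<bar>"
      by (simp add: abs_mult)
    also have "\<dots> \<le> (2 * 2 powr (real_of_int j / 2)) * 2 powr (real_of_int j / 2) * r"
      using assms r by (intro mult_mono) auto
    finally show ?thesis by (simp add: powr_half_square mult.assoc)
  qed
  have jb: "\<bar>2 powr real_of_int j * b\<bar> \<le> 2 powr real_of_int j * r" if "\<bar>b\<bar> \<le> r" for b
    using that by (simp add: abs_mult)
  have hb: "\<bar>2 powr (real_of_int j / 2) * b\<bar> \<le> 2 powr (real_of_int j / 2) * r" if "\<bar>b\<bar> \<le> r" for b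
    using that by (simp add: abs_mult)
  have hr: "2 powr (real_of_int j / 2) * r \<le> 2 powr real_of_int j * r" using h r by (rule mult_right_mono)
  show "\<bar>2 powr (real_of_int j / 2) * a\<bar> \<le> 2 powr (real_of_int j / 2) * r" by (rule hb[OF assms(3)])
  have jr: "0 \<le> 2 powr real_of_int j * r" using r by simp
  show "\<bar>2 powr real_of_int j * a\<bar> \<le> 3 * 2 powr real_of_int j * r" using jb[OF assms(3)] jr by linarith
  show "\<bar>real_of_int k * 2 powr (real_of_int j / 2) * a + 2 powr real_of_int j * b\<bar> \<le> 3 * 2 powr real_of_int j * r"
    using ka jb[OF assms(4)] by linarith
  show "\<bar>real_of_int k * 2 powr (real_of_int j / 2) * a + 2 powr (real_of_int j / 2) * b\<bar> \<le> 3 * 2 powr real_of_int j * r"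
    using ka hb[OF assms(4)] hr by linarith
qed

lemma sh_matrix_transpose_bound:
  assumes "(j, k, m, \<iota>) \<in> sh_indices" "\<iota> = 1 \<or> \<iota> = -1"
  shows "\<bar>(transpose (sh_matrix j k \<iota>) *v \<eta>) $ i\<bar> \<le> (3 * 2 powr real_of_int j) * decay_weight \<eta>"
proof -
  note b = sh_indices_bounds(1,4)[OF assms(1)]
  note s12 = shear_component_bound[OF b decay_weight_ge(2)[of \<eta> 1] decay_weight_ge(2)[of \<eta> 2]]
  note s21 = shear_component_bound[OF b decay_weight_ge(2)[of \<eta> 2] decay_weight_ge(2)[of \<eta> 1]]
  show ?thesis
    using assms(2) exhaust_2[of i] s12(1,4) s21(1,4)
    by (elim disjE) (simp_all only: sh_matrix_transpose_apply)
qed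

text \<open>The support condition concerns m = 0 only. The shearlet with index m is a translate of
  that one, by the point v that the matrix maps to the lattice shift.\<close>

lemma shearlet_location:
  assumes \<nu>: "(j, k, m, \<iota>) \<in> sh_indices" and S5: "shearlet_support q \<phi> \<psi> \<psi>' (c1, c2)"
  obtains v where "ess_supp (shearlet \<phi> \<psi> \<psi>' (c1, c2) (j, k, m, \<iota>)) \<subseteq> ball v (2 powr (- real_of_int j / 2) * q / 2)"
    and "\<iota> \<noteq> 0 \<Longrightarrow> sh_matrix j k \<iota> *v v = sh_shift c1 c2 m \<iota>"
    and "\<iota> = 0 \<Longrightarrow> v = c1 *\<^sub>R lattice_pt m"
proof -
  have s0: "ess_supp (shearlet \<phi> \<psi> \<psi>' (c1, c2) (j, k, 0, \<iota>)) \<subseteq> ball 0 (2 powr (- real_of_int j / 2) * q / 2)"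
    using S5 sh_indices_bounds(6)[OF \<nu>] unfolding shearlet_support_def by blast
  have l0: "lattice_pt 0 = 0" by (simp add: lattice_pt_def vec_eq_iff)
  have "\<exists>v. (\<forall>x. shearlet \<phi> \<psi> \<psi>' (c1, c2) (j, k, m, \<iota>) x = shearlet \<phi> \<psi> \<psi>' (c1, c2) (j, k, 0, \<iota>) (x - v)) \<and>
     (\<iota> \<noteq> 0 \<longrightarrow> sh_matrix j k \<iota> *v v = sh_shift c1 c2 m \<iota>) \<and> (\<iota> = 0 \<longrightarrow> v = c1 *\<^sub>R lattice_pt m)"
  proof (cases "\<iota> = 0")
    case True
    then show ?thesis by (intro exI[of _ "c1 *\<^sub>R lattice_pt m"]) (simp add: l0)
  next
    case False
    then have i: "\<iota> = 1 \<or> \<iota> = -1" using sh_indices_bounds(2)[OF \<nu>] by auto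
    obtain B' where B': "\<And>x. sh_matrix j k \<iota> *v (B' *v x) = x"
      using matrix_inverse_exists[OF sh_matrix_det[OF i, of j k]] by blast
    have z: "sh_shift c1 c2 0 \<iota> = 0" by (simp add: sh_shift_def l0)
    define v where "v = B' *v sh_shift c1 c2 m \<iota>"
    have "sh_matrix j k \<iota> *v (x - v) = sh_matrix j k \<iota> *v x - sh_shift c1 c2 m \<iota>" for x
      by (simp add: matrix_vector_mult_diff_distrib v_def B')
    then have "shearlet \<phi> \<psi> \<psi>' (c1, c2) (j, k, m, \<iota>) x = shearlet \<phi> \<psi> \<psi>' (c1, c2) (j, k, 0, \<iota>) (x - v)" for x
      unfolding shearlet_affine[OF i] z by simp
    moreover have "sh_matrix j k \<iota> *v v = sh_shift c1 c2 m \<iota>" by (simp add: v_def B')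
    ultimately show ?thesis using False by blast
  qed
  then obtain v where v: "\<And>x. shearlet \<phi> \<psi> \<psi>' (c1, c2) (j, k, m, \<iota>) x = shearlet \<phi> \<psi> \<psi>' (c1, c2) (j, k, 0, \<iota>) (x - v)"
    "\<iota> \<noteq> 0 \<Longrightarrow> sh_matrix j k \<iota> *v v = sh_shift c1 c2 m \<iota>" "\<iota> = 0 \<Longrightarrow> v = c1 *\<^sub>R lattice_pt m" by blast
  have "ess_supp (shearlet \<phi> \<psi> \<psi>' (c1, c2) (j, k, m, \<iota>)) \<subseteq> (+) v ` ess_supp (shearlet \<phi> \<psi> \<psi>' (c1, c2) (j, k, 0, \<iota>))"
    using ess_supp_translate[of "shearlet \<phi> \<psi> \<psi>' (c1, c2) (j, k, 0, \<iota>)" v] v(1) by presburger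
  also have "\<dots> \<subseteq> (+) v ` ball 0 (2 powr (- real_of_int j / 2) * q / 2)" using s0 by (rule image_mono)
  also have "\<dots> = ball v (2 powr (- real_of_int j / 2) * q / 2)" by (simp add: ball_translation[symmetric])
  finally show ?thesis using that v by blast
qed

text \<open>The centre v of a relevant shearlet lies in a fixed disc, so the scaled lattice point,
  being the image of v under the shearlet matrix, lies in a rectangle with sides of order 2^j and
  2^(j/2). Together with O(2^(j/2)) shears this gives O(2^(2j)) indices.\<close>

lemma shearlet_count:
  assumes S5: "shearlet_support q \<phi> \<psi> \<psi>' (c1, c2)" and c: "0 < c1" "0 < c2" and R: "0 < R"
  obtains C where "0 < C" "\<And>j. finite {\<nu> \<in> sh_indices. fst \<nu> = j \<and> ess_supp (shearlet \<phi> \<psi> \<psi>' (c1, c2) \<nu>) \<inter> ball 0 R \<noteq> {}} \<and>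
     real (card {\<nu> \<in> sh_indices. fst \<nu> = j \<and> ess_supp (shearlet \<phi> \<psi> \<psi>' (c1, c2) \<nu>) \<inter> ball 0 R \<noteq> {}}) \<le> C * 2 powr (2 * real_of_int j)"
proof -
  \<comment> \<open>Supports have radius at most q/2 when j \<ge> 0, so centres of supports meeting
    the disc of radius R have norm at most R'.\<close>
  define R' where "R' = R + q / 2"
  define c where "c = min c1 c2"
  have q: "0 < q" using S5 unfolding shearlet_support_def by simp
  have R'0: "0 < R'" using R q by (simp add: R'_def)
  have c0: "0 < c" "c \<le> c1" "c \<le> c2" using c by (auto simp: c_def)
  define X where "X = (\<lambda>j. 3 * 2 powr real_of_int j * R' / c)"
  define Y where "Y = (\<lambda>j. 2 powr (real_of_int j / 2) * R' / c)"
  have XY0: "0 \<le> X j" "0 \<le> Y j" for j using R'0 c0 by (auto simp: X_def Y_def)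
  define n where "n = (\<lambda>j. \<lceil>2 powr (real_of_int j / 2)\<rceil>)"
  define S where "S = (\<lambda>x y. {m :: int^2. \<bar>real_of_int (m $ 1)\<bar> \<le> x \<and> \<bar>real_of_int (m $ 2)\<bar> \<le> y})"
  define T where "T = (\<lambda>j. {j} \<times> {- n j..n j} \<times> (S (X j) (Y j) \<union> S (Y j) (X j)) \<times> {-1, 0, 1 :: int})"
  \<comment> \<open>30 = 5 * 2 * 3: at most 5 * 2^(j/2) shears, two orientations of the rectangle,
    three values of \<iota>.\<close>
  define C where "C = 30 * ((6 * R' / c + 2) * (2 * R' / c + 2))"
  have C: "0 < C" using R'0 c0 unfolding C_def by (intro mult_pos_pos add_pos_pos) auto
  have finS: "finite (S (X j) (Y j))" "finite (S (Y j) (X j))" for j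
    unfolding S_def using lattice_count(1) XY0 by blast+
  have finT: "finite (T j)" for j unfolding T_def using finS by auto
  have sub: "{\<nu> \<in> sh_indices. fst \<nu> = j \<and> ess_supp (shearlet \<phi> \<psi> \<psi>' (c1, c2) \<nu>) \<inter> ball 0 R \<noteq> {}} \<subseteq> T j" for j
  proof
    fix \<nu> assume \<nu>: "\<nu> \<in> {\<nu> \<in> sh_indices. fst \<nu> = j \<and> ess_supp (shearlet \<phi> \<psi> \<psi>' (c1, c2) \<nu>) \<inter> ball 0 R \<noteq> {}}"
    obtain k m \<iota> where eq: "\<nu> = (j, k, m, \<iota>)" using \<nu> by (cases \<nu>) auto
    have idx: "(j, k, m, \<iota>) \<in> sh_indices" using \<nu> eq by auto
    note b = sh_indices_bounds[OF idx]
    obtain v where v: "ess_supp (shearlet \<phi> \<psi> \<psi>' (c1, c2) (j, k, m, \<iota>)) \<subseteq> ball v (2 powr (- real_of_int j / 2) * q / 2)"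
      "\<iota> \<noteq> 0 \<Longrightarrow> sh_matrix j k \<iota> *v v = sh_shift c1 c2 m \<iota>" "\<iota> = 0 \<Longrightarrow> v = c1 *\<^sub>R lattice_pt m"
      using shearlet_location[OF idx S5] by blast
    have "ess_supp (shearlet \<phi> \<psi> \<psi>' (c1, c2) (j, k, m, \<iota>)) \<inter> ball 0 R \<noteq> {}" using \<nu> unfolding eq by simp
    then obtain x where "x \<in> ess_supp (shearlet \<phi> \<psi> \<psi>' (c1, c2) (j, k, m, \<iota>))" and x1: "x \<in> ball 0 R" by blast
    with v(1) have x: "x \<in> ball 0 R" "x \<in> ball v (2 powr (- real_of_int j / 2) * q / 2)" by blast+
    have "2 powr (- real_of_int j / 2) \<le> 2 powr (0 :: real)" using b(1) by (intro powr_mono) auto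
    then have "2 powr (- real_of_int j / 2) * q / 2 \<le> q / 2" using q by simp
    then have "norm v \<le> R'"
      using x norm_triangle_sub[of v x] unfolding R'_def by (simp add: dist_norm)
    then have vi: "\<bar>v $ i\<bar> \<le> R'" for i using component_le_norm_cart[of v i] by linarith
    note s12 = shear_component_bound[OF b(1,4) vi[of 1] vi[of 2]]
    note s21 = shear_component_bound[OF b(1,4) vi[of 2] vi[of 1]]
    have div: "\<bar>z\<bar> \<le> y / c" if "\<bar>c' * z\<bar> \<le> y" "c \<le> c'" for z y c'
    proof -
      have "c * \<bar>z\<bar> \<le> c' * \<bar>z\<bar>" using that(2) by (rule mult_right_mono) simp
      also have "\<dots> = \<bar>c' * z\<bar>" using that(2) c0 by (simp add: abs_mult)
      finally show ?thesis using that(1) c0 by (simp add: field_simps)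
    qed
    have "m \<in> S (X j) (Y j) \<union> S (Y j) (X j)"
    proof -
      consider "\<iota> = 1" | "\<iota> = -1" | "\<iota> = 0" using b(2) by auto
      then show ?thesis
      proof cases
        case 1
        have "c1 * real_of_int (m $ 1) = 2 powr real_of_int j * v $ 1 + real_of_int k * 2 powr (real_of_int j / 2) * v $ 2"
          "c2 * real_of_int (m $ 2) = 2 powr (real_of_int j / 2) * v $ 2"
          using v(2) 1 sh_matrix_apply(1,2)[of j k v] sh_shift_apply(1,2)[of c1 c2 m] by simp_all
        then have "\<bar>c1 * real_of_int (m $ 1)\<bar> \<le> 3 * 2 powr real_of_int j * R'"
          "\<bar>c2 * real_of_int (m $ 2)\<bar> \<le> 2 powr (real_of_int j / 2) * R'"
          using s21(3) s21(2) by (simp_all add: add.commute)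
        then have "m \<in> S (X j) (Y j)" unfolding S_def X_def Y_def using div c0 by blast
        then show ?thesis by simp
      next
        case 2
        have "c2 * real_of_int (m $ 1) = 2 powr (real_of_int j / 2) * v $ 1"
          "c1 * real_of_int (m $ 2) = real_of_int k * 2 powr (real_of_int j / 2) * v $ 1 + 2 powr real_of_int j * v $ 2"
          using v(2) 2 sh_matrix_apply(3,4)[of j k v] sh_shift_apply(3,4)[of c1 c2 m] by simp_all
        then have "\<bar>c2 * real_of_int (m $ 1)\<bar> \<le> 2 powr (real_of_int j / 2) * R'"
          "\<bar>c1 * real_of_int (m $ 2)\<bar> \<le> 3 * 2 powr real_of_int j * R'"
          using s12(2,3) by simp_all
        then have "m \<in> S (Y j) (X j)" unfolding S_def X_def Y_def using div c0 by blast
        then show ?thesis by simp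
      next
        case 3
        then have j: "j = 0" using b(5) by simp
        have "v $ i = c1 * real_of_int (m $ i)" for i using v(3) 3 by (simp add: lattice_pt_def)
        then have "\<bar>c1 * real_of_int (m $ i)\<bar> \<le> R'" for i using vi[of i] by simp
        then have *: "\<bar>real_of_int (m $ i)\<bar> \<le> R' / c" for i using div c0 by blast
        have "R' / c \<le> 3 * R' / c" using R'0 c0 by (simp add: field_simps)
        then have "m \<in> S (X j) (Y j)" unfolding S_def X_def Y_def j using *[of 1] *[of 2] by simp
        then show ?thesis by simp
      qed
    qed
    moreover have "k \<in> {- n j..n j}" using b(3) unfolding n_def by auto
    ultimately show "\<nu> \<in> T j" unfolding T_def eq using b(2) by auto
  qed
  have cardT: "real (card (T j)) \<le> C * 2 powr (2 * real_of_int j)" if j: "0 \<le> j" for j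
  proof -
    define a where "a = 2 powr (real_of_int j / 2)"
    have a1: "1 \<le> a" unfolding a_def using j by (simp add: ge_one_powr_ge_zero)
    have aa: "a * a = 2 powr real_of_int j" unfolding a_def by (rule powr_half_square)
    have aaaa: "a * a * (a * a) = 2 powr (2 * real_of_int j)" unfolding aa by (simp flip: powr_add)
    have nj: "0 \<le> n j" "real_of_int (n j) \<le> 2 * a" using a1 unfolding n_def a_def by linarith+
    have cS: "real (card (S (X j) (Y j) \<union> S (Y j) (X j))) \<le> 2 * ((2 * X j + 2) * (2 * Y j + 2))"
    proof -
      have "real (card (S (X j) (Y j) \<union> S (Y j) (X j))) \<le> real (card (S (X j) (Y j))) + real (card (S (Y j) (X j)))"
        using card_Un_le by (metis of_nat_add of_nat_le_iff)
      also have "\<dots> \<le> (2 * X j + 2) * (2 * Y j + 2) + (2 * Y j + 2) * (2 * X j + 2)"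
        unfolding S_def by (intro add_mono lattice_count(2) XY0)
      finally show ?thesis by (simp add: mult.commute)
    qed
    have "real (card (T j)) = real (nat (2 * n j + 1)) * (real (card (S (X j) (Y j) \<union> S (Y j) (X j))) * 3)"
      unfolding T_def by (simp add: card_cartesian_product)
    also have "\<dots> \<le> (5 * a) * (2 * ((2 * X j + 2) * (2 * Y j + 2)) * 3)"
    proof (rule mult_mono)
      have "real (nat (2 * n j + 1)) = 2 * real_of_int (n j) + 1" using nj(1) by simp
      then show "real (nat (2 * n j + 1)) \<le> 5 * a" using nj(2) a1 by linarith
      show "real (card (S (X j) (Y j) \<union> S (Y j) (X j))) * 3 \<le> 2 * ((2 * X j + 2) * (2 * Y j + 2)) * 3"
        using cS by (intro mult_right_mono) auto
    qed (use a1 in auto)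
    also have "\<dots> \<le> (5 * a) * (2 * ((a * a * (6 * R' / c + 2)) * (a * (2 * R' / c + 2))) * 3)"
    proof -
      have "2 * X j + 2 \<le> a * a * (6 * R' / c + 2)"
        using mult_mono[of 1 a 1 a] a1 unfolding X_def aa by (simp add: algebra_simps)
      moreover have "2 * Y j + 2 \<le> a * (2 * R' / c + 2)"
        using a1 unfolding Y_def a_def[symmetric] by (simp add: algebra_simps)
      ultimately show ?thesis
        using a1 XY0[of j] R'0 c0 by (intro mult_left_mono mult_right_mono mult_mono) (auto intro!: add_nonneg_nonneg mult_nonneg_nonneg)
    qed
    also have "\<dots> = C * (a * a * (a * a))" unfolding C_def by simp
    finally show ?thesis unfolding aaaa .
  qed
  show ?thesis
  proof (rule that[OF C])
    fix j
    let ?S = "{\<nu> \<in> sh_indices. fst \<nu> = j \<and> ess_supp (shearlet \<phi> \<psi> \<psi>' (c1, c2) \<nu>) \<inter> ball 0 R \<noteq> {}}"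
    have "real (card ?S) \<le> C * 2 powr (2 * real_of_int j)"
    proof (cases "0 \<le> j")
      case True
      have "real (card ?S) \<le> real (card (T j))" using card_mono[OF finT sub] by simp
      then show ?thesis using cardT[OF True] by simp
    next
      case False
      then have e: "?S = {}" unfolding sh_indices_def by auto
      show ?thesis unfolding e using C by simp
    qed
    then show "finite ?S \<and> real (card ?S) \<le> C * 2 powr (2 * real_of_int j)"
      using finite_subset[OF sub finT] by blast
  qed
qed

lemma ess_supp_scaled: "ess_supp (scaled s j u) = ess_supp u"
  unfolding ess_supp_def scaled_def by simp

text \<open>The numerator is at most 1, and for \<beta> \<ge> 0 the maximum with 1 commutes with the
  power, which makes the denominator a power of \<open>decay_weight\<close>.\<close>

lemma shearlet_decay_weight:
  assumes "shearlet_decay \<alpha> \<beta> \<psi> \<psi>'" "0 \<le> \<beta>"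
  obtains C where "0 \<le> C" "\<And>\<eta>. cmod (fourier \<psi> \<eta>) \<le> C * decay_weight \<eta> powr (- \<beta>)"
    "\<And>\<eta>. cmod (fourier \<psi>' \<eta>) \<le> C * decay_weight \<eta> powr (- \<beta>)"
proof -
  obtain C1 C2 where C: "0 < C1" "0 < C2"
    "\<And>\<xi>. cmod (fourier \<psi> \<xi>) \<le> C1 * (min 1 (\<bar>\<xi> $ 1\<bar> powr \<alpha>) / (max 1 (\<bar>\<xi> $ 1\<bar> powr \<beta>) * max 1 (\<bar>\<xi> $ 2\<bar> powr \<beta>)))"
    "\<And>\<xi>. cmod (fourier \<psi>' \<xi>) \<le> C2 * (min 1 (\<bar>\<xi> $ 2\<bar> powr \<alpha>) / (max 1 (\<bar>\<xi> $ 1\<bar> powr \<beta>) * max 1 (\<bar>\<xi> $ 2\<bar> powr \<beta>)))"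
    using assms(1) unfolding shearlet_decay_def by blast
  have mx: "max 1 (\<bar>t\<bar> powr \<beta>) = (max 1 \<bar>t\<bar>) powr \<beta>" for t :: real
  proof (cases "\<bar>t\<bar> \<le> 1")
    case True
    then have "\<bar>t\<bar> powr \<beta> \<le> 1" using assms(2) by (simp add: powr_le1)
    with True show ?thesis by simp
  next
    case False
    then have "1 \<le> \<bar>t\<bar> powr \<beta>" using assms(2) by (simp add: ge_one_powr_ge_zero)
    with False show ?thesis by simp
  qed
  have N: "1 / (max 1 (\<bar>\<xi> $ 1\<bar> powr \<beta>) * max 1 (\<bar>\<xi> $ 2\<bar> powr \<beta>)) = decay_weight \<xi> powr (- \<beta>)" for \<xi> :: "real^2"
    unfolding mx decay_weight_def by (simp add: powr_mult powr_minus divide_inverse)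
  have le: "C' * (min 1 x / (max 1 (\<bar>\<xi> $ 1\<bar> powr \<beta>) * max 1 (\<bar>\<xi> $ 2\<bar> powr \<beta>))) \<le> max C1 C2 * decay_weight \<xi> powr (- \<beta>)"
    if "0 < C'" "C' \<le> max C1 C2" "0 \<le> x" for C' x and \<xi> :: "real^2"
    unfolding N[symmetric] using that C(1) by (intro mult_mono divide_right_mono) (auto simp: max_def)
  show ?thesis
  proof (rule that[of "max C1 C2"])
    show "cmod (fourier \<psi> \<eta>) \<le> max C1 C2 * decay_weight \<eta> powr (- \<beta>)" for \<eta>
      by (rule order_trans[OF C(3) le]) (use C in auto)
    show "cmod (fourier \<psi>' \<eta>) \<le> max C1 C2 * decay_weight \<eta> powr (- \<beta>)" for \<eta>
      by (rule order_trans[OF C(4) le]) (use C in auto)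
  qed (use C in auto)
qed

text \<open>The instance of \<open>Hs_inner_fourier_bound\<close> with L = 3 * 2^j. The amplitude k
  combines the L^2 normalisation 2^(3j/4) and the Sobolev scaling 2^(-js).\<close>

lemma shearlet_inner_bound:
  assumes \<nu>: "(j, k, m, \<iota>) \<in> sh_indices" "\<iota> = 1 \<or> \<iota> = -1"
    and p: "scaled s j (shearlet \<phi> \<psi> \<psi>' (c1, c2) (j, k, m, \<iota>)) \<in> Hs s UNIV"
      "bounded (ess_supp (shearlet \<phi> \<psi> \<psi>' (c1, c2) (j, k, m, \<iota>)))"
    and g: "integrable lebesgue \<psi>" "integrable lebesgue \<psi>'"
    and gd: "\<And>\<eta>. cmod (fourier \<psi> \<eta>) \<le> C1 * decay_weight \<eta> powr (- \<beta>)"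
      "\<And>\<eta>. cmod (fourier \<psi>' \<eta>) \<le> C1 * decay_weight \<eta> powr (- \<beta>)" and C1: "0 \<le> C1"
    and u: "u \<in> Hs s UNIV" "bounded (ess_supp u)"
    and ud: "\<And>\<xi>. cmod (fourier u \<xi>) \<le> C2 * \<bar>\<delta> * \<xi> $ i\<bar> powr \<alpha>" and C2: "0 \<le> C2"
    and \<delta>: "0 \<le> \<delta>" and \<alpha>: "0 \<le> \<alpha>" and \<beta>: "2 + 2 * real s + \<alpha> \<le> \<beta>"
  shows "cmod (Hs_inner s UNIV u (scaled s j (shearlet \<phi> \<psi> \<psi>' (c1, c2) (j, k, m, \<iota>)))) \<le>
    sobolev_const s * (2 powr (3 * real_of_int j / 4 - real_of_int j * real s) * C1 * C2 *
       (\<delta> * (3 * 2 powr real_of_int j)) powr \<alpha> * (3 * 2 powr real_of_int j) ^ (2 * s))"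
proof (rule Hs_inner_fourier_bound[OF u p(1) _ sh_matrix_det[OF \<nu>(2), of j k]])
  let ?g = "if \<iota> = 1 then \<psi> else \<psi>'"
  show "bounded (ess_supp (scaled s j (shearlet \<phi> \<psi> \<psi>' (c1, c2) (j, k, m, \<iota>))))"
    using p(2) by (simp add: ess_supp_scaled)
  show "integrable lebesgue ?g" using g by auto
  show "scaled s j (shearlet \<phi> \<psi> \<psi>' (c1, c2) (j, k, m, \<iota>)) x =
      complex_of_real (2 powr (3 * real_of_int j / 4 - real_of_int j * real s)) *
        ?g (sh_matrix j k \<iota> *v x - sh_shift c1 c2 m \<iota>)" for x
  proof -
    have "2 powr (3 * real_of_int j / 4 - real_of_int j * real s) =
        2 powr (- (real_of_int j * real s)) * 2 powr (3 * real_of_int j / 4)"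
      by (simp flip: powr_add)
    then show ?thesis
      unfolding scaled_def shearlet_affine[OF \<nu>(2)] by (simp only: of_real_mult mult.assoc)
  qed
  show "cmod (fourier ?g \<eta>) \<le> C1 * decay_weight \<eta> powr (- \<beta>)" for \<eta> using gd by simp
  show "\<bar>(transpose (sh_matrix j k \<iota>) *v \<eta>) $ i\<bar> \<le> (3 * 2 powr real_of_int j) * decay_weight \<eta>" for \<eta> i
    by (rule sh_matrix_transpose_bound[OF \<nu>])
  have "1 \<le> 2 powr real_of_int j" using sh_indices_bounds(1)[OF \<nu>(1)] by (simp add: ge_one_powr_ge_zero)
  then show "1 \<le> 3 * 2 powr real_of_int j" by simp
qed (use assms in auto)

declare shearlet.simps [simp del]

section \<open>Interaction of interior dual wavelets with boundary shearlets\<close>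

text \<open>Records just the two properties of an interior dual wavelet that the estimates use.
  Unlike the complement of \<open>boundary_w_indices\<close> it does not involve t, so summability
  can be settled before t is chosen.\<close>

definition interior_w_indices ::
    "nat \<Rightarrow> (real^2) set \<Rightarrow> w_index set \<Rightarrow> (w_index \<Rightarrow> cfun) \<Rightarrow> w_index set" where
  "interior_w_indices s \<Omega> \<Theta> d = {\<theta> \<in> \<Theta>. zero_ext \<Omega> (d \<theta>) \<in> Hs s UNIV \<and> ess_supp (zero_ext \<Omega> (d \<theta>)) \<subseteq> \<Omega>}"

text \<open>j' - j / (2\<tau>) for a shearlet of scale j and a wavelet of scale j'. The geometry of
  the boundary strip forces it above t for interacting pairs of a shearlet leaving \<Omega> and an
  interior wavelet.\<close>

definition level_gap :: "real \<Rightarrow> sh_index \<times> w_index \<Rightarrow> real" where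
  "level_gap \<tau> z = real_of_int (fst (snd z)) - real_of_int (fst (fst z)) / (2 * \<tau>)"

lemma sobolev_const_nonneg: "0 \<le> sobolev_const s"
  unfolding sobolev_const_def
  by (intro mult_nonneg_nonneg sum_nonneg Bochner_Integration.integral_nonneg) auto

lemma Hs_inner_zero_ext:
  assumes "open \<Omega>" "f \<in> Hs s \<Omega>" "zero_ext \<Omega> f \<in> Hs s UNIV" "ess_supp (zero_ext \<Omega> f) \<subseteq> \<Omega>" "q \<in> Hs s UNIV"
  shows "Hs_inner s \<Omega> f q = Hs_inner s UNIV (zero_ext \<Omega> f) q"
  using zero_ext_finite_combination(2)[of \<Omega> "{()}" "\<lambda>_. f" s q "\<lambda>_. 1"] assms by simp

text \<open>Meant for the translates of \<phi>: finitely many rows, each summable by the Bessel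
  bound of the dual frame.\<close>

lemma summable_on_finite_product:
  fixes a :: "'l \<times> 't \<Rightarrow> real"
  assumes "finite L" "\<And>l. l \<in> L \<Longrightarrow> (\<lambda>\<theta>. a (l, \<theta>)) summable_on \<Theta>"
  shows "a summable_on (L \<times> \<Theta>)"
  using assms
proof (induction L rule: finite_induct)
  case (insert l L)
  have "(a \<circ> Pair l) summable_on \<Theta>" using insert.prems[of l] by (simp add: o_def)
  then have 1: "a summable_on (Pair l ` \<Theta>)" by (subst summable_on_reindex) (auto simp: inj_on_def)
  have 2: "a summable_on (L \<times> \<Theta>)" using insert by blast
  have "Pair l ` \<Theta> \<inter> L \<times> \<Theta> = {}" using insert.hyps(2) by auto
  with 1 2 have "a summable_on (Pair l ` \<Theta> \<union> L \<times> \<Theta>)" by (rule summable_on_Un_disjoint)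
  moreover have "Pair l ` \<Theta> \<union> L \<times> \<Theta> = insert l L \<times> \<Theta>" by auto
  ultimately show ?case by simp
qed simp

text \<open>Wavelets of scale k whose dual support meets a shearlet support of scale i are centred
  in a disc of radius O(2^(-i/2)), since i/2 \<le> k makes them the smaller objects. Points 2^(-k)
  \<open>q2\<close> apart in such a disc number O(2^(2k-i)).\<close>

lemma dual_count:
  fixes A :: "(real^2) set"
  assumes q2: "0 < q2" and sep: "\<And>m m'. m \<in> A \<Longrightarrow> m' \<in> A \<Longrightarrow> m \<noteq> m' \<Longrightarrow> 2 powr (- k) * q2 \<le> norm (m - m')"
    and A: "A \<subseteq> cball v (2 powr (- k) * q0 + 2 powr (- i / 2) * q / 2)"
    and q: "0 \<le> q0" "0 \<le> q" and ik: "i / 2 \<le> k"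
  shows "finite A \<and> real (card A) \<le> (4 * (q0 + q / 2) / q2 + 2)\<^sup>2 * 2 powr (2 * k - i)"
proof -
  define r where "r = 2 powr (- k) * q0 + 2 powr (- i / 2) * q / 2"
  define \<delta> where "\<delta> = 2 powr (- k) * q2"
  define b where "b = (2 :: real) powr (k - i / 2)"
  have b1: "1 \<le> b" unfolding b_def using ik by (simp add: ge_one_powr_ge_zero)
  have \<delta>: "0 < \<delta>" unfolding \<delta>_def using q2 by simp
  have r0: "0 \<le> r" unfolding r_def using q by simp
  have "(2 :: real) powr (- k) \<le> 2 powr (- i / 2)" using ik by simp
  then have "r \<le> 2 powr (- i / 2) * (q0 + q / 2)"
    unfolding r_def using q by (simp add: distrib_left mult_right_mono)
  then have "4 * r / \<delta> \<le> 4 * (2 powr (- i / 2) * (q0 + q / 2)) / \<delta>"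
    using \<delta> by (intro divide_right_mono mult_left_mono) auto
  also have "\<dots> = b * (4 * (q0 + q / 2) / q2)"
  proof -
    have "2 powr (- i / 2) = b * 2 powr (- k)" unfolding b_def by (simp flip: powr_add)
    then show ?thesis unfolding \<delta>_def by simp
  qed
  finally have "4 * r / \<delta> + 2 \<le> b * (4 * (q0 + q / 2) / q2) + b * 2" using b1 by linarith
  then have le: "4 * r / \<delta> + 2 \<le> b * (4 * (q0 + q / 2) / q2 + 2)" by (simp add: distrib_left)
  have pk: "finite A \<and> real (card A) \<le> (4 * r / \<delta> + 2)\<^sup>2"
    by (rule packing_bound[of A v]) (use A sep \<delta> r0 in \<open>auto simp: r_def \<delta>_def\<close>)
  have "(4 * r / \<delta> + 2)\<^sup>2 \<le> (b * (4 * (q0 + q / 2) / q2 + 2))\<^sup>2"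
    using le r0 \<delta> by (intro power_mono) auto
  also have "\<dots> = (4 * (q0 + q / 2) / q2 + 2)\<^sup>2 * 2 powr (2 * k - i)"
    unfolding power_mult_distrib b_def by (simp add: power2_eq_square mult.commute flip: powr_add)
  finally show ?thesis using pk by linarith
qed

text \<open>Two mechanisms. For \<iota> = 0 there is no Fourier bound, but only finitely many
  translates occur and the Bessel bound of the dual family sums over the wavelets. For the other
  shearlets, the number of pairs at two given scales times the largest squared product decays
  geometrically in both scales.\<close>

lemma coupling_summable:
  fixes s :: nat
  assumes \<Omega>: "open \<Omega>" "\<Omega> \<subseteq> ball 0 R" "0 < R"
    and par: "0 < \<alpha>" "2 + 2 * real s + 2 * \<alpha> < \<beta>" "0 < \<tau>" "0 < \<epsilon>" "((1 - \<epsilon>) / \<tau> - 2) * \<alpha> > 5 / 2"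
    and \<psi>: "\<psi> \<in> L2 UNIV" "\<psi>' \<in> L2 UNIV" and c: "0 < c1" "0 < c2"
    and S2: "shearlet_decay \<alpha>' \<beta> \<psi> \<psi>'"
    and pU: "\<And>\<nu>. \<nu> \<in> sh_indices \<Longrightarrow> scaled s (fst \<nu>) (shearlet \<phi> \<psi> \<psi>' (c1, c2) \<nu>) \<in> Hs s UNIV"
    and S5: "shearlet_support q \<phi> \<psi> \<psi>' (c1, c2)"
    and dV: "\<And>\<theta>. \<theta> \<in> w_indices J0 K \<Longrightarrow> d \<theta> \<in> Hs s \<Omega>"
    and Bd: "\<And>f. f \<in> Hs s \<Omega> \<Longrightarrow> (\<lambda>\<theta>. (cmod (Hs_inner s \<Omega> f (d \<theta>)))\<^sup>2) summable_on w_indices J0 K"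
    and decay: "wavelet_dual_decay s \<Omega> \<alpha> \<beta>' (w_indices J0 K) d"
    and rad: "support_radii \<Omega> (w_indices J0 K) d \<noteq> {}" "0 < support_radius \<Omega> (w_indices J0 K) d"
    and q2: "0 < q2" and sep: "\<And>j m m'. j \<ge> J0 \<Longrightarrow> m \<in> K j \<Longrightarrow> m' \<in> K j \<Longrightarrow> m \<noteq> m' \<Longrightarrow>
        2 powr (- real_of_int j) * q2 \<le> norm (m - m')"
  shows "(\<lambda>(\<nu>, \<theta>). (cmod (Hs_inner s \<Omega> (d \<theta>) (scaled s (fst \<nu>) (shearlet \<phi> \<psi> \<psi>' (c1, c2) \<nu>))))\<^sup>2) summable_on
     {z \<in> sh_indices \<times> interior_w_indices s \<Omega> (w_indices J0 K) d.
        ess_supp (shearlet \<phi> \<psi> \<psi>' (c1, c2) (fst z)) \<inter> ess_supp (zero_ext \<Omega> (d (snd z))) \<noteq> {} \<and> 0 < level_gap \<tau> z}"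
    (is "?a summable_on ?P")
proof -
  interpret semi_inner_space "Hs s \<Omega>" "Hs_inner s \<Omega>" by (rule semi_inner_space_Hs[OF \<Omega>(1)])
  let ?\<Theta> = "w_indices J0 K"
  let ?sh = "shearlet \<phi> \<psi> \<psi>' (c1, c2)"
  let ?p = "\<lambda>\<nu>. scaled s (fst \<nu>) (?sh \<nu>)"
  let ?I = "interior_w_indices s \<Omega> ?\<Theta> d"
  have q: "0 < q" using S5 unfolding shearlet_support_def by simp
  define q0 where "q0 = support_radius \<Omega> ?\<Theta> d"
  have q0: "0 < q0" using rad(2) by (simp add: q0_def)
  \<comment> \<open>The hypothesis on \<tau> forces (1 - \<epsilon>) / \<tau> > 2. Hence 2\<tau> <
    1, and a positive gap makes the wavelet scale at least the shearlet scale.\<close>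
  have "0 < ((1 - \<epsilon>) / \<tau> - 2) * \<alpha>" using par(5) by linarith
  then have "(1 - \<epsilon>) / \<tau> - 2 > 0" using par(1) by (simp add: zero_less_mult_iff)
  then have e\<tau>: "2 * \<tau> < 1 - \<epsilon>" using par(3) by (simp add: field_simps)
  then have \<tau>: "2 * \<tau> < 1" and \<epsilon>: "\<epsilon> < 1" using par(3,4) by linarith+
  obtain Cn where Cn: "0 < Cn" "\<And>j. finite {\<nu> \<in> sh_indices. fst \<nu> = j \<and> ess_supp (?sh \<nu>) \<inter> ball 0 R \<noteq> {}} \<and>
     real (card {\<nu> \<in> sh_indices. fst \<nu> = j \<and> ess_supp (?sh \<nu>) \<inter> ball 0 R \<noteq> {}}) \<le> Cn * 2 powr (2 * real_of_int j)"
    using shearlet_count[OF S5 c \<Omega>(3)] by blast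
  define L where "L = (\<lambda>j. {\<nu> \<in> sh_indices. fst \<nu> = j \<and> ess_supp (?sh \<nu>) \<inter> ball 0 R \<noteq> {}})"
  have L: "finite (L j)" "real (card (L j)) \<le> Cn * 2 powr (2 * real_of_int j)" for j
    using Cn(2)[of j] unfolding L_def by auto
  have inL: "\<nu> \<in> L (fst \<nu>)" if "(\<nu>, \<theta>) \<in> ?P" for \<nu> \<theta>
    using that \<Omega>(2) unfolding L_def interior_w_indices_def by auto
  have pV: "?p \<nu> \<in> Hs s \<Omega>" if "\<nu> \<in> sh_indices" for \<nu> by (rule Hs_restrict[OF \<Omega>(1) pU[OF that]])
  have a0: "0 \<le> ?a z" for z by (simp add: split_beta)
  \<comment> \<open>\<iota> = 0 is split off because the Fourier decay is assumed for \<psi> and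
    \<psi>' only.\<close>
  define P0 where "P0 = {z \<in> ?P. snd (snd (snd (fst z))) = 0}"
  define P1 where "P1 = {z \<in> ?P. snd (snd (snd (fst z))) \<noteq> 0}"
  have "?a summable_on P0"
  proof (rule summable_on_subset_banach)
    show "?a summable_on (L 0 \<times> ?\<Theta>)"
    proof (rule summable_on_finite_product[OF L(1)])
      fix \<nu> assume "\<nu> \<in> L 0"
      then have "\<nu> \<in> sh_indices" unfolding L_def by blast
      then have "?p \<nu> \<in> Hs s \<Omega>" by (rule pV)
      from Bd[OF this]
      have "(\<lambda>\<theta>. (cmod (cnj (Hs_inner s \<Omega> (?p \<nu>) (d \<theta>))))\<^sup>2) summable_on ?\<Theta>" by simp
      then show "(\<lambda>\<theta>. ?a (\<nu>, \<theta>)) summable_on ?\<Theta>" by (simp add: ip_cnj)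
    qed
    show "P0 \<subseteq> L 0 \<times> ?\<Theta>"
    proof
      fix z assume z: "z \<in> P0"
      obtain j k m \<iota> \<theta> where eq: "z = ((j, k, m, \<iota>), \<theta>)" by (metis prod.exhaust)
      have P: "((j, k, m, \<iota>), \<theta>) \<in> ?P" "\<iota> = 0" using z unfolding P0_def eq by auto
      then have "j = 0" using sh_indices_bounds(5)[of j k m \<iota>] by auto
      then show "z \<in> L 0 \<times> ?\<Theta>" using inL[OF P(1)] P(1) unfolding eq interior_w_indices_def by auto
    qed
  qed
  moreover have "?a summable_on P1"
  proof -
    have \<beta>0: "0 \<le> \<beta>" using par(1,2) by linarith
    obtain C1 where C1: "0 \<le> C1" "\<And>\<eta>. cmod (fourier \<psi> \<eta>) \<le> C1 * decay_weight \<eta> powr (- \<beta>)"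
      "\<And>\<eta>. cmod (fourier \<psi>' \<eta>) \<le> C1 * decay_weight \<eta> powr (- \<beta>)"
      by (rule shearlet_decay_weight[OF S2 \<beta>0]) blast
    obtain Cd where Cd: "0 < Cd" "\<And>j m \<upsilon>. (j, m, \<upsilon>) \<in> ?\<Theta> \<Longrightarrow> frontier \<Omega> \<inter> ess_supp (zero_ext \<Omega> (d (j, m, \<upsilon>))) = {} \<Longrightarrow>
       (\<exists>i. \<forall>\<xi>. cmod (fourier (zero_ext \<Omega> (d (j, m, \<upsilon>))) \<xi>) \<le>
          Cd * (2 powr (- (real_of_int j * real s)) * 2 powr (- real_of_int j) *
            (min 1 (\<bar>2 powr (- real_of_int j) * \<xi> $ i\<bar> powr \<alpha>) /
             (max 1 (\<bar>2 powr (- real_of_int j) * \<xi> $ 1\<bar> powr \<beta>') *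
              max 1 (\<bar>2 powr (- real_of_int j) * \<xi> $ 2\<bar> powr \<beta>')))))"
      using decay unfolding wavelet_dual_decay_def
    proof (elim exE conjE)
      fix C
      assume C: "0 < C" and all: "\<forall>(j, m, \<upsilon>)\<in>?\<Theta>. frontier \<Omega> \<inter> ess_supp (zero_ext \<Omega> (d (j, m, \<upsilon>))) = {} \<longrightarrow>
       (\<exists>i. \<forall>\<xi>. cmod (fourier (zero_ext \<Omega> (d (j, m, \<upsilon>))) \<xi>) \<le>
          C * (2 powr (- (real_of_int j * real s)) * 2 powr (- real_of_int j) *
            (min 1 (\<bar>2 powr (- real_of_int j) * \<xi> $ i\<bar> powr \<alpha>) /
             (max 1 (\<bar>2 powr (- real_of_int j) * \<xi> $ 1\<bar> powr \<beta>') *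
              max 1 (\<bar>2 powr (- real_of_int j) * \<xi> $ 2\<bar> powr \<beta>')))))"
      show thesis by (rule that[OF C]) (drule bspec[OF all], simp)
    qed
    have d_decay: "\<exists>i. \<forall>\<xi>. cmod (fourier (zero_ext \<Omega> (d (j, m, \<upsilon>))) \<xi>) \<le>
          (Cd * 2 powr (- (real_of_int j * real s) - real_of_int j)) * \<bar>2 powr (- real_of_int j) * \<xi> $ i\<bar> powr \<alpha>"
      if "(j, m, \<upsilon>) \<in> ?I" for j m \<upsilon>
    proof -
      \<comment> \<open>The decay of the dual elements is granted only off the frontier; a support
        inside the open set \<Omega> is off it.\<close>
      have "frontier \<Omega> \<inter> ess_supp (zero_ext \<Omega> (d (j, m, \<upsilon>))) = {}"
        using that \<Omega>(1) unfolding interior_w_indices_def frontier_def by (auto simp: interior_open)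
      moreover have "(j, m, \<upsilon>) \<in> ?\<Theta>" using that unfolding interior_w_indices_def by simp
      ultimately obtain i where i: "\<forall>\<xi>. cmod (fourier (zero_ext \<Omega> (d (j, m, \<upsilon>))) \<xi>) \<le>
          Cd * (2 powr (- (real_of_int j * real s)) * 2 powr (- real_of_int j) *
            (min 1 (\<bar>2 powr (- real_of_int j) * \<xi> $ i\<bar> powr \<alpha>) /
             (max 1 (\<bar>2 powr (- real_of_int j) * \<xi> $ 1\<bar> powr \<beta>') *
              max 1 (\<bar>2 powr (- real_of_int j) * \<xi> $ 2\<bar> powr \<beta>'))))"
        using Cd(2)[of j m \<upsilon>] by (elim exE meta_impE)
      have le: "min 1 x / (max 1 y * max 1 z) \<le> x" if "0 \<le> x" for x y z :: real
      proof -
        have "1 \<le> max 1 y * max 1 z" using mult_mono[of 1 "max 1 y" 1 "max 1 z"] by simp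
        then have "min 1 x / (max 1 y * max 1 z) \<le> min 1 x / 1" using that by (intro divide_left_mono) auto
        then show ?thesis by simp
      qed
      have "cmod (fourier (zero_ext \<Omega> (d (j, m, \<upsilon>))) \<xi>) \<le>
          Cd * (2 powr (- (real_of_int j * real s)) * 2 powr (- real_of_int j) * \<bar>2 powr (- real_of_int j) * \<xi> $ i\<bar> powr \<alpha>)" for \<xi>
        using Cd(1) by (intro order_trans[OF i[rule_format]] mult_left_mono le) auto
      then show ?thesis by (intro exI[of _ i]) (simp add: mult.assoc powr_diff powr_minus divide_inverse)
    qed
    define D where "D = (4 * (q0 + q / 2) / q2 + 2)\<^sup>2"
    define G where "G = sobolev_const s * (C1 * Cd * 3 powr \<alpha> * 3 ^ (2 * s))"
    have G0: "0 \<le> G" unfolding G_def using C1(1) Cd(1) sobolev_const_nonneg by simp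
    (* At scales j and j' there are O(2^(2j)) shearlets meeting \<Omega>, each of which meets O(2^(2j'-j)) dual
       wavelets, and a squared inner product is O(2^((3/2+2\<alpha>)j-2(1+\<alpha>)j')). The product of the three is
       2^((5/2+2\<alpha>)j-2\<alpha>j'), which is summable over j' > j/(2\<tau>) exactly under the hypothesis on \<tau>. *)
    define \<kappa> where "\<kappa> = (1 - \<epsilon>) * \<alpha> / \<tau> - 5 / 2 - 2 * \<alpha>"
    have \<kappa>: "0 < \<kappa>" using par(5) unfolding \<kappa>_def by (simp add: algebra_simps)
    have val: "?a ((j, k, m, \<iota>), (j', m', \<upsilon>)) \<le> G\<^sup>2 * 2 powr ((3 / 2 + 2 * \<alpha>) * real_of_int j - 2 * (1 + \<alpha>) * real_of_int j')"
      if P: "((j, k, m, \<iota>), (j', m', \<upsilon>)) \<in> P1" and jj: "j \<le> j'" for j k m \<iota> j' m' \<upsilon>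
    proof -
      have idx: "(j, k, m, \<iota>) \<in> sh_indices" "(j', m', \<upsilon>) \<in> ?I" "\<iota> = 1 \<or> \<iota> = -1"
        using P sh_indices_bounds(2)[of j k m \<iota>] unfolding P1_def by auto
      have d: "zero_ext \<Omega> (d (j', m', \<upsilon>)) \<in> Hs s UNIV" "ess_supp (zero_ext \<Omega> (d (j', m', \<upsilon>))) \<subseteq> \<Omega>" "(j', m', \<upsilon>) \<in> ?\<Theta>"
        using idx(2) unfolding interior_w_indices_def by auto
      have b\<Omega>: "bounded \<Omega>" using \<Omega>(2) bounded_ball bounded_subset by blast
      obtain v where v: "ess_supp (?sh (j, k, m, \<iota>)) \<subseteq> ball v (2 powr (- real_of_int j / 2) * q / 2)"
        using shearlet_location[OF idx(1) S5] by blast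
      \<comment> \<open>At scale 0 without shear and shift all matrices are the identity, so the
        generators are themselves shearlets. The support condition then bounds their supports and
        makes them integrable.\<close>
      have idx0: "(0, 0, 0, 1) \<in> sh_indices" "(0, 0, 0, -1) \<in> sh_indices" unfolding sh_indices_def by auto
      have "?sh (0, 0, 0, 1) = \<psi>" "?sh (0, 0, 0, -1) = \<psi>'"
      proof -
        have "lattice_pt 0 = 0" by (simp add: lattice_pt_def vec_eq_iff)
        moreover have "S_mat 0 = mat 1" "A_mat 0 = mat 1" "At_mat 0 = mat 1"
          by (simp_all add: S_mat_def A_mat_def At_mat_def vec_eq_iff forall_2 mat_def)
        ultimately show "?sh (0, 0, 0, 1) = \<psi>" "?sh (0, 0, 0, -1) = \<psi>'"
          by (simp_all add: fun_eq_iff shearlet.simps)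
      qed
      then have "ess_supp \<psi> \<subseteq> ball 0 (q / 2)" "ess_supp \<psi>' \<subseteq> ball 0 (q / 2)"
        using S5 idx0 unfolding shearlet_support_def by force+
      then have "integrable lebesgue \<psi>" "integrable lebesgue \<psi>'"
        using \<psi> bounded_ball bounded_subset by (blast intro: integrable_bounded_ess_supp)+
      obtain i where i: "\<And>\<xi>. cmod (fourier (zero_ext \<Omega> (d (j', m', \<upsilon>))) \<xi>) \<le>
          (Cd * 2 powr (- (real_of_int j' * real s) - real_of_int j')) * \<bar>2 powr (- real_of_int j') * \<xi> $ i\<bar> powr \<alpha>"
        using d_decay[OF idx(2)] by blast
      have eq: "Hs_inner s \<Omega> (d (j', m', \<upsilon>)) (?p (j, k, m, \<iota>)) =
          Hs_inner s UNIV (zero_ext \<Omega> (d (j', m', \<upsilon>))) (scaled s j (?sh (j, k, m, \<iota>)))"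
        using Hs_inner_zero_ext[OF \<Omega>(1) dV[OF d(3)] d(1,2) pU[OF idx(1)]] unfolding fst_conv .
      have bound: "cmod (Hs_inner s UNIV (zero_ext \<Omega> (d (j', m', \<upsilon>))) (scaled s j (?sh (j, k, m, \<iota>)))) \<le>
          sobolev_const s * (2 powr (3 * real_of_int j / 4 - real_of_int j * real s) * C1 *
            (Cd * 2 powr (- (real_of_int j' * real s) - real_of_int j')) *
            (2 powr (- real_of_int j') * (3 * 2 powr real_of_int j)) powr \<alpha> * (3 * 2 powr real_of_int j) ^ (2 * s))"
      proof (rule shearlet_inner_bound[OF idx(1,3) _ _ \<open>integrable lebesgue \<psi>\<close> \<open>integrable lebesgue \<psi>'\<close> C1(2,3,1) d(1) _ i])
        show "scaled s j (?sh (j, k, m, \<iota>)) \<in> Hs s UNIV" using pU[OF idx(1)] unfolding fst_conv .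
        show "bounded (ess_supp (?sh (j, k, m, \<iota>)))" by (rule bounded_subset[OF bounded_ball v])
        show "bounded (ess_supp (zero_ext \<Omega> (d (j', m', \<upsilon>))))" by (rule bounded_subset[OF b\<Omega> d(2)])
      qed (use Cd par in auto)
      also have "\<dots> = G * 2 powr (3 * real_of_int j / 4 - real_of_int j * real s - real_of_int j' * real s - real_of_int j' +
          (real_of_int j - real_of_int j') * \<alpha> + real_of_int j * (2 * real s))"
      proof -
        have "(2 powr (- real_of_int j') * (3 * 2 powr real_of_int j)) powr \<alpha> =
            3 powr \<alpha> * 2 powr ((real_of_int j - real_of_int j') * \<alpha>)"
        proof -
          have "2 powr (- real_of_int j') * (3 * 2 powr real_of_int j) = 3 * 2 powr (real_of_int j - real_of_int j')"
            by (simp add: powr_diff powr_minus divide_inverse)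
          then show ?thesis by (simp only: powr_mult powr_powr)
        qed
        moreover have "(3 * 2 powr real_of_int j) ^ (2 * s) = 3 ^ (2 * s) * 2 powr (real_of_int j * (2 * real s))"
          unfolding power_mult_distrib by (simp add: powr_powr flip: powr_realpow)
        moreover have "2 powr (3 * real_of_int j / 4 - real_of_int j * real s - real_of_int j' * real s - real_of_int j' +
            (real_of_int j - real_of_int j') * \<alpha> + real_of_int j * (2 * real s)) =
          2 powr (3 * real_of_int j / 4 - real_of_int j * real s) * 2 powr (- (real_of_int j' * real s) - real_of_int j') *
          2 powr ((real_of_int j - real_of_int j') * \<alpha>) * 2 powr (real_of_int j * (2 * real s))"
          unfolding powr_add[symmetric] by simp
        ultimately show ?thesis unfolding G_def by (simp only: mult_ac)
      qed
      \<comment> \<open>All powers involving s combine to 2^((j-j')s): a factor 2^(-js) from the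
        shearlet, 2^(-j's) from the dual wavelet, and 2^(2js) from the derivatives. This is at most
        1 as j \<le> j'.\<close>
      also have "\<dots> \<le> G * 2 powr (3 * real_of_int j / 4 - real_of_int j' + (real_of_int j - real_of_int j') * \<alpha>)"
      proof -
        have "(real_of_int j - real_of_int j') * real s \<le> 0"
          using jj by (intro mult_nonpos_nonneg) auto
        then show ?thesis using G0 by (intro mult_left_mono powr_mono) (auto simp: algebra_simps)
      qed
      finally have "(cmod (Hs_inner s UNIV (zero_ext \<Omega> (d (j', m', \<upsilon>))) (scaled s j (?sh (j, k, m, \<iota>)))))\<^sup>2 \<le>
          (G * 2 powr (3 * real_of_int j / 4 - real_of_int j' + (real_of_int j - real_of_int j') * \<alpha>))\<^sup>2"
        by (intro power_mono) auto
      also have "\<dots> = G\<^sup>2 * 2 powr ((3 / 2 + 2 * \<alpha>) * real_of_int j - 2 * (1 + \<alpha>) * real_of_int j')"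
        unfolding power_mult_distrib power2_eq_square[of "2 powr _"] powr_add[symmetric] by (simp add: algebra_simps)
      finally show ?thesis unfolding split_conv eq .
    qed
    \<comment> \<open>The factor 4 accounts for the possible types 0, 1, 2, 3 of a wavelet at one
      location.\<close>
    have cnt: "finite {\<theta> \<in> ?I. fst \<theta> = j' \<and> ess_supp (?sh (j, k, m, \<iota>)) \<inter> ess_supp (zero_ext \<Omega> (d \<theta>)) \<noteq> {}} \<and>
        real (card {\<theta> \<in> ?I. fst \<theta> = j' \<and> ess_supp (?sh (j, k, m, \<iota>)) \<inter> ess_supp (zero_ext \<Omega> (d \<theta>)) \<noteq> {}})
          \<le> 4 * D * 2 powr (2 * real_of_int j' - real_of_int j)"
      if idx: "(j, k, m, \<iota>) \<in> sh_indices" and jj: "j \<le> j'" for j k m \<iota> j'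
    proof (cases "j' \<ge> J0")
      case True
      let ?M = "{\<theta> \<in> ?I. fst \<theta> = j' \<and> ess_supp (?sh (j, k, m, \<iota>)) \<inter> ess_supp (zero_ext \<Omega> (d \<theta>)) \<noteq> {}}"
      define A where "A = (\<lambda>\<theta>. fst (snd \<theta>)) ` ?M"
      obtain v where v: "ess_supp (?sh (j, k, m, \<iota>)) \<subseteq> ball v (2 powr (- real_of_int j / 2) * q / 2)"
        using shearlet_location[OF idx S5] by blast
      have AK: "A \<subseteq> K j'" unfolding A_def interior_w_indices_def w_indices_def by auto
      have Ab: "A \<subseteq> cball v (2 powr (- real_of_int j') * q0 + 2 powr (- real_of_int j / 2) * q / 2)"
      proof
        fix m' assume "m' \<in> A"
        then obtain \<theta> where \<theta>: "\<theta> \<in> ?M" "m' = fst (snd \<theta>)" unfolding A_def by blast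
        define \<upsilon> where "\<upsilon> = snd (snd \<theta>)"
        have "\<theta> = (j', m', \<upsilon>)" using \<theta> by (simp add: \<upsilon>_def prod_eq_iff)
        with \<theta>(1) have th: "(j', m', \<upsilon>) \<in> ?M" by simp
        then obtain x where x: "x \<in> ess_supp (?sh (j, k, m, \<iota>))" "x \<in> ess_supp (zero_ext \<Omega> (d (j', m', \<upsilon>)))" by blast
        have "(j', m', \<upsilon>) \<in> ?\<Theta>" using th unfolding interior_w_indices_def by simp
        then have "dist m' x \<le> 2 powr (- real_of_int j') * q0"
          unfolding q0_def using support_radius_bound[OF rad(1) _ x(2)] by blast
        moreover have "dist v x < 2 powr (- real_of_int j / 2) * q / 2" using v x(1) by auto
        ultimately show "m' \<in> cball v (2 powr (- real_of_int j') * q0 + 2 powr (- real_of_int j / 2) * q / 2)"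
          using dist_triangle2[of v m' x] by simp
      qed
      have cA: "finite A \<and> real (card A) \<le> D * 2 powr (2 * real_of_int j' - real_of_int j)"
        unfolding D_def
      proof (rule dual_count[OF q2 _ Ab])
        show "2 powr (- real_of_int j') * q2 \<le> norm (m' - m'')" if "m' \<in> A" "m'' \<in> A" "m' \<noteq> m''" for m' m''
          using sep[OF True _ _ that(3)] that AK by blast
        show "real_of_int j / 2 \<le> real_of_int j'" using jj sh_indices_bounds(1)[OF idx] by linarith
      qed (use q q0 in auto)
      have sub: "?M \<subseteq> {j'} \<times> A \<times> {0, 1, 2, 3}"
      proof
        fix \<theta> assume th: "\<theta> \<in> ?M"
        then have "fst (snd \<theta>) \<in> A" unfolding A_def by blast
        moreover have "snd (snd \<theta>) \<in> {0, 1, 2, 3}" using th unfolding interior_w_indices_def w_indices_def by auto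
        ultimately show "\<theta> \<in> {j'} \<times> A \<times> {0, 1, 2, 3}" using th by (cases \<theta>) auto
      qed
      have fin: "finite ({j'} \<times> A \<times> {0, 1, 2, 3 :: nat})" using cA by simp
      have "card ?M \<le> card ({j'} \<times> A \<times> {0, 1, 2, 3 :: nat})" by (rule card_mono[OF fin sub])
      also have "\<dots> = card A * 4" by (simp add: card_cartesian_product)
      finally have "real (card ?M) \<le> real (card A) * 4" by (simp flip: of_nat_mult)
      then show ?thesis using finite_subset[OF sub fin] cA by auto
    next
      case False
      have e: "{\<theta> \<in> ?I. fst \<theta> = j' \<and> ess_supp (?sh (j, k, m, \<iota>)) \<inter> ess_supp (zero_ext \<Omega> (d \<theta>)) \<noteq> {}} = {}"
        using False unfolding interior_w_indices_def w_indices_def by auto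
      show ?thesis unfolding e by (simp add: D_def)
    qed
    show ?thesis
    proof (rule summable_on_levels[where lev = "\<lambda>z. (nat (fst (fst z)), nat (fst (snd z)))" and x = "2 powr (- \<kappa>)"
          and y = "2 powr (- (2 * \<alpha> * \<epsilon>))" and C = "Cn * (4 * D) * G\<^sup>2"])
      show "0 \<le> ?a z" for z by (rule a0)
      show "2 powr (- \<kappa>) < 1" "2 powr (- (2 * \<alpha> * \<epsilon>)) < 1"
        using \<kappa> par(1,4) by (simp_all add: powr_less_one)
      show "0 \<le> Cn * (4 * D) * G\<^sup>2" using Cn(1) by (simp add: D_def)
      fix F i k
      assume F: "finite F" "F \<subseteq> {z \<in> P1. (nat (fst (fst z)), nat (fst (snd z))) = (i, k)}"
      show "sum ?a F \<le> Cn * (4 * D) * G\<^sup>2 * ((2 powr (- \<kappa>)) ^ i * (2 powr (- (2 * \<alpha> * \<epsilon>))) ^ k)"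
      proof (cases "F = {}")
        case True
        then show ?thesis using Cn(1) by (simp add: D_def)
      next
        case False
        have z: "z \<in> P1" "fst (fst z) = int i" "fst (snd z) = int k" "real i / (2 * \<tau>) < real k" if "z \<in> F" for z
        proof -
          show zP: "z \<in> P1" using that F by auto
          obtain j a m \<iota> \<theta> where eq: "z = ((j, a, m, \<iota>), \<theta>)" by (metis prod.exhaust)
          have j0: "0 \<le> j" using zP sh_indices_bounds(1)[of j a m \<iota>] unfolding P1_def eq by auto
          have gap: "real_of_int j / (2 * \<tau>) < real_of_int (fst \<theta>)"
            using zP unfolding P1_def eq level_gap_def by auto
          moreover have "0 \<le> real_of_int j / (2 * \<tau>)" using j0 par(3) by simp
          \<comment> \<open>J0 may be negative, and \<open>nat\<close> would then merge scales; the
            positive gap over a shearlet scale j \<ge> 0 rules this out.\<close>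
          ultimately have "0 < real_of_int (fst \<theta>)" by linarith
          then have k0: "0 < fst \<theta>" by simp
          have ik: "nat j = i" "nat (fst \<theta>) = k" using that F unfolding eq by auto
          show "fst (fst z) = int i" "fst (snd z) = int k" using ik j0 k0 unfolding eq by auto
          then show "real i / (2 * \<tau>) < real k" using gap unfolding eq by simp
        qed
        obtain z0 where "z0 \<in> F" using False by blast
        note gap = z(4)[OF this]
        have "1 \<le> 1 / (2 * \<tau>)" using par(3) \<tau> by simp
        from mult_left_mono[OF this, of "real i"] have "real i \<le> real i / (2 * \<tau>)" by simp
        then have ik: "i \<le> k" using gap by linarith
        define M where "M = (\<lambda>\<nu>. {\<theta> \<in> ?I. fst \<theta> = int k \<and> ess_supp (?sh \<nu>) \<inter> ess_supp (zero_ext \<Omega> (d \<theta>)) \<noteq> {}})"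
        have M: "finite (M \<nu>)" "real (card (M \<nu>)) \<le> 4 * D * 2 powr (2 * real k - real i)"
          if \<nu>L: "\<nu> \<in> L (int i)" for \<nu>
        proof -
          obtain a m \<iota> where eq: "\<nu> = (int i, a, m, \<iota>)" using \<nu>L unfolding L_def by (cases \<nu>) auto
          have idx: "(int i, a, m, \<iota>) \<in> sh_indices" using \<nu>L unfolding L_def eq by auto
          have ik': "int i \<le> int k" using ik by simp
          show "finite (M \<nu>)" "real (card (M \<nu>)) \<le> 4 * D * 2 powr (2 * real k - real i)"
            using cnt[OF idx ik'] unfolding M_def eq by auto
        qed
        have FS: "F \<subseteq> Sigma (L (int i)) M"
        proof
          fix y assume y: "y \<in> F"
          obtain \<nu> \<theta> where eq: "y = (\<nu>, \<theta>)" by (cases y)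
          have yP: "(\<nu>, \<theta>) \<in> ?P" using z(1)[OF y] unfolding P1_def eq by simp
          have "\<nu> \<in> L (int i)" using inL[OF yP] z(2)[OF y] unfolding eq by simp
          moreover have "\<theta> \<in> M \<nu>" using yP z(3)[OF y] unfolding M_def eq by auto
          ultimately show "y \<in> Sigma (L (int i)) M" unfolding eq by simp
        qed
        have finS: "finite (Sigma (L (int i)) M)" by (rule finite_SigmaI[OF L(1) M(1)])
        define V where "V = G\<^sup>2 * 2 powr ((3 / 2 + 2 * \<alpha>) * real i - 2 * (1 + \<alpha>) * real k)"
        have V0: "0 \<le> V" unfolding V_def by simp
        have aV: "?a y \<le> V" if "y \<in> F" for y
        proof -
          obtain j a m \<iota> j' m' \<upsilon> where eq: "y = ((j, a, m, \<iota>), (j', m', \<upsilon>))" by (metis prod.exhaust)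
          have "j = int i" "j' = int k" using z(2,3)[OF that] unfolding eq by auto
          then show ?thesis using val[OF z(1)[OF that, unfolded eq]] ik unfolding V_def eq by simp
        qed
        have "sum ?a F \<le> real (card F) * V" by (rule sum_bounded_above[OF aV])
        also have "\<dots> \<le> (Cn * (4 * D) * 2 powr (2 * real i) * 2 powr (2 * real k - real i)) * V"
        proof (rule mult_right_mono[OF _ V0])
          have "real (card F) \<le> real (card (Sigma (L (int i)) M))" using card_mono[OF finS FS] by simp
          also have "\<dots> = (\<Sum>\<nu>\<in>L (int i). real (card (M \<nu>)))" using L(1) M(1) by (simp add: card_SigmaI)
          also have "\<dots> \<le> real (card (L (int i))) * (4 * D * 2 powr (2 * real k - real i))"
            by (rule sum_bounded_above[OF M(2)])
          also have "\<dots> \<le> (Cn * 2 powr (2 * real i)) * (4 * D * 2 powr (2 * real k - real i))"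
            using L(2)[of "int i"] by (intro mult_right_mono) (auto simp: D_def)
          finally show "real (card F) \<le> Cn * (4 * D) * 2 powr (2 * real i) * 2 powr (2 * real k - real i)"
            by (simp only: mult_ac)
        qed
        also have "\<dots> = Cn * (4 * D) * G\<^sup>2 * 2 powr ((5 / 2 + 2 * \<alpha>) * real i - 2 * \<alpha> * real k)"
        proof -
          have "2 powr (2 * real i) * 2 powr (2 * real k - real i) * 2 powr ((3 / 2 + 2 * \<alpha>) * real i - 2 * (1 + \<alpha>) * real k) =
              2 powr ((5 / 2 + 2 * \<alpha>) * real i - 2 * \<alpha> * real k)"
            unfolding powr_add[symmetric] by (simp add: algebra_simps)
          from this[symmetric] show ?thesis unfolding V_def by (simp only: mult_ac)
        qed
        also have "\<dots> \<le> Cn * (4 * D) * G\<^sup>2 * 2 powr (- \<kappa> * real i + (- (2 * \<alpha> * \<epsilon>)) * real k)"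
        proof -
          \<comment> \<open>The gap says 2k > i / \<tau>. Writing 2\<alpha>k =
            2\<alpha>(1-\<epsilon>)k + 2\<alpha>\<epsilon>k, the first part outweighs the growth in
            i and leaves -\<kappa> i; the second part keeps decay in k.\<close>
          have "real i / \<tau> * (\<alpha> * (1 - \<epsilon>)) \<le> 2 * real k * (\<alpha> * (1 - \<epsilon>))"
            using gap par(1) \<epsilon> par(3) by (intro mult_right_mono) (auto simp: field_simps)
          then have "(5 / 2 + 2 * \<alpha>) * real i - 2 * \<alpha> * real k \<le> - \<kappa> * real i + (- (2 * \<alpha> * \<epsilon>)) * real k"
            unfolding \<kappa>_def by (simp add: algebra_simps diff_divide_distrib)
          then show ?thesis using Cn(1) by (intro mult_left_mono powr_mono) (auto simp: D_def)
        qed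
        also have "2 powr (- \<kappa> * real i + (- (2 * \<alpha> * \<epsilon>)) * real k) = (2 powr (- \<kappa>)) ^ i * (2 powr (- (2 * \<alpha> * \<epsilon>))) ^ k"
        proof -
          have pw: "(2 powr y) ^ n = 2 powr (y * real n)" for y :: real and n
            by (simp add: powr_powr flip: powr_realpow)
          show ?thesis by (simp only: pw powr_add)
        qed
        finally show ?thesis .
      qed
    qed auto
  qed
  ultimately have "?a summable_on (P0 \<union> P1)"
    by (rule summable_on_Un_disjoint) (auto simp: P0_def P1_def)
  moreover have "P0 \<union> P1 = ?P" unfolding P0_def P1_def by blast
  ultimately show ?thesis by simp
qed

lemma Hs_frame_bounds:
  assumes "Hs_frame s \<Omega> I u"
  obtains A B where "0 < A" "A \<le> B"
    "\<And>f. f \<in> Hs s \<Omega> \<Longrightarrow> (\<lambda>i. (cmod (Hs_inner s \<Omega> f (u i)))\<^sup>2) summable_on I \<and>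
      A * (Hs_norm s \<Omega> f)\<^sup>2 \<le> (\<Sum>\<^sub>\<infinity>i\<in>I. (cmod (Hs_inner s \<Omega> f (u i)))\<^sup>2) \<and>
      (\<Sum>\<^sub>\<infinity>i\<in>I. (cmod (Hs_inner s \<Omega> f (u i)))\<^sup>2) \<le> B * (Hs_norm s \<Omega> f)\<^sup>2"
  using assms unfolding Hs_frame_def by blast

theorem theorem3p4:
  fixes s :: nat
    and \<Omega> :: "(real^2) set"
    and E :: "cfun \<Rightarrow> cfun"
    and M_ext \<alpha>_w \<alpha>_sh \<beta>_w \<beta>_sh \<tau> \<epsilon> c1 c2 q_sh :: real
    and \<phi> \<psi> \<psi>' :: cfun
    and J0 :: int
    and K :: "int \<Rightarrow> (real^2) set"
    and \<omega> d :: "w_index \<Rightarrow> cfun"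
  assumes "open \<Omega>" and "connected \<Omega>" and "\<Omega> \<noteq> {}" and "bounded \<Omega>"
    and "M_ext > 0" and "extension_operator s \<Omega> E M_ext"
    and "\<alpha>_w > 1" and "\<alpha>_sh > 0" and "\<beta>_w > 0" and "\<beta>_w \<ge> real s"
    and "\<beta>_sh > 2 + 2 * real s + 2 * \<alpha>_w"
    and "\<tau> > 0" and "\<epsilon> > 0" and "((1 - \<epsilon>) / \<tau> - 2) * \<alpha>_w > 5 / 2"
    and "\<phi> \<in> L2 UNIV" and "\<psi> \<in> L2 UNIV" and "\<psi>' \<in> L2 UNIV" and "c1 > 0" and "c2 > 0"
    and S2: "shearlet_decay \<alpha>_sh \<beta>_sh \<psi> \<psi>'"
    and S4: "shearlet_sobolev_frame s \<phi> \<psi> \<psi>' (c1, c2)"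
    and S5: "shearlet_support q_sh \<phi> \<psi> \<psi>' (c1, c2)"
    and W: "boundary_wavelet_system \<Omega> J0 K \<omega>"
    and W2: "wavelet_characterization s \<Omega> (w_indices J0 K) \<omega>"
    and W3: "wavelet_dual_condition s \<Omega> \<alpha>_w \<beta>_w (w_indices J0 K) \<omega> d"
    and W4: "wavelet_support_condition \<Omega> J0 K \<omega>"
  shows "\<exists>T>0. \<forall>t\<ge>T. \<exists>A B. 0 < A \<and> A \<le> B \<and>
    (let I = bsh_indices \<Omega> \<phi> \<psi> \<psi>' (c1, c2) (w_indices J0 K) \<omega> d q_sh t \<tau>;
         u = (\<lambda>n. scaled s (bsh_scale n) (bsh \<phi> \<psi> \<psi>' (c1, c2) \<omega> n))
     in \<forall>f\<in>Hs s \<Omega>.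
          (\<lambda>n. (cmod (Hs_inner s \<Omega> f (u n)))\<^sup>2) summable_on I \<and>
          A * (Hs_norm s \<Omega> f)\<^sup>2 \<le> (\<Sum>\<^sub>\<infinity>n\<in>I. (cmod (Hs_inner s \<Omega> f (u n)))\<^sup>2) \<and>
          (\<Sum>\<^sub>\<infinity>n\<in>I. (cmod (Hs_inner s \<Omega> f (u n)))\<^sup>2) \<le> B * (Hs_norm s \<Omega> f)\<^sup>2)"
proof -
  let ?\<Theta> = "w_indices J0 K"
  let ?sh = "shearlet \<phi> \<psi> \<psi>' (c1, c2)"
  let ?\<Lambda>0 = "interior_sh_indices \<Omega> \<phi> \<psi> \<psi>' (c1, c2)"
  let ?ip = "Hs_inner s \<Omega>"
  define p where "p = (\<lambda>\<nu>. scaled s (fst \<nu>) (?sh \<nu>))"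
  define w where "w = (\<lambda>\<theta>. scaled s (fst \<theta>) (\<omega> \<theta>))"
  note \<Omega> = \<open>open \<Omega>\<close>
  have frS: "Hs_frame s UNIV sh_indices p"
    using S4 unfolding shearlet_sobolev_frame_def p_def by blast
  have frU: "Hs_frame s \<Omega> ?\<Theta> w" and frD: "Hs_frame s \<Omega> ?\<Theta> d"
    and rec: "\<And>f. f \<in> Hs s \<Omega> \<Longrightarrow> Hs_has_sum s \<Omega> (\<lambda>\<theta> x. ?ip f (w \<theta>) * d \<theta> x) ?\<Theta> f"
    and decay: "wavelet_dual_decay s \<Omega> \<alpha>_w \<beta>_w ?\<Theta> d"
    and rad: "support_radii \<Omega> ?\<Theta> d \<noteq> {}" "0 < support_radius \<Omega> ?\<Theta> d"
    using W3 unfolding wavelet_dual_condition_def Hs_dual_frame_def w_def by auto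
  have pU: "p \<nu> \<in> Hs s UNIV" if "\<nu> \<in> sh_indices" for \<nu>
    using frS that unfolding Hs_frame_def by blast
  have wV: "w \<theta> \<in> Hs s \<Omega>" and dV: "d \<theta> \<in> Hs s \<Omega>" if "\<theta> \<in> ?\<Theta>" for \<theta>
    using frU frD that unfolding Hs_frame_def by blast+

  \<comment> \<open>Constants of the three frames\<close>
  obtain AS BS where S: "0 < AS" "AS \<le> BS" "\<And>g. g \<in> Hs s UNIV \<Longrightarrow>
      (\<lambda>\<nu>. (cmod (Hs_inner s UNIV g (p \<nu>)))\<^sup>2) summable_on sh_indices \<and>
      AS * (Hs_norm s UNIV g)\<^sup>2 \<le> (\<Sum>\<^sub>\<infinity>\<nu>\<in>sh_indices. (cmod (Hs_inner s UNIV g (p \<nu>)))\<^sup>2) \<and>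
      (\<Sum>\<^sub>\<infinity>\<nu>\<in>sh_indices. (cmod (Hs_inner s UNIV g (p \<nu>)))\<^sup>2) \<le> BS * (Hs_norm s UNIV g)\<^sup>2"
    by (rule Hs_frame_bounds[OF frS]) (rule that)
  obtain Au Bu where U: "0 < Au" "Au \<le> Bu" "\<And>f. f \<in> Hs s \<Omega> \<Longrightarrow>
      (\<lambda>\<theta>. (cmod (?ip f (w \<theta>)))\<^sup>2) summable_on ?\<Theta> \<and>
      Au * (Hs_norm s \<Omega> f)\<^sup>2 \<le> (\<Sum>\<^sub>\<infinity>\<theta>\<in>?\<Theta>. (cmod (?ip f (w \<theta>)))\<^sup>2) \<and>
      (\<Sum>\<^sub>\<infinity>\<theta>\<in>?\<Theta>. (cmod (?ip f (w \<theta>)))\<^sup>2) \<le> Bu * (Hs_norm s \<Omega> f)\<^sup>2"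
    by (rule Hs_frame_bounds[OF frU]) (rule that)
  obtain Ad Bd where D: "0 < Ad" "Ad \<le> Bd" "\<And>f. f \<in> Hs s \<Omega> \<Longrightarrow>
      (\<lambda>\<theta>. (cmod (?ip f (d \<theta>)))\<^sup>2) summable_on ?\<Theta> \<and>
      Ad * (Hs_norm s \<Omega> f)\<^sup>2 \<le> (\<Sum>\<^sub>\<infinity>\<theta>\<in>?\<Theta>. (cmod (?ip f (d \<theta>)))\<^sup>2) \<and>
      (\<Sum>\<^sub>\<infinity>\<theta>\<in>?\<Theta>. (cmod (?ip f (d \<theta>)))\<^sup>2) \<le> Bd * (Hs_norm s \<Omega> f)\<^sup>2"
    by (rule Hs_frame_bounds[OF frD]) (rule that)
  obtain q2 where q2: "0 < q2" "\<And>j m m'. j \<ge> J0 \<Longrightarrow> m \<in> K j \<Longrightarrow> m' \<in> K j \<Longrightarrow> m \<noteq> m' \<Longrightarrow>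
      2 powr (- real_of_int j) * q2 \<le> norm (m - m')"
    and rad1: "0 < support_radius \<Omega> ?\<Theta> \<omega>"
    using W4 unfolding wavelet_support_condition_def by metis
  have q: "0 < q_sh" using S5 unfolding shearlet_support_def by simp
  obtain R where R: "0 < R" "\<Omega> \<subseteq> ball 0 R" using bounded_subset_ballD[OF \<open>bounded \<Omega>\<close>, of 0] by blast
  define M where "M = BS * M_ext\<^sup>2"
  have M0: "0 \<le> M" using S(1,2) unfolding M_def by simp
  \<comment> \<open>For a shearlet supported in \<Omega>, the inner product of f over \<Omega> is
    that of its extension over the plane. The upper frame bound there, together with the norm of the
    extension, gives BS M_ext^2.\<close>
  have upper: "(\<lambda>\<nu>. (cmod (?ip f (p \<nu>)))\<^sup>2) summable_on ?\<Lambda>0 \<and>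
      (\<Sum>\<^sub>\<infinity>\<nu>\<in>?\<Lambda>0. (cmod (?ip f (p \<nu>)))\<^sup>2) \<le> M * (Hs_norm s \<Omega> f)\<^sup>2" if f: "f \<in> Hs s \<Omega>" for f
  proof -
    have sets: "\<Omega> \<in> sets lebesgue" using \<Omega> by auto
    have Ef: "E f \<in> Hs s UNIV" "AE x in lebesgue_on \<Omega>. E f x = f x" "Hs_norm s UNIV (E f) \<le> M_ext * Hs_norm s \<Omega> f"
      using \<open>extension_operator s \<Omega> E M_ext\<close> f unfolding extension_operator_def by blast+
    have eq: "?ip f (p \<nu>) = Hs_inner s UNIV (E f) (p \<nu>)" if "\<nu> \<in> ?\<Lambda>0" for \<nu>
    proof -
      have \<nu>: "\<nu> \<in> sh_indices" "ess_supp (p \<nu>) \<subseteq> \<Omega>"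
        using that unfolding interior_sh_indices_def p_def ess_supp_scaled by auto
      have "?ip f (p \<nu>) = ?ip (E f) (p \<nu>)"
        by (rule Hs_inner_AE_cong[OF \<Omega> Hs_restrict[OF \<Omega> Ef(1)] Hs_restrict[OF \<Omega> pU[OF \<nu>(1)]] Ef(2), symmetric])
      also have "\<dots> = Hs_inner s UNIV (E f) (p \<nu>)" by (rule Hs_inner_restrict[OF \<Omega> Ef(1) pU[OF \<nu>(1)] \<nu>(2)])
      finally show ?thesis .
    qed
    have sub: "?\<Lambda>0 \<subseteq> sh_indices" unfolding interior_sh_indices_def by auto
    have s: "(\<lambda>\<nu>. (cmod (Hs_inner s UNIV (E f) (p \<nu>)))\<^sup>2) summable_on sh_indices" using S(3)[OF Ef(1)] by simp
    have s0: "(\<lambda>\<nu>. (cmod (Hs_inner s UNIV (E f) (p \<nu>)))\<^sup>2) summable_on ?\<Lambda>0"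
      by (rule summable_on_subset_banach[OF s sub])
    have "(\<Sum>\<^sub>\<infinity>\<nu>\<in>?\<Lambda>0. (cmod (?ip f (p \<nu>)))\<^sup>2) = (\<Sum>\<^sub>\<infinity>\<nu>\<in>?\<Lambda>0. (cmod (Hs_inner s UNIV (E f) (p \<nu>)))\<^sup>2)"
      by (rule infsum_cong) (simp add: eq)
    also have "\<dots> \<le> (\<Sum>\<^sub>\<infinity>\<nu>\<in>sh_indices. (cmod (Hs_inner s UNIV (E f) (p \<nu>)))\<^sup>2)"
      by (rule infsum_mono_neutral[OF s0 s]) (use sub in auto)
    also have "\<dots> \<le> BS * (Hs_norm s UNIV (E f))\<^sup>2" using S(3)[OF Ef(1)] by simp
    also have "\<dots> \<le> BS * (M_ext * Hs_norm s \<Omega> f)\<^sup>2"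
      using S(1,2) Ef(3) by (intro mult_left_mono power_mono) (auto simp: Hs_norm_def Hs_inner_self)
    also have "\<dots> = M * (Hs_norm s \<Omega> f)\<^sup>2" by (simp add: M_def power_mult_distrib)
    finally have "(\<Sum>\<^sub>\<infinity>\<nu>\<in>?\<Lambda>0. (cmod (?ip f (p \<nu>)))\<^sup>2) \<le> M * (Hs_norm s \<Omega> f)\<^sup>2" .
    moreover have "(\<lambda>\<nu>. (cmod (?ip f (p \<nu>)))\<^sup>2) summable_on ?\<Lambda>0"
      by (rule summable_on_cong[THEN iffD2, OF _ s0]) (simp add: eq)
    ultimately show ?thesis by blast
  qed

  \<comment> \<open>Choice of the threshold T\<close>
  define a where "a = (\<lambda>(\<nu>, \<theta>). (cmod (?ip (d \<theta>) (p \<nu>)))\<^sup>2)"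
  define P where "P = {z \<in> sh_indices \<times> interior_w_indices s \<Omega> ?\<Theta> d.
        ess_supp (?sh (fst z)) \<inter> ess_supp (zero_ext \<Omega> (d (snd z))) \<noteq> {} \<and> 0 < level_gap \<tau> z}"
  have aP: "a summable_on P"
    unfolding a_def P_def p_def
  proof (rule coupling_summable[OF \<Omega> R(2,1)])
    show "2 + 2 * real s + 2 * \<alpha>_w < \<beta>_sh" "0 < \<tau>" "0 < \<epsilon>" "((1 - \<epsilon>) / \<tau> - 2) * \<alpha>_w > 5 / 2" by fact+
    show "0 < q2" by (rule q2(1))
    show "2 powr (- real_of_int j) * q2 \<le> norm (m - m')"
      if "J0 \<le> j" "m \<in> K j" "m' \<in> K j" "m \<noteq> m'" for j m m' using q2(2) that by blast
    show "scaled s (fst \<nu>) (?sh \<nu>) \<in> Hs s UNIV" if "\<nu> \<in> sh_indices" for \<nu>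
      using pU[OF that] unfolding p_def .
    show "(\<lambda>\<theta>. (cmod (?ip f (d \<theta>)))\<^sup>2) summable_on ?\<Theta>" if "f \<in> Hs s \<Omega>" for f using D(3)[OF that] by simp
  qed (use assms dV decay rad in auto)
  \<comment> \<open>The coupling that \<open>frame_absorption\<close> tolerates. It depends only on
    frame constants, so T can be chosen before t.\<close>
  define e where "e = AS / (8 * Bu)"
  have Bu: "0 < Bu" using U by linarith
  have e: "0 < e" "8 * Bu * e \<le> AS" using S(1) Bu unfolding e_def by auto
  have a0: "0 \<le> a z" if "z \<in> P" for z unfolding a_def by (simp add: split_beta)
  obtain T where T: "T > 0" "\<And>t. t \<ge> T \<Longrightarrow> infsum a {z \<in> P. t < level_gap \<tau> z} \<le> e"
    by (rule infsum_tail[OF aP a0 e(1), of "level_gap \<tau>"], assumption) (rule that)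
  show ?thesis
  proof (rule exI[of _ T], intro conjI allI impI)
    show "T > 0" by (rule T(1))
    fix t assume t: "t \<ge> T"
    let ?\<Theta>b = "boundary_w_indices \<Omega> ?\<Theta> \<omega> d q_sh t \<tau>"
    have \<Theta>b: "?\<Theta>b \<subseteq> ?\<Theta>" unfolding boundary_w_indices_def by auto
    define \<rho> where "\<rho> = support_radius \<Omega> ?\<Theta> d + support_radius \<Omega> ?\<Theta> \<omega>"
    \<comment> \<open>The index condition keeps the ball of radius 2^(-j) \<rho> away from the strip
      and thereby inside \<Omega>. The dual support needs only the first summand of \<rho>; the
      second one is the margin for extension by zero.\<close>
    have interior: "zero_ext \<Omega> (d \<theta>) \<in> Hs s UNIV" "ess_supp (zero_ext \<Omega> (d \<theta>)) \<subseteq> \<Omega>"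
      "ess_supp (zero_ext \<Omega> (d \<theta>)) \<inter> boundary_strip \<Omega> q_sh (\<tau> * (real_of_int (fst \<theta>) - t)) = {}"
      if \<theta>: "\<theta> \<in> ?\<Theta> - ?\<Theta>b" for \<theta>
    proof -
      obtain j m \<upsilon> where eq: "\<theta> = (j, m, \<upsilon>)" by (cases \<theta>)
      have \<theta>\<Theta>: "(j, m, \<upsilon>) \<in> ?\<Theta>" using \<theta> eq by simp
      define r where "r = 2 powr (- real_of_int j) * support_radius \<Omega> ?\<Theta> d"
      define r' where "r' = 2 powr (- real_of_int j) * \<rho>"
      have r: "0 < r" "r < r'" using rad(2) rad1 unfolding r_def r'_def \<rho>_def by auto
      have "J0 \<le> j" "m \<in> K j" using \<theta>\<Theta> unfolding w_indices_def by auto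
      then have m: "m \<in> \<Omega>" using W unfolding boundary_wavelet_system_def by blast
      have disj: "ball m r' \<inter> boundary_strip \<Omega> q_sh (\<tau> * (real_of_int j - t)) = {}"
        using \<theta> unfolding eq boundary_w_indices_def r'_def \<rho>_def by auto
      have b\<Omega>: "ball m r' \<subseteq> \<Omega>" by (rule ball_inside_if_avoids_strip[OF m q disj])
      \<comment> \<open>Radii strictly between r and r': the support lies in the closed ball of
        radius r and needs an open one, and the cutoff needs a closed ball in \<Omega>.\<close>
      define r1 where "r1 = (2 * r + r') / 3"
      define r2 where "r2 = (r + 2 * r') / 3"
      have rr: "r < r1" "r1 < r2" "r2 < r'" using r unfolding r1_def r2_def by (simp_all add: field_simps)
      have sup: "ess_supp (zero_ext \<Omega> (d \<theta>)) \<subseteq> cball m r"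
        using support_radius_bound[OF rad(1) \<theta>\<Theta>] unfolding eq r_def by auto
      also have "cball m r \<subseteq> ball m r1" using rr by (auto intro: le_less_trans)
      finally have sup1: "ess_supp (zero_ext \<Omega> (d \<theta>)) \<subseteq> ball m r1" .
      have "cball m r2 \<subseteq> ball m r'" using rr by (auto intro: le_less_trans)
      then have "cball m r2 \<subseteq> \<Omega>" using b\<Omega> by blast
      moreover have "\<theta> \<in> ?\<Theta>" using \<theta> by simp
      ultimately show "zero_ext \<Omega> (d \<theta>) \<in> Hs s UNIV"
        using Hs_zero_ext[OF \<Omega> dV sup1 rr(2)] rr r by simp
      have supr': "ess_supp (zero_ext \<Omega> (d \<theta>)) \<subseteq> ball m r'" using sup1 rr by fastforce
      then show "ess_supp (zero_ext \<Omega> (d \<theta>)) \<subseteq> \<Omega>" using b\<Omega> by blast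
      show "ess_supp (zero_ext \<Omega> (d \<theta>)) \<inter> boundary_strip \<Omega> q_sh (\<tau> * (real_of_int (fst \<theta>) - t)) = {}"
        using supr' disj unfolding eq by auto
    qed
    define Q where "Q = {z \<in> P. t < level_gap \<tau> z}"
    have Qsum: "(\<lambda>(\<nu>, \<theta>). (cmod (?ip (d \<theta>) (p \<nu>)))\<^sup>2) summable_on Q"
      using summable_on_subset_banach[OF aP, of Q] unfolding a_def Q_def by auto
    have Qle: "(\<Sum>\<^sub>\<infinity>(\<nu>, \<theta>)\<in>Q. (cmod (?ip (d \<theta>) (p \<nu>)))\<^sup>2) \<le> e"
      using T(2)[OF t] unfolding a_def Q_def .
    \<comment> \<open>A common support point x lies in \<Omega> off the strip, hence at distance at
      least q 2^(-\<tau>(j'-t)) from the frontier. A point y of the shearlet's support outside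
      \<Omega> is nearer to x than q 2^(-j/2). Comparing exponents gives j' > t + j / (2\<tau>), so
      the pair lies in \<open>Q\<close>.\<close>
    have Q0: "?ip (d \<theta>) (p \<nu>) = 0" if \<nu>: "\<nu> \<in> sh_indices - ?\<Lambda>0" and \<theta>: "\<theta> \<in> ?\<Theta> - ?\<Theta>b" and nQ: "(\<nu>, \<theta>) \<notin> Q" for \<nu> \<theta>
    proof (rule ccontr)
      assume nz: "?ip (d \<theta>) (p \<nu>) \<noteq> 0"
      have \<nu>': "\<nu> \<in> sh_indices" and \<theta>': "\<theta> \<in> ?\<Theta>" using \<nu> \<theta> by auto
      have meet: "ess_supp (zero_ext \<Omega> (d \<theta>)) \<inter> ess_supp (?sh \<nu>) \<noteq> {}"
        using Hs_inner_disjoint_supports[OF \<Omega> dV[OF \<theta>'] Hs_restrict[OF \<Omega> pU[OF \<nu>']]] nz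
        unfolding p_def ess_supp_scaled by blast
      then obtain x where x: "x \<in> ess_supp (zero_ext \<Omega> (d \<theta>))" "x \<in> ess_supp (?sh \<nu>)" by blast
      obtain y where y: "y \<in> ess_supp (?sh \<nu>)" "y \<notin> \<Omega>" using \<nu> unfolding interior_sh_indices_def by blast
      obtain j k m \<iota> where eq: "\<nu> = (j, k, m, \<iota>)" by (cases \<nu>)
      have idx: "(j, k, m, \<iota>) \<in> sh_indices" using \<nu>' eq by simp
      obtain v where v: "ess_supp (?sh \<nu>) \<subseteq> ball v (2 powr (- real_of_int j / 2) * q_sh / 2)"
        using shearlet_location[OF idx S5] unfolding eq by blast
      have "dist x y \<le> dist v x + dist v y" by (rule dist_triangle3)
      also have "\<dots> < 2 powr (- real_of_int j / 2) * q_sh"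
      proof -
        have "x \<in> ball v (2 powr (- real_of_int j / 2) * q_sh / 2)" "y \<in> ball v (2 powr (- real_of_int j / 2) * q_sh / 2)"
          using v x(2) y(1) by blast+
        then show ?thesis by simp
      qed
      finally have xy: "dist x y < 2 powr (- real_of_int j / 2) * q_sh" .
      have x\<Omega>: "x \<in> \<Omega>" using x(1) interior(2)[OF \<theta>] by blast
      have "x \<notin> boundary_strip \<Omega> q_sh (\<tau> * (real_of_int (fst \<theta>) - t))" using x(1) interior(3)[OF \<theta>] by blast
      then have "q_sh * 2 powr (- (\<tau> * (real_of_int (fst \<theta>) - t))) \<le> infdist x (frontier \<Omega>)"
        using x\<Omega> unfolding boundary_strip_def by auto
      also have "\<dots> \<le> dist x y" by (rule infdist_frontier_le[OF x\<Omega> y(2)])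
      finally have "q_sh * 2 powr (- (\<tau> * (real_of_int (fst \<theta>) - t))) < q_sh * 2 powr (- real_of_int j / 2)"
        using xy by (simp add: mult.commute)
      then have "2 powr (- (\<tau> * (real_of_int (fst \<theta>) - t))) < 2 powr (- real_of_int j / 2)" using q by simp
      then have "- (\<tau> * (real_of_int (fst \<theta>) - t)) < - real_of_int j / 2" by simp
      then have gap: "t < level_gap \<tau> (\<nu>, \<theta>)"
        using \<open>\<tau> > 0\<close> unfolding level_gap_def eq by (simp add: field_simps)
      have "(\<nu>, \<theta>) \<in> P"
        unfolding P_def interior_w_indices_def using \<nu>' \<theta>' interior[OF \<theta>] meet gap t T(1) by auto
      with gap nQ show False unfolding Q_def by simp
    qed
    have "\<exists>A>0. \<forall>f\<in>Hs s \<Omega>. A * (Hs_norm s \<Omega> f)\<^sup>2 \<le>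
       (\<Sum>\<^sub>\<infinity>l\<in>?\<Lambda>0. (cmod (?ip f (p l)))\<^sup>2) + (\<Sum>\<^sub>\<infinity>\<theta>\<in>?\<Theta> - (?\<Theta> - ?\<Theta>b). (cmod (?ip f (w \<theta>)))\<^sup>2)"
    proof (rule frame_absorption[OF \<Omega> _ _ dV wV pU, where AS = AS and BS = M and Bu = Bu and Bd = Bd and e = e and Q = Q])
      show "?\<Lambda>0 \<subseteq> sh_indices" unfolding interior_sh_indices_def by auto
      show "?\<Theta> - ?\<Theta>b \<subseteq> ?\<Theta>" by blast
      show "(\<lambda>\<theta>. (cmod (?ip f (w \<theta>)))\<^sup>2) summable_on ?\<Theta> \<and>
          (\<Sum>\<^sub>\<infinity>\<theta>\<in>?\<Theta>. (cmod (?ip f (w \<theta>)))\<^sup>2) \<le> Bu * (Hs_norm s \<Omega> f)\<^sup>2"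
        "(\<lambda>\<theta>. (cmod (?ip f (d \<theta>)))\<^sup>2) summable_on ?\<Theta> \<and>
          (\<Sum>\<^sub>\<infinity>\<theta>\<in>?\<Theta>. (cmod (?ip f (d \<theta>)))\<^sup>2) \<le> Bd * (Hs_norm s \<Omega> f)\<^sup>2"
        if "f \<in> Hs s \<Omega>" for f using U(3)[OF that] D(3)[OF that] by blast+
      show "(\<lambda>l. (cmod (Hs_inner s UNIV g (p l)))\<^sup>2) summable_on sh_indices \<and>
          AS * (Hs_norm s UNIV g)\<^sup>2 \<le> (\<Sum>\<^sub>\<infinity>l\<in>sh_indices. (cmod (Hs_inner s UNIV g (p l)))\<^sup>2)"
        if "g \<in> Hs s UNIV" for g using S(3)[OF that] by blast
      show "0 < Bd" using D by linarith
      show "0 \<le> Bu" "0 \<le> e" using Bu e by linarith+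
    qed (fact rec upper interior(1,2) Qsum Qle Q0 M0 e(2) S(1) | assumption)+
    moreover have "?\<Theta> - (?\<Theta> - ?\<Theta>b) = ?\<Theta>b" using \<Theta>b by blast
    ultimately obtain A where A: "0 < A" "\<And>f. f \<in> Hs s \<Omega> \<Longrightarrow> A * (Hs_norm s \<Omega> f)\<^sup>2 \<le>
       (\<Sum>\<^sub>\<infinity>l\<in>?\<Lambda>0. (cmod (?ip f (p l)))\<^sup>2) + (\<Sum>\<^sub>\<infinity>\<theta>\<in>?\<Theta>b. (cmod (?ip f (w \<theta>)))\<^sup>2)"
      by auto

    \<comment> \<open>Frame inequalities over the disjoint union of the index sets\<close>
    define I where "I = bsh_indices \<Omega> \<phi> \<psi> \<psi>' (c1, c2) ?\<Theta> \<omega> d q_sh t \<tau>"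
    define u where "u = (\<lambda>n. scaled s (bsh_scale n) (bsh \<phi> \<psi> \<psi>' (c1, c2) \<omega> n))"
    have I_eq: "I = Inl ` ?\<Lambda>0 \<union> Inr ` ?\<Theta>b" unfolding I_def bsh_indices_def Plus_def ..
    have u_eq: "u (Inl \<nu>) = p \<nu>" "u (Inr \<theta>) = w \<theta>" for \<nu> \<theta>
      unfolding u_def p_def w_def bsh_def bsh_scale_def by simp_all
    have sums: "(\<lambda>n. (cmod (?ip f (u n)))\<^sup>2) summable_on I"
      "(\<Sum>\<^sub>\<infinity>n\<in>I. (cmod (?ip f (u n)))\<^sup>2) =
         (\<Sum>\<^sub>\<infinity>l\<in>?\<Lambda>0. (cmod (?ip f (p l)))\<^sup>2) + (\<Sum>\<^sub>\<infinity>\<theta>\<in>?\<Theta>b. (cmod (?ip f (w \<theta>)))\<^sup>2)"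
      if f: "f \<in> Hs s \<Omega>" for f
    proof -
      let ?g = "\<lambda>n. (cmod (?ip f (u n)))\<^sup>2"
      have 1: "?g summable_on Inl ` ?\<Lambda>0"
        using upper[OF f] by (subst summable_on_reindex) (auto simp: o_def u_eq)
      have 2: "?g summable_on Inr ` ?\<Theta>b"
        using summable_on_subset_banach[OF conjunct1[OF U(3)[OF f]] \<Theta>b]
        by (subst summable_on_reindex) (auto simp: o_def u_eq)
      have disj: "Inl ` ?\<Lambda>0 \<inter> Inr ` ?\<Theta>b = {}" by auto
      show "?g summable_on I" unfolding I_eq by (rule summable_on_Un_disjoint[OF 1 2 disj])
      have "infsum ?g I = infsum ?g (Inl ` ?\<Lambda>0) + infsum ?g (Inr ` ?\<Theta>b)"
        unfolding I_eq by (rule infsum_Un_disjoint[OF 1 2 disj])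
      then show "infsum ?g I = (\<Sum>\<^sub>\<infinity>l\<in>?\<Lambda>0. (cmod (?ip f (p l)))\<^sup>2) + (\<Sum>\<^sub>\<infinity>\<theta>\<in>?\<Theta>b. (cmod (?ip f (w \<theta>)))\<^sup>2)"
        by (simp add: infsum_reindex o_def u_eq)
    qed
    have upper_sum: "(\<Sum>\<^sub>\<infinity>n\<in>I. (cmod (?ip f (u n)))\<^sup>2) \<le> (M + Bu) * (Hs_norm s \<Omega> f)\<^sup>2" if f: "f \<in> Hs s \<Omega>" for f
    proof -
      have "(\<Sum>\<^sub>\<infinity>\<theta>\<in>?\<Theta>b. (cmod (?ip f (w \<theta>)))\<^sup>2) \<le> (\<Sum>\<^sub>\<infinity>\<theta>\<in>?\<Theta>. (cmod (?ip f (w \<theta>)))\<^sup>2)"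
        using U(3)[OF f] \<Theta>b summable_on_subset_banach[OF conjunct1[OF U(3)[OF f]] \<Theta>b]
        by (intro infsum_mono_neutral) auto
      then show ?thesis using sums(2)[OF f] upper[OF f] U(3)[OF f] by (simp add: distrib_right)
    qed
    \<comment> \<open>The maximum gives A \<le> B outright, without exhibiting an f of positive
      norm.\<close>
    define B where "B = max A (M + Bu)"
    have "0 < A \<and> A \<le> B \<and> (\<forall>f\<in>Hs s \<Omega>.
          (\<lambda>n. (cmod (?ip f (u n)))\<^sup>2) summable_on I \<and>
          A * (Hs_norm s \<Omega> f)\<^sup>2 \<le> (\<Sum>\<^sub>\<infinity>n\<in>I. (cmod (?ip f (u n)))\<^sup>2) \<and>
          (\<Sum>\<^sub>\<infinity>n\<in>I. (cmod (?ip f (u n)))\<^sup>2) \<le> B * (Hs_norm s \<Omega> f)\<^sup>2)"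
    proof (intro conjI ballI)
      fix f assume f: "f \<in> Hs s \<Omega>"
      show "(\<lambda>n. (cmod (?ip f (u n)))\<^sup>2) summable_on I" by (rule sums(1)[OF f])
      show "A * (Hs_norm s \<Omega> f)\<^sup>2 \<le> (\<Sum>\<^sub>\<infinity>n\<in>I. (cmod (?ip f (u n)))\<^sup>2)" using A(2)[OF f] sums(2)[OF f] by simp
      have "(M + Bu) * (Hs_norm s \<Omega> f)\<^sup>2 \<le> B * (Hs_norm s \<Omega> f)\<^sup>2"
        unfolding B_def by (intro mult_right_mono) auto
      with upper_sum[OF f] show "(\<Sum>\<^sub>\<infinity>n\<in>I. (cmod (?ip f (u n)))\<^sup>2) \<le> B * (Hs_norm s \<Omega> f)\<^sup>2" by linarith
    qed (use A(1) in \<open>auto simp: B_def\<close>)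
    then show "\<exists>A B. 0 < A \<and> A \<le> B \<and>
      (let I = bsh_indices \<Omega> \<phi> \<psi> \<psi>' (c1, c2) (w_indices J0 K) \<omega> d q_sh t \<tau>;
           u = (\<lambda>n. scaled s (bsh_scale n) (bsh \<phi> \<psi> \<psi>' (c1, c2) \<omega> n))
       in \<forall>f\<in>Hs s \<Omega>.
            (\<lambda>n. (cmod (Hs_inner s \<Omega> f (u n)))\<^sup>2) summable_on I \<and>
            A * (Hs_norm s \<Omega> f)\<^sup>2 \<le> (\<Sum>\<^sub>\<infinity>n\<in>I. (cmod (Hs_inner s \<Omega> f (u n)))\<^sup>2) \<and>
            (\<Sum>\<^sub>\<infinity>n\<in>I. (cmod (Hs_inner s \<Omega> f (u n)))\<^sup>2) \<le> B * (Hs_norm s \<Omega> f)\<^sup>2)"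
      unfolding Let_def I_def[symmetric] u_def[symmetric] by blast
  qed
qed

end
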